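(* Let $r\ge2$ and let $X$ be the blowup of the Hirzebruch surface $\mathbb F_r$ over $\mathbb K$ at two distinct points of a (distinguished) fiber $f$ not lying on the zero section $s$. Then $X$ is a smooth projective surface which admits a one-dimensional family of pairwise non-isomorphic additive actions.
   Context: $\mathbb K$ is an algebraically closed field of characteristic zero, $\mathbb G_a=(\mathbb K,+)$. $\mathbb F_r$ is the $r$-th Hirzebruch surface, $f$ is a fiber of its ruling, and $s$ is the section with self-intersection number $-r$. An additive action on a surface is an effective action of $\mathbb G_a^2$ with an open orbit. Two additive actions $\sigma_1,\sigma_2:\mathbb G_a^2\times X\to X$ are isomorphic if there are an automorphism $\phi$ of $X$ and an automorphism $\psi$ of the algebraic group $\mathbb G_a^2$ with $\phi(\sigma_1(g,x))=\sigma_2(\psi(g),\phi(x))$ for all $g,x$. *)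

theory Defs
  imports "HOL-Analysis.Analysis" "HOL-Computational_Algebra.Computational_Algebra"
begin

section \<open>Spaces with functions\<close>

text \<open>
  Varieties are treated classically, as spaces with functions (Serre, Kempf): a topological space
  together with, for every open \<open>U\<close>, the algebra of regular \<open>\<bbbK>\<close>-valued functions on \<open>U\<close>.
  Functions are total in HOL, so membership in \<open>reg X U\<close> depends only on the values on \<open>U\<close>,
  and \<open>reg X U\<close> is meaningful only for open \<open>U\<close>.
\<close>

record ('a, 'k) fspace =
  topo :: "'a topology"
  reg :: "'a set \<Rightarrow> ('a \<Rightarrow> 'k) set"

abbreviation points :: "('a, 'k) fspace \<Rightarrow> 'a set" where
  "points X \<equiv> topspace (topo X)"

definition space_with_functions :: "('a, 'k::field) fspace \<Rightarrow> bool" where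
  "space_with_functions X \<longleftrightarrow>
     (\<forall>U. openin (topo X) U \<longrightarrow>
        (\<forall>c. (\<lambda>_. c) \<in> reg X U) \<and>
        (\<forall>f\<in>reg X U. \<forall>g\<in>reg X U. (\<lambda>x. f x + g x) \<in> reg X U \<and> (\<lambda>x. f x * g x) \<in> reg X U) \<and>
        (\<forall>f\<in>reg X U. \<forall>g. (\<forall>x\<in>U. g x = f x) \<longrightarrow> g \<in> reg X U) \<and>
        (\<forall>f\<in>reg X U. \<forall>V. openin (topo X) V \<and> V \<subseteq> U \<longrightarrow> f \<in> reg X V) \<and>
        (\<forall>f. (\<forall>x\<in>U. \<exists>V. openin (topo X) V \<and> x \<in> V \<and> V \<subseteq> U \<and> f \<in> reg X V) \<longrightarrow> f \<in> reg X U) \<and>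
        (\<forall>f\<in>reg X U. openin (topo X) {x \<in> U. f x \<noteq> 0} \<and>
                      (\<lambda>x. inverse (f x)) \<in> reg X {x \<in> U. f x \<noteq> 0}))"

definition morphism :: "('a, 'k) fspace \<Rightarrow> ('b, 'k) fspace \<Rightarrow> ('a \<Rightarrow> 'b) \<Rightarrow> bool" where
  "morphism X Y f \<longleftrightarrow> continuous_map (topo X) (topo Y) f \<and>
     (\<forall>V g. openin (topo Y) V \<and> g \<in> reg Y V \<longrightarrow> (\<lambda>x. g (f x)) \<in> reg X {x \<in> points X. f x \<in> V})"

definition isomorphism :: "('a, 'k) fspace \<Rightarrow> ('b, 'k) fspace \<Rightarrow> ('a \<Rightarrow> 'b) \<Rightarrow> bool" where
  "isomorphism X Y f \<longleftrightarrow> morphism X Y f \<and>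
     (\<exists>g. morphism Y X g \<and> (\<forall>x\<in>points X. g (f x) = x) \<and> (\<forall>y\<in>points Y. f (g y) = y))"

definition isomorphic_spaces :: "('a, 'k) fspace \<Rightarrow> ('b, 'k) fspace \<Rightarrow> bool" where
  "isomorphic_spaces X Y \<longleftrightarrow> (\<exists>f. isomorphism X Y f)"

definition subspace_of :: "('a, 'k) fspace \<Rightarrow> 'a set \<Rightarrow> ('a, 'k) fspace" where
  "subspace_of X Z = \<lparr>topo = subtopology (topo X) Z,
     reg = (\<lambda>U. {f. \<forall>x\<in>U. \<exists>V g. openin (topo X) V \<and> x \<in> V \<and> V \<inter> Z \<subseteq> U \<and>
                          g \<in> reg X V \<and> (\<forall>y\<in>V \<inter> Z. f y = g y)})\<rparr>"

definition quotient_topology :: "'a topology \<Rightarrow> ('a \<Rightarrow> 'b) \<Rightarrow> 'b topology" where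
  "quotient_topology T q =
     topology (\<lambda>U. U \<subseteq> q ` topspace T \<and> openin T {x \<in> topspace T. q x \<in> U})"

lemma openin_quotient_topology:
  "openin (quotient_topology T q) U \<longleftrightarrow>
     U \<subseteq> q ` topspace T \<and> openin T {x \<in> topspace T. q x \<in> U}"
proof -
  have "istopology (\<lambda>U. U \<subseteq> q ` topspace T \<and> openin T {x \<in> topspace T. q x \<in> U})"
    unfolding istopology_def
  proof (intro conjI allI impI; (elim conjE)?)
    fix S U
    assume "openin T {x \<in> topspace T. q x \<in> S}" "openin T {x \<in> topspace T. q x \<in> U}"
    then have "openin T ({x \<in> topspace T. q x \<in> S} \<inter> {x \<in> topspace T. q x \<in> U})"
      by blast
    moreover have "{x \<in> topspace T. q x \<in> S} \<inter> {x \<in> topspace T. q x \<in> U} =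
        {x \<in> topspace T. q x \<in> S \<inter> U}" by blast
    ultimately show "openin T {x \<in> topspace T. q x \<in> S \<inter> U}" by simp
  next
    fix \<K>
    assume *: "\<forall>K\<in>\<K>. K \<subseteq> q ` topspace T \<and> openin T {x \<in> topspace T. q x \<in> K}"
    have "openin T (\<Union>K\<in>\<K>. {x \<in> topspace T. q x \<in> K})"
      using * by blast
    moreover have "(\<Union>K\<in>\<K>. {x \<in> topspace T. q x \<in> K}) = {x \<in> topspace T. q x \<in> \<Union>\<K>}"
      by blast
    ultimately show "openin T {x \<in> topspace T. q x \<in> \<Union>\<K>}" by simp
  qed blast+
  then show ?thesis
    unfolding quotient_topology_def by (simp add: topology_inverse')
qed

definition quotient_space :: "('a, 'k) fspace \<Rightarrow> ('a \<Rightarrow> 'b) \<Rightarrow> ('b, 'k) fspace" where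
  "quotient_space X q = \<lparr>topo = quotient_topology (topo X) q,
     reg = (\<lambda>U. {f. (\<lambda>x. f (q x)) \<in> reg X {x \<in> points X. q x \<in> U}})\<rparr>"

text \<open>
  The categorical product of spaces with functions (Kempf): basic open sets are the non-vanishing
  loci of finite sums \<open>\<Sum>\<^sub>i a\<^sub>i(x) b\<^sub>i(y)\<close>, and regular functions are locally quotients of such sums.
  For varieties it is the usual product, with the Zariski and not the product topology.
\<close>

definition tensor_functions ::
  "('a, 'k::field) fspace \<Rightarrow> ('b, 'k) fspace \<Rightarrow> 'a set \<Rightarrow> 'b set \<Rightarrow> ('a \<times> 'b \<Rightarrow> 'k) set" where
  "tensor_functions X Y U V = {h. \<exists>(n::nat) a b. (\<forall>i<n. a i \<in> reg X U \<and> b i \<in> reg Y V) \<and>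
     h = (\<lambda>(x, y). \<Sum>i<n. a i x * b i y)}"

definition prod_space ::
  "('a, 'k::field) fspace \<Rightarrow> ('b, 'k) fspace \<Rightarrow> ('a \<times> 'b, 'k) fspace" where
  "prod_space X Y = \<lparr>
     topo = topology_generated_by
       {{z \<in> U \<times> V. h z \<noteq> 0} | U V h.
          openin (topo X) U \<and> openin (topo Y) V \<and> h \<in> tensor_functions X Y U V},
     reg = (\<lambda>W. {f. \<forall>z\<in>W. \<exists>U V g h. openin (topo X) U \<and> openin (topo Y) V \<and>
        g \<in> tensor_functions X Y U V \<and> h \<in> tensor_functions X Y U V \<and>
        z \<in> U \<times> V \<and> h z \<noteq> 0 \<and> {w \<in> U \<times> V. h w \<noteq> 0} \<subseteq> W \<and>
        (\<forall>w\<in>U \<times> V. h w \<noteq> 0 \<longrightarrow> f w = g w / h w)})\<rparr>"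


section \<open>Affine and projective space\<close>

inductive_set poly_functions :: "nat \<Rightarrow> ((nat \<Rightarrow> 'k::field) \<Rightarrow> 'k) set" for n :: nat where
  const: "(\<lambda>_. c) \<in> poly_functions n"
| coord: "i < n \<Longrightarrow> (\<lambda>x. x i) \<in> poly_functions n"
| add: "\<lbrakk>f \<in> poly_functions n; g \<in> poly_functions n\<rbrakk> \<Longrightarrow> (\<lambda>x. f x + g x) \<in> poly_functions n"
| mult: "\<lbrakk>f \<in> poly_functions n; g \<in> poly_functions n\<rbrakk> \<Longrightarrow> (\<lambda>x. f x * g x) \<in> poly_functions n"

text \<open>The points of \<open>\<bbbA>\<^sup>n\<close> are the sequences vanishing from index \<open>n\<close> on.\<close>

definition affine_points :: "nat \<Rightarrow> (nat \<Rightarrow> 'k::field) set" where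
  "affine_points n = {x. \<forall>i\<ge>n. x i = 0}"

definition affine_space :: "nat \<Rightarrow> (nat \<Rightarrow> 'k::field, 'k) fspace" where
  "affine_space n = \<lparr>
     topo = topology_generated_by {{x \<in> affine_points n. h x \<noteq> 0} | h. h \<in> poly_functions n},
     reg = (\<lambda>U. {f. \<forall>x\<in>U. \<exists>g h. g \<in> poly_functions n \<and> h \<in> poly_functions n \<and> h x \<noteq> 0 \<and>
        {y \<in> affine_points n. h y \<noteq> 0} \<subseteq> U \<and>
        (\<forall>y\<in>affine_points n. h y \<noteq> 0 \<longrightarrow> f y = g y / h y)})\<rparr>"

definition proj_class :: "(nat \<Rightarrow> 'k::field) \<Rightarrow> (nat \<Rightarrow> 'k) set" where
  "proj_class v = {(\<lambda>i. c * v i) | c. c \<noteq> 0}"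

definition proj_space :: "nat \<Rightarrow> ((nat \<Rightarrow> 'k::field) set, 'k) fspace" where
  "proj_space n =
     quotient_space (subspace_of (affine_space (Suc n)) (affine_points (Suc n) - {\<lambda>_. 0})) proj_class"


section \<open>Varieties\<close>

definition affine_variety :: "('a, 'k::field) fspace \<Rightarrow> bool" where
  "affine_variety X \<longleftrightarrow> (\<exists>n Z. closedin (topo (affine_space n :: (nat \<Rightarrow> 'k, 'k) fspace)) Z \<and>
     isomorphic_spaces X (subspace_of (affine_space n) Z))"

definition irreducible_closed :: "'a topology \<Rightarrow> 'a set \<Rightarrow> bool" where
  "irreducible_closed T Z \<longleftrightarrow> closedin T Z \<and> Z \<noteq> {} \<and>
     (\<forall>A B. closedin T A \<and> closedin T B \<and> Z = A \<union> B \<longrightarrow> Z = A \<or> Z = B)"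

text \<open>An irreducible separated prevariety; affine pieces need not be assumed irreducible.\<close>

definition variety :: "('a, 'k::field) fspace \<Rightarrow> bool" where
  "variety X \<longleftrightarrow> space_with_functions X \<and> irreducible_closed (topo X) (points X) \<and>
     (\<exists>\<U>. finite \<U> \<and> \<Union>\<U> = points X \<and>
        (\<forall>U\<in>\<U>. openin (topo X) U \<and> affine_variety (subspace_of X U))) \<and>
     closedin (topo (prod_space X X)) {(x, x) | x. x \<in> points X}"

definition irreducible_chain :: "'a topology \<Rightarrow> nat \<Rightarrow> bool" where
  "irreducible_chain T n \<longleftrightarrow> (\<exists>Z. (\<forall>i\<le>n. irreducible_closed T (Z i)) \<and> (\<forall>i<n. Z i \<subset> Z (Suc i)))"

definition has_dimension :: "('a, 'k) fspace \<Rightarrow> nat \<Rightarrow> bool" where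
  "has_dimension X d \<longleftrightarrow> irreducible_chain (topo X) d \<and> (\<forall>n>d. \<not> irreducible_chain (topo X) n)"

definition projective_variety :: "('a, 'k::field) fspace \<Rightarrow> bool" where
  "projective_variety X \<longleftrightarrow> variety X \<and>
     (\<exists>n Z. closedin (topo (proj_space n :: ((nat \<Rightarrow> 'k) set, 'k) fspace)) Z \<and>
        isomorphic_spaces X (subspace_of (proj_space n) Z))"

text \<open>
  \<open>smooth_point X d p\<close> says that the maximal ideal of the local ring at \<open>p\<close> is generated by \<open>d\<close> germs;
  for \<open>d\<close> the dimension of the variety \<open>X\<close> this is regularity of that local ring.
\<close>

definition smooth_point :: "('a, 'k::field) fspace \<Rightarrow> nat \<Rightarrow> 'a \<Rightarrow> bool" where
  "smooth_point X d p \<longleftrightarrow> (\<exists>U t. openin (topo X) U \<and> p \<in> U \<and>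
     (\<forall>i<d. t i \<in> reg X U \<and> t i p = 0) \<and>
     (\<forall>V g. openin (topo X) V \<and> p \<in> V \<and> g \<in> reg X V \<and> g p = 0 \<longrightarrow>
        (\<exists>W a. openin (topo X) W \<and> p \<in> W \<and> W \<subseteq> U \<inter> V \<and> (\<forall>i<d. a i \<in> reg X W) \<and>
           (\<forall>x\<in>W. g x = (\<Sum>i<d. a i x * t i x)))))"

definition smooth_variety :: "('a, 'k::field) fspace \<Rightarrow> bool" where
  "smooth_variety X \<longleftrightarrow> variety X \<and>
     (\<exists>d. has_dimension X d \<and> (\<forall>p\<in>points X. smooth_point X d p))"

definition curve :: "('a, 'k::field) fspace \<Rightarrow> bool" where
  "curve X \<longleftrightarrow> variety X \<and> has_dimension X 1"

definition surface :: "('a, 'k::field) fspace \<Rightarrow> bool" where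
  "surface X \<longleftrightarrow> variety X \<and> has_dimension X 2"


section \<open>Blowups\<close>

text \<open>
  \<open>\<pi> : X \<rightarrow> Y\<close> is the blowup of \<open>Y\<close> along the closed set \<open>S\<close> (with its reduced structure) if, over the
  members \<open>U\<close> of an affine open cover of \<open>Y\<close>, it is the closure in \<open>U \<times> \<bbbP>\<^sup>m\<close> of the graph of
  \<open>[f\<^sub>0 : \<dots> : f\<^sub>m]\<close>, where \<open>f\<^sub>0, \<dots>, f\<^sub>m\<close> generate the ideal of \<open>S \<inter> U\<close> in the coordinate ring of \<open>U\<close>.
\<close>

definition generates_ideal_of ::
  "('a, 'k::field) fspace \<Rightarrow> 'a set \<Rightarrow> 'a set \<Rightarrow> nat \<Rightarrow> (nat \<Rightarrow> 'a \<Rightarrow> 'k) \<Rightarrow> bool" where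
  "generates_ideal_of Y S U m f \<longleftrightarrow>
     (\<forall>i\<le>m. f i \<in> reg Y U \<and> (\<forall>y\<in>S \<inter> U. f i y = 0)) \<and>
     (\<forall>g\<in>reg Y U. (\<forall>y\<in>S \<inter> U. g y = 0) \<longrightarrow>
        (\<exists>a. (\<forall>i\<le>m. a i \<in> reg Y U) \<and> (\<forall>y\<in>U. g y = (\<Sum>i\<le>m. a i y * f i y))))"

definition graph_closure ::
  "('a, 'k::field) fspace \<Rightarrow> 'a set \<Rightarrow> nat \<Rightarrow> (nat \<Rightarrow> 'a \<Rightarrow> 'k) \<Rightarrow>
     ('a \<times> (nat \<Rightarrow> 'k) set, 'k) fspace" where
  "graph_closure Y U m f =
     subspace_of (prod_space (subspace_of Y U) (proj_space m))
       (topo (prod_space (subspace_of Y U) (proj_space m)) closure_of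
          {(y, proj_class (\<lambda>i. if i \<le> m then f i y else 0)) | y. y \<in> U \<and> (\<exists>i\<le>m. f i y \<noteq> 0)})"

definition is_blowup ::
  "('x, 'k::field) fspace \<Rightarrow> ('x \<Rightarrow> 'y) \<Rightarrow> ('y, 'k) fspace \<Rightarrow> 'y set \<Rightarrow> bool" where
  "is_blowup X \<pi> Y S \<longleftrightarrow> space_with_functions X \<and> morphism X Y \<pi> \<and>
     (\<forall>y\<in>points Y. \<exists>U m f \<phi>. openin (topo Y) U \<and> y \<in> U \<and> affine_variety (subspace_of Y U) \<and>
        generates_ideal_of Y S U m f \<and>
        isomorphism (subspace_of X {x \<in> points X. \<pi> x \<in> U}) (graph_closure Y U m f) \<phi> \<and>
        (\<forall>x\<in>points X. \<pi> x \<in> U \<longrightarrow> fst (\<phi> x) = \<pi> x))"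


section \<open>Hirzebruch surfaces\<close>

text \<open>
  \<open>\<bbbF>\<^sub>r = \<bbbP>(\<O> \<oplus> \<O>(r))\<close> is the quotient of \<open>(\<bbbA>\<^sup>2 - 0) \<times> (\<bbbA>\<^sup>2 - 0)\<close> by the torus acting by
  \<open>(\<lambda>, \<mu>) \<cdot> (v\<^sub>0, v\<^sub>1, v\<^sub>2, v\<^sub>3) = (\<lambda> v\<^sub>0, \<lambda> v\<^sub>1, \<mu> v\<^sub>2, \<lambda>\<^sup>-\<^sup>r \<mu> v\<^sub>3)\<close>; the ruling is \<open>[v\<^sub>0 : v\<^sub>1]\<close>.
  The function \<open>v\<^sub>0\<^sup>r v\<^sub>3 / v\<^sub>2\<close> shows that \<open>{v\<^sub>2 = 0}\<close> is linearly equivalent to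
  \<open>{v\<^sub>3 = 0} + r f\<close>. As \<open>{v\<^sub>2 = 0}\<close> and \<open>{v\<^sub>3 = 0}\<close> are disjoint sections, \<open>{v\<^sub>3 = 0}\<close> has
  self-intersection number \<open>-r\<close>, so it is the section \<open>s\<close>.
\<close>

definition hirzebruch_class :: "nat \<Rightarrow> (nat \<Rightarrow> 'k::field) \<Rightarrow> (nat \<Rightarrow> 'k) set" where
  "hirzebruch_class r v =
     {(\<lambda>i. if i < 2 then c * v i
           else if i = 2 then d * v 2
           else if i = 3 then inverse (c ^ r) * d * v 3 else 0) | c d. c \<noteq> 0 \<and> d \<noteq> 0}"

definition hirzebruch_domain :: "(nat \<Rightarrow> 'k::field) set" where
  "hirzebruch_domain =
     {v \<in> affine_points 4. (v 0 \<noteq> 0 \<or> v 1 \<noteq> 0) \<and> (v 2 \<noteq> 0 \<or> v 3 \<noteq> 0)}"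

definition hirzebruch :: "nat \<Rightarrow> ((nat \<Rightarrow> 'k::field) set, 'k) fspace" where
  "hirzebruch r =
     quotient_space (subspace_of (affine_space 4) hirzebruch_domain) (hirzebruch_class r)"

definition hirzebruch_fiber :: "nat \<Rightarrow> (nat \<Rightarrow> 'k::field) set \<Rightarrow> (nat \<Rightarrow> 'k) set set" where
  "hirzebruch_fiber r b =
     {hirzebruch_class r v | v. v \<in> hirzebruch_domain \<and> proj_class (\<lambda>i. if i < 2 then v i else 0) = b}"

definition hirzebruch_zero_section :: "nat \<Rightarrow> (nat \<Rightarrow> 'k::field) set set" where
  "hirzebruch_zero_section r = {hirzebruch_class r v | v. v \<in> hirzebruch_domain \<and> v 3 = 0}"


section \<open>Additive actions\<close>

text \<open>The variety underlying the group \<open>\<bbbG>\<^sub>a\<^sup>2\<close> is \<open>\<bbbA>\<^sup>2\<close>; its neutral element is the zero sequence.\<close>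

abbreviation Ga2 :: "(nat \<Rightarrow> 'k::field, 'k) fspace" where
  "Ga2 \<equiv> affine_space 2"

definition ga_add :: "(nat \<Rightarrow> 'k::field) \<Rightarrow> (nat \<Rightarrow> 'k) \<Rightarrow> nat \<Rightarrow> 'k" where
  "ga_add g h = (\<lambda>i. g i + h i)"

definition additive_action ::
  "('x, 'k::field) fspace \<Rightarrow> ((nat \<Rightarrow> 'k) \<times> 'x \<Rightarrow> 'x) \<Rightarrow> bool" where
  "additive_action X \<sigma> \<longleftrightarrow>
     morphism (prod_space Ga2 X) X \<sigma> \<and>
     (\<forall>x\<in>points X. \<sigma> (\<lambda>_. 0, x) = x) \<and>
     (\<forall>g\<in>points Ga2. \<forall>h\<in>points Ga2. \<forall>x\<in>points X. \<sigma> (ga_add g h, x) = \<sigma> (g, \<sigma> (h, x))) \<and>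
     (\<forall>g\<in>points Ga2. (\<forall>x\<in>points X. \<sigma> (g, x) = x) \<longrightarrow> g = (\<lambda>_. 0)) \<and>
     (\<exists>x\<in>points X. openin (topo X) ((\<lambda>g. \<sigma> (g, x)) ` points Ga2))"

definition Ga2_automorphism :: "((nat \<Rightarrow> 'k::field) \<Rightarrow> nat \<Rightarrow> 'k) \<Rightarrow> bool" where
  "Ga2_automorphism \<psi> \<longleftrightarrow> isomorphism Ga2 Ga2 \<psi> \<and>
     (\<forall>g\<in>points Ga2. \<forall>h\<in>points Ga2. \<psi> (ga_add g h) = ga_add (\<psi> g) (\<psi> h))"

definition isomorphic_actions ::
  "('x, 'k::field) fspace \<Rightarrow> ((nat \<Rightarrow> 'k) \<times> 'x \<Rightarrow> 'x) \<Rightarrow> ((nat \<Rightarrow> 'k) \<times> 'x \<Rightarrow> 'x) \<Rightarrow> bool" where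
  "isomorphic_actions X \<sigma>\<^sub>1 \<sigma>\<^sub>2 \<longleftrightarrow>
     (\<exists>\<phi> \<psi>. isomorphism X X \<phi> \<and> Ga2_automorphism \<psi> \<and>
        (\<forall>g\<in>points Ga2. \<forall>x\<in>points X. \<phi> (\<sigma>\<^sub>1 (g, x)) = \<sigma>\<^sub>2 (\<psi> g, \<phi> x)))"

text \<open>
  A family \<open>(\<tau>\<^sub>t)\<close> of additive actions on \<open>X\<close> indexed by the points of a curve \<open>T\<close> is algebraic if, after
  pulling back along a surjective (hence quasi-finite) morphism of curves \<open>q : C \<rightarrow> T\<close>, it is up to
  isomorphism given by one morphism \<open>C \<times> \<bbbG>\<^sub>a\<^sup>2 \<times> X \<rightarrow> X\<close>. The base change cannot be dispensed with:
  if \<open>X\<close> has automorphisms permuting the actions of a family, the curve of isomorphism classes is a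
  quotient of the curve carrying the family.
\<close>

definition algebraic_family_of_actions ::
  "('x, 'k::field) fspace \<Rightarrow> ('t, 'k) fspace \<Rightarrow> ('t \<Rightarrow> (nat \<Rightarrow> 'k) \<times> 'x \<Rightarrow> 'x) \<Rightarrow> bool" where
  "algebraic_family_of_actions X T \<tau> \<longleftrightarrow>
     (\<forall>t\<in>points T. additive_action X (\<tau> t)) \<and>
     (\<exists>(C :: (nat \<Rightarrow> 'k, 'k) fspace) q \<Sigma>.
        curve C \<and> morphism C T q \<and> q ` points C = points T \<and>
        morphism (prod_space C (prod_space Ga2 X)) X \<Sigma> \<and>
        (\<forall>c\<in>points C. additive_action X (\<lambda>z. \<Sigma> (c, z)) \<and>
           isomorphic_actions X (\<lambda>z. \<Sigma> (c, z)) (\<tau> (q c))))"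

definition one_dim_family_of_nonisomorphic_actions :: "('x, 'k::field) fspace \<Rightarrow> bool" where
  "one_dim_family_of_nonisomorphic_actions X \<longleftrightarrow>
     (\<exists>(T :: (nat \<Rightarrow> 'k, 'k) fspace) \<tau>. curve T \<and> algebraic_family_of_actions X T \<tau> \<and>
        (\<forall>t\<in>points T. \<forall>t'\<in>points T. t \<noteq> t' \<longrightarrow> \<not> isomorphic_actions X (\<tau> t) (\<tau> t')))"

end

theory Submission
  imports Defs
begin

text \<open>
  After an automorphism of \<open>\<bbbF>\<^sub>r\<close> the blown up points are \<open>v\<^sub>0 = 0\<close>, \<open>v\<^sub>2 (v\<^sub>2 - v\<^sub>1\<^sup>r v\<^sub>3) = 0\<close>. In the affine coordinates
  \<open>x = v\<^sub>1 / v\<^sub>0\<close>, \<open>y = v\<^sub>2 / (v\<^sub>0\<^sup>r v\<^sub>3)\<close> and with \<open>z = y (y - x\<^sup>r)\<close>, the monomials \<open>x\<^sup>i\<close>, \<open>y x\<^sup>i\<close>, \<open>z x\<^sup>i\<close>, \<open>y z x\<^sup>i\<close> of degree in \<open>x\<close>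
  at most \<open>3r\<close>, \<open>2r\<close>, \<open>r + 1\<close>, \<open>1\<close> embed the blowup into a projective space. The maps
  \<open>(x, y) \<mapsto> (x + a, y + b + \<lambda> ((x + a)\<^sup>r - x\<^sup>r))\<close> preserve the span of these monomials, hence extend to the blowup; they form
  an additive action \<open>\<sigma>\<^sub>\<lambda>\<close>. An isomorphism between \<open>\<sigma>\<^sub>\<lambda>\<close> and \<open>\<sigma>\<^sub>\<mu>\<close> respects the open orbit and permutes the two exceptional
  curves, which forces \<open>\<mu> = \<lambda>\<close> or \<open>\<mu> = 1 - \<lambda>\<close>; the second case is realised by \<open>y \<mapsto> x\<^sup>r - y\<close>.
\<close>

text \<open>The space \<open>X\<close> is known only through \<open>is_blowup\<close>, that is, by
  local graph closures with unspecified ideal generators. The geometry is therefore done on one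
  explicit closed subset of projective space, and a large part of the work is an isomorphism from
  \<open>X\<close> to it. Maps are written down on the affine plane and extended chart by chart, and
  identities are checked on the plane alone: two morphisms into a separated space that agree on a
  dense set are equal. The degree bounds of the four blocks are chosen so that the span is stable
  for every \<lambda>: the increment of \<open>y\<close> has degree at most \<open>r - 1\<close> in
  \<open>x\<close>, since the leading terms of \<open>(x + a)^r - x^r\<close> cancel, and for
  \<open>z x^(r+1)\<close> the resulting degrees meet the bounds exactly. As \<lambda> and
  \<open>1 - \<lambda>\<close> give isomorphic actions, the classes are parametrised by
  \<open>\<lambda> (1 - \<lambda>)\<close>. Choosing a root for each value is not an algebraic
  operation, which is why the family becomes algebraic only after pulling back along this quotient
  map.\<close>

abbreviation (input) Opn :: "('a, 'k) fspace => 'a set => bool" where "Opn X == openin (topo X)"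
abbreviation (input) "Sub == subspace_of"
abbreviation (input) "Aff == affine_space"
abbreviation (input) "Proj == proj_space"
abbreviation (input) "Polys == poly_functions"
abbreviation (input) "Tens == tensor_functions"
abbreviation (input) "Cls == hirzebruch_class"
abbreviation (input) "Dom == hirzebruch_domain"
type_synonym 'k pspace = "((nat => 'k) set, 'k) fspace"
type_synonym 'k aspace = "(nat => 'k, 'k) fspace"

section \<open>Spaces with functions\<close>

abbreviation swf :: "('a, 'k::field) fspace => bool" where
 "swf \<equiv> space_with_functions"

lemmas swf_unfold = space_with_functions_def[THEN iffD1, THEN spec, THEN mp]

lemmas reg_const = swf_unfold[THEN conjunct1, THEN spec]

lemmas reg_add = swf_unfold[THEN conjunct2, THEN conjunct1, THEN bspec, THEN bspec, THEN conjunct1]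

lemmas reg_mult = swf_unfold[THEN conjunct2, THEN conjunct1, THEN bspec, THEN bspec, THEN conjunct2]

lemma reg_cong:
 assumes "swf X" "Opn X U" "f : reg X U" "!!x. x : U ==> g x = f x"
 shows "g : reg X U"
 using swf_unfold[THEN conjunct2, THEN conjunct2, THEN conjunct1, THEN bspec, THEN spec, THEN mp,
   OF assms(1-3), of g] assms(4) by simp

lemma reg_mono:
 assumes "swf X" "Opn X U" "f : reg X U" "Opn X V" "V <= U"
 shows "f : reg X V"
 using swf_unfold[THEN conjunct2, THEN conjunct2, THEN conjunct2, THEN conjunct1, THEN bspec, THEN spec,
   THEN mp, OF assms(1-3), of V] assms(4,5) by simp

lemma reg_local:
 assumes "swf X" "Opn X U"
  "!!x. x : U ==> EX V. Opn X V & x : V & V <= U & f : reg X V"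
 shows "f : reg X U"
 using swf_unfold[THEN conjunct2, THEN conjunct2, THEN conjunct2, THEN conjunct2, THEN conjunct1,
   THEN spec, THEN mp, OF assms(1,2), of f] assms(3) by simp

lemmas reg_nonzero = swf_unfold[THEN conjunct2, THEN conjunct2, THEN conjunct2, THEN conjunct2,
  THEN conjunct2, THEN bspec, THEN conjunct1]

lemma reg_inverse:
 assumes "swf X" "Opn X U" "f : reg X U" "!!x. x : U ==> f x ~= 0"
 shows "(%x. inverse (f x)) : reg X U"
proof -
 have "{x : U. f x ~= 0} = U" using assms(4) by blast
 then show ?thesis using swf_unfold[THEN conjunct2, THEN conjunct2, THEN conjunct2, THEN conjunct2,
  THEN conjunct2, THEN bspec, THEN conjunct2, OF assms(1-3)] by simp
qed

lemma reg_divide: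
 assumes "swf X" "Opn X U" "g : reg X U" "f : reg X U" "!!x. x : U ==> f x ~= 0"
 shows "(%x. g x / f x) : reg X U"
 using reg_mult[OF assms(1-3) reg_inverse[OF assms(1,2,4,5)]] by (simp add: divide_inverse)

lemma reg_uminus:
 assumes "swf X" "Opn X U" "f : reg X U" shows "(%x. - f x) : reg X U"
 using reg_mult[OF assms(1,2) reg_const[OF assms(1,2), of "-1"] assms(3)] by simp

lemma reg_diff:
 assumes "swf X" "Opn X U" "f : reg X U" "g : reg X U"
 shows "(%x. f x - g x) : reg X U"
 using reg_add[OF assms(1-3) reg_uminus[OF assms(1,2,4)]] by simp

lemma reg_sum:
 assumes "swf X" "Opn X U" "!!i. i : I ==> f i : reg X U"
 shows "(%x. \<Sum>i\<in>I. f i x) : reg X U"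
 using assms(3)
proof (induction I rule: infinite_finite_induct)
 case (insert i I)
 then show ?case using reg_add[OF assms(1,2)] by simp
qed (simp_all add: reg_const assms)

lemma reg_power:
 assumes "swf X" "Opn X U" "f : reg X U" shows "(%x. f x ^ n) : reg X U"
 by (induction n) (simp_all add: reg_const reg_mult assms)

lemmas reg_ops = reg_const reg_add reg_mult reg_uminus reg_diff reg_power

lemma morphismI:
 assumes "!!x. x : points X ==> f x : points Y"
  and "!!V. Opn Y V ==> Opn X {x : points X. f x : V}"
  and "!!V g. Opn Y V ==> g : reg Y V ==> (%x. g (f x)) : reg X {x : points X. f x : V}"
 shows "morphism X Y f"
 using assms unfolding morphism_def continuous_map_def by auto

lemma morphism_points: "morphism X Y f ==> x : points X ==> f x : points Y"
 unfolding morphism_def continuous_map_def by auto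

lemma morphism_open: "morphism X Y f ==> Opn Y V ==> Opn X {x : points X. f x : V}"
 unfolding morphism_def continuous_map_def by auto

lemma morphism_reg:
 "morphism X Y f ==> Opn Y V ==> g : reg Y V ==> (%x. g (f x)) : reg X {x : points X. f x : V}"
 unfolding morphism_def by auto

lemma morphism_reg_on:
 assumes "swf X" "morphism X Y f" "Opn Y V" "g : reg Y V" "Opn X U"
  "!!x. x : U ==> f x : V"
 shows "(%x. g (f x)) : reg X U"
proof -
 have "U <= points X" using assms(5) openin_subset by blast
 then show ?thesis
  using reg_mono[OF assms(1) morphism_open[OF assms(2,3)] morphism_reg[OF assms(2-4)] assms(5)] assms(6)
  by blast
qed

lemma morphism_id: assumes "swf X" shows "morphism X X (%x. x)"
proof (rule morphismI)
 fix V assume "Opn X V"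
 moreover have "{x : points X. x : V} = V" using calculation openin_subset by blast
 ultimately show "Opn X {x : points X. x : V}"
  "!!g. g : reg X V ==> (%x. g x) : reg X {x : points X. x : V}" by auto
qed

lemma morphism_comp:
 assumes "morphism X Y f" "morphism Y Z g" shows "morphism X Z (%x. g (f x))"
proof (rule morphismI)
 fix x assume "x : points X" then show "g (f x) : points Z" using assms morphism_points by metis
next
 fix V assume V: "Opn Z V"
 have *: "{x : points X. g (f x) : V} = {x : points X. f x : {y : points Y. g y : V}}"
  using morphism_points[OF assms(1)] by blast
 show "Opn X {x : points X. g (f x) : V}"
  unfolding * using morphism_open[OF assms(1) morphism_open[OF assms(2) V]] .
 show "(%x. h (g (f x))) : reg X {x : points X. g (f x) : V}" if "h : reg Z V" for h
  unfolding * using morphism_reg[OF assms(1) morphism_open[OF assms(2) V] morphism_reg[OF assms(2) V that]]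
  by simp
qed

text \<open>Morphisms are total functions in HOL, and only their values on the points of the source
  count.\<close>

lemma morphism_cong:
 assumes "swf X" "morphism X Y f" "!!x. x : points X ==> g x = f x" shows "morphism X Y g"
proof (rule morphismI)
 fix x assume "x : points X" then show "g x : points Y" using assms morphism_points by metis
next
 fix V assume V: "Opn Y V"
 have *: "{x : points X. g x : V} = {x : points X. f x : V}" using assms(3) by auto
 show "Opn X {x : points X. g x : V}"
  unfolding * by (rule morphism_open[OF assms(2) V])
 fix h assume "h : reg Y V"
 then show "(%x. h (g x)) : reg X {x : points X. g x : V}" unfolding *
  by (intro reg_cong[OF assms(1) morphism_open[OF assms(2) V] morphism_reg[OF assms(2) V]])
   (auto simp: assms(3))
qed

lemma morphism_const:
 assumes "swf X" "y : points Y" shows "morphism X Y (%_. y)"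
proof (rule morphismI)
 fix V
 show o: "Opn X {x : points X. y : V}" by (cases "y : V") simp_all
 show "(%x. g y) : reg X {x : points X. y : V}" for g by (rule reg_const[OF assms(1) o])
qed (use assms in auto)

subsection \<open>Subspaces\<close>

lemma topo_subspace [simp]: "topo (Sub X Z) = subtopology (topo X) Z"
 by (simp add: subspace_of_def)

lemma reg_subspace_iff:
 "f : reg (Sub X Z) U \<longleftrightarrow> (ALL x:U. EX V g. Opn X V & x : V & V \<inter> Z <= U &
             g : reg X V & (ALL y:V \<inter> Z. f y = g y))"
 by (simp add: subspace_of_def)

lemma reg_subspaceD:
 "f : reg (Sub X Z) U ==> x : U ==> EX V g. Opn X V & x : V & V \<inter> Z <= U &
  g : reg X V & (ALL y:V \<inter> Z. f y = g y)"
 unfolding reg_subspace_iff by (drule bspec)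

lemma reg_subspace_intro:
 assumes "!!x. x : U ==> EX V g. Opn X V & x : V & V \<inter> Z <= U & g : reg X V & (ALL y:V \<inter> Z. f y = g y)"
 shows "f : reg (Sub X Z) U"
 unfolding reg_subspace_iff using assms by (rule ballI)

lemma reg_subspaceI:
 assumes "Opn X V" "g : reg X V" shows "g : reg (Sub X Z) (V \<inter> Z)"
 by (rule reg_subspace_intro, rule exI[of _ V], rule exI[of _ g]) (use assms in auto)

text \<open>A regular function on a subspace is locally the restriction of one on \<open>X\<close>,
  so every axiom is checked on such local extensions.\<close>

lemma swf_subspace: assumes X: "swf X" shows "swf (Sub X Z)"
 unfolding space_with_functions_def topo_subspace
proof (intro allI impI conjI ballI)
 fix U assume "openin (subtopology (topo X) Z) U"
 then obtain U0 where U0: "Opn X U0" "U = U0 \<inter> Z" by (auto simp: openin_subtopology)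
 show "(%_. c) : reg (Sub X Z) U" for c
  using reg_subspaceI[OF U0(1) reg_const[OF X U0(1)]] U0(2) by simp
 show "(%x. f x + g x) : reg (Sub X Z) U" "(%x. f x * g x) : reg (Sub X Z) U"
  if f: "f : reg (Sub X Z) U" and g: "g : reg (Sub X Z) U" for f g
 proof -
  \<comment> \<open>Shrinking makes both extensions live on one neighbourhood, where they can be
    added and multiplied.\<close>
  have *: "EX V f' g'. Opn X V & x : V & V \<inter> Z <= U & f' : reg X V & g' : reg X V &
   (ALL y:V \<inter> Z. f y = f' y & g y = g' y)" if x: "x : U" for x
  proof -
   obtain V f' where 1: "Opn X V" "x : V" "V \<inter> Z <= U" "f' : reg X V"
    "ALL y:V \<inter> Z. f y = f' y" using reg_subspaceD[OF f x] by (elim exE conjE)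
   obtain W g' where 2: "Opn X W" "x : W" "W \<inter> Z <= U" "g' : reg X W"
    "ALL y:W \<inter> Z. g y = g' y" using reg_subspaceD[OF g x] by (elim exE conjE)
   show ?thesis
    using 1 2 reg_mono[OF X 1(1,4), of "V \<inter> W"] reg_mono[OF X 2(1,4), of "V \<inter> W"]
    by (intro exI[of _ "V \<inter> W"] exI[of _ f'] exI[of _ g']) auto
  qed
  show "(%x. f x + g x) : reg (Sub X Z) U"
  proof (rule reg_subspace_intro)
   fix x assume "x : U"
   from *[OF this] obtain V f' g' where "Opn X V" "x : V" "V \<inter> Z <= U" "f' : reg X V" "g' : reg X V"
    "ALL y:V \<inter> Z. f y = f' y & g y = g' y" by (elim exE conjE)
   then show "EX V h. Opn X V & x : V & V \<inter> Z <= U & h : reg X V & (ALL y:V \<inter> Z. f y + g y = h y)"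
    by (intro exI[of _ V] exI[of _ "%x. f' x + g' x"]) (simp add: reg_add[OF X])
  qed
  show "(%x. f x * g x) : reg (Sub X Z) U"
  proof (rule reg_subspace_intro)
   fix x assume "x : U"
   from *[OF this] obtain V f' g' where "Opn X V" "x : V" "V \<inter> Z <= U" "f' : reg X V" "g' : reg X V"
    "ALL y:V \<inter> Z. f y = f' y & g y = g' y" by (elim exE conjE)
   then show "EX V h. Opn X V & x : V & V \<inter> Z <= U & h : reg X V & (ALL y:V \<inter> Z. f y * g y = h y)"
    by (intro exI[of _ V] exI[of _ "%x. f' x * g' x"]) (simp add: reg_mult[OF X])
  qed
 qed
 show "g : reg (Sub X Z) U" if f: "f : reg (Sub X Z) U" and fg: "ALL x:U. g x = f x" for f g
 proof (rule reg_subspace_intro)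
  fix x assume x: "x : U"
  obtain V f' where V: "Opn X V" "x : V" "V \<inter> Z <= U" "f' : reg X V"
    "ALL y:V \<inter> Z. f y = f' y" using reg_subspaceD[OF f x] by (elim exE conjE)
  have "ALL y:V \<inter> Z. g y = f' y" using V(3,5) fg by auto
  then show "EX V h. Opn X V & x : V & V \<inter> Z <= U & h : reg X V & (ALL y:V \<inter> Z. g y = h y)"
   using V by (intro exI[of _ V] exI[of _ f']) simp
 qed
 show "f : reg (Sub X Z) V"
  if f: "f : reg (Sub X Z) U" and V: "openin (subtopology (topo X) Z) V & V <= U" for f V
 proof (rule reg_subspace_intro)
  fix x assume x: "x : V"
  from V obtain V0 where V0: "Opn X V0" "V = V0 \<inter> Z" by (auto simp: openin_subtopology)
  obtain W f' where W: "Opn X W" "x : W" "W \<inter> Z <= U" "f' : reg X W"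
    "ALL y:W \<inter> Z. f y = f' y" using reg_subspaceD[OF f, of x] x V by blast
  then show "EX V' h. Opn X V' & x : V' & V' \<inter> Z <= V & h : reg X V' & (ALL y:V' \<inter> Z. f y = h y)"
   using V0 x reg_mono[OF X W(1,4), of "W \<inter> V0"]
   by (intro exI[of _ "W \<inter> V0"] exI[of _ f']) auto
 qed
 show "f : reg (Sub X Z) U"
  if *: "ALL x:U. EX V. openin (subtopology (topo X) Z) V & x : V & V <= U & f : reg (Sub X Z) V" for f
 proof (rule reg_subspace_intro)
  fix x assume x: "x : U"
  from bspec[OF * this] obtain V where V: "x : V" "V <= U" "f : reg (Sub X Z) V" by (elim exE conjE)
  obtain W f' where W: "Opn X W" "x : W" "W \<inter> Z <= V" "f' : reg X W"
    "ALL y:W \<inter> Z. f y = f' y" using reg_subspaceD[OF V(3,1)] by (elim exE conjE)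
  show "EX V h. Opn X V & x : V & V \<inter> Z <= U & h : reg X V & (ALL y:V \<inter> Z. f y = h y)"
   using W V(2) by (intro exI[of _ W] exI[of _ f']) auto
 qed
 fix f assume f: "f : reg (Sub X Z) U"
 \<comment> \<open>The extension may vanish where \<open>f\<close> does not, but only off
   \<open>Z\<close>; its non-vanishing locus is the right neighbourhood.\<close>
 have *: "EX V g. Opn X V & x : V & V \<inter> Z <= {x : U. f x ~= 0} & (%y. inverse (g y)) : reg X V &
   (ALL y:V \<inter> Z. f y = g y)" if x: "x : {x : U. f x ~= 0}" for x
 proof -
  obtain V g where V: "Opn X V" "x : V" "V \<inter> Z <= U" "g : reg X V"
    "ALL y:V \<inter> Z. f y = g y" using reg_subspaceD[OF f, of x] x by blast
  have o: "Opn X {y : V. g y ~= 0}" by (rule reg_nonzero[OF X V(1,4)])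
  have r: "(%y. inverse (g y)) : reg X {y : V. g y ~= 0}"
   by (rule reg_inverse[OF X o reg_mono[OF X V(1,4) o]]) auto
  have "x : Z" using x U0 by auto
  then show ?thesis using x V o r
   by (intro exI[of _ "{y : V. g y ~= 0}"] exI[of _ g]) auto
 qed
 show "openin (subtopology (topo X) Z) {x : U. f x ~= 0}"
 proof (subst openin_subopen, rule ballI)
  fix x assume x: "x : {x : U. f x ~= 0}"
  from *[OF this] obtain V g where "Opn X V" "x : V" "V \<inter> Z <= {x : U. f x ~= 0}" by (elim exE conjE)
  then show "EX T. openin (subtopology (topo X) Z) T & x : T & T <= {x : U. f x ~= 0}"
   using x U0 by (intro exI[of _ "V \<inter> Z"]) (auto simp: openin_subtopology)
 qed
 show "(%x. inverse (f x)) : reg (Sub X Z) {x : U. f x ~= 0}"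
 proof (rule reg_subspace_intro)
  fix x assume x: "x : {x : U. f x ~= 0}"
  from *[OF this] obtain V g where "Opn X V" "x : V" "V \<inter> Z <= {x : U. f x ~= 0}"
   "(%y. inverse (g y)) : reg X V" "ALL y:V \<inter> Z. f y = g y" by (elim exE conjE)
  then show "EX V g. Opn X V & x : V & V \<inter> Z <= {x : U. f x ~= 0} & g : reg X V &
   (ALL y:V \<inter> Z. inverse (f y) = g y)"
   by (intro exI[of _ V] exI[of _ "%y. inverse (g y)"]) simp
 qed
qed

lemma points_subspace: "points (Sub X Z) = points X \<inter> Z"
 by simp

lemma openin_subspace_open:
 "Opn X V ==> Opn (Sub X V) U \<longleftrightarrow> Opn X U & U <= V"
 by (simp add: openin_open_subtopology)

text \<open>On an open subspace the local extensions agree with the function itself on open sets, so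
  they glue back.\<close>

lemma reg_subspace_open:
 assumes X: "swf X" and V: "Opn X V" and U: "Opn X U" "U <= V"
 shows "reg (Sub X V) U = reg X U"
proof (intro set_eqI iffI)
 fix f assume f: "f : reg (Sub X V) U"
 show "f : reg X U"
 proof (rule reg_local[OF X U(1)])
  fix x assume x: "x : U"
  obtain W g where W: "Opn X W" "x : W" "W \<inter> V <= U" "g : reg X W"
    "ALL y:W \<inter> V. f y = g y" using reg_subspaceD[OF f x] by (elim exE conjE)
  have o: "Opn X (W \<inter> V)" using W V by blast
  show "EX V. Opn X V & x : V & V <= U & f : reg X V"
   using x U W o reg_cong[OF X o reg_mono[OF X W(1,4) o], of f] by (intro exI[of _ "W \<inter> V"]) auto
 qed
next
 fix f assume "f : reg X U"
 then show "f : reg (Sub X V) U" using reg_subspaceI[OF U(1), of f V] U(2)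
  by (simp add: Int_absorb2)
qed

text \<open>The universal property of a subspace. Functions on the subspace extend only locally,
  hence the appeal to \<open>reg_local\<close>.\<close>

lemma morphism_into_subspace_iff:
 assumes "swf X" "swf W"
 shows "morphism W (Sub X Z) f \<longleftrightarrow> morphism W X f & f ` points W <= Z"
proof (intro iffI conjI)
 assume f: "morphism W (Sub X Z) f"
 show "f ` points W <= Z" using morphism_points[OF f] by auto
 have *: "{x : points W. f x : V \<inter> Z} = {x : points W. f x : V}" for V
  using morphism_points[OF f] by auto
 show "morphism W X f"
 proof (rule morphismI)
  fix V assume V: "Opn X V"
  then have o: "Opn (Sub X Z) (V \<inter> Z)" by (auto simp: openin_subtopology)
  show "Opn W {x : points W. f x : V}" using morphism_open[OF f o] by (simp only: *)
  show "(%x. g (f x)) : reg W {x : points W. f x : V}" if "g : reg X V" for g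
   using morphism_reg[OF f o reg_subspaceI[OF V that]] by (simp only: *)
 qed (use morphism_points[OF f] in auto)
next
 assume "morphism W X f & f ` points W <= Z"
 then have f: "morphism W X f" and "f ` points W <= Z" by auto
 then have fZ: "f x : Z" if "x : points W" for x using that by auto
 show "morphism W (Sub X Z) f"
 proof (rule morphismI)
  fix V assume V: "Opn (Sub X Z) V"
  then obtain V0 where V0: "Opn X V0" "V = V0 \<inter> Z" by (auto simp: openin_subtopology)
  have *: "{x : points W. f x : V} = {x : points W. f x : V0}" using V0 fZ by auto
  show o: "Opn W {x : points W. f x : V}" unfolding * by (rule morphism_open[OF f V0(1)])
  fix g assume g: "g : reg (Sub X Z) V"
  show "(%x. g (f x)) : reg W {x : points W. f x : V}"
  proof (rule reg_local[OF assms(2) o])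
   fix x assume x: "x : {x : points W. f x : V}"
   obtain U h where U: "Opn X U" "f x : U" "U \<inter> Z <= V" "h : reg X U"
    "ALL y:U \<inter> Z. g y = h y" using reg_subspaceD[OF g, of "f x"] x by blast
   have oU: "Opn W {x : points W. f x : U}" by (rule morphism_open[OF f U(1)])
   have "(%x. g (f x)) : reg W {x : points W. f x : U}"
    by (rule reg_cong[OF assms(2) oU morphism_reg[OF f U(1,4)]]) (use U fZ in auto)
   then show "EX V'. Opn W V' & x : V' & V' <= {x : points W. f x : V} & (%x. g (f x)) : reg W V'"
    using x U oU fZ by (intro exI[of _ "{x : points W. f x : U}"]) auto
  qed
 qed (use morphism_points[OF f] fZ in auto)
qed

lemma morphism_inclusion: "swf X ==> morphism (Sub X Z) X (%x. x)"
 using morphism_into_subspace_iff[of X "Sub X Z" Z "%x. x"]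
  morphism_id[of "Sub X Z"] swf_subspace[of X Z] by blast

lemma morphism_restrict: "swf X ==> morphism X Y f ==> morphism (Sub X Z) Y f"
 using morphism_comp[OF morphism_inclusion] .

lemma subspace_subspace_morphism:
 assumes "swf X" "morphism (Sub X V) Y f" "U <= V" shows "morphism (Sub X U) Y f"
proof -
 have "morphism (Sub X U) (Sub X V) (%x. x)"
  using morphism_into_subspace_iff[OF assms(1) swf_subspace[OF assms(1), of U], of V "%x. x"]
   morphism_inclusion[OF assms(1), of U] assms(3) by auto
 then show ?thesis using morphism_comp assms(2) by blast
qed

text \<open>Preimages and pullbacks are assembled from an open cover of the source; no compatibility
  condition arises, since \<open>f\<close> is a single function.\<close>

lemma morphism_local:
 assumes W: "swf W"
  and "!!w. w : points W ==> EX V. Opn W V & w : V & morphism (Sub W V) Y f"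
 shows "morphism W Y f"
proof (rule morphismI)
 fix w assume w: "w : points W"
 obtain V where V: "w : V" "morphism (Sub W V) Y f" using assms(2)[OF w] by (elim exE conjE)
 show "f w : points Y" using morphism_points[OF V(2), of w] V(1) w by simp
next
 fix U assume U: "Opn Y U"
 have *: "EX V. Opn W {x : V. f x : U} & V <= points W & w : V & (ALL g : reg Y U. (%x. g (f x)) : reg W {x : V. f x : U})"
  if w: "w : points W" for w
 proof -
  obtain V where V: "Opn W V" "w : V" "morphism (Sub W V) Y f" using assms(2)[OF w] by (elim exE conjE)
  have VW: "V <= points W" using V(1) openin_subset by blast
  have e: "{x : points (Sub W V). f x : U} = {x : V. f x : U}" using VW by auto
  have o: "Opn W {x : V. f x : U}"
   using morphism_open[OF V(3) U, unfolded e] openin_subspace_open[OF V(1)] by blast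
  have "ALL g : reg Y U. (%x. g (f x)) : reg W {x : V. f x : U}"
   using morphism_reg[OF V(3) U, unfolded e] reg_subspace_open[OF W V(1) o] by auto
  then show ?thesis using o V(2) VW by (intro exI[of _ V]) simp
 qed
 show o: "Opn W {x : points W. f x : U}"
 proof (subst openin_subopen, rule ballI)
  fix w assume w: "w : {x : points W. f x : U}"
  then obtain V where "Opn W {x : V. f x : U}" "V <= points W" "w : V" using *[of w] by auto
  then show "EX T. Opn W T & w : T & T <= {x : points W. f x : U}"
   using w by (intro exI[of _ "{x : V. f x : U}"]) auto
 qed
 fix g assume g: "g : reg Y U"
 show "(%x. g (f x)) : reg W {x : points W. f x : U}"
 proof (rule reg_local[OF W o])
  fix w assume w: "w : {x : points W. f x : U}"
  then obtain V where "Opn W {x : V. f x : U}" "V <= points W" "w : V"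
   "(%x. g (f x)) : reg W {x : V. f x : U}" using *[of w] g by auto
  then show "EX V'. Opn W V' & w : V' & V' <= {x : points W. f x : U} & (%x. g (f x)) : reg W V'"
   using w by (intro exI[of _ "{x : V. f x : U}"]) auto
 qed
qed

subsection \<open>Quotients\<close>

lemma openin_quotient_space:
 "Opn (quotient_space X q) U \<longleftrightarrow> U <= q ` points X & Opn X {x : points X. q x : U}"
 by (simp add: quotient_space_def openin_quotient_topology)

lemma points_quotient: "points (quotient_space X q) = q ` points X"
proof
 show "points (quotient_space X q) <= q ` points X"
  using openin_topspace[of "topo (quotient_space X q)"] unfolding openin_quotient_space by simp
 have "{x : points X. q x : q ` points X} = points X" by auto
 then have "Opn (quotient_space X q) (q ` points X)" unfolding openin_quotient_space by simp
 then show "q ` points X <= points (quotient_space X q)" by (rule openin_subset)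
qed

lemma reg_quotient: "reg (quotient_space X q) U = {f. (%x. f (q x)) : reg X {x : points X. q x : U}}"
 by (simp add: quotient_space_def)

lemma swf_quotient: assumes X: "swf X" shows "swf (quotient_space X q)"
 unfolding space_with_functions_def
proof (intro allI impI conjI ballI)
 let ?p = "%U. {x : points X. q x : U}"
 fix U assume U: "Opn (quotient_space X q) U"
 then have o: "Opn X (?p U)" and Uq: "U <= q ` points X" unfolding openin_quotient_space by auto
 show "(%_. c) : reg (quotient_space X q) U" for c
  unfolding reg_quotient using reg_const[OF X o] by simp
 show "(%x. f x + g x) : reg (quotient_space X q) U" "(%x. f x * g x) : reg (quotient_space X q) U"
  if "f : reg (quotient_space X q) U" "g : reg (quotient_space X q) U" for f g
  using that reg_add[OF X o] reg_mult[OF X o] unfolding reg_quotient by auto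
 show "g : reg (quotient_space X q) U" if "f : reg (quotient_space X q) U" "ALL x:U. g x = f x" for f g
  using that reg_cong[OF X o, of "%x. f (q x)" "%x. g (q x)"] unfolding reg_quotient by auto
 show "f : reg (quotient_space X q) V"
  if "f : reg (quotient_space X q) U" "Opn (quotient_space X q) V & V <= U" for f V
 proof -
  have "Opn X (?p V)" using that(2) unfolding openin_quotient_space by simp
  then show ?thesis using that reg_mono[OF X o, of "%x. f (q x)" "?p V"] unfolding reg_quotient by auto
 qed
 show "f : reg (quotient_space X q) U"
  if *: "ALL x:U. EX V. Opn (quotient_space X q) V & x : V & V <= U & f : reg (quotient_space X q) V" for f
  unfolding reg_quotient
 proof (rule CollectI, rule reg_local[OF X o])
  fix x assume x: "x : ?p U"
  then obtain V where "Opn (quotient_space X q) V" "q x : V" "V <= U" "f : reg (quotient_space X q) V"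
   using bspec[OF *, of "q x"] by auto
  then show "EX V. Opn X V & x : V & V <= ?p U & (%x. f (q x)) : reg X V"
   using x unfolding openin_quotient_space reg_quotient by (intro exI[of _ "?p V"]) auto
 qed
 fix f assume "f : reg (quotient_space X q) U"
 then have f: "(%x. f (q x)) : reg X (?p U)" unfolding reg_quotient by simp
 have e: "?p {x : U. f x ~= 0} = {x : ?p U. f (q x) ~= 0}" by auto
 show "Opn (quotient_space X q) {x : U. f x ~= 0}"
  unfolding openin_quotient_space e
  by (intro conjI reg_nonzero[OF X o f] subset_trans[OF _ Uq]) simp
 show "(%x. inverse (f x)) : reg (quotient_space X q) {x : U. f x ~= 0}"
  unfolding reg_quotient e
  by (rule CollectI, rule reg_inverse[OF X reg_nonzero[OF X o f] reg_mono[OF X o f reg_nonzero[OF X o f]]]) auto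
qed

lemma morphism_quotient_map: "morphism X (quotient_space X q) q"
 by (rule morphismI) (auto simp: points_quotient openin_quotient_space reg_quotient)

text \<open>The universal property of the quotient: open sets and regular functions below are by
  definition those whose pullback along \<open>q\<close> is open or regular.\<close>

lemma morphism_from_quotient:
 assumes f: "morphism X Y (%x. f (q x))" shows "morphism (quotient_space X q) Y f"
proof (rule morphismI)
 fix x assume "x : points (quotient_space X q)"
 then show "f x : points Y" using morphism_points[OF f] unfolding points_quotient by auto
next
 fix V assume V: "Opn Y V"
 have e: "{x : points X. q x : {x : points (quotient_space X q). f x : V}} = {x : points X. f (q x) : V}"
  unfolding points_quotient by auto
 show "Opn (quotient_space X q) {x : points (quotient_space X q). f x : V}"
  unfolding openin_quotient_space e
  by (intro conjI morphism_open[OF f V]) (auto simp: points_quotient)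
 show "(%x. g (f x)) : reg (quotient_space X q) {x : points (quotient_space X q). f x : V}"
  if "g : reg Y V" for g
  unfolding reg_quotient e using morphism_reg[OF f V that] by simp
qed

subsection \<open>Products\<close>

text \<open>Closure under binary intersections turns the subbasis into a basis, so that openness can
  be tested point by point.\<close>

lemma openin_generated_basis:
 assumes "!!a b. a : B ==> b : B ==> a \<inter> b : B"
 shows "openin (topology_generated_by B) W \<longleftrightarrow> (ALL z:W. EX b:B. z : b & b <= W)"
proof
 assume "openin (topology_generated_by B) W"
 then have "generate_topology_on B W" by (simp add: openin_topology_generated_by_iff)
 then show "ALL z:W. EX b:B. z : b & b <= W"
 proof induction
  case (Int a b)
  show ?case
  proof
   fix z assume z: "z : a \<inter> b"
   obtain c where c: "c : B" "z : c" "c <= a" using Int.IH(1) z by auto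
   obtain d where d: "d : B" "z : d" "d <= b" using Int.IH(2) z by auto
   show "EX c:B. z : c & c <= a \<inter> b" using c d assms by (intro bexI[of _ "c \<inter> d"]) auto
  qed
 next
  case (UN K)
  show ?case
  proof
   fix z assume "z : \<Union>K"
   then obtain k where k: "k : K" "z : k" by auto
   then obtain b where "b : B" "z : b" "b <= k" using UN.IH[of k] by auto
   then show "EX b:B. z : b & b <= \<Union>K" using k by auto
  qed
 qed auto
next
 assume *: "ALL z:W. EX b:B. z : b & b <= W"
 show "openin (topology_generated_by B) W"
 proof (subst openin_subopen, rule ballI)
  fix z assume "z : W"
  then obtain b where "b : B" "z : b" "b <= W" using * by auto
  then show "EX T. openin (topology_generated_by B) T & z : T & T <= W"
   using topology_generated_by_Basis by (intro exI[of _ b]) auto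
 qed
qed

text \<open>Arbitrary finite index sets allow sums to be indexed by a disjoint union and products by
  a cartesian product.\<close>

lemma tensor_functionsI:
 assumes "finite I" "!!i. i : I ==> a i : reg X U" "!!i. i : I ==> b i : reg Y V"
 shows "(%(x, y). \<Sum>i\<in>I. a i x * b i y) : Tens X Y U V"
proof -
 obtain e where e: "bij_betw e {..<card I} I"
  using ex_bij_betw_nat_finite[OF assms(1)] by (auto simp: atLeast0LessThan)
 have "(%(x, y). \<Sum>i\<in>I. a i x * b i y) = (%(x, y). \<Sum>i<card I. a (e i) x * b (e i) y)"
  by (intro ext) (simp add: sum.reindex_bij_betw[OF e, of "%i. a i _ * b i _"] split: prod.splits)
 moreover have "e i : I" if "i < card I" for i using e that by (auto simp: bij_betw_def)
 ultimately show ?thesis unfolding tensor_functions_def using assms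
  by (intro CollectI exI[of _ "card I"] exI[of _ "%i. a (e i)"] exI[of _ "%i. b (e i)"]) simp
qed

lemma tensor_functionsE:
 assumes "h : Tens X Y U V"
 obtains n :: nat and a b where "!!i. i < n ==> a i : reg X U" "!!i. i < n ==> b i : reg Y V"
  "h = (%(x, y). \<Sum>i<n. a i x * b i y)"
 using assms unfolding tensor_functions_def by auto

lemma tensor_product:
 assumes "f : reg X U" "g : reg Y V" shows "(%(x, y). f x * g y) : Tens X Y U V"
 using tensor_functionsI[of "{0::nat}" "%_. f" X U "%_. g" Y V] assms by simp

lemma tensor_add:
 assumes "g : Tens X Y U V" "h : Tens X Y U V"
 shows "(%z. g z + h z) : Tens X Y U V"
proof -
 obtain n a b where 1: "!!i. i < (n::nat) ==> a i : reg X U" "!!i. i < n ==> b i : reg Y V"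
  "g = (%(x, y). \<Sum>i<n. a i x * b i y)" by (rule tensor_functionsE[OF assms(1)]) (rule that)
 obtain m c d where 2: "!!i. i < (m::nat) ==> c i : reg X U" "!!i. i < m ==> d i : reg Y V"
  "h = (%(x, y). \<Sum>i<m. c i x * d i y)" by (rule tensor_functionsE[OF assms(2)]) (rule that)
 have "(%z. g z + h z) = (%(x, y). \<Sum>i\<in>{..<n} <+> {..<m}. case_sum a c i x * case_sum b d i y)"
  by (intro ext) (simp add: 1 2 sum.Plus split: prod.splits)
 moreover have "(%(x, y). \<Sum>i\<in>{..<n} <+> {..<m}. case_sum a c i x * case_sum b d i y) : Tens X Y U V"
  by (rule tensor_functionsI) (use 1 2 in auto)
 ultimately show ?thesis by simp
qed

lemma tensor_mult:
 assumes "swf X" "swf Y" "Opn X U" "Opn Y V"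
  and "g : Tens X Y U V" "h : Tens X Y U V"
 shows "(%z. g z * h z) : Tens X Y U V"
proof -
 obtain n a b where 1: "!!i. i < (n::nat) ==> a i : reg X U" "!!i. i < n ==> b i : reg Y V"
  "g = (%(x, y). \<Sum>i<n. a i x * b i y)" by (rule tensor_functionsE[OF assms(5)]) (rule that)
 obtain m c d where 2: "!!i. i < (m::nat) ==> c i : reg X U" "!!i. i < m ==> d i : reg Y V"
  "h = (%(x, y). \<Sum>i<m. c i x * d i y)" by (rule tensor_functionsE[OF assms(6)]) (rule that)
 have "(%z. g z * h z) = (%(x, y). \<Sum>i\<in>{..<n} \<times> {..<m}. (a (fst i) x * c (snd i) x) * (b (fst i) y * d (snd i) y))"
  by (intro ext)
   (simp add: 1 2 sum_product sum.cartesian_product ac_simps case_prod_beta split: prod.splits)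
 then show ?thesis
  using tensor_functionsI[of "{..<n} \<times> {..<m}" "%i x. a (fst i) x * c (snd i) x" X U
    "%i y. b (fst i) y * d (snd i) y" Y V]
   1 2 reg_mult[OF assms(1,3)] reg_mult[OF assms(2,4)] by auto
qed

lemma tensor_mono:
 assumes "swf X" "swf Y" "Opn X U" "Opn Y V" "Opn X U'" "Opn Y V'"
  "U' <= U" "V' <= V" "h : Tens X Y U V"
 shows "h : Tens X Y U' V'"
proof -
 obtain n a b where 1: "!!i. i < (n::nat) ==> a i : reg X U" "!!i. i < n ==> b i : reg Y V"
  "h = (%(x, y). \<Sum>i<n. a i x * b i y)" by (rule tensor_functionsE[OF assms(9)]) (rule that)
 show ?thesis unfolding 1(3)
  by (rule tensor_functionsI)
   (simp_all add: reg_mono[OF assms(1,3) 1(1) assms(5,7)] reg_mono[OF assms(2,4) 1(2) assms(6,8)])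
qed

definition prod_basis :: "('a, 'k::field) fspace => ('b, 'k) fspace => ('a \<times> 'b) set set" where
 "prod_basis X Y = {{z : U \<times> V. h z ~= 0} | U V h.
     Opn X U & Opn Y V & h : Tens X Y U V}"

lemma openin_prod:
 assumes X: "swf X" and Y: "swf Y"
 shows "Opn (prod_space X Y) W \<longleftrightarrow> (ALL z:W. EX U V h. Opn X U & Opn Y V &
   h : Tens X Y U V & z : U \<times> V & h z ~= 0 & {w : U \<times> V. h w ~= 0} <= W)"
proof -
 \<comment> \<open>Two non-vanishing loci meet in the non-vanishing locus of the product of their
   functions.\<close>
 have "a \<inter> b : prod_basis X Y" if "a : prod_basis X Y" "b : prod_basis X Y" for a b
 proof -
  from that(1) obtain U V h where 1: "a = {z : U \<times> V. h z ~= 0}" "Opn X U" "Opn Y V"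
   "h : Tens X Y U V" unfolding prod_basis_def by auto
  from that(2) obtain U' V' h' where 2: "b = {z : U' \<times> V'. h' z ~= 0}" "Opn X U'" "Opn Y V'"
   "h' : Tens X Y U' V'" unfolding prod_basis_def by auto
  have o: "Opn X (U \<inter> U')" "Opn Y (V \<inter> V')" using 1 2 by auto
  have "(%z. h z * h' z) : Tens X Y (U \<inter> U') (V \<inter> V')"
   by (rule tensor_mult[OF X Y o tensor_mono[OF X Y 1(2,3) o _ _ 1(4)] tensor_mono[OF X Y 2(2,3) o _ _ 2(4)]]) auto
  moreover have "a \<inter> b = {z : (U \<inter> U') \<times> (V \<inter> V'). h z * h' z ~= 0}" using 1 2 by auto
  ultimately show ?thesis unfolding prod_basis_def using o
   by (intro CollectI exI[of _ "U \<inter> U'"] exI[of _ "V \<inter> V'"] exI[of _ "%z. h z * h' z"] conjI)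
 qed
 note basis = openin_generated_basis[of "prod_basis X Y" W, OF this]
 have e: "topo (prod_space X Y) = topology_generated_by (prod_basis X Y)"
  unfolding prod_space_def prod_basis_def by (simp only: fspace.select_convs)
 have "Opn (prod_space X Y) W \<longleftrightarrow> (ALL z:W. EX b:prod_basis X Y. z : b & b <= W)"
  unfolding e by (rule basis)
 also have "\<dots> \<longleftrightarrow> (ALL z:W. EX U V h. Opn X U & Opn Y V &
   h : Tens X Y U V & z : U \<times> V & h z ~= 0 & {w : U \<times> V. h w ~= 0} <= W)"
 proof (rule ball_cong[OF refl])
  fix z
  show "(EX b:prod_basis X Y. z : b & b <= W) \<longleftrightarrow> (EX U V h. Opn X U & Opn Y V &
   h : Tens X Y U V & z : U \<times> V & h z ~= 0 & {w : U \<times> V. h w ~= 0} <= W)"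
   (is "?L = ?R")
  proof
   assume ?L
   then obtain b where b: "b : prod_basis X Y" "z : b" "b <= W" by (elim bexE conjE)
   from b(1) obtain U V h where "b = {z : U \<times> V. h z ~= 0}" "Opn X U" "Opn Y V"
    "h : Tens X Y U V" unfolding prod_basis_def by auto
   then show ?R using b(2,3) by (intro exI[of _ U] exI[of _ V] exI[of _ h]) simp
  next
   assume ?R
   then obtain U V h where 1: "Opn X U" "Opn Y V"
    "h : Tens X Y U V" "z : U \<times> V" "h z ~= 0" "{w : U \<times> V. h w ~= 0} <= W"
    by (elim exE conjE)
   then have "{w : U \<times> V. h w ~= 0} : prod_basis X Y" unfolding prod_basis_def
    by (intro CollectI exI[of _ U] exI[of _ V] exI[of _ h] conjI refl)
   then show ?L by (rule bexI[rotated]) (use 1 in simp)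
  qed
 qed
 finally show ?thesis .
qed

lemma openin_prod_basic:
 assumes X: "swf X" and Y: "swf Y" and "Opn X U" "Opn Y V" "h : Tens X Y U V"
 shows "Opn (prod_space X Y) {w : U \<times> V. h w ~= 0}"
 unfolding openin_prod[OF X Y]
 by (rule ballI, rule exI[of _ U], rule exI[of _ V], rule exI[of _ h]) (use assms in auto)

lemma tensor_const:
 assumes "swf X" "swf Y" "Opn X U" "Opn Y V"
 shows "(%_. c) : Tens X Y U V"
 using tensor_product[OF reg_const[OF assms(1,3), of c] reg_const[OF assms(2,4), of 1]]
 by (simp add: case_prod_unfold)

lemma openin_prod_Times:
 assumes X: "swf X" and Y: "swf Y" and U: "Opn X U" "Opn Y V"
 shows "Opn (prod_space X Y) (U \<times> V)"
 using openin_prod_basic[OF assms tensor_const[OF assms, of 1]] by simp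

lemma points_prod: assumes X: "swf X" and Y: "swf Y" shows "points (prod_space X Y) = points X \<times> points Y"
proof
 show "points X \<times> points Y <= points (prod_space X Y)"
  by (rule openin_subset, rule openin_prod_Times[OF X Y]) auto
 show "points (prod_space X Y) <= points X \<times> points Y"
 proof
  fix z assume "z : points (prod_space X Y)"
  with openin_topspace[of "topo (prod_space X Y)"]
  obtain U V where "Opn X U" "Opn Y V" "z : U \<times> V"
   unfolding openin_prod[OF X Y] by (elim ballE[of _ _ z] exE conjE) auto
  then show "z : points X \<times> points Y" using openin_subset[of "topo X" U] openin_subset[of "topo Y" V] by auto
 qed
qed

lemma reg_prodD:
 assumes "f : reg (prod_space X Y) W" "z : W"
 shows "EX U V g h. Opn X U & Opn Y V &
    g : Tens X Y U V & h : Tens X Y U V &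
    z : U \<times> V & h z ~= 0 & {w : U \<times> V. h w ~= 0} <= W &
    (ALL w:U \<times> V. h w ~= 0 --> f w = g w / h w)"
 using assms unfolding prod_space_def by simp

lemma reg_prodI:
 assumes "!!z. z : W ==> EX U V g h. Opn X U & Opn Y V &
    g : Tens X Y U V & h : Tens X Y U V &
    z : U \<times> V & h z ~= 0 & {w : U \<times> V. h w ~= 0} <= W &
    (ALL w:U \<times> V. h w ~= 0 --> f w = g w / h w)"
 shows "f : reg (prod_space X Y) W"
 using assms unfolding prod_space_def by simp

text \<open>Near a point two quotients are brought to the common denominator \<open>h h'\<close>;
  sums and products are then read off from the numerators.\<close>

lemma reg_prod_common:
 assumes X: "swf X" and Y: "swf Y"
  and f: "f : reg (prod_space X Y) W" "z : W" and f': "f' : reg (prod_space X Y) W'" "z : W'"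
 shows "EX U V g g' h. Opn X U & Opn Y V & g : Tens X Y U V &
    g' : Tens X Y U V & h : Tens X Y U V &
    z : U \<times> V & h z ~= 0 & {w : U \<times> V. h w ~= 0} <= W \<inter> W' &
    (ALL w:U \<times> V. h w ~= 0 --> f w = g w / h w & f' w = g' w / h w)"
proof -
 from reg_prodD[OF f] obtain U V g h where 1: "Opn X U" "Opn Y V"
    "g : Tens X Y U V" "h : Tens X Y U V"
    "z : U \<times> V" "h z ~= 0" "{w : U \<times> V. h w ~= 0} <= W"
    "ALL w:U \<times> V. h w ~= 0 --> f w = g w / h w" by (elim exE conjE)
 from reg_prodD[OF f'] obtain U' V' g' h' where 2: "Opn X U'" "Opn Y V'"
    "g' : Tens X Y U' V'" "h' : Tens X Y U' V'"
    "z : U' \<times> V'" "h' z ~= 0" "{w : U' \<times> V'. h' w ~= 0} <= W'"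
    "ALL w:U' \<times> V'. h' w ~= 0 --> f' w = g' w / h' w" by (elim exE conjE)
 have o: "Opn X (U \<inter> U')" "Opn Y (V \<inter> V')" using 1 2 by auto
 have m: "k : Tens X Y (U \<inter> U') (V \<inter> V')" if "k : Tens X Y U V" for k
  by (rule tensor_mono[OF X Y 1(1,2) o _ _ that]) auto
 have m': "k : Tens X Y (U \<inter> U') (V \<inter> V')" if "k : Tens X Y U' V'" for k
  by (rule tensor_mono[OF X Y 2(1,2) o _ _ that]) auto
 show ?thesis
  apply (rule exI[of _ "U \<inter> U'"], rule exI[of _ "V \<inter> V'"], rule exI[of _ "%z. g z * h' z"],
   rule exI[of _ "%z. g' z * h z"], rule exI[of _ "%z. h z * h' z"])
  using 1 2 o tensor_mult[OF X Y o m m'[OF 2(4)], OF 1(3)] tensor_mult[OF X Y o m'[OF 2(3)] m[OF 1(4)]]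
   tensor_mult[OF X Y o m[OF 1(4)] m'[OF 2(4)]]
  by auto
qed

lemma swf_prod: assumes X: "swf X" and Y: "swf Y" shows "swf (prod_space X Y)"
 unfolding space_with_functions_def
proof (intro allI impI conjI ballI)
 fix W assume W: "Opn (prod_space X Y) W"
 show const: "(%_. c) : reg (prod_space X Y) W" for c
 proof (rule reg_prodI)
  fix z assume "z : W"
  with W obtain U V h where 1: "Opn X U" "Opn Y V"
   "h : Tens X Y U V" "z : U \<times> V" "h z ~= 0" "{w : U \<times> V. h w ~= 0} <= W"
   unfolding openin_prod[OF X Y] by (elim ballE[of _ _ z] exE conjE) auto
  \<comment> \<open>The fraction must be defined exactly on a basic set inside \<open>W\<close>, so
    the constant is written as \<open>c h / h\<close> with the \<open>h\<close> of that set.\<close>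
  have "(%z. c * h z) : Tens X Y U V"
   by (rule tensor_mult[OF X Y 1(1,2) tensor_const[OF X Y 1(1,2)] 1(3)])
  then show "EX U V g h. Opn X U & Opn Y V &
    g : Tens X Y U V & h : Tens X Y U V &
    z : U \<times> V & h z ~= 0 & {w : U \<times> V. h w ~= 0} <= W &
    (ALL w:U \<times> V. h w ~= 0 --> c = g w / h w)"
   using 1 by (intro exI[of _ U] exI[of _ V] exI[of _ "%z. c * h z"] exI[of _ h]) simp
 qed
 show "(%x. f x + g x) : reg (prod_space X Y) W" "(%x. f x * g x) : reg (prod_space X Y) W"
  if f: "f : reg (prod_space X Y) W" and g: "g : reg (prod_space X Y) W" for f g
 proof -
  show "(%x. f x + g x) : reg (prod_space X Y) W"
  proof (rule reg_prodI)
   fix z assume z: "z : W"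
   from reg_prod_common[OF X Y f z g z] obtain U V a b h where 1: "Opn X U" "Opn Y V"
    "a : Tens X Y U V" "b : Tens X Y U V" "h : Tens X Y U V"
    "z : U \<times> V" "h z ~= 0" "{w : U \<times> V. h w ~= 0} <= W \<inter> W"
    "ALL w:U \<times> V. h w ~= 0 --> f w = a w / h w & g w = b w / h w" by (elim exE conjE)
   then show "EX U V k h. Opn X U & Opn Y V &
    k : Tens X Y U V & h : Tens X Y U V &
    z : U \<times> V & h z ~= 0 & {w : U \<times> V. h w ~= 0} <= W &
    (ALL w:U \<times> V. h w ~= 0 --> f w + g w = k w / h w)"
    using tensor_add[OF 1(3,4)]
    by (intro exI[of _ U] exI[of _ V] exI[of _ "%z. a z + b z"] exI[of _ h]) (simp add: add_divide_distrib)
  qed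
  show "(%x. f x * g x) : reg (prod_space X Y) W"
  proof (rule reg_prodI)
   fix z assume z: "z : W"
   from reg_prod_common[OF X Y f z g z] obtain U V a b h where 1: "Opn X U" "Opn Y V"
    "a : Tens X Y U V" "b : Tens X Y U V" "h : Tens X Y U V"
    "z : U \<times> V" "h z ~= 0" "{w : U \<times> V. h w ~= 0} <= W \<inter> W"
    "ALL w:U \<times> V. h w ~= 0 --> f w = a w / h w & g w = b w / h w" by (elim exE conjE)
   then show "EX U V k h. Opn X U & Opn Y V &
    k : Tens X Y U V & h : Tens X Y U V &
    z : U \<times> V & h z ~= 0 & {w : U \<times> V. h w ~= 0} <= W &
    (ALL w:U \<times> V. h w ~= 0 --> f w * g w = k w / h w)"
    using tensor_mult[OF X Y 1(1,2,3,4)] tensor_mult[OF X Y 1(1,2,5,5)]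
    by (intro exI[of _ U] exI[of _ V] exI[of _ "%z. a z * b z"] exI[of _ "%z. h z * h z"]) simp
  qed
 qed
 show "g : reg (prod_space X Y) W" if f: "f : reg (prod_space X Y) W" and fg: "ALL x:W. g x = f x" for f g
 proof (rule reg_prodI)
  fix z assume z: "z : W"
  from reg_prodD[OF f z] obtain U V a h where 1: "Opn X U" "Opn Y V"
    "a : Tens X Y U V" "h : Tens X Y U V"
    "z : U \<times> V" "h z ~= 0" "{w : U \<times> V. h w ~= 0} <= W"
    "ALL w:U \<times> V. h w ~= 0 --> f w = a w / h w" by (elim exE conjE)
  have "ALL w:U \<times> V. h w ~= 0 --> g w = a w / h w" using 1(7,8) fg by (auto simp: subset_iff)
  then show "EX U V k h. Opn X U & Opn Y V &
    k : Tens X Y U V & h : Tens X Y U V &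
    z : U \<times> V & h z ~= 0 & {w : U \<times> V. h w ~= 0} <= W &
    (ALL w:U \<times> V. h w ~= 0 --> g w = k w / h w)"
   using 1 by (intro exI[of _ U] exI[of _ V] exI[of _ a] exI[of _ h] conjI)
 qed
 show "f : reg (prod_space X Y) W'"
  if f: "f : reg (prod_space X Y) W" and W': "Opn (prod_space X Y) W' & W' <= W" for f W'
 proof (rule reg_prodI)
  fix z assume z: "z : W'"
  with W' obtain U V h where 1: "Opn X U" "Opn Y V"
   "h : Tens X Y U V" "z : U \<times> V" "h z ~= 0" "{w : U \<times> V. h w ~= 0} <= W'"
   unfolding openin_prod[OF X Y] by (elim ballE[of _ _ z] exE conjE) auto
  from z W' have zW: "z : W" by auto
  from reg_prodD[OF f zW] obtain U' V' a h' where 2: "Opn X U'" "Opn Y V'"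
    "a : Tens X Y U' V'" "h' : Tens X Y U' V'"
    "z : U' \<times> V'" "h' z ~= 0" "{w : U' \<times> V'. h' w ~= 0} <= W"
    "ALL w:U' \<times> V'. h' w ~= 0 --> f w = a w / h' w" by (elim exE conjE)
  have o: "Opn X (U \<inter> U')" "Opn Y (V \<inter> V')" using 1 2 by auto
  have m: "k : Tens X Y (U \<inter> U') (V \<inter> V')" if "k : Tens X Y U V" for k
   by (rule tensor_mono[OF X Y 1(1,2) o _ _ that]) auto
  have m': "k : Tens X Y (U \<inter> U') (V \<inter> V')" if "k : Tens X Y U' V'" for k
   by (rule tensor_mono[OF X Y 2(1,2) o _ _ that]) auto
  show "EX U V k h. Opn X U & Opn Y V &
    k : Tens X Y U V & h : Tens X Y U V &
    z : U \<times> V & h z ~= 0 & {w : U \<times> V. h w ~= 0} <= W' &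
    (ALL w:U \<times> V. h w ~= 0 --> f w = k w / h w)"
   \<comment> \<open>Expanding the fraction by \<open>h\<close> shrinks its domain into
     \<open>W'\<close> without changing its value.\<close>
   apply (rule exI[of _ "U \<inter> U'"], rule exI[of _ "V \<inter> V'"], rule exI[of _ "%z. a z * h z"],
     rule exI[of _ "%z. h' z * h z"])
   using 1 2 o tensor_mult[OF X Y o m'[OF 2(3)] m[OF 1(3)]] tensor_mult[OF X Y o m'[OF 2(4)] m[OF 1(3)]]
   by auto
 qed
 show "f : reg (prod_space X Y) W"
  if *: "ALL x:W. EX V. Opn (prod_space X Y) V & x : V & V <= W & f : reg (prod_space X Y) V" for f
 proof (rule reg_prodI)
  fix z assume z: "z : W"
  from bspec[OF * this] obtain W' where W': "z : W'" "W' <= W" "f : reg (prod_space X Y) W'" by (elim exE conjE)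
  from reg_prodD[OF W'(3,1)] obtain U V a h where 1: "Opn X U" "Opn Y V"
    "a : Tens X Y U V" "h : Tens X Y U V"
    "z : U \<times> V" "h z ~= 0" "{w : U \<times> V. h w ~= 0} <= W'"
    "ALL w:U \<times> V. h w ~= 0 --> f w = a w / h w" by (elim exE conjE)
  show "EX U V k h. Opn X U & Opn Y V &
    k : Tens X Y U V & h : Tens X Y U V &
    z : U \<times> V & h z ~= 0 & {w : U \<times> V. h w ~= 0} <= W &
    (ALL w:U \<times> V. h w ~= 0 --> f w = k w / h w)"
   using 1 subset_trans[OF 1(7) W'(2)]
   by (intro exI[of _ U] exI[of _ V] exI[of _ a] exI[of _ h] conjI)
 qed
 fix f assume f: "f : reg (prod_space X Y) W"
 have *: "EX U V g h. Opn X U & Opn Y V &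
    g : Tens X Y U V & h : Tens X Y U V &
    z : U \<times> V & h z ~= 0 & {w : U \<times> V. h w ~= 0} <= {z : W. f z ~= 0} &
    (ALL w:U \<times> V. h w ~= 0 --> inverse (f w) = g w / h w)" if z: "z : {z : W. f z ~= 0}" for z
 proof -
  have zW: "z : W" using z by simp
  from reg_prodD[OF f zW] obtain U V a h where 1: "Opn X U" "Opn Y V"
    "a : Tens X Y U V" "h : Tens X Y U V"
    "z : U \<times> V" "h z ~= 0" "{w : U \<times> V. h w ~= 0} <= W"
    "ALL w:U \<times> V. h w ~= 0 --> f w = a w / h w" by (elim exE conjE)
  show ?thesis
   \<comment> \<open>The inverse of \<open>a / h\<close> is written as \<open>h h / (a h)\<close>:
     the extra factor confines the domain to the set where the original fraction represents
     \<open>f\<close>.\<close>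
   apply (rule exI[of _ U], rule exI[of _ V], rule exI[of _ "%z. h z * h z"],
     rule exI[of _ "%z. a z * h z"])
   using 1 z tensor_mult[OF X Y 1(1,2,4,4)] tensor_mult[OF X Y 1(1,2,3,4)] by auto
 qed
 show "Opn (prod_space X Y) {z : W. f z ~= 0}"
  unfolding openin_prod[OF X Y]
 proof
  fix z assume "z : {z : W. f z ~= 0}"
  from *[OF this] show "EX U V h. Opn X U & Opn Y V &
    h : Tens X Y U V &
    z : U \<times> V & h z ~= 0 & {w : U \<times> V. h w ~= 0} <= {z : W. f z ~= 0}"
   by (elim exE conjE) (intro exI conjI)
 qed
 show "(%z. inverse (f z)) : reg (prod_space X Y) {z : W. f z ~= 0}"
  by (rule reg_prodI) (rule *)
qed

lemma morphism_fst: assumes X: "swf X" and Y: "swf Y" shows "morphism (prod_space X Y) X fst"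
proof (rule morphismI)
 fix U assume U: "Opn X U"
 have e: "{z : points (prod_space X Y). fst z : U} = U \<times> points Y"
  using openin_subset[OF U] by (auto simp: points_prod[OF X Y])
 have Y': "Opn Y (points Y)" by simp
 show "Opn (prod_space X Y) {z : points (prod_space X Y). fst z : U}"
  unfolding e by (rule openin_prod_Times[OF X Y U Y'])
 show "(%z. g (fst z)) : reg (prod_space X Y) {z : points (prod_space X Y). fst z : U}" if g: "g : reg X U" for g
  unfolding e
 proof (rule reg_prodI)
  fix z assume "z : U \<times> points Y"
  then show "EX U' V a h. Opn X U' & Opn Y V &
    a : Tens X Y U' V & h : Tens X Y U' V &
    z : U' \<times> V & h z ~= 0 & {w : U' \<times> V. h w ~= 0} <= U \<times> points Y &
    (ALL w:U' \<times> V. h w ~= 0 --> g (fst w) = a w / h w)"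
   using U tensor_const[OF X Y U Y', of 1] tensor_product[OF g reg_const[OF Y Y', of 1]]
   by (intro exI[of _ U] exI[of _ "points Y"] exI[of _ "%(x, y). g x * 1"] exI[of _ "%_. 1"]) auto
 qed
qed (auto simp: points_prod[OF X Y])

lemma morphism_snd: assumes X: "swf X" and Y: "swf Y" shows "morphism (prod_space X Y) Y snd"
proof (rule morphismI)
 fix U assume U: "Opn Y U"
 have e: "{z : points (prod_space X Y). snd z : U} = points X \<times> U"
  using openin_subset[OF U] by (auto simp: points_prod[OF X Y])
 have X': "Opn X (points X)" by simp
 show "Opn (prod_space X Y) {z : points (prod_space X Y). snd z : U}"
  unfolding e by (rule openin_prod_Times[OF X Y X' U])
 show "(%z. g (snd z)) : reg (prod_space X Y) {z : points (prod_space X Y). snd z : U}" if g: "g : reg Y U" for g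
  unfolding e
 proof (rule reg_prodI)
  fix z assume "z : points X \<times> U"
  then show "EX U' V a h. Opn X U' & Opn Y V &
    a : Tens X Y U' V & h : Tens X Y U' V &
    z : U' \<times> V & h z ~= 0 & {w : U' \<times> V. h w ~= 0} <= points X \<times> U &
    (ALL w:U' \<times> V. h w ~= 0 --> g (snd w) = a w / h w)"
   using U tensor_const[OF X Y X' U, of 1] tensor_product[OF reg_const[OF X X', of 1] g]
   by (intro exI[of _ "points X"] exI[of _ U] exI[of _ "%(x, y). 1 * g y"] exI[of _ "%_. 1"]) auto
 qed
qed (auto simp: points_prod[OF X Y])

lemma tensor_pullback:
 assumes W: "swf W" and f: "morphism W X f" "Opn X U" and g: "morphism W Y g" "Opn Y V"
  and h: "h : Tens X Y U V"
  and O: "Opn W O'" "!!w. w : O' ==> f w : U & g w : V"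
 shows "(%w. h (f w, g w)) : reg W O'"
proof -
 obtain n a b where 1: "!!i. i < (n::nat) ==> a i : reg X U" "!!i. i < n ==> b i : reg Y V"
  "h = (%(x, y). \<Sum>i<n. a i x * b i y)" by (rule tensor_functionsE[OF h]) (rule that)
 have "(%w. \<Sum>i<n. a i (f w) * b i (g w)) : reg W O'"
 proof (rule reg_sum[OF W O(1)])
  fix i assume "i : {..<n}"
  then have i: "i < n" by simp
  show "(%w. a i (f w) * b i (g w)) : reg W O'"
   by (rule reg_mult[OF W O(1) morphism_reg_on[OF W f 1(1)[OF i] O(1)] morphism_reg_on[OF W g 1(2)[OF i] O(1)]])
    (use O(2) in auto)
 qed
 then show ?thesis by (simp add: 1(3))
qed

text \<open>The universal property of the product. The topology is finer than the product topology,
  so openness of preimages rests on pulling back tensor functions to regular functions.\<close>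

lemma morphism_pair:
 assumes W: "swf W" and X: "swf X" and Y: "swf Y" and f: "morphism W X f" and g: "morphism W Y g"
 shows "morphism W (prod_space X Y) (%w. (f w, g w))"
proof (rule morphismI)
 fix w assume "w : points W"
 then show "(f w, g w) : points (prod_space X Y)"
  using morphism_points[OF f] morphism_points[OF g] by (auto simp: points_prod[OF X Y])
next
 let ?O = "%U V. {w : points W. f w : U} \<inter> {w : points W. g w : V}"
 have oO: "Opn W (?O U V)" if "Opn X U" "Opn Y V" for U V
  by (rule openin_Int[OF morphism_open[OF f that(1)] morphism_open[OF g that(2)]])
 fix T assume T: "Opn (prod_space X Y) T"
 show oT: "Opn W {w : points W. (f w, g w) : T}"
 proof (subst openin_subopen, rule ballI)
  fix w assume w: "w : {w : points W. (f w, g w) : T}"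
  then have "(f w, g w) : T" by simp
  from bspec[OF T[unfolded openin_prod[OF X Y]] this]
  obtain U V h where 1: "Opn X U" "Opn Y V"
   "h : Tens X Y U V" "(f w, g w) : U \<times> V" "h (f w, g w) ~= 0" "{w : U \<times> V. h w ~= 0} <= T"
   by (elim exE conjE)
  have "Opn W {w : ?O U V. h (f w, g w) ~= 0}"
   by (rule reg_nonzero[OF W oO[OF 1(1,2)] tensor_pullback[OF W f 1(1) g 1(2,3) oO[OF 1(1,2)]]]) simp
  moreover have "w : {w : ?O U V. h (f w, g w) ~= 0}" using 1(4,5) w by simp
  moreover have "{w : ?O U V. h (f w, g w) ~= 0} <= {w : points W. (f w, g w) : T}"
   using 1(6) by (simp add: subset_iff)
  ultimately show "EX T'. Opn W T' & w : T' & T' <= {w : points W. (f w, g w) : T}"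
   by (intro exI conjI)
 qed
 fix k assume k: "k : reg (prod_space X Y) T"
 show "(%w. k (f w, g w)) : reg W {w : points W. (f w, g w) : T}"
 proof (rule reg_local[OF W oT])
  fix w assume w: "w : {w : points W. (f w, g w) : T}"
  then have "(f w, g w) : T" by simp
  from reg_prodD[OF k this]
  obtain U V a h where 1: "Opn X U" "Opn Y V"
   "a : Tens X Y U V" "h : Tens X Y U V"
   "(f w, g w) : U \<times> V" "h (f w, g w) ~= 0" "{w : U \<times> V. h w ~= 0} <= T"
   "ALL w:U \<times> V. h w ~= 0 --> k w = a w / h w"
   by (elim exE conjE)
  let ?N = "{w : ?O U V. h (f w, g w) ~= 0}"
  have N: "Opn W ?N"
   by (rule reg_nonzero[OF W oO[OF 1(1,2)] tensor_pullback[OF W f 1(1) g 1(2,4) oO[OF 1(1,2)]]]) simp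
  have "(%w. a (f w, g w) / h (f w, g w)) : reg W ?N"
   by (rule reg_divide[OF W N tensor_pullback[OF W f 1(1) g 1(2,3) N] tensor_pullback[OF W f 1(1) g 1(2,4) N]]) simp_all
  then have "(%w. k (f w, g w)) : reg W ?N"
   by (rule reg_cong[OF W N]) (use 1(8) in simp)
  moreover have "w : ?N" using 1(5,6) w by simp
  moreover have "?N <= {w : points W. (f w, g w) : T}" using 1(7) by (simp add: subset_iff)
  ultimately show "EX V. Opn W V & w : V & V <= {w : points W. (f w, g w) : T} & (%w. k (f w, g w)) : reg W V"
   using N by (intro exI[of _ ?N] conjI)
 qed
qed

section \<open>Affine space\<close>

lemma poly_uminus: "f : Polys n ==> (%x. - f x) : Polys n"
 using poly_functions.mult[OF poly_functions.const[of "-1" n]] by simp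

lemma poly_diff: "f : Polys n ==> g : Polys n ==> (%x. f x - g x) : Polys n"
 using poly_functions.add[OF _ poly_uminus, of f n g] by simp

lemma poly_power: "f : Polys n ==> (%x. f x ^ k) : Polys n"
 by (induction k) (simp_all add: poly_functions.const poly_functions.mult)

lemma poly_sum: "(!!i. i : I ==> f i : Polys n) ==> (%x. \<Sum>i\<in>I. f i x) : Polys n"
 by (induction I rule: infinite_finite_induct) (simp_all add: poly_functions.const poly_functions.add)

lemmas poly_ops = poly_functions.const poly_functions.coord poly_functions.add poly_functions.mult
 poly_uminus poly_diff poly_power

lemma poly_subst:
 assumes "P : Polys n" "!!i. i < n ==> F i : Polys m"
 shows "(%x. P (%i. F i x)) : Polys m"
 using assms by (induction P rule: poly_functions.induct) (simp_all add: poly_ops)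

lemma poly_cong: "P : Polys n ==> (!!i. i < n ==> x i = y i) ==> P x = P y"
 by (induction P rule: poly_functions.induct) simp_all

lemma reg_poly_comp:
 assumes "P : Polys n" "swf W" "Opn W V" "!!i. i < n ==> F i : reg W V"
 shows "(%w. P (%i. F i w)) : reg W V"
 using assms by (induction P rule: poly_functions.induct) (simp_all add: reg_ops)

definition affine_basic :: "nat => ((nat => 'k::field) => 'k) => (nat => 'k) set" where
 "affine_basic n h = {y : affine_points n. h y ~= 0}"

lemma openin_affine:
 fixes W :: "(nat => 'k::field) set"
 shows "Opn (Aff n) W \<longleftrightarrow>
  (ALL x:W. EX h:Polys n. x : affine_basic n h & affine_basic n h <= W)"
proof -
 let ?B = "{affine_basic n h | h. h : Polys n} :: (nat => 'k) set set"
 have "a \<inter> b : ?B" if "a : ?B" "b : ?B" for a b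
 proof -
  from that obtain g h where gh: "a = affine_basic n g" "g : Polys n"
   "b = affine_basic n h" "h : Polys n" by (elim CollectE exE conjE)
  have "a \<inter> b = affine_basic n (%x. g x * h x)" using gh by (auto simp: affine_basic_def)
  then show ?thesis using poly_functions.mult[OF gh(2,4)] by (intro CollectI exI conjI)
 qed
 note basis = openin_generated_basis[of ?B W, OF this]
 have e: "topo (Aff n :: 'k aspace) = topology_generated_by ?B"
  unfolding affine_space_def affine_basic_def by (simp only: fspace.select_convs)
 have "Opn (Aff n) W \<longleftrightarrow> (ALL x:W. EX b:?B. x : b & b <= W)"
  unfolding e by (rule basis)
 moreover have "(EX b:?B. x : b & b <= W) \<longleftrightarrow> (EX h:Polys n. x : affine_basic n h & affine_basic n h <= W)" for x
  by auto
 ultimately show ?thesis by simp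
qed

lemma openin_affine_basic: "h : Polys n ==> Opn (Aff n) (affine_basic n h)"
 unfolding openin_affine by auto

lemma points_affine [simp]: "points (Aff n) = affine_points n"
proof
 have "affine_basic n (%_. 1) = affine_points n" by (auto simp: affine_basic_def)
 then show "affine_points n <= points (Aff n)"
  using openin_subset[OF openin_affine_basic[OF poly_functions.const, of n 1]] by metis
 show "points (Aff n) <= affine_points n"
  using openin_topspace[of "topo (Aff n)"] unfolding openin_affine by (auto simp: affine_basic_def)
qed

lemma reg_affineD:
 assumes "f : reg (Aff n) U" "x : U"
 shows "EX g h. g : Polys n & h : Polys n & h x ~= 0 &
    affine_basic n h <= U & (ALL y:affine_basic n h. f y = g y / h y)"
 using assms unfolding affine_space_def affine_basic_def by (simp add: Ball_def imp_conjL)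

lemma reg_affineI:
 assumes "!!x. x : U ==> EX g h. g : Polys n & h : Polys n & h x ~= 0 &
    affine_basic n h <= U & (ALL y:affine_basic n h. f y = g y / h y)"
 shows "f : reg (Aff n) U"
 using assms unfolding affine_space_def affine_basic_def by (simp add: Ball_def imp_conjL)

lemma reg_affine_common:
 assumes f: "f : reg (Aff n) W" "x : W" and f': "f' : reg (Aff n) W'" "x : W'"
 shows "EX g g' h. g : Polys n & g' : Polys n & h : Polys n & h x ~= 0 &
    affine_basic n h <= W \<inter> W' & (ALL y:affine_basic n h. f y = g y / h y & f' y = g' y / h y)"
proof -
 from reg_affineD[OF f] obtain g h where 1: "g : Polys n" "h : Polys n" "h x ~= 0"
    "affine_basic n h <= W" "ALL y:affine_basic n h. f y = g y / h y" by (elim exE conjE)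
 from reg_affineD[OF f'] obtain g' h' where 2: "g' : Polys n" "h' : Polys n" "h' x ~= 0"
    "affine_basic n h' <= W'" "ALL y:affine_basic n h'. f' y = g' y / h' y" by (elim exE conjE)
 have e: "affine_basic n (%y. h y * h' y) = affine_basic n h \<inter> affine_basic n h'"
  by (auto simp: affine_basic_def)
 show ?thesis
  by (rule exI[of _ "%y. g y * h' y"], rule exI[of _ "%y. g' y * h y"], rule exI[of _ "%y. h y * h' y"])
   (use 1 2 in \<open>auto simp: e poly_functions.mult, auto simp: affine_basic_def\<close>)
qed

lemma swf_affine: "swf (Aff n :: (nat => 'k::field, 'k) fspace)"
 unfolding space_with_functions_def
proof (intro allI impI conjI ballI)
 fix W assume W: "Opn (Aff n :: 'k aspace) W"
 show "(%_. c) : reg (Aff n) W" for c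
 proof (rule reg_affineI)
  fix x assume x: "x : W"
  from bspec[OF W[unfolded openin_affine] x] obtain h where "h : Polys n"
   "x : affine_basic n h" "affine_basic n h <= W" by (elim bexE conjE)
  then show "EX g h. g : Polys n & h : Polys n & h x ~= 0 &
    affine_basic n h <= W & (ALL y:affine_basic n h. c = g y / h y)"
   by (intro exI[of _ "%x. c * h x"] exI[of _ h]) (simp add: affine_basic_def poly_ops)
 qed
 show "(%x. f x + g x) : reg (Aff n) W" "(%x. f x * g x) : reg (Aff n) W"
  if f: "f : reg (Aff n) W" and g: "g : reg (Aff n) W" for f g
 proof -
  have *: "EX a b h. a : Polys n & b : Polys n & h : Polys n & h x ~= 0 &
    affine_basic n h <= W & (ALL y:affine_basic n h. f y = a y / h y & g y = b y / h y)" if x: "x : W" for x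
   using reg_affine_common[OF f x g x] by (simp only: Int_absorb)
  show "(%x. f x + g x) : reg (Aff n) W"
  proof (rule reg_affineI)
   fix x assume "x : W"
   from *[OF this] obtain a b h where "a : Polys n" "b : Polys n" "h : Polys n"
    "h x ~= 0" "affine_basic n h <= W" "ALL y:affine_basic n h. f y = a y / h y & g y = b y / h y"
    by (elim exE conjE)
   then show "EX k h. k : Polys n & h : Polys n & h x ~= 0 &
    affine_basic n h <= W & (ALL y:affine_basic n h. f y + g y = k y / h y)"
    by (intro exI[of _ "%x. a x + b x"] exI[of _ h]) (simp add: poly_ops add_divide_distrib)
  qed
  show "(%x. f x * g x) : reg (Aff n) W"
  proof (rule reg_affineI)
   fix x assume "x : W"
   from *[OF this] obtain a b h where "a : Polys n" "b : Polys n" "h : Polys n"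
    "h x ~= 0" "affine_basic n h <= W" "ALL y:affine_basic n h. f y = a y / h y & g y = b y / h y"
    by (elim exE conjE)
   then show "EX k h. k : Polys n & h : Polys n & h x ~= 0 &
    affine_basic n h <= W & (ALL y:affine_basic n h. f y * g y = k y / h y)"
    by (intro exI[of _ "%x. a x * b x"] exI[of _ "%x. h x * h x"])
     (simp add: poly_ops affine_basic_def)
  qed
 qed
 show "g : reg (Aff n) W" if f: "f : reg (Aff n) W" and fg: "ALL x:W. g x = f x" for f g
 proof (rule reg_affineI)
  fix x assume x: "x : W"
  from reg_affineD[OF f x] obtain a h where 1: "a : Polys n" "h : Polys n" "h x ~= 0"
    "affine_basic n h <= W" "ALL y:affine_basic n h. f y = a y / h y" by (elim exE conjE)
  have "ALL y:affine_basic n h. g y = a y / h y" using 1(4,5) fg by (simp add: subset_iff)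
  then show "EX k h. k : Polys n & h : Polys n & h x ~= 0 &
    affine_basic n h <= W & (ALL y:affine_basic n h. g y = k y / h y)"
   using 1 by (intro exI[of _ a] exI[of _ h] conjI)
 qed
 show "f : reg (Aff n) W'"
  if f: "f : reg (Aff n) W" and W': "Opn (Aff n) W' & W' <= W" for f W'
 proof (rule reg_affineI)
  fix x assume x: "x : W'"
  from bspec[OF conjunct1[OF W', unfolded openin_affine] x] obtain h where 1: "h : Polys n"
   "x : affine_basic n h" "affine_basic n h <= W'" by (elim bexE conjE)
  from x W' have xW: "x : W" by (simp add: subset_iff)
  from reg_affineD[OF f xW] obtain a k where 2: "a : Polys n" "k : Polys n" "k x ~= 0"
    "affine_basic n k <= W" "ALL y:affine_basic n k. f y = a y / k y" by (elim exE conjE)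
  show "EX g h. g : Polys n & h : Polys n & h x ~= 0 &
    affine_basic n h <= W' & (ALL y:affine_basic n h. f y = g y / h y)"
   using 1 2 by (intro exI[of _ "%x. a x * h x"] exI[of _ "%x. k x * h x"])
    (auto simp: poly_ops affine_basic_def)
 qed
 show "f : reg (Aff n) W"
  if *: "ALL x:W. EX V. Opn (Aff n) V & x : V & V <= W & f : reg (Aff n) V" for f
 proof (rule reg_affineI)
  fix x assume x: "x : W"
  from bspec[OF * this] obtain W' where W': "x : W'" "W' <= W" "f : reg (Aff n) W'" by (elim exE conjE)
  from reg_affineD[OF W'(3,1)] obtain a k where "a : Polys n" "k : Polys n" "k x ~= 0"
    "affine_basic n k <= W'" "ALL y:affine_basic n k. f y = a y / k y" by (elim exE conjE)
  then show "EX g h. g : Polys n & h : Polys n & h x ~= 0 &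
    affine_basic n h <= W & (ALL y:affine_basic n h. f y = g y / h y)"
   using W'(2) by (intro exI[of _ a] exI[of _ k]) simp
 qed
 fix f assume f: "f : reg (Aff n) W"
 have *: "EX g h. g : Polys n & h : Polys n & h x ~= 0 &
    affine_basic n h <= {z : W. f z ~= 0} & (ALL y:affine_basic n h. inverse (f y) = g y / h y)"
  if x: "x : {z : W. f z ~= 0}" for x
 proof -
  have xW: "x : W" and fx: "f x ~= 0" using x by auto
  have "x : affine_points n" using xW openin_subset[OF W] by auto
  moreover from reg_affineD[OF f xW] obtain a k where "a : Polys n" "k : Polys n" "k x ~= 0"
    "affine_basic n k <= W" "ALL y:affine_basic n k. f y = a y / k y" by (elim exE conjE)
  ultimately show ?thesis using fx
   by (intro exI[of _ "%x. k x * k x"] exI[of _ "%x. a x * k x"])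
    (auto simp: poly_ops affine_basic_def)
 qed
 show "Opn (Aff n) {z : W. f z ~= 0}"
  unfolding openin_affine
 proof
  fix x assume x: "x : {z : W. f z ~= 0}"
  then have "x : affine_points n" using openin_subset[OF W] by auto
  moreover from *[OF x] obtain h where "h : Polys n" "h x ~= 0" "affine_basic n h <= {z : W. f z ~= 0}"
   by (elim exE conjE)
  ultimately show "EX h:Polys n. x : affine_basic n h & affine_basic n h <= {z : W. f z ~= 0}"
   by (intro bexI[of _ h]) (simp_all add: affine_basic_def)
 qed
 show "(%x. inverse (f x)) : reg (Aff n) {z : W. f z ~= 0}"
  by (rule reg_affineI) (rule *)
qed

lemma reg_affine_poly: 
 assumes "P : Polys n" "Opn (Aff n) U" shows "P : reg (Aff n) U"
proof -
 have "P : reg (Aff n) (affine_points n)"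
 proof (rule reg_affineI)
  fix x :: "nat => 'a" assume "x : affine_points n"
  then show "EX g h. g : Polys n & h : Polys n & h x ~= 0 &
    affine_basic n h <= affine_points n & (ALL y:affine_basic n h. P y = g y / h y)"
   using assms(1) by (intro exI[of _ P] exI[of _ "%_. 1"]) (simp add: affine_basic_def poly_ops)
 qed
 moreover have "Opn (Aff n) (affine_points n)"
  using openin_topspace[of "topo (Aff n)"] unfolding points_affine .
 ultimately show ?thesis using reg_mono[OF swf_affine, of n "affine_points n" P U] assms(2)
  openin_subset[OF assms(2)] by simp
qed

text \<open>Open sets and regular functions of affine space are described by polynomials in the
  coordinates, so regularity of the coordinates is enough.\<close>

lemma morphism_into_affine:
 fixes W :: "('w, 'k::field) fspace" and F :: "'w => nat => 'k"
 assumes W: "swf W" and F: "!!w. w : points W ==> F w : affine_points n"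
  "!!i. i < n ==> (%w. F w i) : reg W (points W)"
 shows "morphism W (Aff n) F"
proof (rule morphismI)
 have oW: "Opn W (points W)" by simp
 have P: "(%w. P (F w)) : reg W (points W)" if "P : Polys n" for P
  using reg_poly_comp[OF that W oW, of "%i w. F w i"] F(2) by simp
 have PV: "(%w. P (F w)) : reg W V" if "P : Polys n" "Opn W V" for P V
  by (rule reg_mono[OF W oW P[OF that(1)] that(2) openin_subset[OF that(2)]])
 have o: "Opn W {w : points W. h (F w) ~= 0}" if "h : Polys n" for h
  by (rule reg_nonzero[OF W oW P[OF that]])
 fix V :: "(nat => 'k) set" assume V: "Opn (Aff n) V"
 show oV: "Opn W {w : points W. F w : V}"
 proof (subst openin_subopen, rule ballI)
  fix w assume w: "w : {w : points W. F w : V}"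
  then have "F w : V" by simp
  from bspec[OF V[unfolded openin_affine] this] obtain h where h: "h : Polys n"
   "F w : affine_basic n h" "affine_basic n h <= V" by (elim bexE conjE)
  have "w : {w : points W. h (F w) ~= 0}" using w h(2) by (simp add: affine_basic_def)
  moreover have "{w : points W. h (F w) ~= 0} <= {w : points W. F w : V}"
   using h(3) F(1) by (simp add: affine_basic_def subset_iff)
  ultimately show "EX T. Opn W T & w : T & T <= {w : points W. F w : V}"
   using o[OF h(1)] by (intro exI conjI)
 qed
 fix f assume f: "f : reg (Aff n) V"
 show "(%w. f (F w)) : reg W {w : points W. F w : V}"
 proof (rule reg_local[OF W oV])
  fix w assume w: "w : {w : points W. F w : V}"
  then have "F w : V" by simp
  from reg_affineD[OF f this] obtain a h where h: "a : Polys n" "h : Polys n" "h (F w) ~= 0"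
    "affine_basic n h <= V" "ALL y:affine_basic n h. f y = a y / h y" by (elim exE conjE)
  let ?N = "{w : points W. h (F w) ~= 0}"
  have N: "Opn W ?N" by (rule o[OF h(2)])
  have "(%w. a (F w) / h (F w)) : reg W ?N"
   by (rule reg_divide[OF W N PV[OF h(1) N] PV[OF h(2) N]]) simp
  then have "(%w. f (F w)) : reg W ?N"
   by (rule reg_cong[OF W N]) (use h(5) F(1) in \<open>simp add: affine_basic_def\<close>)
  moreover have "w : ?N" using w h(3) by simp
  moreover have "?N <= {w : points W. F w : V}"
   using h(4) F(1) by (simp add: affine_basic_def subset_iff)
  ultimately show "EX V'. Opn W V' & w : V' & V' <= {w : points W. F w : V} & (%w. f (F w)) : reg W V'"
   using N by (intro exI conjI)
 qed
qed (use F in simp)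

lemma coord_reg:
 assumes "swf W" "morphism W (Aff n) F" "Opn W U" "i < n"
 shows "(%w. F w i) : reg W U"
proof -
 have o: "Opn (Aff n) (points (Aff n))" by (rule openin_topspace)
 show ?thesis
  by (rule morphism_reg_on[OF assms(1,2) o reg_affine_poly[OF poly_functions.coord[OF assms(4)] o] assms(3)])
   (use morphism_points[OF assms(2)] openin_subset[OF assms(3)] in auto)
qed

text \<open>Restriction to the line through two points reduces irreducibility questions to one
  variable: over an infinite field two nonzero polynomials have a common non-root, so non-empty open
  sets meet on that line.\<close>

lemma poly_on_line:
 assumes "P : Polys n"
 shows "EX p. ALL t. P (%i. x i + t * (y i - x i)) = poly p t"
 using assms
proof induction
 case (const c) show ?case by (rule exI[of _ "[:c:]"]) simp
next
 case (coord i) show ?case by (rule exI[of _ "[:x i, y i - x i:]"]) simp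
next
 case (add f g)
 then obtain p q where "ALL t. f (%i. x i + t * (y i - x i)) = poly p t"
  "ALL t. g (%i. x i + t * (y i - x i)) = poly q t" by (elim exE)
 then show ?case by (intro exI[of _ "p + q"]) simp
next
 case (mult f g)
 then obtain p q where "ALL t. f (%i. x i + t * (y i - x i)) = poly p t"
  "ALL t. g (%i. x i + t * (y i - x i)) = poly q t" by (elim exE)
 then show ?case by (intro exI[of _ "p * q"]) simp
qed

lemma poly_common_nonzero:
 fixes P Q :: "(nat => 'k::field_char_0) => 'k"
 assumes P: "P : Polys n" "P x ~= 0" and Q: "Q : Polys n" "Q y ~= 0"
 shows "EX t. P (%i. x i + t * (y i - x i)) ~= 0 & Q (%i. x i + t * (y i - x i)) ~= 0"
proof -
 obtain p where p: "!!t. P (%i. x i + t * (y i - x i)) = poly p t" using poly_on_line[OF P(1)] by metis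
 obtain q where q: "!!t. Q (%i. x i + t * (y i - x i)) = poly q t" using poly_on_line[OF Q(1)] by metis
 have "poly p 0 ~= 0" using p[of 0] P(2) by simp
 moreover have "poly q 1 ~= 0" using q[of 1] Q(2) by simp
 ultimately have "p * q ~= 0" by auto
 then have "finite {t. poly (p * q) t = 0}" by (rule poly_roots_finite)
 then obtain t where "poly (p * q) t ~= 0" using infinite_UNIV_char_0[where 'a = 'k]
  by (metis (mono_tags, lifting) UNIV_eq_I mem_Collect_eq)
 then show ?thesis using p[of t] q[of t] by (intro exI[of _ t]) simp
qed

lemma affine_opens_meet:
 fixes U V :: "(nat => 'k::field_char_0) set"
 assumes "Opn (Aff n) U" "Opn (Aff n) V" "U ~= {}" "V ~= {}"
 shows "U \<inter> V ~= {}"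
proof -
 obtain x y where x: "x : U" and y: "y : V" using assms by auto
 from bspec[OF assms(1)[unfolded openin_affine] x] obtain g where g: "g : Polys n"
  "x : affine_basic n g" "affine_basic n g <= U" by (elim bexE conjE)
 from bspec[OF assms(2)[unfolded openin_affine] y] obtain h where h: "h : Polys n"
  "y : affine_basic n h" "affine_basic n h <= V" by (elim bexE conjE)
 obtain t where t: "g (%i. x i + t * (y i - x i)) ~= 0" "h (%i. x i + t * (y i - x i)) ~= 0"
  using poly_common_nonzero[of g n x h y] g h by (auto simp: affine_basic_def)
 have "(%i. x i + t * (y i - x i)) : affine_points n"
  using g(2) h(2) by (simp add: affine_basic_def affine_points_def)
 then have "(%i. x i + t * (y i - x i)) : U \<inter> V"
  using g(3) h(3) t by (auto simp: affine_basic_def)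
 then show ?thesis by blast
qed

section \<open>Projective space\<close>

text \<open>The point with homogeneous coordinates \<open>v 0, ..., v n\<close>. Entries beyond
  \<open>n\<close> are cut off, so a vector given by a formula for all indices can be used
  directly.\<close>

definition hp :: "nat => (nat => 'k::field) => (nat => 'k) set" where
 "hp n v = proj_class (%i. if i <= n then v i else 0)"

text \<open>An arbitrary choice of homogeneous coordinates. Only vanishing of forms and ratios of
  forms of equal degree are ever read off from it.\<close>

definition rep :: "(nat => 'k::field) set => nat => 'k" where
 "rep A = (SOME z. z : A)"

lemma rep_proj_class: "EX c. c ~= 0 & (ALL i. rep (proj_class v) i = c * v i)"
proof -
 have "v : proj_class v" unfolding proj_class_def by (intro CollectI exI[of _ 1]) simp
 then have "rep (proj_class v) : proj_class v" unfolding rep_def by (rule someI[of "%z. z : proj_class v"])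
 then show ?thesis unfolding proj_class_def by auto
qed

lemma proj_class_eqI:
 assumes "c ~= 0" "!!i. w i = c * v i" shows "proj_class w = proj_class v"
proof -
 have w: "w = (%i. c * v i)" using assms(2) by blast
 have "(%i. d * w i) = (%i. (d * c) * v i)" for d by (simp add: w mult.assoc)
 moreover have "(%i. d * v i) = (%i. (d / c) * w i)" for d using assms(1) by (simp add: w)
 moreover have "d ~= 0 ==> d * c ~= 0" "d ~= 0 ==> d / c ~= 0" for d using assms(1) by auto
 ultimately show ?thesis unfolding proj_class_def by (intro subset_antisym subsetI) blast+
qed

lemma rep_hp: "EX c. c ~= 0 & (ALL i<=n. rep (hp n v) i = c * v i)"
 using rep_proj_class[of "%i. if i <= n then v i else 0"] unfolding hp_def by (elim exE) (auto intro!: exI)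

lemma hp_eqI:
 assumes "c ~= 0" "!!i. i <= n ==> w i = c * v i" shows "hp n w = hp n v"
 unfolding hp_def by (rule proj_class_eqI[OF assms(1)]) (simp add: assms(2))

lemma hp_eqD:
 assumes "hp n w = hp n v" shows "EX c. c ~= 0 & (ALL i<=n. w i = c * v i)"
proof -
 obtain c where c: "c ~= 0" "ALL i<=n. rep (hp n v) i = c * v i" using rep_hp by metis
 obtain d where d: "d ~= 0" "ALL i<=n. rep (hp n w) i = d * w i" using rep_hp by metis
 have "w i = (c / d) * v i" if "i <= n" for i using c d assms that by (simp add: field_simps)
 then show ?thesis using c(1) d(1) by (intro exI[of _ "c / d"]) simp
qed

definition cone_points :: "nat => (nat => 'k::field) set" where
 "cone_points n = affine_points (Suc n) - {%_. 0}"

lemma proj_space_eq: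
 "Proj n = quotient_space (Sub (Aff (Suc n)) (cone_points n)) proj_class"
 by (simp add: proj_space_def cone_points_def)

lemma swf_cone: "swf (Sub (Aff (Suc n)) (cone_points n))"
 by (rule swf_subspace[OF swf_affine])

lemma swf_proj: "swf (Proj n)"
 unfolding proj_space_eq by (rule swf_quotient[OF swf_cone])

lemma points_cone: "points (Sub (Aff (Suc n)) (cone_points n)) = cone_points n"
 by (auto simp: cone_points_def)

lemma hp_cone: assumes "v : cone_points n" shows "hp n v = proj_class v"
proof -
 have "(%i. if i <= n then v i else 0) = v"
  using assms by (auto simp: cone_points_def affine_points_def)
 then show ?thesis by (simp add: hp_def)
qed

lemma truncate_cone: "(%i. if i <= n then v i else 0) : cone_points n \<longleftrightarrow> (EX i<=n. v i ~= 0)"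
 by (auto simp: cone_points_def affine_points_def fun_eq_iff)

lemma points_proj: "points (Proj n :: ((nat => 'k::field) set, 'k) fspace) = {hp n v | v. EX i<=n. v i ~= 0}"
proof -
 have "proj_class ` (cone_points n :: (nat => 'k) set) = {hp n v | v. EX i<=n. v i ~= 0}"
 proof (intro subset_antisym subsetI)
  fix A :: "(nat => 'k) set" assume "A : proj_class ` cone_points n"
  then obtain v where v: "v : cone_points n" "A = proj_class v" by auto
  have "(%i. if i <= n then v i else 0) = v"
   using v(1) by (auto simp: cone_points_def affine_points_def)
  then have "EX i<=n. v i ~= 0" using truncate_cone[of n v] v(1) by simp
  then show "A : {hp n v | v. EX i<=n. v i ~= 0}" using hp_cone[OF v(1)] v(2) by blast
 next
  fix A :: "(nat => 'k) set" assume "A : {hp n v | v. EX i<=n. v i ~= 0}"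
  then show "A : proj_class ` cone_points n" using truncate_cone[of n] unfolding hp_def by auto
 qed
 then show ?thesis unfolding proj_space_eq points_quotient points_cone .
qed

lemma hp_points: "hp n v : points (Proj n) \<longleftrightarrow> (EX i<=n. v i ~= 0)"
proof
 assume "hp n v : points (Proj n)"
 then obtain w where w: "hp n v = hp n w" "EX i<=n. w i ~= 0" unfolding points_proj by auto
 from hp_eqD[OF w(1)[symmetric]] w(2) show "EX i<=n. v i ~= 0" by force
qed (auto simp: points_proj)

lemma hp_rep: assumes "A : points (Proj n)" shows "hp n (rep A) = A"
proof -
 obtain v where v: "A = hp n v" using assms unfolding points_proj by auto
 obtain c where "c ~= 0" "ALL i<=n. rep (hp n v) i = c * v i" using rep_hp by metis
 then show ?thesis using hp_eqI[of c n "rep A" v] v by simp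
qed

lemma rep_nonzero: "A : points (Proj n) ==> EX i<=n. rep A i ~= 0"
 using hp_rep hp_points by metis

definition hom_poly :: "nat => nat => ((nat => 'k::field) => 'k) => bool" where
 "hom_poly n d F \<longleftrightarrow> F : Polys (Suc n) & (ALL c v. F (%i. c * v i) = c ^ d * F v)"

lemma hom_poly_coord: "i <= n ==> hom_poly n 1 (%v. v i)"
 by (simp add: hom_poly_def poly_ops)

lemma hom_poly_mult: "hom_poly n d F ==> hom_poly n e G ==> hom_poly n (d + e) (%v. F v * G v)"
 by (simp add: hom_poly_def poly_ops power_add)

lemma hom_poly_add: "hom_poly n d F ==> hom_poly n d G ==> hom_poly n d (%v. F v + G v)"
 by (simp add: hom_poly_def poly_ops distrib_left)

lemma hom_poly_diff: "hom_poly n d F ==> hom_poly n d G ==> hom_poly n d (%v. F v - G v)"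
 by (simp add: hom_poly_def poly_ops right_diff_distrib)

lemma hom_poly_rep:
 assumes F: "hom_poly n d F" shows "EX c. c ~= 0 & F (rep (hp n v)) = c ^ d * F v"
proof -
 obtain c where c: "c ~= 0" "ALL i<=n. rep (hp n v) i = c * v i" using rep_hp by metis
 have "F (rep (hp n v)) = F (%i. c * v i)"
  using F c(2) by (intro poly_cong[of F "Suc n"]) (auto simp: hom_poly_def)
 then show ?thesis using F c(1) by (intro exI[of _ c]) (simp add: hom_poly_def)
qed

lemma hom_poly_rep_zero: "hom_poly n d F ==> F (rep (hp n v)) = 0 \<longleftrightarrow> F v = 0"
 using hom_poly_rep[of n d F v] by auto

lemma hom_poly_class_zero: "hom_poly n d F ==> v : cone_points n ==> F (rep (proj_class v)) = 0 \<longleftrightarrow> F v = 0"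
 using hom_poly_rep_zero[of n d F v] hp_cone[of v n] by simp

lemma hom_poly_nonzero_preimage:
 assumes F: "hom_poly n d F"
 shows "{v : cone_points n. proj_class v : {A : proj_class ` cone_points n. F (rep A) ~= 0}} =
   affine_basic (Suc n) F \<inter> cone_points n"
proof (rule set_eqI)
 fix v :: "nat => 'a"
 have "v : cone_points n ==> v : affine_points (Suc n)" by (simp add: cone_points_def)
 then show "v : {v : cone_points n. proj_class v : {A : proj_class ` cone_points n. F (rep A) ~= 0}} \<longleftrightarrow>
   v : affine_basic (Suc n) F \<inter> cone_points n"
  using hom_poly_class_zero[OF F, of v] by (simp add: affine_basic_def) blast
qed

lemma openin_hom_poly:
 assumes F: "hom_poly n d F"
 shows "Opn (Proj n) {A : points (Proj n). F (rep A) ~= 0}"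
proof -
 note e = hom_poly_nonzero_preimage[OF F]
 have o: "Opn (Sub (Aff (Suc n)) (cone_points n)) (affine_basic (Suc n) F \<inter> cone_points n)"
  using F unfolding topo_subspace openin_subtopology hom_poly_def
  by (intro exI[of _ "affine_basic (Suc n) F"] conjI openin_affine_basic refl) simp
 show ?thesis
  unfolding proj_space_eq openin_quotient_space points_quotient points_cone e
  by (rule conjI[OF _ o]) (rule subsetI, simp)
qed

text \<open>On the cone the ratio is an ordinary quotient of polynomials; replacing \<open>v\<close>
  by the chosen representative multiplies both forms by the same power of a scalar.\<close>

lemma hom_ratio_reg:
 assumes F: "hom_poly n d F" and G: "hom_poly n d G"
 shows "(%A. F (rep A) / G (rep A)) : reg (Proj n) {A : points (Proj n). G (rep A) ~= 0}"
proof -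
 let ?C = "Sub (Aff (Suc n)) (cone_points n)"
 note e = hom_poly_nonzero_preimage[OF G]
 have oG: "Opn (Aff (Suc n)) (affine_basic (Suc n) G)"
  using openin_affine_basic G unfolding hom_poly_def by auto
 have "(%v. F v / G v) : reg (Aff (Suc n)) (affine_basic (Suc n) G)"
  by (rule reg_divide[OF swf_affine oG]) (use F G reg_affine_poly[OF _ oG] in \<open>auto simp: hom_poly_def affine_basic_def\<close>)
 from reg_subspaceI[OF oG this, of "cone_points n"]
 have "(%v. F (rep (proj_class v)) / G (rep (proj_class v))) : reg ?C (affine_basic (Suc n) G \<inter> cone_points n)"
 proof (rule reg_cong[OF swf_cone, rotated])
  show "Opn ?C (affine_basic (Suc n) G \<inter> cone_points n)"
   unfolding topo_subspace openin_subtopology by (intro exI[of _ "affine_basic (Suc n) G"] conjI oG refl)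
  fix v assume v: "v : affine_basic (Suc n) G \<inter> cone_points n"
  obtain c where c: "c ~= 0" "ALL i<=n. rep (hp n v) i = c * v i" using rep_hp by metis
  have H: "H (rep (hp n v)) = c ^ d * H v" if "hom_poly n d H" for H
  proof -
   have "H (rep (hp n v)) = H (%i. c * v i)"
    using that c(2) by (intro poly_cong[of H "Suc n"]) (auto simp: hom_poly_def)
   then show ?thesis using that by (simp add: hom_poly_def)
  qed
  have "hp n v = proj_class v" using v by (simp add: hp_cone)
  then show "F (rep (proj_class v)) / G (rep (proj_class v)) = F v / G v"
   using H[OF F] H[OF G] c(1) by simp
 qed
 then show ?thesis
  unfolding proj_space_eq reg_quotient points_quotient points_cone e by (simp only: mem_Collect_eq)
qed

lemma morphism_hp:
 fixes W :: "('w, 'k::field) fspace"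
 assumes W: "swf W" and F: "!!i. i <= n ==> F i : reg W (points W)"
  and nz: "!!w. w : points W ==> EX i<=n. F i w ~= 0"
 shows "morphism W (Proj n) (%w. hp n (%i. F i w))"
proof -
 let ?G = "%w i. if i <= n then F i w else 0"
 have "morphism W (Aff (Suc n)) ?G"
  by (rule morphism_into_affine[OF W]) (use F in \<open>auto simp: affine_points_def\<close>)
 moreover have "?G ` points W <= cone_points n"
  using nz truncate_cone by fast
 ultimately have "morphism W (Sub (Aff (Suc n)) (cone_points n)) ?G"
  unfolding morphism_into_subspace_iff[OF swf_affine W] by blast
 from morphism_comp[OF this morphism_quotient_map[of _ proj_class]]
 show ?thesis unfolding proj_space_eq hp_def .
qed

lemma morphism_hp_local:
 fixes W :: "('w, 'k::field) fspace"
 assumes W: "swf W"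
  and "!!w. w : points W ==> EX V F. Opn W V & w : V & (ALL i<=n. F i : reg W V) &
   (ALL v:V. (EX i<=n. F i v ~= 0) & f v = hp n (%i. F i v))"
 shows "morphism W (Proj n) f"
proof (rule morphism_local[OF W])
 fix w assume "w : points W"
 from assms(2)[OF this] obtain V F where V: "Opn W V" "w : V" "ALL i<=n. F i : reg W V"
  "ALL v:V. (EX i<=n. F i v ~= 0) & f v = hp n (%i. F i v)" by (elim exE conjE)
 have p: "points (Sub W V) = V" using openin_subset[OF V(1)] by auto
 have "morphism (Sub W V) (Proj n) (%w. hp n (%i. F i w))"
  by (rule morphism_hp[OF swf_subspace[OF W]], unfold p)
   (use V in \<open>auto simp: reg_subspace_open[OF W V(1) V(1)]\<close>)
 then have "morphism (Sub W V) (Proj n) f"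
  by (rule morphism_cong[OF swf_subspace[OF W]], unfold p) (use V(4) in auto)
 then show "EX V. Opn W V & w : V & morphism (Sub W V) (Proj n) f"
  using V(1,2) by (intro exI[of _ V] conjI)
qed

lemma open_rep_nonzero:
 assumes "morphism W (Proj n) f" "l <= n"
 shows "Opn W {w : points W. rep (f w) l ~= 0}"
proof -
 have "{w : points W. f w : {A : points (Proj n). rep A l ~= 0}} = {w : points W. rep (f w) l ~= 0}"
  using morphism_points[OF assms(1)] by auto
 then show ?thesis using morphism_open[OF assms(1) openin_hom_poly[OF hom_poly_coord[OF assms(2)]]] by simp
qed

lemma hom_ratio_reg_on:
 assumes "swf W" "morphism W (Proj n) f" "hom_poly n d F" "hom_poly n d G"
  "Opn W V" "!!w. w : V ==> G (rep (f w)) ~= 0"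
 shows "(%w. F (rep (f w)) / G (rep (f w))) : reg W V"
 by (rule morphism_reg_on[OF assms(1,2) openin_hom_poly[OF assms(4)] hom_ratio_reg[OF assms(3,4)] assms(5)])
  (use assms(6) morphism_points[OF assms(2)] openin_subset[OF assms(5)] in auto)

lemma ratio_reg:
 assumes "swf W" "morphism W (Proj n) f" "j <= n" "l <= n"
  "Opn W V" "!!w. w : V ==> rep (f w) l ~= 0"
 shows "(%w. rep (f w) j / rep (f w) l) : reg W V"
 using hom_ratio_reg_on[OF assms(1,2) hom_poly_coord[OF assms(3)] hom_poly_coord[OF assms(4)] assms(5,6)] .

text \<open>The homogeneous coordinates of \<open>f w\<close> are not regular functions of
  \<open>w\<close>, but their quotients by a coordinate that does not vanish are; dividing the
  relation by it shows that its failure is an open condition.\<close>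

lemma linear_relation_closed:
 fixes W :: "('w, 'k::field) fspace"
 assumes W: "swf W" and f: "morphism W (Proj n) f" and c: "!!i. i <= n ==> c i : reg W (points W)"
 shows "closedin (topo W) {w : points W. (\<Sum>i\<le>n. c i w * rep (f w) i) = 0}"
proof -
 have "Opn W {w : points W. (\<Sum>i\<le>n. c i w * rep (f w) i) ~= 0}"
 proof (subst openin_subopen, rule ballI)
  fix w assume w: "w : {w : points W. (\<Sum>i\<le>n. c i w * rep (f w) i) ~= 0}"
  then have "f w : points (Proj n)" using morphism_points[OF f] by auto
  then obtain l where l: "l <= n" "rep (f w) l ~= 0" using rep_nonzero by blast
  let ?V = "{w : points W. rep (f w) l ~= 0}"
  have V: "Opn W ?V" by (rule open_rep_nonzero[OF f l(1)])
  have oW: "Opn W (points W)" by simp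
  let ?s = "%w. \<Sum>i\<le>n. c i w * (rep (f w) i / rep (f w) l)"
  have "?s : reg W ?V"
   by (intro reg_sum[OF W V] reg_mult[OF W V] reg_mono[OF W oW c V] ratio_reg[OF W f _ l(1) V]) auto
  then have "Opn W {w : ?V. ?s w ~= 0}" by (rule reg_nonzero[OF W V])
  moreover have s: "?s w = (\<Sum>i\<le>n. c i w * rep (f w) i) / rep (f w) l" for w
   by (simp add: sum_divide_distrib)
  have "w : {w : ?V. ?s w ~= 0}" unfolding s using w l by simp
  moreover have "{w : ?V. ?s w ~= 0} <= {w : points W. (\<Sum>i\<le>n. c i w * rep (f w) i) ~= 0}"
   unfolding s by auto
  ultimately show "EX T. Opn W T & w : T & T <= {w : points W. (\<Sum>i\<le>n. c i w * rep (f w) i) ~= 0}"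
   by (intro exI conjI)
 qed
 moreover have "points W - {w : points W. (\<Sum>i\<le>n. c i w * rep (f w) i) = 0} =
   {w : points W. (\<Sum>i\<le>n. c i w * rep (f w) i) ~= 0}" by auto
 ultimately show ?thesis unfolding closedin_def by auto
qed

text \<open>A matrix of regular functions applied to homogeneous coordinates. Where the
  \<open>l\<close>-th coordinate does not vanish, dividing by it gives regular components of the
  same projective point.\<close>

lemma morphism_linear_map:
 fixes W :: "('w, 'k::field) fspace"
 assumes W: "swf W" and f: "morphism W (Proj n) f"
  and B: "!!j i. j <= m ==> i <= n ==> B j i : reg W (points W)"
  and nz: "!!w. w : points W ==> EX j<=m. (\<Sum>i\<le>n. B j i w * rep (f w) i) ~= 0"
 shows "morphism W (Proj m) (%w. hp m (%j. \<Sum>i\<le>n. B j i w * rep (f w) i))"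
proof (rule morphism_hp_local[OF W])
 fix w assume w: "w : points W"
 then have "f w : points (Proj n)" using morphism_points[OF f] by auto
 then obtain l where l: "l <= n" "rep (f w) l ~= 0" using rep_nonzero by blast
 let ?V = "{w : points W. rep (f w) l ~= 0}"
 have V: "Opn W ?V" by (rule open_rep_nonzero[OF f l(1)])
 have oW: "Opn W (points W)" by simp
 let ?F = "%j w. \<Sum>i\<le>n. B j i w * (rep (f w) i / rep (f w) l)"
 have F: "?F j : reg W ?V" if "j <= m" for j
  by (intro reg_sum[OF W V] reg_mult[OF W V] reg_mono[OF W oW B[OF that] V] ratio_reg[OF W f _ l(1) V]) auto
 have s: "?F j w = inverse (rep (f w) l) * (\<Sum>i\<le>n. B j i w * rep (f w) i)" for j w
  by (simp add: sum_distrib_left divide_inverse ac_simps)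
 have "(EX j<=m. ?F j v ~= 0) & hp m (%j. \<Sum>i\<le>n. B j i v * rep (f v) i) = hp m (%j. ?F j v)"
  if v: "v : ?V" for v
 proof
  have nz': "inverse (rep (f v) l) ~= 0" using v by simp
  show "EX j<=m. ?F j v ~= 0" unfolding s using nz[of v] v nz' by (simp only: mult_eq_0_iff mem_Collect_eq) blast
  show "hp m (%j. \<Sum>i\<le>n. B j i v * rep (f v) i) = hp m (%j. ?F j v)"
   by (rule hp_eqI[OF nz', symmetric], rule s)
 qed
 then show "EX V F. Opn W V & w : V & (ALL i<=m. F i : reg W V) &
   (ALL v:V. (EX i<=m. F i v ~= 0) & hp m (%j. \<Sum>i\<le>n. B j i v * rep (f v) i) = hp m (%i. F i v))"
  using V w l F by (intro exI[of _ ?V] exI[of _ ?F]) blast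
qed

subsection \<open>Separatedness and gluing\<close>

text \<open>Separatedness of \<open>Y\<close> tested on equalisers. The test space \<open>W\<close>
  is a parameter because its point type cannot be quantified over inside a definition.\<close>

definition separated_for :: "('w, 'k::field) fspace => ('y, 'k) fspace => bool" where
 "separated_for W Y \<longleftrightarrow> (ALL f g. morphism W Y f --> morphism W Y g -->
  closedin (topo W) {w : points W. f w = g w})"

lemma separated_forI:
 assumes "!!f g w. morphism W Y f ==> morphism W Y g ==> w : points W ==> f w ~= g w ==>
  EX V. Opn W V & w : V & (ALL v:V. f v ~= g v)"
 shows "separated_for W Y"
 unfolding separated_for_def
proof (intro allI impI)
 fix f g assume f: "morphism W Y f" and g: "morphism W Y g"
 have "Opn W {w : points W. f w ~= g w}"
 proof (subst openin_subopen, rule ballI)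
  fix w assume "w : {w : points W. f w ~= g w}"
  then have "w : points W" "f w ~= g w" by auto
  from assms[OF f g this] obtain V where "Opn W V" "w : V" "ALL v:V. f v ~= g v" by (elim exE conjE)
  then show "EX T. Opn W T & w : T & T <= {w : points W. f w ~= g w}"
   using openin_subset[of "topo W" V] by (intro exI[of _ V]) auto
 qed
 moreover have "points W - {w : points W. f w = g w} = {w : points W. f w ~= g w}" by auto
 ultimately show "closedin (topo W) {w : points W. f w = g w}" unfolding closedin_def by auto
qed

text \<open>Two points of projective space differ exactly if some two-by-two minor of their
  coordinate vectors is nonzero, and this is an open condition.\<close>

lemma separated_proj:
 fixes W :: "('w, 'k::field) fspace"
 assumes W: "swf W" shows "separated_for W (Proj n)"
proof (rule separated_forI)
 fix f g w assume f: "morphism W (Proj n) f" and g: "morphism W (Proj n) g"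
  and w: "w : points W" and ne: "f w ~= g w"
 have fw: "f w : points (Proj n)" and gw: "g w : points (Proj n)"
  using morphism_points f g w by metis+
 obtain k where k: "k <= n" "rep (f w) k ~= 0" using rep_nonzero[OF fw] by blast
 obtain l where l: "l <= n" "rep (g w) l ~= 0" using rep_nonzero[OF gw] by blast
 have "EX i<=n. EX j<=n. rep (f w) i * rep (g w) j ~= rep (f w) j * rep (g w) i"
 proof (rule ccontr)
  assume "\<not> ?thesis"
  then have e: "rep (f w) i * rep (g w) j = rep (f w) j * rep (g w) i" if "i <= n" "j <= n" for i j
   using that by auto
  have "rep (g w) k ~= 0" using e[OF k(1) l(1)] k l by auto
  then have c: "rep (g w) k / rep (f w) k ~= 0" using k(2) by simp
  have "rep (g w) i = rep (g w) k / rep (f w) k * rep (f w) i" if "i <= n" for i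
   using e[OF that k(1)] k(2) by (simp add: field_simps)
  then have "hp n (rep (g w)) = hp n (rep (f w))" by (rule hp_eqI[OF c])
  then show False using ne hp_rep[OF fw] hp_rep[OF gw] by simp
 qed
 then obtain i j where ij: "i <= n" "j <= n" "rep (f w) i * rep (g w) j ~= rep (f w) j * rep (g w) i" by (elim exE conjE)
 let ?V = "{w : points W. rep (f w) k ~= 0} \<inter> {w : points W. rep (g w) l ~= 0}"
 have V: "Opn W ?V" by (rule openin_Int[OF open_rep_nonzero[OF f k(1)] open_rep_nonzero[OF g l(1)]])
 \<comment> \<open>The minor depends on the representatives; divided by one nonvanishing coordinate
   of each point it becomes a regular function.\<close>
 let ?h = "%w. (rep (f w) i / rep (f w) k) * (rep (g w) j / rep (g w) l) -
   (rep (f w) j / rep (f w) k) * (rep (g w) i / rep (g w) l)"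
 have "?h : reg W ?V"
  by (rule reg_diff[OF W V reg_mult[OF W V ratio_reg[OF W f ij(1) k(1) V] ratio_reg[OF W g ij(2) l(1) V]]
    reg_mult[OF W V ratio_reg[OF W f ij(2) k(1) V] ratio_reg[OF W g ij(1) l(1) V]]]) simp_all
 then have "Opn W {w : ?V. ?h w ~= 0}" by (rule reg_nonzero[OF W V])
 moreover have "w : {w : ?V. ?h w ~= 0}" using w k l ij by (simp add: field_simps)
 moreover have "ALL v:{w : ?V. ?h w ~= 0}. f v ~= g v"
 proof (intro ballI notI)
  fix v assume "v : {w : ?V. ?h w ~= 0}" "f v = g v"
  then show False by simp
 qed
 ultimately show "EX V. Opn W V & w : V & (ALL v:V. f v ~= g v)" by (intro exI conjI)
qed

text \<open>The set \<open>D\<close> may contain elements outside the space; only its trace on the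
  points matters. This lets one set serve for all open subspaces.\<close>

definition dense_in :: "('w, 'k) fspace => 'w set => bool" where
 "dense_in W D \<longleftrightarrow> (ALL U. Opn W U --> U ~= {} --> U \<inter> D ~= {})"

lemma dense_in_subspace:
 assumes "dense_in W D" "Opn W V" shows "dense_in (Sub W V) D"
 using assms openin_subspace_open[OF assms(2)] unfolding dense_in_def by blast

lemma closedin_dense:
 assumes "dense_in W D" "closedin (topo W) C" "!!d. d : D ==> d : points W ==> d : C" "w : points W"
 shows "w : C"
proof (rule ccontr)
 assume "w ~: C"
 have "Opn W (points W - C)" using assms(2) by auto
 moreover have "points W - C ~= {}" using assms(4) \<open>w ~: C\<close> by auto
 ultimately have "(points W - C) \<inter> D ~= {}" using assms(1) unfolding dense_in_def by simp
 then show False using assms(3) by auto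
qed

lemma agree_on_dense:
 assumes "separated_for W Y" "dense_in W D" "morphism W Y f" "morphism W Y g"
  "!!d. d : D ==> d : points W ==> f d = g d" "w : points W"
 shows "f w = g w"
proof -
 have "w : {w : points W. f w = g w}"
  by (rule closedin_dense[OF assms(2)]) (use assms in \<open>auto simp: separated_for_def\<close>)
 then show ?thesis by simp
qed

text \<open>The local morphisms are only required to agree with the prescribed values
  \<open>R\<close> on the dense set. On overlaps they then agree everywhere by separatedness, so no
  cocycle condition is assumed.\<close>

lemma glue_morphism:
 assumes W: "swf W" and D: "dense_in W D"
  and sep: "!!V. Opn W V ==> separated_for (Sub W V) Y"
  and loc: "!!w. w : points W ==> EX V f. Opn W V & w : V & morphism (Sub W V) Y f &
   (ALL d:D \<inter> V. f d = R d)"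
 obtains F where "morphism W Y F" "!!d. d : D ==> d : points W ==> F d = R d"
  "!!V f w. Opn W V ==> morphism (Sub W V) Y f ==> (!!d. d : D ==> d : V ==> f d = R d) ==>
   w : V ==> F w = f w"
proof -
 have "ALL w:points W. EX p. Opn W (fst p) & w : fst p & morphism (Sub W (fst p)) Y (snd p) &
   (ALL d:D \<inter> fst p. snd p d = R d)" using loc by simp
 from bchoice[OF this] obtain p where p: "!!w. w : points W ==> Opn W (fst (p w)) & w : fst (p w) &
  morphism (Sub W (fst (p w))) Y (snd (p w)) & (ALL d:D \<inter> fst (p w). snd (p w) d = R d)" by auto
 \<comment> \<open>Each point uses its own local morphism; \<open>eq\<close> shows that any other
   admissible one gives the same value.\<close>
 define F where "F w = snd (p w) w" for w
 have eq: "F w = f w" if V: "Opn W V" "morphism (Sub W V) Y f"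
  "!!d. d : D ==> d : V ==> f d = R d" "w : V" for V f w
 proof -
  have w: "w : points W" using openin_subset[OF V(1)] V(4) by auto
  let ?V = "V \<inter> fst (p w)"
  have o: "Opn W ?V" using V(1) p[OF w] by auto
  have "snd (p w) w = f w"
   by (rule agree_on_dense[OF sep[OF o] dense_in_subspace[OF D o]])
    (use V p[OF w] w in \<open>auto intro: subspace_subspace_morphism[OF W]\<close>)
  then show ?thesis unfolding F_def .
 qed
 show thesis
 proof (rule that[of F])
  show "morphism W Y F"
  proof (rule morphism_local[OF W])
   fix w assume w: "w : points W"
   have "morphism (Sub W (fst (p w))) Y F"
    by (rule morphism_cong[OF swf_subspace[OF W], of _ _ "snd (p w)"])
     (use p[OF w] eq[of "fst (p w)" "snd (p w)"] in auto)
   then show "EX V. Opn W V & w : V & morphism (Sub W V) Y F" using p[OF w] by blast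
  qed
  show "F d = R d" if "d : D" "d : points W" for d
   unfolding F_def using p[OF that(2)] that(1) by blast
 qed (rule eq)
qed

section \<open>Dimension and smoothness\<close>

text \<open>An irreducible closed set is the union of the closure of its trace on \<open>U\<close>
  and of its part outside \<open>U\<close>; as the second piece is proper, the first is
  everything.\<close>

lemma irreducible_closed_open_part:
 assumes Z: "irreducible_closed T Z" and U: "openin T U" "Z \<inter> U ~= {}"
 shows "T closure_of (Z \<inter> U) = Z" "irreducible_closed (subtopology T U) (Z \<inter> U)"
proof -
 have cZ: "closedin T Z" and irr: "!!A B. closedin T A ==> closedin T B ==> Z = A \<union> B ==> Z = A | Z = B"
  using Z unfolding irreducible_closed_def by auto
 have ZT: "Z <= topspace T" using closedin_subset[OF cZ] .
 show cl: "T closure_of (Z \<inter> U) = Z"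
 proof -
  have "closedin T (Z - U)" by (rule closedin_diff[OF cZ U(1)])
  moreover have "T closure_of (Z \<inter> U) <= Z" by (rule closure_of_minimal[OF _ cZ]) simp
  moreover have "Z \<inter> U <= T closure_of (Z \<inter> U)" by (rule closure_of_subset) (use ZT in auto)
  ultimately have "Z = T closure_of (Z \<inter> U) | Z = Z - U" by (intro irr) auto
  then show ?thesis using U(2) by auto
 qed
 have sub: "A = T closure_of A \<inter> U" if A: "closedin (subtopology T U) A" for A
 proof -
  obtain C where C: "closedin T C" "A = C \<inter> U" using A unfolding closedin_subtopology by blast
  have "T closure_of A <= C" by (rule closure_of_minimal) (use C in auto)
  moreover have "A <= T closure_of A" by (rule closure_of_subset) (use C closedin_subset in auto)
  ultimately show ?thesis using C(2) by auto
 qed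
 show "irreducible_closed (subtopology T U) (Z \<inter> U)"
  unfolding irreducible_closed_def
 proof (intro conjI allI impI)
  show "closedin (subtopology T U) (Z \<inter> U)" using cZ unfolding closedin_subtopology by auto
  fix A B assume AB: "closedin (subtopology T U) A & closedin (subtopology T U) B & Z \<inter> U = A \<union> B"
  have "Z = T closure_of A | Z = T closure_of B"
   by (rule irr) (use AB cl closure_of_Un[of T A B] in auto)
  then show "Z \<inter> U = A | Z \<inter> U = B" using sub[of A] sub[of B] AB by blast
 qed (rule U(2))
qed

lemma irreducible_closed_closure:
 assumes Z: "irreducible_closed (subtopology T U) Z"
 shows "irreducible_closed T (T closure_of Z)" "T closure_of Z \<inter> U = Z"
proof -
 have cZ: "closedin (subtopology T U) Z" and ne: "Z ~= {}"
  and irr: "!!A B. closedin (subtopology T U) A ==> closedin (subtopology T U) B ==> Z = A \<union> B ==> Z = A | Z = B"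
  using Z unfolding irreducible_closed_def by auto
 obtain C where C: "closedin T C" "Z = C \<inter> U" using cZ unfolding closedin_subtopology by blast
 have sub: "Z <= T closure_of Z" by (rule closure_of_subset) (use C closedin_subset in auto)
 have "T closure_of Z <= C" by (rule closure_of_minimal) (use C in auto)
 then show "T closure_of Z \<inter> U = Z" using sub C(2) by auto
 show "irreducible_closed T (T closure_of Z)"
  unfolding irreducible_closed_def
 proof (intro conjI allI impI)
  show "T closure_of Z ~= {}" using sub ne by auto
  fix A B assume AB: "closedin T A & closedin T B & T closure_of Z = A \<union> B"
  have "Z = A \<inter> U \<inter> Z | Z = B \<inter> U \<inter> Z"
  proof (rule irr)
   have "A \<inter> U \<inter> Z = (A \<inter> C) \<inter> U" "B \<inter> U \<inter> Z = (B \<inter> C) \<inter> U" using C(2) by auto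
   then show "closedin (subtopology T U) (A \<inter> U \<inter> Z)" "closedin (subtopology T U) (B \<inter> U \<inter> Z)"
    unfolding closedin_subtopology using AB C(1) closedin_Int by metis+
  qed (use AB sub C(2) in auto)
  then have "T closure_of Z <= A | T closure_of Z <= B"
   using AB closure_of_minimal[of Z A T] closure_of_minimal[of Z B T] by auto
  then show "T closure_of Z = A | T closure_of Z = B" using AB by auto
 qed simp
qed

text \<open>All members meet \<open>U\<close> because the smallest one does, and inclusions stay
  strict because every member is the closure of its trace.\<close>

lemma irreducible_chain_open:
 assumes "!!i. i <= n ==> irreducible_closed T (Z i)" "!!i. i < n ==> Z i \<subset> Z (Suc i)"
  and U: "openin T U" "Z 0 \<inter> U ~= {}"
 shows "irreducible_chain (subtopology T U) n"
proof -
 have Z0: "Z 0 <= Z i" if "i <= n" for i using that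
 proof (induction i)
  case (Suc i) then show ?case using assms(2)[of i] by auto
 qed simp
 then have ne: "Z i \<inter> U ~= {}" if "i <= n" for i using that U(2) by blast
 show ?thesis unfolding irreducible_chain_def
 proof (intro exI[of _ "%i. Z i \<inter> U"] conjI allI impI)
  fix i assume i: "i <= n"
  show "irreducible_closed (subtopology T U) (Z i \<inter> U)"
   by (rule irreducible_closed_open_part(2)[OF assms(1)[OF i] U(1) ne[OF i]])
 next
  fix i assume i: "i < n"
  then have i': "i <= n" "Suc i <= n" by auto
  have "Z i \<inter> U ~= Z (Suc i) \<inter> U"
  proof
   assume e: "Z i \<inter> U = Z (Suc i) \<inter> U"
   have "Z i = T closure_of (Z (Suc i) \<inter> U)"
    using irreducible_closed_open_part(1)[OF assms(1)[OF i'(1)] U(1) ne[OF i'(1)]] unfolding e by (rule sym)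
   also have "\<dots> = Z (Suc i)"
    by (rule irreducible_closed_open_part(1)[OF assms(1)[OF i'(2)] U(1) ne[OF i'(2)]])
   finally show False using assms(2)[OF i] by (simp only: psubset_eq simp_thms)
  qed
  moreover have "Z i \<inter> U <= Z (Suc i) \<inter> U" using assms(2)[OF i] by (simp only: psubset_eq Int_mono subset_refl)
  ultimately show "Z i \<inter> U \<subset> Z (Suc i) \<inter> U" by (simp only: psubset_eq simp_thms)
 qed
qed

lemma irreducible_chain_closure:
 assumes "irreducible_chain (subtopology T U) n" shows "irreducible_chain T n"
proof -
 obtain Z where Z: "!!i. i <= n ==> irreducible_closed (subtopology T U) (Z i)" "!!i. i < n ==> Z i \<subset> Z (Suc i)"
  using assms unfolding irreducible_chain_def by auto
 show ?thesis unfolding irreducible_chain_def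
 proof (intro exI[of _ "%i. T closure_of (Z i)"] conjI allI impI)
  fix i assume i: "i <= n"
  show "irreducible_closed T (T closure_of Z i)" by (rule irreducible_closed_closure(1)[OF Z(1)[OF i]])
 next
  fix i assume i: "i < n"
  then have i': "i <= n" "Suc i <= n" by auto
  have "T closure_of Z i ~= T closure_of Z (Suc i)"
  proof
   assume e: "T closure_of Z i = T closure_of Z (Suc i)"
   have "Z i = T closure_of Z (Suc i) \<inter> U"
    using irreducible_closed_closure(2)[OF Z(1)[OF i'(1)]] unfolding e by (rule sym)
   also have "\<dots> = Z (Suc i)" by (rule irreducible_closed_closure(2)[OF Z(1)[OF i'(2)]])
   finally show False using Z(2)[OF i] by (simp only: psubset_eq simp_thms)
  qed
  moreover have "T closure_of Z i <= T closure_of Z (Suc i)"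
   by (rule closure_of_mono[OF psubset_imp_subset[OF Z(2)[OF i]]])
  ultimately show "T closure_of Z i \<subset> T closure_of Z (Suc i)" by (simp only: psubset_eq simp_thms)
 qed
qed

lemma irreducible_closed_homeomorphic:
 assumes f: "continuous_map T T' f" and g: "continuous_map T' T g"
  and gf: "!!x. x : topspace T ==> g (f x) = x" and fg: "!!y. y : topspace T' ==> f (g y) = y"
  and Z: "irreducible_closed T Z"
 shows "irreducible_closed T' (f ` Z)"
proof -
 have cZ: "closedin T Z" and ne: "Z ~= {}"
  and irr: "!!A B. closedin T A ==> closedin T B ==> Z = A \<union> B ==> Z = A | Z = B"
  using Z unfolding irreducible_closed_def by auto
 have ZT: "Z <= topspace T" using closedin_subset[OF cZ] .
 have fT: "f x : topspace T'" if "x : topspace T" for x using f that by (auto simp: continuous_map_def)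
 have gT: "g x : topspace T" if "x : topspace T'" for x using g that by (auto simp: continuous_map_def)
 have e: "f ` Z = {y : topspace T'. g y : Z}"
 proof (intro subset_antisym subsetI)
  fix y assume "y : {y : topspace T'. g y : Z}"
  then show "y : f ` Z" using fg[of y] by (intro image_eqI[of _ _ "g y"]) auto
 qed (use ZT fT gf in auto)
 show ?thesis unfolding irreducible_closed_def
 proof (intro conjI allI impI)
  show "closedin T' (f ` Z)" unfolding e by (rule closedin_continuous_map_preimage[OF g cZ])
  fix A B assume AB: "closedin T' A & closedin T' B & f ` Z = A \<union> B"
  have "Z = {x : topspace T. f x : A} | Z = {x : topspace T. f x : B}"
  proof (rule irr)
   show "Z = {x : topspace T. f x : A} \<union> {x : topspace T. f x : B}"
   proof (intro subset_antisym subsetI)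
    fix x assume "x : Z" then show "x : {x : topspace T. f x : A} \<union> {x : topspace T. f x : B}"
     using AB ZT by auto
   next
    fix x assume "x : {x : topspace T. f x : A} \<union> {x : topspace T. f x : B}"
    then have x: "x : topspace T" "f x : f ` Z" using AB by auto
    then have "g (f x) : Z" using e by auto
    then show "x : Z" using gf[OF x(1)] by simp
   qed
  qed (use AB closedin_continuous_map_preimage[OF f] in auto)
  moreover have "f ` {x : topspace T. f x : A} = A" if "closedin T' A" for A
  proof (intro subset_antisym subsetI)
   fix y assume y: "y : A"
   then have "y : topspace T'" using closedin_subset[OF that] by auto
   then show "y : f ` {x : topspace T. f x : A}" using gT fg y by (intro image_eqI[of _ _ "g y"]) auto
  qed auto
  ultimately show "f ` Z = A | f ` Z = B" using AB by metis
 qed (use ne in simp)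
qed

lemma irreducible_chain_homeomorphic:
 assumes f: "continuous_map T T' f" and g: "continuous_map T' T g"
  and gf: "!!x. x : topspace T ==> g (f x) = x" and fg: "!!y. y : topspace T' ==> f (g y) = y"
  and "irreducible_chain T n"
 shows "irreducible_chain T' n"
proof -
 obtain Z where Z: "!!i. i <= n ==> irreducible_closed T (Z i)" "!!i. i < n ==> Z i \<subset> Z (Suc i)"
  using assms(5) unfolding irreducible_chain_def by auto
 have ZT: "Z i <= topspace T" if "i <= n" for i
  using Z(1)[OF that] closedin_subset unfolding irreducible_closed_def by blast
 have inj: "inj_on f (topspace T)" using gf by (metis inj_onI)
 show ?thesis unfolding irreducible_chain_def
 proof (intro exI[of _ "%i. f ` Z i"] conjI allI impI)
  fix i assume i: "i <= n"
  show "irreducible_closed T' (f ` Z i)" by (rule irreducible_closed_homeomorphic[OF f g gf fg Z(1)[OF i]])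
 next
  fix i assume i: "i < n"
  then show "f ` Z i \<subset> f ` Z (Suc i)"
   using Z(2)[OF i] ZT[of i] ZT[of "Suc i"] inj_on_image_eq_iff[OF inj, of "Z i" "Z (Suc i)"] by auto
 qed
qed

lemma irreducible_chain_le: "irreducible_chain T n ==> m <= n ==> irreducible_chain T m"
 unfolding irreducible_chain_def by (meson le_trans less_le_trans)

subsection \<open>Closed subsets of affine space\<close>

lemma closedin_affine_separate:
 assumes "closedin (topo (Aff n)) Z" "x : affine_points n" "x ~: Z"
 shows "EX h:Polys n. h x ~= 0 & (ALL z:Z. h z = 0)"
proof -
 have "Opn (Aff n) (affine_points n - Z)" using assms(1) by (simp add: closedin_def)
 then obtain h where "h : Polys n" "x : affine_basic n h" "affine_basic n h <= affine_points n - Z"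
  unfolding openin_affine using assms(2,3) by (elim ballE[of _ _ x] bexE conjE) auto
 then show ?thesis using closedin_subset[OF assms(1)] by (intro bexI[of _ h]) (auto simp: affine_basic_def)
qed

lemma closedin_zero_set:
 assumes "h : Polys n" shows "closedin (topo (Aff n)) {x : affine_points n. h x = 0}"
proof -
 have "affine_points n - {x : affine_points n. h x = 0} = affine_basic n h" by (auto simp: affine_basic_def)
 then show ?thesis using openin_affine_basic[OF assms] by (auto simp: closedin_def)
qed

lemma closedin_affine_singleton:
 assumes "x : affine_points n" shows "closedin (topo (Aff n)) {x}"
proof -
 have "Opn (Aff n) (affine_points n - {x})"
  unfolding openin_affine
 proof
  fix y assume y: "y : affine_points n - {x}"
  then obtain i where i: "y i ~= x i" by auto
  then have "i < n" using y assms by (auto simp: affine_points_def not_le[symmetric])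
  then show "EX h:Polys n. y : affine_basic n h & affine_basic n h <= affine_points n - {x}"
   using y i by (intro bexI[of _ "%z. z i - x i"]) (auto simp: affine_basic_def poly_ops)
 qed
 then show ?thesis using assms by (simp add: closedin_def)
qed

text \<open>Points are closed, so a finite set with two points splits into two proper closed
  parts.\<close>

lemma irreducible_finite_singleton:
 assumes Z: "irreducible_closed (topo (Aff n)) Z" "finite Z" "x : Z" "y : Z"
 shows "x = y"
proof -
 have sub: "Z <= affine_points n"
  using Z(1) closedin_subset unfolding irreducible_closed_def by fastforce
 have fin: "closedin (topo (Aff n)) A" if "A <= Z" for A
 proof -
  have "closedin (topo (Aff n)) (\<Union>x\<in>A. {x})"
   by (rule closedin_Union) (use that sub finite_subset[OF that Z(2)] closedin_affine_singleton in auto)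
  then show ?thesis by simp
 qed
 have "closedin (topo (Aff n)) {x}" "closedin (topo (Aff n)) (Z - {x})"
  using fin Z(3) by auto
 moreover have "Z = {x} \<union> (Z - {x})" using Z(3) by auto
 ultimately have "Z = {x} | Z = Z - {x}" using Z(1) unfolding irreducible_closed_def by blast
 then show ?thesis using Z(3,4) by auto
qed

text \<open>Covers all affine linear subspaces: polynomials that separate a point from each of two
  proper closed parts have a common non-root on the line through these points.\<close>

lemma irreducible_line_closed:
 fixes Z :: "(nat => 'k::field_char_0) set"
 assumes Z: "closedin (topo (Aff n)) Z" "Z ~= {}"
  and line: "!!x y t. x : Z ==> y : Z ==> (%i. x i + t * (y i - x i)) : Z"
 shows "irreducible_closed (topo (Aff n)) Z"
 unfolding irreducible_closed_def
proof (intro conjI allI impI)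
 fix A B
 assume AB: "closedin (topo (Aff n)) A & closedin (topo (Aff n)) B & Z = A \<union> B"
 have sub: "Z <= affine_points n" using closedin_subset[OF Z(1)] by simp
 show "Z = A | Z = B"
 proof (rule ccontr)
  assume "\<not> ?thesis"
  then obtain x y where xy: "x : Z" "x ~: A" "y : Z" "y ~: B" using AB by blast
  have "x : affine_points n" "y : affine_points n" using xy sub by (auto simp only: subset_iff)
  then obtain g h where g: "g : Polys n" "g x ~= 0" "ALL z:A. g z = 0"
   and h: "h : Polys n" "h y ~= 0" "ALL z:B. h z = 0"
   using closedin_affine_separate[of n A x] closedin_affine_separate[of n B y] AB xy(2,4) by blast
  obtain t where "g (%i. x i + t * (y i - x i)) ~= 0" "h (%i. x i + t * (y i - x i)) ~= 0"
   using poly_common_nonzero[OF g(1,2) h(1,2)] by auto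
  moreover have "(%i. x i + t * (y i - x i)) : A \<union> B" using line[OF xy(1,3)] AB by simp
  ultimately show False using g(3) h(3) by blast
 qed
qed (use Z in auto)

lemma irreducible_affine: "irreducible_closed (topo (Aff n)) (affine_points n :: (nat => 'k::field_char_0) set)"
proof (rule irreducible_line_closed)
 show "closedin (topo (Aff n)) (affine_points n :: (nat => 'k) set)"
  using closedin_topspace[of "topo (Aff n)"] by simp
 have "(%_. 0) : (affine_points n :: (nat => 'k) set)" by (simp add: affine_points_def)
 then show "(affine_points n :: (nat => 'k) set) ~= {}" by blast
qed (simp add: affine_points_def)

subsection \<open>Dimension of the line and the plane\<close>

lemma poly_line:
 assumes "P : Polys 1" shows "EX p. ALL x. P x = poly p (x 0)"
 using assms
proof induction
 case (const c) show ?case by (rule exI[of _ "[:c:]"]) simp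
next
 case (coord i) then show ?case by (intro exI[of _ "[:0, 1:]"]) simp
next
 case (add f g)
 then obtain p q where "ALL x. f x = poly p (x 0)" "ALL x. g x = poly q (x 0)" by (elim exE)
 then show ?case by (intro exI[of _ "p + q"]) simp
next
 case (mult f g)
 then obtain p q where "ALL x. f x = poly p (x 0)" "ALL x. g x = poly q (x 0)" by (elim exE)
 then show ?case by (intro exI[of _ "p * q"]) simp
qed

text \<open>The middle member of the chain lies in the zero set of a nonzero polynomial in one
  variable, hence is finite and irreducible, hence a point.\<close>

lemma no_chain_line: "\<not> irreducible_chain (topo (Aff 1 :: (nat => 'k::field_char_0, 'k) fspace)) 2"
proof
 assume "irreducible_chain (topo (Aff 1 :: 'k aspace)) 2"
 then obtain Z where Z: "!!i. i <= 2 ==> irreducible_closed (topo (Aff 1 :: 'k aspace)) (Z i)"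
  "!!i. i < 2 ==> Z i \<subset> Z (Suc i)" unfolding irreducible_chain_def by auto
 have Z01: "Z 0 \<subset> Z 1" "Z 1 \<subset> Z 2" using Z(2)[of 0] Z(2)[of 1] by (auto simp: numeral_2_eq_2)
 have c: "closedin (topo (Aff 1)) (Z i)" "Z i <= affine_points 1" if "i <= 2" for i
  using Z(1)[OF that] closedin_subset[of "topo (Aff 1)" "Z i"] unfolding irreducible_closed_def by auto
 obtain x where x: "x : Z 2" "x ~: Z 1" using Z01 by auto
 obtain h where h: "h : Polys 1" "h x ~= 0" "ALL z:Z 1. h z = 0"
  using closedin_affine_separate[OF c(1)[of 1], of x] x c(2)[of 2] by auto
 obtain p where p: "ALL x. h x = poly p (x 0)" using poly_line[OF h(1)] by auto
 have "p ~= 0" using p h(2) by auto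
 then have "finite {t. poly p t = 0}" by (rule poly_roots_finite)
 moreover have "(%z. z 0) ` Z 1 <= {t. poly p t = 0}" using h(3) p by auto
 moreover have "inj_on (%z. z 0) (Z 1)"
 proof (rule inj_onI, rule ext)
  fix y z i assume "y : Z 1" "z : Z 1" "y 0 = z 0"
  moreover from this have "y : affine_points 1" "z : affine_points 1" using c(2)[of 1] by auto
  ultimately show "y i = z i" by (cases i) (auto simp: affine_points_def)
 qed
 ultimately have "finite (Z 1)" by (meson finite_imageD finite_subset)
 moreover obtain a where a: "a : Z 0" using Z(1)[of 0] unfolding irreducible_closed_def by auto
 moreover obtain b where "b : Z 1" "b ~: Z 0" using Z01 by auto
 ultimately show False using irreducible_finite_singleton[OF Z(1)[of 1], of a b] Z01 by auto
qed

text \<open>Evaluation of an element of \<open>K[x][y]\<close> at \<open>x = a\<close> and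
  \<open>y = b\<close>; the outer variable is \<open>y\<close>.\<close>

definition biv :: "'k::field poly poly => 'k => 'k => 'k" where
 "biv P a b = poly (poly P [:b:]) a"

lemma biv_simps [simp]: "biv (P + Q) a b = biv P a b + biv Q a b" "biv (P * Q) a b = biv P a b * biv Q a b"
 "biv (P - Q) a b = biv P a b - biv Q a b" "biv [:c:] a b = poly c a" "biv 0 a b = 0"
 by (simp_all add: biv_def)

lemma poly_biv:
 assumes "P : Polys 2" "i < 2" "j = 1 - i" shows "EX p. ALL x. P x = biv p (x i) (x j)"
 using assms(1)
proof induction
 case (const c) show ?case by (rule exI[of _ "[:[:c:]:]"]) simp
next
 case (coord k)
 then consider "k = i" | "k = j" using assms(2,3) by linarith
 then show ?case
 proof cases
  case 1 then show ?thesis by (intro exI[of _ "[:[:0, 1:]:]"]) simp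
 next
  case 2 then show ?thesis by (intro exI[of _ "[:0, 1:]"]) (simp add: biv_def)
 qed
next
 case (add f g)
 then obtain p q where "ALL x. f x = biv p (x i) (x j)" "ALL x. g x = biv q (x i) (x j)" by (elim exE)
 then show ?case by (intro exI[of _ "p + q"]) simp
next
 case (mult f g)
 then obtain p q where "ALL x. f x = biv p (x i) (x j)" "ALL x. g x = biv q (x i) (x j)" by (elim exE)
 then show ?case by (intro exI[of _ "p * q"]) simp
qed

lemma poly_coord_function: "i < n ==> (%x. poly p (x i)) : Polys n"
 by (induction p) (simp_all add: poly_ops)

lemma biv_poly_function:
 assumes "i < 2" "j < 2" shows "(%x. biv p (x i) (x j)) : Polys 2"
 by (induction p) (simp_all add: biv_def poly_ops poly_coord_function assms)

text \<open>
 A chain of two nonzero primes of \<open>\<bbbK>[x][y]\<close>, the larger of which meets \<open>\<bbbK>[x]\<close> only in \<open>0\<close>, is constant: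
 an element of minimal degree of the larger one pseudo-divides everything.
\<close>

lemma prime_chain_collapse:
 fixes I J :: "'k::field poly poly set"
 assumes I: "!!P Q. P : I ==> Q * P : I" "!!P Q. P : I ==> Q : I ==> P - Q : I"
  and J: "!!P Q. P : J ==> Q * P : J" "!!P Q. P * Q : J ==> P : J | Q : J"
  and JI: "J <= I" and G: "G : J" "G ~= 0" and const: "!!d. [:d:] : I ==> d = 0"
 shows "I <= J"
proof -
 define f where "f = arg_min degree (%P. P : I & P ~= 0)"
 have f: "f : I" "f ~= 0" and fmin: "!!P. P : I ==> P ~= 0 ==> degree f <= degree P"
  using arg_min_nat_lemma[of "%P. P : I & P ~= 0" G degree] G JI unfolding f_def by auto
 define g where "g = arg_min degree (%P. P : J & P ~= 0)"
 have g: "g : J" "g ~= 0" and gmin: "!!P. P : J ==> P ~= 0 ==> degree g <= degree P"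
  using arg_min_nat_lemma[of "%P. P : J & P ~= 0" G degree] G unfolding g_def by auto
 \<comment> \<open>The pseudo-remainder lies in \<open>I\<close> and has smaller degree than
   \<open>f\<close>, so it vanishes by minimality.\<close>
 have div: "EX a q. a ~= 0 & [:a:] * h = f * q" if h: "h : I" for h
 proof -
  obtain a q where a: "a ~= 0" "smult a h = f * q + pseudo_mod h f"
   using pseudo_mod(1)[OF f(2), of h] by auto
  have "pseudo_mod h f = [:a:] * h - q * f" using a(2) by (simp add: algebra_simps)
  then have "pseudo_mod h f : I" using I h f by metis
  then have "pseudo_mod h f = 0" using fmin pseudo_mod(2)[OF f(2), of h] by fastforce
  then show ?thesis using a by (intro exI[of _ a] exI[of _ q]) simp
 qed
 \<comment> \<open>This is where the hypothesis that \<open>I\<close> contains no nonzero element of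
   \<open>K[x]\<close> enters.\<close>
 have deg: "degree f ~= 0"
 proof
  assume "degree f = 0"
  then obtain d where "f = [:d:]" by (rule degree_eq_zeroE)
  then show False using const f by auto
 qed
 have "f : J"
 proof -
  have "g : I" using g JI by auto
  from div[OF this] obtain a q where a: "a ~= 0" "[:a:] * g = f * q" by (elim exE conjE)
  have fq: "f * q : J" using J(1)[OF g(1), of "[:a:]"] a(2) by simp
  have q: "q ~= 0" using a g by auto
  have "degree g = degree ([:a:] * g)" using a(1) by simp
  also have "\<dots> = degree f + degree q" unfolding a(2) by (rule degree_mult_eq[OF f(2) q])
  finally have "degree g = degree f + degree q" .
  \<comment> \<open>As \<open>f\<close> has positive degree, \<open>q\<close> has smaller degree
    than the minimal \<open>g\<close>; primeness of \<open>J\<close> then puts \<open>f\<close> into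
    \<open>J\<close>.\<close>
  then have "q ~: J" using gmin[of q] q deg by auto
  then show ?thesis using J(2)[OF fq] by blast
 qed
 show "I <= J"
 proof
  fix h assume h: "h : I"
  obtain a q where a: "a ~= 0" "[:a:] * h = f * q" using div[OF h] by auto
  have "[:a:] * h : J" using J(1)[OF \<open>f : J\<close>, of q] a(2) by (simp add: mult.commute)
  from J(2)[OF this] have "[:a:] : J | h : J" .
  then show "h : J" using const[of a] a(1) JI by auto
 qed
qed

text \<open>If no nonzero polynomial in the \<open>i\<close>-th coordinate vanishes on
  \<open>Z\<close>, then \<open>prime_chain_collapse\<close> applies to the ideals of
  \<open>Z\<close> and \<open>Z'\<close> and makes them equal, although a polynomial separates a
  point of \<open>Z'\<close> from \<open>Z\<close>.\<close>

lemma chain_plane_collapse: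
 fixes Z Z' :: "(nat => 'k::field_char_0) set"
 assumes Z: "closedin (topo (Aff 2)) Z" and Z': "irreducible_closed (topo (Aff 2)) Z'" "Z \<subset> Z'"
  "Z' \<subset> affine_points 2" and i: "i < 2"
 shows "EX d. d ~= 0 & (ALL z:Z. poly d (z i) = 0)"
proof (rule ccontr)
 assume no: "\<not> ?thesis"
 define j where "j = 1 - i"
 have j: "j < 2" using i by (simp add: j_def)
 define I where "I = {P. ALL z:Z. biv P (z i) (z j) = 0}"
 define J where "J = {P. ALL z:Z'. biv P (z i) (z j) = 0}"
 have cZ': "closedin (topo (Aff 2)) Z'" using Z'(1) unfolding irreducible_closed_def by auto
 have sep: "EX P. biv P (x i) (x j) ~= 0 & (ALL z:A. biv P (z i) (z j) = 0)"
  if A: "closedin (topo (Aff 2)) A" "x : affine_points 2" "x ~: A" for A x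
 proof -
  obtain h where h: "h : Polys 2" "h x ~= 0" "ALL z:A. h z = 0"
   using closedin_affine_separate[OF A] by auto
  obtain p where "ALL x. h x = biv p (x i) (x j)" using poly_biv[OF h(1) i j_def] by auto
  then show ?thesis using h by (intro exI[of _ p]) auto
 qed
 obtain w where "w : affine_points 2" "w ~: Z'" using Z'(3) by auto
 then obtain G where G: "biv G (w i) (w j) ~= 0" "ALL z:Z'. biv G (z i) (z j) = 0" using sep[OF cZ'] by auto
 have "I <= J"
 proof (rule prime_chain_collapse)
  fix P Q assume PQ: "P * Q : J"
  have zs: "closedin (topo (Aff 2)) {x : affine_points 2. biv P (x i) (x j) = 0}" for P
   by (rule closedin_zero_set[OF biv_poly_function[OF i j]])
  have "Z' = Z' \<inter> {x : affine_points 2. biv P (x i) (x j) = 0} \<union> Z' \<inter> {x : affine_points 2. biv Q (x i) (x j) = 0}"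
   using PQ Z'(3) by (auto simp: J_def)
  then have "Z' = Z' \<inter> {x : affine_points 2. biv P (x i) (x j) = 0} | Z' = Z' \<inter> {x : affine_points 2. biv Q (x i) (x j) = 0}"
   using Z'(1) closedin_Int[OF cZ' zs[of P]] closedin_Int[OF cZ' zs[of Q]] unfolding irreducible_closed_def by blast
  then show "P : J | Q : J" unfolding J_def by blast
 next
  show "G ~= 0" using G(1) by auto
  fix d assume "[:d:] : I"
  then show "d = 0" using no by (auto simp: I_def)
 qed (use G Z'(2) in \<open>auto simp: I_def J_def\<close>)
 moreover obtain x where x: "x : Z'" "x ~: Z" using Z'(2) by auto
 moreover have "x : affine_points 2" using x Z'(3) by auto
 then obtain P where "biv P (x i) (x j) ~= 0" "ALL z:Z. biv P (z i) (z j) = 0" using sep[OF Z] x by auto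
 ultimately show False unfolding I_def J_def by blast
qed

text \<open>In a chain of length three the second member satisfies a nonzero polynomial in each
  coordinate, so it lies in a finite grid and must be a point.\<close>

lemma no_chain_plane: "\<not> irreducible_chain (topo (Aff 2 :: (nat => 'k::field_char_0, 'k) fspace)) 3"
proof
 assume "irreducible_chain (topo (Aff 2 :: 'k aspace)) 3"
 then obtain Z where Z: "!!i. i <= 3 ==> irreducible_closed (topo (Aff 2 :: 'k aspace)) (Z i)"
  "!!i. i < 3 ==> Z i \<subset> Z (Suc i)" unfolding irreducible_chain_def by auto
 have Z01: "Z 0 \<subset> Z 1" "Z 1 \<subset> Z 2" "Z 2 \<subset> Z 3"
  using Z(2)[of 0] Z(2)[of 1] Z(2)[of 2] by (auto simp: numeral_2_eq_2 numeral_3_eq_3)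
 have c: "closedin (topo (Aff 2)) (Z i)" "Z i <= affine_points 2" if "i <= 3" for i
  using Z(1)[OF that] closedin_subset[of "topo (Aff 2)" "Z i"] unfolding irreducible_closed_def by auto
 have Z2: "Z 2 \<subset> affine_points 2" using Z01 c(2)[of 3] by auto
 have "EX d. d ~= 0 & (ALL z:Z 1. poly d (z i) = 0)" if "i < 2" for i
  using chain_plane_collapse[OF c(1)[of 1] Z(1)[of 2] Z01(2) Z2 that] by simp
 from this[of 0] this[of 1] obtain d e where de: "d ~= 0" "ALL z:Z 1. poly d (z 0) = 0" "e ~= 0" "ALL z:Z 1. poly e (z 1) = 0"
  by auto
 have "finite ({t. poly d t = 0} \<times> {t. poly e t = 0})"
  using de by (intro finite_cartesian_product poly_roots_finite)
 moreover have "(%z. (z 0, z 1)) ` Z 1 <= {t. poly d t = 0} \<times> {t. poly e t = 0}" using de by auto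
 moreover have "inj_on (%z. (z 0, z 1)) (Z 1)"
 proof (rule inj_onI, rule ext)
  fix y z i assume yz: "y : Z 1" "z : Z 1" "(y 0, y 1) = (z 0, z 1)"
  show "y i = z i"
  proof (cases "i < 2")
   case True then have "i = 0 | i = 1" by linarith
   then show ?thesis using yz(3) by auto
  next
   case False
   moreover have "y : affine_points 2" "z : affine_points 2" using yz c(2)[of 1] by auto
   ultimately show ?thesis by (auto simp: affine_points_def)
  qed
 qed
 ultimately have "finite (Z 1)" by (meson finite_imageD finite_subset)
 moreover obtain a where a: "a : Z 0" using Z(1)[of 0] unfolding irreducible_closed_def by auto
 moreover obtain b where "b : Z 1" "b ~: Z 0" using Z01 by auto
 ultimately show False using irreducible_finite_singleton[OF Z(1)[of 1], of a b] Z01 by auto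
qed

text \<open>The flag of the point \<open>a\<close>, the line \<open>x 0 = a 0\<close> and the plane;
  it survives in the open set because its smallest member lies there.\<close>

lemma chain_plane_basic:
 fixes \<delta> :: "(nat => 'k::field_char_0) => 'k"
 assumes "\<delta> : Polys 2" "a : affine_basic 2 \<delta>"
 shows "irreducible_chain (subtopology (topo (Aff 2)) (affine_basic 2 \<delta>)) 2"
proof (rule irreducible_chain_open)
 let ?Z = "%i::nat. {x : affine_points 2 :: (nat => 'k) set. (i < 2 --> x 0 = a 0) & (i < 1 --> x 1 = a 1)}"
 have a: "a : affine_points 2" using assms(2) by (simp add: affine_basic_def)
 have cl: "closedin (topo (Aff 2)) {x : affine_points 2 :: (nat => 'k) set. x j - a j = 0}" if "j < 2" for j
  by (rule closedin_zero_set) (simp add: poly_ops that)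
 have cA: "closedin (topo (Aff 2)) (affine_points 2 :: (nat => 'k) set)"
  using closedin_topspace[of "topo (Aff 2)"] by simp
 show "irreducible_closed (topo (Aff 2)) (?Z i)" for i
 proof (rule irreducible_line_closed)
  have "?Z i = (if i < 2 then {x : affine_points 2. x 0 - a 0 = 0} else affine_points 2) \<inter>
   (if i < 1 then {x : affine_points 2. x 1 - a 1 = 0} else affine_points 2)" by auto
  also have "closedin (topo (Aff 2)) \<dots>"
   by (rule closedin_Int) (use cl[of 0] cl[of 1] cA in auto)
  finally show "closedin (topo (Aff 2)) (?Z i)" .
  show "?Z i ~= {}" using a by blast
 qed (auto simp: affine_points_def)
 show "?Z i \<subset> ?Z (Suc i)" if "i < 2" for i
 proof
  show "?Z i <= ?Z (Suc i)" by auto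
  show "?Z i ~= ?Z (Suc i)"
  proof (cases "i = 0")
   case True
   have "a(1 := a 1 + 1) : ?Z (Suc i)" "a(1 := a 1 + 1) ~: ?Z i" using True a by (auto simp: affine_points_def)
   then show ?thesis by metis
  next
   case False
   then have "i = 1" using that by auto
   then have "a(0 := a 0 + 1) : ?Z (Suc i)" "a(0 := a 0 + 1) ~: ?Z i" using a by (auto simp: affine_points_def)
   then show ?thesis by metis
  qed
 qed
 show "Opn (Aff 2) (affine_basic 2 \<delta>)" by (rule openin_affine_basic[OF assms(1)])
 show "?Z 0 \<inter> affine_basic 2 \<delta> ~= {}" using assms(2) a by blast
qed

lemma has_dimension_line: "has_dimension (Aff 1 :: (nat => 'k::field_char_0, 'k) fspace) 1"
 unfolding has_dimension_def
proof (intro conjI allI impI notI)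
 fix n :: nat assume "n > 1" "irreducible_chain (topo (Aff 1 :: 'k aspace)) n"
 then show False using irreducible_chain_le[of _ n 2] no_chain_line by auto
next
 have 0: "(%_. 0) : (affine_points 1 :: (nat => 'k) set)" by (simp add: affine_points_def)
 have 1: "(%i. if i = 0 then 1 else 0) : (affine_points 1 :: (nat => 'k) set)" by (simp add: affine_points_def)
 have ne: "(%i::nat. if i = 0 then 1 else 0) ~= ((%_. 0) :: nat => 'k)" by (auto simp: fun_eq_iff)
 have "irreducible_closed (topo (Aff 1)) {(%_. 0) :: nat => 'k}"
  by (rule irreducible_line_closed[OF closedin_affine_singleton[OF 0]]) auto
 then show "irreducible_chain (topo (Aff 1 :: 'k aspace)) 1"
  unfolding irreducible_chain_def using irreducible_affine[of 1] 0 1 ne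
  by (intro exI[of _ "%i::nat. if i = 0 then {%_. 0} else affine_points 1"]) auto
qed

lemma separated_forD:
 "separated_for W Y ==> morphism W Y f ==> morphism W Y g ==> closedin (topo W) {w : points W. f w = g w}"
 unfolding separated_for_def by (elim allE[of _ f] allE[of _ g] impE)

subsection \<open>Isomorphisms\<close>

lemma isomorphismI:
 assumes "morphism X Y f" "morphism Y X g" "!!x. x : points X ==> g (f x) = x" "!!y. y : points Y ==> f (g y) = y"
 shows "isomorphism X Y f"
 using assms unfolding isomorphism_def by blast

lemma isomorphismE:
 assumes "isomorphism X Y f"
 obtains g where "morphism X Y f" "morphism Y X g" "!!x. x : points X ==> g (f x) = x" "!!y. y : points Y ==> f (g y) = y"
 using assms unfolding isomorphism_def by blast

lemma isomorphism_comp: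
 assumes "isomorphism X Y f" "isomorphism Y Z g" shows "isomorphism X Z (%x. g (f x))"
proof -
 obtain f' where f: "morphism X Y f" "morphism Y X f'" "!!x. x : points X ==> f' (f x) = x"
  "!!y. y : points Y ==> f (f' y) = y" using isomorphismE[OF assms(1)] by metis
 obtain g' where g: "morphism Y Z g" "morphism Z Y g'" "!!x. x : points Y ==> g' (g x) = x"
  "!!y. y : points Z ==> g (g' y) = y" using isomorphismE[OF assms(2)] by metis
 show ?thesis
  by (rule isomorphismI[OF morphism_comp[OF f(1) g(1)] morphism_comp[OF g(2) f(2)]])
   (simp_all add: f g morphism_points[OF f(1)] morphism_points[OF g(2)])
qed

lemma isomorphic_spaces_trans:
 assumes "isomorphic_spaces X Y" "isomorphic_spaces Y Z" shows "isomorphic_spaces X Z"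
proof -
 obtain f g where "isomorphism X Y f" "isomorphism Y Z g" using assms unfolding isomorphic_spaces_def by auto
 from isomorphism_comp[OF this] show ?thesis unfolding isomorphic_spaces_def by blast
qed

lemma isomorphism_restrict:
 assumes X: "swf X" and Z: "swf Z" and h: "isomorphism X Z h"
 shows "isomorphism (Sub X {x : points X. h x : U}) (Sub Z U) h"
proof -
 obtain g where f: "morphism X Z h" "morphism Z X g" "!!x. x : points X ==> g (h x) = x"
  "!!y. y : points Z ==> h (g y) = y" using isomorphismE[OF h] by metis
 show ?thesis
 proof (rule isomorphismI[where g = g])
  show "morphism (Sub X {x : points X. h x : U}) (Sub Z U) h"
   unfolding morphism_into_subspace_iff[OF Z swf_subspace[OF X]]
   using morphism_restrict[OF X f(1)] by auto
  show "morphism (Sub Z U) (Sub X {x : points X. h x : U}) g"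
   unfolding morphism_into_subspace_iff[OF X swf_subspace[OF Z]]
   using morphism_restrict[OF Z f(2)] f(4) morphism_points[OF f(2)] by auto
 qed (use f in auto)
qed

subsection \<open>Planar charts\<close>

lemma poly_taylor:
 assumes "P : Polys n"
 shows "EX Q. (ALL i<n. Q i : Polys n) & (ALL x. P x - P a = (\<Sum>i<n. Q i x * (x i - a i)))"
 using assms
proof induction
 case (const c) show ?case by (rule exI[of _ "%_ _. 0"]) (simp add: poly_ops)
next
 case (coord j)
 have "(\<Sum>i<n. (if i = j then 1 else 0) * (x i - a i)) = x j - a j" for x
 proof -
  have "(\<Sum>i<n. (if i = j then 1 else 0) * (x i - a i)) = (\<Sum>i<n. if i = j then x i - a i else 0)"
   by (rule sum.cong) auto
  then show ?thesis using coord by simp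
 qed
 then show ?case by (intro exI[of _ "%i _. if i = j then 1 else 0"]) (simp add: poly_ops)
next
 case (add f g)
 then obtain Q R where QR: "ALL i<n. Q i : Polys n" "ALL x. f x - f a = (\<Sum>i<n. Q i x * (x i - a i))"
  "ALL i<n. R i : Polys n" "ALL x. g x - g a = (\<Sum>i<n. R i x * (x i - a i))" by (elim exE conjE)
 have "f x + g x - (f a + g a) = (\<Sum>i<n. (Q i x + R i x) * (x i - a i))" for x
 proof -
  have "f x + g x - (f a + g a) = (f x - f a) + (g x - g a)" by simp
  then show ?thesis using QR by (simp add: distrib_right sum.distrib)
 qed
 then show ?case using QR by (intro exI[of _ "%i x. Q i x + R i x"]) (simp add: poly_ops)
next
 case (mult f g)
 then obtain Q R where QR: "ALL i<n. Q i : Polys n" "ALL x. f x - f a = (\<Sum>i<n. Q i x * (x i - a i))"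
  "ALL i<n. R i : Polys n" "ALL x. g x - g a = (\<Sum>i<n. R i x * (x i - a i))" by (elim exE conjE)
 have "f x * g x - f a * g a = (\<Sum>i<n. (Q i x * g x + f a * R i x) * (x i - a i))" for x
 proof -
  have "f x * g x - f a * g a = g x * (f x - f a) + f a * (g x - g a)" by (simp add: algebra_simps)
  also have "\<dots> = (\<Sum>i<n. g x * (Q i x * (x i - a i))) + (\<Sum>i<n. f a * (R i x * (x i - a i)))"
   using QR by (simp add: sum_distrib_left)
  also have "\<dots> = (\<Sum>i<n. (Q i x * g x + f a * R i x) * (x i - a i))"
   unfolding sum.distrib[symmetric] by (rule sum.cong) (simp_all add: algebra_simps)
  finally show ?thesis .
 qed
 then show ?case using QR mult by (intro exI[of _ "%i x. Q i x * g x + f a * R i x"]) (simp add: poly_ops)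
qed

text \<open>In the chart \<open>g\<close> is a quotient \<open>P / Q\<close> with \<open>P\<close>
  vanishing at the image of \<open>p\<close>, and a Taylor expansion of \<open>P\<close> there
  exhibits the two coordinate differences as generators of the maximal ideal. Used both for
  smoothness and for the ideal of the blown up points.\<close>

lemma chart_generators:
 fixes X :: "('x, 'k::field) fspace"
 assumes X: "swf X" and U: "Opn X U" and W: "Opn (Aff 2) W"
  and \<theta>: "morphism (Sub X U) (Aff 2) \<theta>" "!!x. x : U ==> \<theta> x : W"
  and \<kappa>: "morphism (Sub (Aff 2) W) X \<kappa>" "!!x. x : U ==> \<kappa> (\<theta> x) = x"
  and p: "p : U" "p : V" and V: "Opn X V" and g: "g : reg X V" "g p = 0"
 shows "EX W' a0 a1. Opn X W' & p : W' & W' <= U \<inter> V & a0 : reg X W' & a1 : reg X W' &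
  (ALL x:W'. g x = a0 x * (\<theta> x 0 - \<theta> p 0) + a1 x * (\<theta> x 1 - \<theta> p 1))"
proof -
 let ?A = "Sub (Aff 2 :: 'k aspace) W"
 let ?N = "{w : points ?A. \<kappa> w : V}"
 have oN: "Opn ?A ?N" by (rule morphism_open[OF \<kappa>(1) V])
 then have oN': "Opn (Aff 2) ?N" "?N <= W"
  using openin_subspace_open[OF W, of ?N] by auto
 have gN: "(%w. g (\<kappa> w)) : reg (Aff 2) ?N"
  using morphism_reg[OF \<kappa>(1) V g(1)] reg_subspace_open[OF swf_affine W oN'] by simp
 have UX: "U <= points X" by (rule openin_subset[OF U])
 then have \<theta>A: "\<theta> x : affine_points 2" if "x : U" for x
  using morphism_points[OF \<theta>(1), of x] that by auto
 have "\<theta> p : ?N" using p \<theta>(2) \<kappa>(2) \<theta>A by simp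
 from reg_affineD[OF gN this] obtain P Q where PQ: "P : Polys 2" "Q : Polys 2" "Q (\<theta> p) ~= 0"
  "affine_basic 2 Q <= ?N" "ALL y:affine_basic 2 Q. g (\<kappa> y) = P y / Q y" by (elim exE conjE)
 have "\<theta> p : affine_basic 2 Q" using PQ(3) \<theta>A[OF p(1)] by (simp add: affine_basic_def)
 from bspec[OF PQ(5) this] have "P (\<theta> p) / Q (\<theta> p) = 0" using \<kappa>(2)[OF p(1)] g(2) by simp
 then have Pp: "P (\<theta> p) = 0" using PQ(3) by simp
 obtain R where R: "ALL i<2. R i : Polys 2" "ALL x. P x - P (\<theta> p) = (\<Sum>i<2. R i x * (x i - \<theta> p i))"
  using poly_taylor[OF PQ(1)] by blast
 let ?W = "{x : U. Q (\<theta> x) ~= 0}"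
 have reg: "(%x. H (\<theta> x)) : reg X U" if "H : Polys 2" for H
 proof -
  have pU: "points (Sub X U) = U" using UX by auto
  have o: "Opn (Sub X U) U" using openin_subspace_open[OF U, of U] U by blast
  have o2: "Opn (Aff 2) (affine_points 2)"
   using openin_topspace[of "topo (Aff 2)"] by simp
  have "(%x. H (\<theta> x)) : reg (Sub X U) U"
   by (rule morphism_reg_on[OF swf_subspace[OF X] \<theta>(1) o2 reg_affine_poly[OF that o2] o]) (rule \<theta>A)
  then show ?thesis using reg_subspace_open[OF X U U] by simp
 qed
 have oW: "Opn X ?W" by (rule reg_nonzero[OF X U reg[OF PQ(2)]])
 have a: "(%x. R i (\<theta> x) / Q (\<theta> x)) : reg X ?W" if "i < 2" for i
  by (rule reg_divide[OF X oW reg_mono[OF X U reg oW] reg_mono[OF X U reg[OF PQ(2)] oW]]) (use R that in auto)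
 have basic: "\<theta> x : affine_basic 2 Q" if "x : ?W" for x using that \<theta>A by (simp add: affine_basic_def)
 show ?thesis
 proof (intro exI conjI ballI)
  show "?W <= U \<inter> V"
  proof
   fix x assume x: "x : ?W"
   have "\<theta> x : ?N" by (rule subsetD[OF PQ(4) basic[OF x]])
   then show "x : U \<inter> V" using x \<kappa>(2)[of x] by auto
  qed
  fix x assume x: "x : ?W"
  have "g x = P (\<theta> x) / Q (\<theta> x)" using PQ(5) basic[OF x] \<kappa>(2)[of x] x by auto
  also have "P (\<theta> x) = R 0 (\<theta> x) * (\<theta> x 0 - \<theta> p 0) + R 1 (\<theta> x) * (\<theta> x 1 - \<theta> p 1)"
   using R(2) Pp by (simp add: numeral_2_eq_2)
  finally show "g x = R 0 (\<theta> x) / Q (\<theta> x) * (\<theta> x 0 - \<theta> p 0) + R 1 (\<theta> x) / Q (\<theta> x) * (\<theta> x 1 - \<theta> p 1)"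
   by (simp add: add_divide_distrib)
 qed (use oW p PQ(3) a[of 0] a[of 1] in auto)
qed

text \<open>Some charts of the model are the plane minus a curve, hence the polynomial \<delta>.
  Such charts are affine, smooth and two-dimensional, so a finite cover by them settles all local
  properties.\<close>

definition plane_chart :: "('x, 'k::field) fspace => 'x set => bool" where
 "plane_chart X U \<longleftrightarrow> Opn X U & (EX \<delta>:Polys 2. affine_basic 2 \<delta> ~= {} &
  isomorphic_spaces (Sub X U) (Sub (Aff 2) (affine_basic 2 \<delta>)))"

text \<open>The complement of \<open>\<delta> = 0\<close> in the plane is the closed set \<open>\<delta>(x\<^sub>0, x\<^sub>1) x\<^sub>2 = 1\<close> in space.\<close>

lemma affine_basic_affine:
 assumes \<delta>: "\<delta> : Polys 2"
 shows "affine_variety (Sub (Aff 2) (affine_basic 2 \<delta>))"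
proof -
 let ?Z = "{x : affine_points 3. \<delta> x * x 2 - 1 = 0}"
 let ?B = "Sub (Aff 2) (affine_basic 2 \<delta>)"
 let ?C = "Sub (Aff 3) ?Z"
 have B: "swf ?B" and C: "swf ?C" by (rule swf_subspace[OF swf_affine])+
 have \<delta>3: "(%x. \<delta> x) : Polys 3"
  using poly_subst[OF \<delta>, of "%i x. x i" 3] by (simp add: poly_ops)
 have oB: "Opn (Aff 2) (affine_basic 2 \<delta>)" by (rule openin_affine_basic[OF \<delta>])
 have pB: "points ?B = affine_basic 2 \<delta>" by (auto simp: affine_basic_def)
 have cl: "closedin (topo (Aff 3)) ?Z"
  by (rule closedin_zero_set) (simp add: poly_ops \<delta>3)
 let ?f = "%x i. if i < 2 then x i else if i = 2 then inverse (\<delta> x) else 0"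
 let ?g = "%x i. if i < 2 then x i else 0"
 have trunc: "\<delta> (%i. if i < 2 then x i else y i) = \<delta> x" for x y by (rule poly_cong[OF \<delta>]) simp
 have regB: "h : reg ?B (affine_basic 2 \<delta>)" if "h : reg (Aff 2) (affine_basic 2 \<delta>)" for h
  using that reg_subspace_open[OF swf_affine oB oB subset_refl] by simp
 have coord: "(%x. x i) : reg (Aff 2) (affine_basic 2 \<delta>)" if "i < 2" for i
  using reg_affine_poly[OF poly_functions.coord[OF that] oB] .
 have inv: "(%x. inverse (\<delta> x)) : reg (Aff 2) (affine_basic 2 \<delta>)"
  by (rule reg_inverse[OF swf_affine oB reg_affine_poly[OF \<delta> oB]]) (simp add: affine_basic_def)
 have "morphism ?B (Aff 3) ?f"
 proof (rule morphism_into_affine[OF B], goal_cases)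
  case (2 i)
  have "(%w. if i < 2 then w i else if i = 2 then inverse (\<delta> w) else 0) : reg (Aff 2) (affine_basic 2 \<delta>)"
  proof (cases "i < 2")
   case True then show ?thesis using coord[of i] by simp
  next
   case False then have "i = 2" using 2 by simp
   then show ?thesis using inv by simp
  qed
  then show ?case unfolding pB by (rule regB)
 qed (simp add: affine_points_def)
 moreover have "?f x : ?Z" if "x : affine_basic 2 \<delta>" for x
  using that trunc[of x] by (simp add: affine_basic_def affine_points_def)
 ultimately have f: "morphism ?B ?C ?f"
  unfolding morphism_into_subspace_iff[OF swf_affine B] pB by blast
 have gC: "?g x : affine_basic 2 \<delta>" if "x : ?Z" for x
  using that trunc[of x "%_. 0"] by (auto simp: affine_basic_def affine_points_def)
 have o3: "Opn ?C (points ?C)" by (rule openin_topspace)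
 have "morphism ?C (Aff 2) ?g"
 proof (rule morphism_into_affine[OF C], goal_cases)
  case (2 i)
  then show ?case using coord_reg[OF C morphism_inclusion[OF swf_affine] o3, of i] by simp
 qed (simp add: affine_points_def)
 then have g: "morphism ?C ?B ?g"
  unfolding morphism_into_subspace_iff[OF swf_affine C] using gC by auto
 have "isomorphism ?B ?C ?f"
 proof (rule isomorphismI[OF f g])
  fix x assume "x : points ?B"
  then show "?g (?f x) = x" by (auto simp: affine_basic_def affine_points_def)
 next
  fix y assume y: "y : points ?C"
  then have "\<delta> y * y 2 = 1" "y : affine_points 3" by auto
  then have "inverse (\<delta> y) = y 2" "!!i. i \<ge> 3 ==> y i = 0"
   by (simp_all add: inverse_unique affine_points_def)
  then show "?f (?g y) = y" using trunc[of y "%_. 0"] by (auto simp: fun_eq_iff)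
 qed
 then show ?thesis unfolding affine_variety_def isomorphic_spaces_def using cl by blast
qed

lemma plane_chart_affine: "plane_chart X U ==> affine_variety (Sub X U)"
 unfolding plane_chart_def using affine_basic_affine isomorphic_spaces_trans
 unfolding affine_variety_def by blast

lemma plane_chartE:
 assumes "swf X" "plane_chart X U"
 obtains \<delta> \<theta> \<kappa> where "Opn X U" "\<delta> : Polys 2" "affine_basic 2 \<delta> ~= {}"
  "morphism (Sub X U) (Sub (Aff 2) (affine_basic 2 \<delta>)) \<theta>"
  "morphism (Sub (Aff 2) (affine_basic 2 \<delta>)) (Sub X U) \<kappa>"
  "!!x. x : U ==> \<kappa> (\<theta> x) = x" "!!y. y : affine_basic 2 \<delta> ==> \<theta> (\<kappa> y) = y"
proof -
 obtain \<delta> \<theta> where 1: "Opn X U" "\<delta> : Polys 2" "affine_basic 2 \<delta> ~= {}"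
  "isomorphism (Sub X U) (Sub (Aff 2) (affine_basic 2 \<delta>)) \<theta>"
  using assms(2) unfolding plane_chart_def isomorphic_spaces_def by auto
 from 1(4) show thesis
 proof (rule isomorphismE, goal_cases)
  case (1 \<kappa>)
  have "points (Sub X U) = U" using openin_subset[OF \<open>Opn X U\<close>] by auto
  moreover have "points (Sub (Aff 2) (affine_basic 2 \<delta>)) = affine_basic 2 \<delta>"
   by (auto simp: affine_basic_def)
  ultimately show thesis using that[of \<delta> \<theta> \<kappa>] 1 \<open>Opn X U\<close> \<open>\<delta> : Polys 2\<close>
   \<open>affine_basic 2 \<delta> ~= {}\<close> by blast
 qed
qed

lemma plane_chart_smooth:
 assumes X: "swf X" and U: "plane_chart X U" and p: "p : U" shows "smooth_point X 2 p"
proof -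
 obtain \<delta> \<theta> \<kappa> where 1: "Opn X U" "\<delta> : Polys 2" "affine_basic 2 \<delta> ~= {}"
  "morphism (Sub X U) (Sub (Aff 2) (affine_basic 2 \<delta>)) \<theta>"
  "morphism (Sub (Aff 2) (affine_basic 2 \<delta>)) (Sub X U) \<kappa>"
  "!!x. x : U ==> \<kappa> (\<theta> x) = x" by (rule plane_chartE[OF X U]) blast
 have pU: "points (Sub X U) = U" using openin_subset[OF 1(1)] by auto
 have \<theta>: "morphism (Sub X U) (Aff 2) \<theta>" "!!x. x : U ==> \<theta> x : affine_basic 2 \<delta>"
  using 1(4) unfolding morphism_into_subspace_iff[OF swf_affine swf_subspace[OF X]] pU by auto
 have \<kappa>: "morphism (Sub (Aff 2) (affine_basic 2 \<delta>)) X \<kappa>"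
  using 1(5) unfolding morphism_into_subspace_iff[OF X swf_subspace[OF swf_affine]] by auto
 let ?t = "%i x. \<theta> x i - \<theta> p i"
 have t: "?t i : reg X U" if "i < 2" for i
 proof -
  have o: "Opn (Sub X U) U" using openin_subspace_open[OF 1(1), of U] 1(1) by blast
  have "?t i : reg (Sub X U) U"
   by (intro reg_diff[OF swf_subspace[OF X] o] reg_const[OF swf_subspace[OF X] o]
     coord_reg[OF swf_subspace[OF X] \<theta>(1) o that])
  then show ?thesis using reg_subspace_open[OF X 1(1) 1(1)] by simp
 qed
 show ?thesis unfolding smooth_point_def
 proof (rule exI[of _ U], rule exI[of _ ?t], intro conjI allI impI; (elim conjE)?)
  fix V g assume Vg: "Opn X V" "p : V" "g : reg X V" "g p = 0"
  have "EX W' a0 a1. Opn X W' & p : W' & W' <= U \<inter> V & a0 : reg X W' & a1 : reg X W' &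
   (ALL x:W'. g x = a0 x * (\<theta> x 0 - \<theta> p 0) + a1 x * (\<theta> x 1 - \<theta> p 1))"
   by (rule chart_generators[OF X 1(1) openin_affine_basic[OF 1(2)] \<theta>(1) _ \<kappa> _ p Vg(2,1,3,4)])
    (use \<theta>(2) 1(6) in auto)
  then obtain W' a0 a1 where "Opn X W'" "p : W'" "W' <= U \<inter> V" "a0 : reg X W'" "a1 : reg X W'"
   "ALL x:W'. g x = a0 x * (\<theta> x 0 - \<theta> p 0) + a1 x * (\<theta> x 1 - \<theta> p 1)" by (elim exE conjE)
  then show "EX W a. Opn X W & p : W & W <= U \<inter> V & (ALL i<2. a i : reg X W) &
     (ALL x:W. g x = (\<Sum>i<2. a i x * (\<theta> x i - \<theta> p i)))"
   by (intro exI[of _ W'] exI[of _ "%i. if i = 0 then a0 else a1"]) (simp add: numeral_2_eq_2)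
 qed (use 1(1) p t in auto)
qed

lemma plane_chart_dimension:
 fixes X :: "('x, 'k::field_char_0) fspace"
 assumes X: "swf X" and U: "plane_chart X U"
 shows "irreducible_chain (subtopology (topo X) U) n \<longleftrightarrow> n <= 2"
proof -
 obtain \<delta> \<theta> \<kappa> where 1: "Opn X U" "\<delta> : Polys 2" "affine_basic 2 \<delta> ~= {}"
  "morphism (Sub X U) (Sub (Aff 2) (affine_basic 2 \<delta>)) \<theta>"
  "morphism (Sub (Aff 2) (affine_basic 2 \<delta>)) (Sub X U) \<kappa>"
  "!!x. x : U ==> \<kappa> (\<theta> x) = x" "!!y. y : affine_basic 2 \<delta> ==> \<theta> (\<kappa> y) = y"
  by (rule plane_chartE[OF X U]) blast
 let ?T = "subtopology (topo (Aff 2 :: 'k aspace)) (affine_basic 2 \<delta>)"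
 have c: "continuous_map (subtopology (topo X) U) ?T \<theta>" "continuous_map ?T (subtopology (topo X) U) \<kappa>"
  using 1(4,5) by (auto simp: morphism_def)
 have "irreducible_chain (subtopology (topo X) U) n \<longleftrightarrow> irreducible_chain ?T n"
  using irreducible_chain_homeomorphic[OF c] irreducible_chain_homeomorphic[OF c(2,1)] 1(6,7) by auto
 also have "\<dots> \<longleftrightarrow> n <= 2"
 proof
  assume "irreducible_chain ?T n"
  then have "irreducible_chain (topo (Aff 2 :: 'k aspace)) n" by (rule irreducible_chain_closure)
  then show "n <= 2" using irreducible_chain_le[of _ n 3] no_chain_plane by fastforce
 next
  assume "n <= 2"
  obtain a where "a : affine_basic 2 \<delta>" using 1(3) by auto
  from irreducible_chain_le[OF chain_plane_basic[OF 1(2) this] \<open>n <= 2\<close>] show "irreducible_chain ?T n" .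
 qed
 finally show ?thesis .
qed

text \<open>The diagonal is the equaliser of the two projections followed by an injective morphism
  to projective space.\<close>

lemma diagonal_closed:
 fixes X :: "('x, 'k::field) fspace"
 assumes X: "swf X" and \<theta>: "morphism X (Proj n) \<theta>" "inj_on \<theta> (points X)"
 shows "closedin (topo (prod_space X X)) {(x, x) | x. x : points X}"
proof -
 have P: "swf (prod_space X X)" by (rule swf_prod[OF X X])
 have "closedin (topo (prod_space X X)) {w : points (prod_space X X). \<theta> (fst w) = \<theta> (snd w)}"
  by (rule separated_forD[OF separated_proj[OF P] morphism_comp[OF morphism_fst[OF X X] \<theta>(1)]
   morphism_comp[OF morphism_snd[OF X X] \<theta>(1)]])
 moreover have "{w : points (prod_space X X). \<theta> (fst w) = \<theta> (snd w)} = {(x, x) | x. x : points X}"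
 proof (rule set_eqI)
  fix w :: "'x \<times> 'x"
  have "\<theta> (fst w) = \<theta> (snd w) \<longleftrightarrow> fst w = snd w" if "fst w : points X" "snd w : points X"
   using inj_on_eq_iff[OF \<theta>(2) that] .
  then show "w : {w : points (prod_space X X). \<theta> (fst w) = \<theta> (snd w)} \<longleftrightarrow> w : {(x, x) | x. x : points X}"
   unfolding points_prod[OF X X] by (cases w) (simp, blast)
 qed
 ultimately show ?thesis by simp
qed

text \<open>Affineness, smoothness and dimension come from the charts; separatedness, which is not
  local, comes from the injective morphism \<theta>.\<close>

lemma surface_from_charts:
 fixes X :: "('x, 'k::field_char_0) fspace"
 assumes X: "swf X" and irr: "irreducible_closed (topo X) (points X)"
  and cover: "finite \<U>" "\<Union>\<U> = points X" "!!U. U : \<U> ==> plane_chart X U"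
  and \<theta>: "morphism X (Proj n) \<theta>" "inj_on \<theta> (points X)"
 shows "surface X & smooth_variety X"
proof -
 have v: "variety X" unfolding variety_def
 proof (intro conjI exI[of _ \<U>] ballI X irr cover(1,2) diagonal_closed[OF X \<theta>])
  fix U assume "U : \<U>"
  note U = cover(3)[OF this]
  show "Opn X U" using U unfolding plane_chart_def by (elim conjE)
  show "affine_variety (Sub X U)" by (rule plane_chart_affine[OF U])
 qed
 have d: "has_dimension X 2" unfolding has_dimension_def
 proof (intro conjI allI impI notI)
  have "points X ~= {}" using irr unfolding irreducible_closed_def by (elim conjE)
  then obtain x where "x : points X" by blast
  then obtain U where "U : \<U>" using cover(2) by auto
  then show "irreducible_chain (topo X) 2"
   using irreducible_chain_closure plane_chart_dimension[OF X cover(3)] by blast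
 next
  fix m :: nat assume m: "m > 2" "irreducible_chain (topo X) m"
  then obtain Z where Z: "!!i. i <= m ==> irreducible_closed (topo X) (Z i)" "!!i. i < m ==> Z i \<subset> Z (Suc i)"
   unfolding irreducible_chain_def by auto
  \<comment> \<open>A chart through a point of the smallest member meets every member, so the whole
    chain restricts to that chart.\<close>
  obtain x where x: "x : Z 0" using Z(1)[of 0] unfolding irreducible_closed_def by auto
  moreover have "Z 0 <= points X" using Z(1)[of 0] closedin_subset unfolding irreducible_closed_def by blast
  ultimately obtain U where U: "U : \<U>" "x : U" using cover(2) by auto
  have "Opn X U" using cover(3)[OF U(1)] unfolding plane_chart_def by simp
  then have "irreducible_chain (subtopology (topo X) U) m"
   by (rule irreducible_chain_open[where Z = Z, rotated 2]) (use x U Z in auto)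
  then show False using plane_chart_dimension[OF X cover(3)[OF U(1)]] m(1) by simp
 qed
 have "smooth_point X 2 p" if "p : points X" for p
  using that cover(2) plane_chart_smooth[OF X cover(3)] by blast
 then show ?thesis using v d unfolding surface_def smooth_variety_def by blast
qed

lemma plane_chart_isomorphic:
 assumes X: "swf X" and Z: "swf Z" and h: "isomorphism X Z h" and U: "plane_chart Z U"
 shows "plane_chart X {x : points X. h x : U}"
proof -
 have "Opn X {x : points X. h x : U}"
  using h U morphism_open[of X Z h U] unfolding isomorphism_def plane_chart_def by blast
 moreover have "isomorphic_spaces (Sub X {x : points X. h x : U}) (Sub Z U)"
  using isomorphism_restrict[OF X Z h] unfolding isomorphic_spaces_def by blast
 ultimately show ?thesis using U isomorphic_spaces_trans unfolding plane_chart_def by blast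
qed

section \<open>Hirzebruch surfaces\<close>

text \<open>Two morphisms that jointly separate points suffice, which avoids embedding a Hirzebruch
  surface into a single projective space.\<close>

lemma separated_for_injective:
 fixes W :: "('w, 'k::field) fspace"
 assumes W: "swf W" and e: "morphism Y (Proj n) e" "morphism Y (Proj m) e'"
  and inj: "!!x y. x : points Y ==> y : points Y ==> e x = e y ==> e' x = e' y ==> x = y"
 shows "separated_for W Y"
proof (rule separated_forI)
 fix f g w assume f: "morphism W Y f" and g: "morphism W Y g" and w: "w : points W" "f w ~= g w"
 have *: "EX V. Opn W V & w : V & (ALL v:V. f v ~= g v)"
  if k: "morphism Y (Proj l) k" and ne: "k (f w) ~= k (g w)" for k :: "_ => (nat => 'k) set" and l
 proof -
  have "closedin (topo W) {w : points W. k (f w) = k (g w)}"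
   by (rule separated_forD[OF separated_proj[OF W] morphism_comp[OF f k] morphism_comp[OF g k]])
  then have "Opn W (points W - {w : points W. k (f w) = k (g w)})" by auto
  then show ?thesis using w ne
   by (intro exI[of _ "points W - {w : points W. k (f w) = k (g w)}"] conjI ballI notI) auto
 qed
 have "e (f w) ~= e (g w) | e' (f w) ~= e' (g w)"
  using inj[OF morphism_points[OF f w(1)] morphism_points[OF g w(1)]] w(2) by auto
 then show "EX V. Opn W V & w : V & (ALL v:V. f v ~= g v)"
  using *[OF e(1)] *[OF e(2)] by (elim disjE)
qed

definition vec4 :: "'k::zero => 'k => 'k => 'k => nat => 'k" where
 "vec4 a b c d = (%i. if i = 0 then a else if i = 1 then b else if i = 2 then c else if i = 3 then d else 0)"

lemma vec4_simps [simp]: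
 "vec4 a b c d 0 = a" "vec4 a b c d (Suc 0) = b" "vec4 a b c d 1 = b" "vec4 a b c d 2 = c" "vec4 a b c d 3 = d"
 by (simp_all add: vec4_def)

lemma less4_cases:
 assumes "i < (4::nat)" obtains "i = 0" | "i = 1" | "i = 2" | "i = 3"
 using assms by linarith

lemma affine_points4_eqI:
 assumes "v : affine_points 4" "w : affine_points 4" "v 0 = w 0" "v 1 = w 1" "v 2 = w 2" "v 3 = w 3"
 shows "v = w"
proof
 fix i show "v i = w i"
 proof (cases "i < 4")
  case True then show ?thesis by (rule less4_cases) (use assms in auto)
 next
  case False then show ?thesis using assms by (simp add: affine_points_def)
 qed
qed

lemma vec4_eta: "v : affine_points 4 ==> vec4 (v 0) (v 1) (v 2) (v 3) = v"
 by (rule affine_points4_eqI) (simp_all add: affine_points_def vec4_def)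

lemma vec4_domain:
 "vec4 a b c d : Dom \<longleftrightarrow> (a ~= 0 | b ~= 0) & (c ~= 0 | d ~= 0)"
 unfolding hirzebruch_domain_def by (simp add: affine_points_def) (simp add: vec4_def)

lemma domain_affine: "v : Dom ==> v : affine_points 4"
 by (simp add: hirzebruch_domain_def)

definition torus :: "nat => 'k::field => 'k => (nat => 'k) => nat => 'k" where
 "torus r c d v = vec4 (c * v 0) (c * v 1) (d * v 2) (inverse (c ^ r) * d * v 3)"

lemma hirzebruch_class_torus: "Cls r v = {torus r c d v | c d. c ~= 0 & d ~= 0}"
proof -
 have "(%i. if i < 2 then c * v i else if i = 2 then d * v 2
     else if i = 3 then inverse (c ^ r) * d * v 3 else 0) = torus r c d v" for c d
 proof
  fix i :: nat
  have "i < 2 \<longleftrightarrow> i = 0 | i = 1" by auto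
  then show "(if i < 2 then c * v i else if i = 2 then d * v 2
     else if i = 3 then inverse (c ^ r) * d * v 3 else 0) = torus r c d v i"
   by (auto simp: torus_def vec4_def)
 qed
 then show ?thesis unfolding hirzebruch_class_def by simp
qed

lemma torus_domain: "c ~= 0 ==> d ~= 0 ==> v : Dom ==> torus r c d v : Dom"
 unfolding torus_def vec4_domain by (auto simp: hirzebruch_domain_def)

lemma torus_torus: "torus r c d (torus r c' d' v) = torus r (c * c') (d * d') v"
 by (simp add: torus_def power_mult_distrib ac_simps)

lemma torus_one: "v : Dom ==> torus r 1 1 v = v"
 unfolding torus_def using vec4_eta[OF domain_affine] by simp

lemma class_torus:
 assumes "c ~= 0" "d ~= 0" shows "Cls r (torus r c d v) = Cls r v"
proof (intro subset_antisym subsetI)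
 fix w assume "w : Cls r (torus r c d v)"
 then obtain a b where "a ~= 0" "b ~= 0" "w = torus r a b (torus r c d v)" unfolding hirzebruch_class_torus by auto
 then show "w : Cls r v" unfolding hirzebruch_class_torus torus_torus using assms
  by (intro CollectI exI[of _ "a * c"] exI[of _ "b * d"]) simp
next
 fix w assume "w : Cls r v"
 then obtain a b where "a ~= 0" "b ~= 0" "w = torus r a b v" unfolding hirzebruch_class_torus by auto
 then show "w : Cls r (torus r c d v)" unfolding hirzebruch_class_torus torus_torus using assms
  by (intro CollectI exI[of _ "a / c"] exI[of _ "b / d"]) simp
qed

lemma class_vec4_eqI:
 assumes "c ~= 0" "d ~= 0" "a' = c * a" "b' = c * b" "e' = d * e" "f' = inverse (c ^ r) * d * f"
 shows "Cls r (vec4 a' b' e' f') = Cls r (vec4 a b e f)"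
 using class_torus[OF assms(1,2), of r "vec4 a b e f"] assms by (simp add: torus_def)

lemma class_eqD:
 assumes "Cls r w = Cls r v" "w : Dom"
 shows "EX c d. c ~= 0 & d ~= 0 & w = torus r c d v"
proof -
 have "w : Cls r w" unfolding hirzebruch_class_torus
  by (intro CollectI exI[of _ 1]) (simp add: torus_one[OF assms(2)])
 then show ?thesis using assms(1) unfolding hirzebruch_class_torus by auto
qed

lemma swf_domain: "swf (Sub (Aff 4) Dom)"
 by (rule swf_subspace[OF swf_affine])

lemma points_domain: "points (Sub (Aff 4) Dom) = Dom"
 by (auto simp: domain_affine)

lemma swf_hirzebruch: "swf (hirzebruch r)"
 unfolding hirzebruch_def by (rule swf_quotient[OF swf_domain])

lemma points_hirzebruch: "points (hirzebruch r) = Cls r ` Dom"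
 unfolding hirzebruch_def points_quotient points_domain ..

lemma class_points: "v : Dom ==> Cls r v : points (hirzebruch r)"
 unfolding points_hirzebruch by blast

lemma rep_class: "EX c d. c ~= 0 & d ~= 0 & rep (Cls r v) = torus r c d v"
proof -
 have "torus r 1 1 v : Cls r v" unfolding hirzebruch_class_torus by force
 then have "rep (Cls r v) : Cls r v"
  unfolding rep_def by (rule someI[of "%z. z : Cls r v"])
 then show ?thesis unfolding hirzebruch_class_torus by auto
qed

lemma rep_domain: "A : points (hirzebruch r) ==> rep A : Dom"
 unfolding points_hirzebruch using rep_class torus_domain by (metis imageE)

lemma class_rep: "A : points (hirzebruch r) ==> Cls r (rep A) = A"
 unfolding points_hirzebruch using rep_class class_torus by (metis imageE)

lemma openin_domain: "Opn (Aff 4) (Dom :: (nat => 'k::field) set)"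
proof -
 have e: "(Dom :: (nat => 'k) set) = (affine_basic 4 (%v. v 0) \<union> affine_basic 4 (%v. v 1)) \<inter>
   (affine_basic 4 (%v. v 2) \<union> affine_basic 4 (%v. v 3))"
  by (auto simp: hirzebruch_domain_def affine_basic_def)
 have o: "Opn (Aff 4) (affine_basic 4 (%v :: nat => 'k. v i))" if "i < 4" for i
  by (rule openin_affine_basic) (simp add: poly_ops that)
 show ?thesis unfolding e by (intro openin_Int openin_Un o) simp_all
qed

lemma morphism_hirzebruch_class: "morphism (Sub (Aff 4) Dom) (hirzebruch r) (Cls r)"
 unfolding hirzebruch_def by (rule morphism_quotient_map)

lemma morphism_class_vec4:
 fixes W :: "('w, 'k::field) fspace"
 assumes W: "swf W" and r: "a : reg W (points W)" "b : reg W (points W)" "c : reg W (points W)" "d : reg W (points W)"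
  and nz: "!!w. w : points W ==> (a w ~= 0 | b w ~= 0) & (c w ~= 0 | d w ~= 0)"
 shows "morphism W (hirzebruch r) (%w. Cls r (vec4 (a w) (b w) (c w) (d w)))"
proof -
 have "morphism W (Aff 4) (%w. vec4 (a w) (b w) (c w) (d w))"
 proof (rule morphism_into_affine[OF W], goal_cases)
  case 1 show ?case by (simp add: affine_points_def vec4_def)
 next
  case (2 i) then show ?case by (rule less4_cases) (use r in \<open>simp_all add: vec4_simps(3)\<close>)
 qed
 moreover have "(%w. vec4 (a w) (b w) (c w) (d w)) ` points W <= Dom"
  using nz by (auto simp: vec4_domain)
 ultimately have "morphism W (Sub (Aff 4) Dom) (%w. vec4 (a w) (b w) (c w) (d w))"
  unfolding morphism_into_subspace_iff[OF swf_affine W] by blast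
 from morphism_comp[OF this morphism_hirzebruch_class] show ?thesis .
qed

text \<open>Semi-invariants for the character \<open>k\<close>. They play the role of homogeneous
  polynomials: vanishing and ratios of equal weight descend to the Hirzebruch surface.\<close>

definition torus_weight :: "nat => ('k => 'k => 'k) => ((nat => 'k::field) => 'k) => bool" where
 "torus_weight r k F \<longleftrightarrow> F : Polys 4 & (ALL c d v. c ~= 0 --> d ~= 0 --> k c d ~= 0 & F (torus r c d v) = k c d * F v)"

lemma torus_weight_rep:
 assumes "torus_weight r k F" "torus_weight r k G"
 shows "F (rep (Cls r v)) = 0 \<longleftrightarrow> F v = 0"
  "F (rep (Cls r v)) / G (rep (Cls r v)) = F v / G v"
proof -
 obtain c d where "c ~= 0" "d ~= 0" "rep (Cls r v) = torus r c d v" using rep_class by metis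
 then show "F (rep (Cls r v)) = 0 \<longleftrightarrow> F v = 0"
  "F (rep (Cls r v)) / G (rep (Cls r v)) = F v / G v"
  using assms unfolding torus_weight_def by auto
qed

lemma torus_weight_preimage:
 assumes "torus_weight r k G"
 shows "{v : Dom. Cls r v : {A : Cls r ` Dom. G (rep A) ~= 0}} =
  affine_basic 4 G \<inter> Dom"
 using torus_weight_rep(1)[OF assms assms] domain_affine by (auto simp: affine_basic_def)

lemma openin_torus_weight:
 assumes G: "torus_weight r k G"
 shows "Opn (hirzebruch r) {A : points (hirzebruch r). G (rep A) ~= 0}"
proof -
 have o: "Opn (Sub (Aff 4) Dom) (affine_basic 4 G \<inter> Dom)"
  using G unfolding topo_subspace openin_subtopology torus_weight_def
  by (intro exI[of _ "affine_basic 4 G"] conjI openin_affine_basic refl) simp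
 show ?thesis
  unfolding hirzebruch_def openin_quotient_space points_quotient points_domain torus_weight_preimage[OF G]
  by (rule conjI[OF _ o]) (rule subsetI, simp)
qed

lemma torus_ratio_reg:
 assumes F: "torus_weight r k F" and G: "torus_weight r k G"
 shows "(%A. F (rep A) / G (rep A)) : reg (hirzebruch r) {A : points (hirzebruch r). G (rep A) ~= 0}"
proof -
 let ?C = "Sub (Aff 4) Dom"
 have FG: "F : Polys 4" "G : Polys 4" using F G unfolding torus_weight_def by auto
 have oG: "Opn (Aff 4) (affine_basic 4 G)" by (rule openin_affine_basic[OF FG(2)])
 have "(%v. F v / G v) : reg (Aff 4) (affine_basic 4 G)"
  by (rule reg_divide[OF swf_affine oG reg_affine_poly[OF FG(1) oG] reg_affine_poly[OF FG(2) oG]])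
   (simp add: affine_basic_def)
 from reg_subspaceI[OF oG this, of Dom]
 have "(%v. F (rep (Cls r v)) / G (rep (Cls r v))) : reg ?C (affine_basic 4 G \<inter> Dom)"
  by (simp only: torus_weight_rep(2)[OF F G])
 then show ?thesis
  unfolding hirzebruch_def reg_quotient points_quotient points_domain torus_weight_preimage[OF G]
  by (simp only: mem_Collect_eq)
qed

lemma domain_poly_reg:
 assumes "F : Polys 4"
 shows "F : reg (Sub (Aff 4) Dom) Dom"
 unfolding reg_subspace_open[OF swf_affine openin_domain openin_domain subset_refl]
 by (rule reg_affine_poly[OF assms openin_domain])

lemma morphism_from_hirzebruch_hp:
 assumes F: "!!i. i <= n ==> torus_weight r k (F i)"
  and nz: "!!v. v : Dom ==> EX i<=n. F i v ~= 0"
 shows "morphism (hirzebruch r) (Proj n) (%A. hp n (%i. F i (rep A)))"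
proof -
 have "morphism (Sub (Aff 4) Dom) (Proj n) (%v. hp n (%i. F i v))"
  by (rule morphism_hp[OF swf_domain], unfold points_domain)
   (use F nz in \<open>auto simp: torus_weight_def intro!: domain_poly_reg\<close>)
 then have "morphism (Sub (Aff 4) Dom) (Proj n)
  (%v. hp n (%i. F i (rep (Cls r v))))"
 proof (rule morphism_cong[OF swf_domain])
  fix v :: "nat => 'a"
  obtain c d where cd: "c ~= 0" "d ~= 0" "rep (Cls r v) = torus r c d v" using rep_class by metis
  then have k: "k c d ~= 0" using F[of 0] unfolding torus_weight_def by auto
  show "hp n (%i. F i (rep (Cls r v))) = hp n (%i. F i v)"
   by (rule hp_eqI[OF k]) (use F cd in \<open>auto simp: torus_weight_def\<close>)
 qed
 then show ?thesis unfolding hirzebruch_def by (rule morphism_from_quotient)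
qed

text \<open>The ruling together with the map that contracts the section \<open>v 3 = 0\<close> to a
  point separates points: on each fiber the second map is injective.\<close>

lemma separated_hirzebruch:
 fixes W :: "('w, 'k::field) fspace"
 assumes W: "swf W" shows "separated_for W (hirzebruch r)"
proof -
 let ?F = "%i v. (v :: nat => 'k) i"
 \<comment> \<open>All three components have weight \<open>d\<close>. Since \<open>v 0\<close> or
   \<open>v 1\<close> is nonzero, they determine \<open>v 3\<close> once the base point is
   fixed.\<close>
 let ?G = "%(i::nat) v. if i = 0 then v 2 else if i = 1 then v 0 ^ r * v 3 else (v :: nat => 'k) 1 ^ r * v 3"
 have F: "torus_weight r (%c d. c) (?F i)" if "i <= 1" for i
  using that by (cases i) (auto simp: torus_weight_def torus_def poly_ops)
 have G: "torus_weight r (%c d. d) (?G i)" for i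
  by (cases "i = 0"; cases "i = 1") (auto simp: torus_weight_def torus_def poly_ops power_mult_distrib)
 have nzF: "EX i<=1. ?F i v ~= 0" if "v : Dom" for v
  using that by (auto simp: hirzebruch_domain_def)
 have nzG: "EX i<=2. ?G i v ~= 0" if "v : Dom" for v
 proof -
  have "v 2 ~= 0 | v 0 ^ r * v 3 ~= 0 | v 1 ^ r * v 3 ~= 0" using that by (auto simp: hirzebruch_domain_def)
  then show ?thesis
   by (elim disjE) (intro exI[of _ 0], simp, intro exI[of _ 1], simp, intro exI[of _ 2], simp)
 qed
 show ?thesis
 proof (rule separated_for_injective[OF W morphism_from_hirzebruch_hp[OF F nzF] morphism_from_hirzebruch_hp[OF G nzG]])
  fix A B :: "(nat => 'k) set"
  assume A: "A : points (hirzebruch r)" and B: "B : points (hirzebruch r)"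
   and e1: "hp 1 (%i. rep A i) = hp 1 (%i. rep B i)" and e2: "hp 2 (%i. ?G i (rep A)) = hp 2 (%i. ?G i (rep B))"
  note a = rep_domain[OF A] and b = rep_domain[OF B]
  obtain c where c: "c ~= 0" "ALL i<=1. rep A i = c * rep B i" using hp_eqD[OF e1] by auto
  obtain d where d: "d ~= 0" "ALL i<=2. ?G i (rep A) = d * ?G i (rep B)" using hp_eqD[OF e2] by auto
  have 01: "rep A 0 = c * rep B 0" "rep A 1 = c * rep B 1" using c(2) by auto
  have 2: "rep A 2 = d * rep B 2" using spec[OF d(2), of 0] by simp
  have "rep A 0 ^ r * rep A 3 = d * (rep B 0 ^ r * rep B 3)" "rep A 1 ^ r * rep A 3 = d * (rep B 1 ^ r * rep B 3)"
   using spec[OF d(2), of 1] spec[OF d(2), of 2] by simp_all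
  then have "c ^ r * rep B 0 ^ r * rep A 3 = d * rep B 0 ^ r * rep B 3" "c ^ r * rep B 1 ^ r * rep A 3 = d * rep B 1 ^ r * rep B 3"
   unfolding 01 power_mult_distrib by (simp_all add: ac_simps)
  moreover have "rep B 0 ^ r ~= 0 | rep B 1 ^ r ~= 0" using b by (auto simp: hirzebruch_domain_def)
  ultimately have "c ^ r * rep A 3 = d * rep B 3" by (auto simp: ac_simps)
  then have "rep A 3 = inverse (c ^ r) * d * rep B 3" using c(1) by (simp add: field_simps)
  then have "rep A = torus r c d (rep B)"
   using vec4_eta[OF domain_affine[OF a]] 01 2 by (simp add: torus_def)
  then show "A = B" using class_rep[OF A] class_rep[OF B] class_torus[OF c(1) d(1)] by metis
 qed auto
qed

section \<open>A projective model\<close>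

text \<open>
 The coordinates of projective space of dimension \<open>12 r + 7\<close> come in four blocks, the \<open>i\<close>-th coordinate
 of block \<open>e\<close> having index \<open>4 i + e\<close>; unused coordinates are \<open>0\<close>. The blocks \<open>x\<^sup>i\<close>, \<open>y x\<^sup>i\<close>, \<open>z x\<^sup>i\<close> and
 \<open>y z x\<^sup>i\<close> consist of sections of \<open>3 s + (3 r + 1) f\<close> vanishing on the two exceptional curves over
 \<open>y / x\<^sup>r = 0\<close> and \<open>y / x\<^sup>r = 1\<close> of the fiber \<open>v\<^sub>0 = 0\<close>.
\<close>

definition bound :: "nat => nat => nat" where
 "bound r e = (if e = 0 then 3 * r else if e = 1 then 2 * r else if e = 2 then r + 1 else 1)"

definition blk :: "nat => (nat => 'k::zero) => (nat => 'k) => (nat => 'k) => (nat => 'k) => nat => 'k" where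
 "blk r a b c d = (%j. if j div 4 <= bound r (j mod 4)
  then (if j mod 4 = 0 then a else if j mod 4 = 1 then b else if j mod 4 = 2 then c else d) (j div 4) else 0)"

text \<open>The last indices of the four blocks are \<open>12 r\<close>, \<open>8 r + 1\<close>,
  \<open>4 r + 6\<close> and \<open>7\<close>, so this bounds them all.\<close>

abbreviation top_index :: "nat => nat" where
 "top_index r \<equiv> 12 * r + 7"

lemma mod4_cases: obtains i where "j = 4 * i" | i where "j = 4 * i + 1" | i where "j = 4 * i + 2" | i where "j = 4 * i + (3::nat)"
proof -
 have "j mod 4 = 0 | j mod 4 = 1 | j mod 4 = 2 | j mod 4 = 3" by auto
 then show thesis using that[of "j div 4"] div_mult_mod_eq[of j 4] by (elim disjE) (auto simp: mult.commute)
qed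

lemma blk_simps:
 "blk r a b c d (4 * i) = (if i <= 3 * r then a i else 0)"
 "blk r a b c d (4 * i + 1) = (if i <= 2 * r then b i else 0)"
 "blk r a b c d (4 * i + 2) = (if i <= r + 1 then c i else 0)"
 "blk r a b c d (4 * i + 3) = (if i <= 1 then d i else 0)"
proof -
 have "(4 * i + 1) mod 4 = 1" "(4 * i + 2) mod 4 = 2" "(4 * i + 3) mod 4 = 3"
  "(4 * i + 1) div 4 = i" "(4 * i + 2) div 4 = i" "(4 * i + 3) div 4 = i" by presburger+
 then show "blk r a b c d (4 * i) = (if i <= 3 * r then a i else 0)"
  "blk r a b c d (4 * i + 1) = (if i <= 2 * r then b i else 0)"
  "blk r a b c d (4 * i + 2) = (if i <= r + 1 then c i else 0)"
  "blk r a b c d (4 * i + 3) = (if i <= 1 then d i else 0)"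
  unfolding blk_def bound_def by simp_all
qed

lemma blk_scale:
 fixes k :: "'k::field"
 assumes "!!i. i <= 3 * r ==> a' i = k * a i" "!!i. i <= 2 * r ==> b' i = k * b i"
  "!!i. i <= r + 1 ==> c' i = k * c i" "!!i. i <= 1 ==> d' i = k * d i"
 shows "blk r a' b' c' d' j = k * blk r a b c d j"
proof (cases j rule: mod4_cases)
 case (1 i) show ?thesis unfolding 1 blk_simps using assms by simp
next
 case (2 i) show ?thesis unfolding 2 blk_simps using assms by simp
next
 case (3 i) show ?thesis unfolding 3 blk_simps using assms by simp
next
 case (4 i) show ?thesis unfolding 4 blk_simps using assms by simp
qed

lemma blk_poly:
 assumes "!!i. i <= 3 * r ==> (%p. a p i) : Polys n" "!!i. i <= 2 * r ==> (%p. b p i) : Polys n"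
  "!!i. i <= r + 1 ==> (%p. c p i) : Polys n" "!!i. i <= 1 ==> (%p. d p i) : Polys n"
 shows "(%p. blk r (a p) (b p) (c p) (d p) j) : Polys n"
proof (cases j rule: mod4_cases)
 case (1 i) show ?thesis unfolding 1 blk_simps using assms by (cases "i <= 3 * r") (auto simp: poly_ops)
next
 case (2 i) show ?thesis unfolding 2 blk_simps using assms by (cases "i <= 2 * r") (auto simp: poly_ops)
next
 case (3 i) show ?thesis unfolding 3 blk_simps using assms by (cases "i <= r + 1") (auto simp: poly_ops)
next
 case (4 i) show ?thesis unfolding 4 blk_simps using assms by (cases "i <= 1") (auto simp: poly_ops)
qed

text \<open>The bounds of the last two blocks allow every monomial of the available degree in
  \<open>v 0\<close> and \<open>v 1\<close>. In the first two blocks they stop one short, which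
  leaves a factor \<open>v 0\<close>; in the others the factor
  \<open>v 2 (v 2 - v 1 ^ r v 3)\<close> is present. So every coordinate vanishes at both points to
  be blown up.\<close>

definition Phi :: "nat => (nat => 'k::field) => nat => 'k" where
 "Phi r v = blk r (%i. v 0 ^ (3 * r + 1 - i) * v 1 ^ i * v 3 ^ 3)
  (%i. v 2 * v 3 ^ 2 * (v 0 ^ (2 * r + 1 - i) * v 1 ^ i))
  (%i. v 2 * (v 2 - v 1 ^ r * v 3) * v 3 * (v 0 ^ (r + 1 - i) * v 1 ^ i))
  (%i. v 2 ^ 2 * (v 2 - v 1 ^ r * v 3) * (v 0 ^ (1 - i) * v 1 ^ i))"

lemma Phi_poly: "(%v. Phi r v j) : Polys 4"
 unfolding Phi_def by (rule blk_poly) (simp_all add: poly_ops)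

lemma power_pair_scale: "i <= n ==> (c * a) ^ (n - i) * (c * b) ^ i = c ^ n * (a ^ (n - i) * (b::'k::field) ^ i)"
proof -
 assume "i <= n"
 then have "c ^ n = c ^ (n - i) * c ^ i" by (simp flip: power_add)
 then show ?thesis by (simp add: power_mult_distrib ac_simps)
qed

lemma Phi_torus:
 fixes v :: "nat => 'k::field"
 assumes "c ~= 0" "d ~= 0" shows "Phi r (torus r c d v) j = c * d ^ 3 * Phi r v j"
proof -
 have sub: "d * v 2 - (c * v 1) ^ r * (inverse (c ^ r) * d * v 3) = d * (v 2 - v 1 ^ r * v 3)"
  using assms by (simp add: power_mult_distrib right_diff_distrib)
 have q: "c ^ r * inverse (c ^ r) = 1" using assms by simp
 have c2: "c ^ (r * 2) = c ^ r * c ^ r" by (simp add: mult_2_right power_add)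
 let ?e = "inverse (c ^ r)"
 show ?thesis unfolding Phi_def torus_def vec4_simps sub
 proof (rule blk_scale)
  fix i assume "i <= 3 * r"
  then have i: "i <= 3 * r + 1" by simp
  \<comment> \<open>Keeping \<open>c ^ r\<close> together with its inverse isolates the powers that
    cancel; what remains is the common weight \<open>c d ^ 3\<close>.\<close>
  have "(c * v 0) ^ (3 * r + 1 - i) * (c * v 1) ^ i * (?e * d * v 3) ^ 3 =
   c * (c ^ r * ?e) ^ 3 * d ^ 3 * (v 0 ^ (3 * r + 1 - i) * v 1 ^ i * v 3 ^ 3)"
   unfolding power_pair_scale[OF i] by (simp add: power_mult_distrib power_add power_mult[symmetric] ac_simps)
  then show "(c * v 0) ^ (3 * r + 1 - i) * (c * v 1) ^ i * (?e * d * v 3) ^ 3 =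
   c * d ^ 3 * (v 0 ^ (3 * r + 1 - i) * v 1 ^ i * v 3 ^ 3)" unfolding q by simp
 next
  fix i assume "i <= 2 * r"
  then have i: "i <= 2 * r + 1" by simp
  have "d * v 2 * (?e * d * v 3) ^ 2 * ((c * v 0) ^ (2 * r + 1 - i) * (c * v 1) ^ i) =
   c * (c ^ r * ?e) ^ 2 * d ^ 3 * (v 2 * v 3 ^ 2 * (v 0 ^ (2 * r + 1 - i) * v 1 ^ i))"
   unfolding power_pair_scale[OF i]
   by (simp add: power_mult_distrib power_add power_mult[symmetric] c2 ac_simps power2_eq_square power3_eq_cube)
  then show "d * v 2 * (?e * d * v 3) ^ 2 * ((c * v 0) ^ (2 * r + 1 - i) * (c * v 1) ^ i) =
   c * d ^ 3 * (v 2 * v 3 ^ 2 * (v 0 ^ (2 * r + 1 - i) * v 1 ^ i))" unfolding q by simp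
 next
  fix i assume i: "i <= r + 1"
  have "d * v 2 * (d * (v 2 - v 1 ^ r * v 3)) * (?e * d * v 3) * ((c * v 0) ^ (r + 1 - i) * (c * v 1) ^ i) =
   c * (c ^ r * ?e) * d ^ 3 * (v 2 * (v 2 - v 1 ^ r * v 3) * v 3 * (v 0 ^ (r + 1 - i) * v 1 ^ i))"
   unfolding power_pair_scale[OF i] by (simp add: ac_simps power3_eq_cube)
  then show "d * v 2 * (d * (v 2 - v 1 ^ r * v 3)) * (?e * d * v 3) * ((c * v 0) ^ (r + 1 - i) * (c * v 1) ^ i) =
   c * d ^ 3 * (v 2 * (v 2 - v 1 ^ r * v 3) * v 3 * (v 0 ^ (r + 1 - i) * v 1 ^ i))" unfolding q by simp
 next
  fix i :: nat assume i: "i <= 1"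
  show "(d * v 2) ^ 2 * (d * (v 2 - v 1 ^ r * v 3)) * ((c * v 0) ^ (1 - i) * (c * v 1) ^ i) =
   c * d ^ 3 * (v 2 ^ 2 * (v 2 - v 1 ^ r * v 3) * (v 0 ^ (1 - i) * v 1 ^ i))"
   unfolding power_pair_scale[OF i] by (simp add: ac_simps power2_eq_square power3_eq_cube)
 qed
qed

lemma Phi_weight: "torus_weight r (%c d. c * d ^ 3) (%v. Phi r v j)"
 unfolding torus_weight_def using Phi_poly Phi_torus by auto

definition good :: "nat => (nat => 'k::field) set" where
 "good r = {v : Dom. v 0 ~= 0 | v 2 * (v 2 - v 1 ^ r * v 3) ~= 0}"

text \<open>The base locus is exactly the pair of points to be blown up. Elsewhere the coordinate
  \<open>x^0\<close> is nonzero on the plane, \<open>y z x^0\<close> on the section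
  \<open>v 3 = 0\<close> over \<open>v 0 ~= 0\<close>, and \<open>y z x^1\<close> on the rest of the
  fiber \<open>v 0 = 0\<close>.\<close>

lemma Phi_nonzero_iff:
 assumes v: "v : Dom" shows "(EX j<=top_index r. Phi r v j ~= 0) \<longleftrightarrow> v : good r"
proof
 assume "v : good r"
 then consider "v 0 ~= 0" "v 3 ~= 0" | "v 0 ~= 0" "v 3 = 0" | "v 0 = 0" "v 2 * (v 2 - v 1 ^ r * v 3) ~= 0"
  unfolding good_def by blast
 then show "EX j<=top_index r. Phi r v j ~= 0"
 proof cases
  case 1
  have "Phi r v (4 * 0) ~= 0" unfolding Phi_def blk_simps using 1 by simp
  then show ?thesis by (intro exI[of _ "4 * 0"]) simp
 next
  case 2
  then have "v 2 ~= 0" using v by (auto simp: hirzebruch_domain_def)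
  then have "Phi r v (4 * 0 + 3) ~= 0" unfolding Phi_def blk_simps using 2 by simp
  then show ?thesis by (intro exI[of _ "4 * 0 + 3"]) simp
 next
  case 3
  then have "v 1 ~= 0" using v by (auto simp: hirzebruch_domain_def)
  then have "Phi r v (4 * 1 + 3) ~= 0" unfolding Phi_def blk_simps using 3 by simp
  then show ?thesis by (intro exI[of _ "4 * 1 + 3"]) simp
 qed
next
 assume "EX j<=top_index r. Phi r v j ~= 0"
 then obtain j where j: "Phi r v j ~= 0" by auto
 show "v : good r"
 proof (rule ccontr)
  assume "v ~: good r"
  then have z: "v 0 = 0" "v 2 * (v 2 - v 1 ^ r * v 3) = 0" using v unfolding good_def by auto
  then have z2: "v 2 ^ 2 * (v 2 - v 1 ^ r * v 3) = 0" by (auto simp: power2_eq_square)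
  have "Phi r v j = 0 * Phi r v j" unfolding Phi_def
  proof (rule blk_scale)
   fix i assume "i <= 3 * r"
   then have "3 * r + 1 - i ~= 0" by simp
   then show "v 0 ^ (3 * r + 1 - i) * v 1 ^ i * v 3 ^ 3 = 0 * (v 0 ^ (3 * r + 1 - i) * v 1 ^ i * v 3 ^ 3)"
    using z by (simp add: power_0_left)
  next
   fix i assume "i <= 2 * r"
   then have "2 * r + 1 - i ~= 0" by simp
   then show "v 2 * v 3 ^ 2 * (v 0 ^ (2 * r + 1 - i) * v 1 ^ i) = 0 * (v 2 * v 3 ^ 2 * (v 0 ^ (2 * r + 1 - i) * v 1 ^ i))"
    using z by (simp add: power_0_left)
  next
   fix i
   show "v 2 * (v 2 - v 1 ^ r * v 3) * v 3 * (v 0 ^ (r + 1 - i) * v 1 ^ i) =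
    0 * (v 2 * (v 2 - v 1 ^ r * v 3) * v 3 * (v 0 ^ (r + 1 - i) * v 1 ^ i))" unfolding z(2) by simp
  next
   fix i :: nat
   show "v 2 ^ 2 * (v 2 - v 1 ^ r * v 3) * (v 0 ^ (1 - i) * v 1 ^ i) =
    0 * (v 2 ^ 2 * (v 2 - v 1 ^ r * v 3) * (v 0 ^ (1 - i) * v 1 ^ i))" unfolding z2 by simp
  qed
  then show False using j by simp
 qed
qed

definition Hmap :: "nat => (nat => 'k::field) => (nat => 'k) set" where
 "Hmap r v = hp (top_index r) (Phi r v)"

lemma Hmap_torus: "c ~= 0 ==> d ~= 0 ==> Hmap r (torus r c d v) = Hmap r v"
 unfolding Hmap_def by (rule hp_eqI[of "c * d ^ 3"]) (simp_all add: Phi_torus)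

lemma Hmap_class: 
 assumes "Cls r v = Cls r w" "v : Dom" shows "Hmap r v = Hmap r w"
 using class_eqD[OF assms] Hmap_torus by metis

definition aff :: "nat => 'k::field => 'k => (nat => 'k) set" where
 "aff r x y = Hmap r (vec4 1 x y 1)"

lemma Phi_affine:
 "Phi r (vec4 1 x y 1) = blk r (%i. x ^ i) (%i. y * x ^ i) (%i. y * (y - x ^ r) * x ^ i) (%i. y ^ 2 * (y - x ^ r) * x ^ i)"
 unfolding Phi_def by simp

section \<open>The closure of the affine plane in projective space\<close>

definition model :: "nat => (nat => 'k::field) set set" where
 "model r = topo (Proj (top_index r)) closure_of {aff r x y | x y. True}"

definition model_space :: "nat => ((nat => 'k::field) set, 'k) fspace" where
 "model_space r = Sub (Proj (top_index r)) (model r)"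

lemma closedin_model: "closedin (topo (Proj (top_index r))) (model r)"
 unfolding model_def by (rule closedin_closure_of)

lemma model_sub: "model r <= points (Proj (top_index r))"
 by (rule closedin_subset[OF closedin_model])

lemma points_model: "points (model_space r) = model r"
 unfolding model_space_def points_subspace by (rule Int_absorb1[OF model_sub])

lemma swf_model: "swf (model_space r)"
 unfolding model_space_def by (rule swf_subspace[OF swf_proj])

lemma morphism_model: "morphism (model_space r) (Proj (top_index r)) (%\<zeta>. \<zeta>)"
 unfolding model_space_def by (rule morphism_inclusion[OF swf_proj])

lemma good_affine: "vec4 1 x y 1 : good r"
 by (simp add: good_def vec4_domain)

lemma aff_point: "aff r x y : points (Proj (top_index r))"
 unfolding aff_def Hmap_def hp_points
 using Phi_nonzero_iff[of "vec4 1 x y 1" r] good_affine by (auto simp: good_def)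

lemma aff_model: "aff r x y : model r"
proof -
 have "{aff r x y | x y. True} <= model r" unfolding model_def
  by (rule closure_of_subset) (use aff_point in blast)
 then show ?thesis by blast
qed

definition aff_points :: "nat => (nat => 'k::field) set set" where
 "aff_points r = {aff r x y | x y. True}"

lemma dense_model: "dense_in (model_space r) (aff_points r)"
 unfolding dense_in_def
proof (intro allI impI)
 fix U assume U: "Opn (model_space r) U" "U ~= {}"
 then obtain V where V: "Opn (Proj (top_index r)) V" "U = V \<inter> model r"
  unfolding model_space_def topo_subspace openin_subtopology by auto
 obtain \<zeta> where \<zeta>: "\<zeta> : V" "\<zeta> : model r" using U(2) V(2) by auto
 have "ALL T. \<zeta> : T & Opn (Proj (top_index r)) T --> (EX y. y : {aff r x y | x y. True} & y : T)"
  using \<zeta>(2) unfolding model_def in_closure_of by (elim conjE)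
 then obtain w where w: "w : {aff r x y | x y. True}" "w : V"
  using V(1) \<zeta>(1) by (elim allE[of _ V]) auto
 then have "w : model r" using aff_model by auto
 then show "U \<inter> aff_points r ~= {}" using V(2) w unfolding aff_points_def by auto
qed

text \<open>The source of all equations of the model: a form that vanishes on the affine plane
  vanishes on its closure.\<close>

lemma model_hom:
 assumes F: "hom_poly (top_index r) d F" and 0: "!!x y. F (Phi r (vec4 1 x y 1)) = 0" and \<zeta>: "\<zeta> : model r"
 shows "F (rep \<zeta>) = 0"
proof (rule ccontr)
 assume "F (rep \<zeta>) ~= 0"
 then have "\<zeta> : {A : points (Proj (top_index r)). F (rep A) ~= 0}" using \<zeta> model_sub by auto
 moreover have "ALL T. \<zeta> : T & Opn (Proj (top_index r)) T --> (EX y. y : {aff r x y | x y. True} & y : T)"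
  using \<zeta> unfolding model_def in_closure_of by (elim conjE)
 ultimately obtain w where w: "w : {aff r x y | x y. True}" "F (rep w) ~= 0"
  using openin_hom_poly[OF F] by (elim allE[of _ "{A : points (Proj (top_index r)). F (rep A) ~= 0}"]) auto
 from w(1) obtain x y where "w = aff r x y" by auto
 then show False using w(2) hom_poly_rep_zero[OF F, of "Phi r (vec4 1 x y 1)"] 0[of x y]
  unfolding aff_def Hmap_def by simp
qed

lemma closed_image_model:
 assumes W: "swf W" and f: "morphism W (Proj (top_index r)) f" and E: "dense_in W E"
  and "!!e. e : E ==> e : points W ==> f e : model r" and w: "w : points W"
 shows "f w : model r"
proof -
 have "continuous_map (topo W) (topo (Proj (top_index r))) f" using f unfolding morphism_def by auto
 from closedin_continuous_map_preimage[OF this closedin_model]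
 have "closedin (topo W) {x : points W. f x : model r}" .
 then have "w : {x : points W. f x : model r}" by (rule closedin_dense[OF E]) (use assms in auto)
 then show ?thesis by simp
qed

lemma dense_affine_nonzero:
 fixes h :: "(nat => 'k::field_char_0) => 'k"
 assumes U: "Opn (Aff n) U" and h: "h : Polys n" "h a ~= 0" "a : affine_points n"
 shows "dense_in (Sub (Aff n) U) {x. h x ~= 0}"
 unfolding dense_in_def
proof (intro allI impI)
 fix V assume V: "Opn (Sub (Aff n) U) V" "V ~= {}"
 then have "Opn (Aff n) V" using openin_subspace_open[OF U] by blast
 moreover have "affine_basic n h ~= {}" using h by (auto simp: affine_basic_def)
 ultimately have "V \<inter> affine_basic n h ~= {}" by (rule affine_opens_meet[OF _ openin_affine_basic[OF h(1)] V(2)])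
 then show "V \<inter> {x. h x ~= 0} ~= {}" by (auto simp: affine_basic_def)
qed

lemma openin_good: "Opn (Aff 4) (good r :: (nat => 'k::field) set)"
proof -
 have "(good r :: (nat => 'k) set) = Dom \<inter>
  (affine_basic 4 (%v. v 0) \<union> affine_basic 4 (%v. v 2 * (v 2 - v 1 ^ r * v 3)))"
  using domain_affine by (auto simp: good_def affine_basic_def)
 then show ?thesis using openin_domain
  by (simp only:) (intro openin_Int openin_Un openin_affine_basic openin_domain; simp add: poly_ops)
qed

lemma morphism_Hmap:
 "morphism (Sub (Aff 4) (good r)) (Proj (top_index r)) (Hmap r :: (nat => 'k::field) => _)"
proof -
 let ?G = "Sub (Aff 4 :: 'k aspace) (good r)"
 have p: "points ?G = good r" using domain_affine by (auto simp: good_def)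
 have 1: "(%v. Phi r v j) : reg ?G (points ?G)" for j
  unfolding p reg_subspace_open[OF swf_affine openin_good openin_good subset_refl]
  by (rule reg_affine_poly[OF Phi_poly openin_good])
 have 2: "EX j<=top_index r. Phi r v j ~= 0" if "v : points ?G" for v
  using Phi_nonzero_iff[of v r] that unfolding p by (auto simp: good_def)
 have "morphism ?G (Proj (top_index r)) (%v. hp (top_index r) (%j. Phi r v j))"
  by (rule morphism_hp[OF swf_subspace[OF swf_affine] 1 2])
 then show ?thesis unfolding Hmap_def .
qed

lemma Hmap_aff:
 assumes "v 0 ~= 0" "v 3 ~= 0" "v : Dom"
 shows "Cls r v = Cls r (vec4 1 (v 1 / v 0) (v 2 / (v 0 ^ r * v 3)) 1)"
  "Hmap r v = aff r (v 1 / v 0) (v 2 / (v 0 ^ r * v 3))"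
proof -
 have "Cls r (vec4 (v 0) (v 1) (v 2) (v 3)) = Cls r (vec4 1 (v 1 / v 0) (v 2 / (v 0 ^ r * v 3)) 1)"
  by (rule class_vec4_eqI[of "v 0" "v 0 ^ r * v 3"]) (use assms in auto)
 then show *: "Cls r v = Cls r (vec4 1 (v 1 / v 0) (v 2 / (v 0 ^ r * v 3)) 1)"
  using vec4_eta[OF domain_affine[OF assms(3)]] by simp
 show "Hmap r v = aff r (v 1 / v 0) (v 2 / (v 0 ^ r * v 3))"
  unfolding aff_def by (rule Hmap_class[OF * assms(3)])
qed

lemma dense_good: "dense_in (Sub (Aff 4) (good r)) {v :: nat => 'k::field_char_0. v 0 * v 3 ~= 0}"
 by (rule dense_affine_nonzero[OF openin_good, of _ "vec4 1 0 0 1"])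
  (simp_all add: poly_ops affine_points_def, simp add: vec4_def)

text \<open>Where \<open>v 0\<close> and \<open>v 3\<close> are nonzero the image is an affine
  point, and such \<open>v\<close> are dense among the good ones.\<close>

lemma Hmap_model:
 fixes v :: "nat => 'k::field_char_0"
 assumes "v : good r" shows "Hmap r v : model r"
proof (rule closed_image_model[OF swf_subspace[OF swf_affine] morphism_Hmap dense_good])
 fix e :: "nat => 'k"
 assume "e : {v. v 0 * v 3 ~= 0}" "e : points (Sub (Aff 4) (good r))"
 then show "Hmap r e : model r" using Hmap_aff(2)[of e r] aff_model by (auto simp: good_def)
next
 show "v : points (Sub (Aff 4) (good r))"
  using assms domain_affine by (auto simp: good_def)
qed

definition vec2 :: "'k::zero => 'k => nat => 'k" where
 "vec2 a b = (%i. if i = 0 then a else if i = 1 then b else 0)"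

lemma vec2_simps [simp]: "vec2 a b 0 = a" "vec2 a b 1 = b" "vec2 a b (Suc 0) = b"
 by (simp_all add: vec2_def)

lemma vec2_affine [simp]: "vec2 a b : affine_points 2"
 by (simp add: vec2_def affine_points_def)

lemma less2_cases: assumes "i < (2::nat)" obtains "i = 0" | "i = 1"
 using assms by linarith

lemma vec2_eta: assumes "p : affine_points 2" shows "vec2 (p 0) (p 1) = p"
proof
 fix i show "vec2 (p 0) (p 1) i = p i"
  using assms by (cases "i < 2", elim less2_cases) (auto simp: affine_points_def vec2_def)
qed

lemma morphism_vec2:
 fixes W :: "('w, 'k::field) fspace"
 assumes "swf W" "a : reg W (points W)" "b : reg W (points W)"
 shows "morphism W (Aff 2) (%w. vec2 (a w) (b w))"
proof (rule morphism_into_affine[OF assms(1)])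
 fix i :: nat assume "i < 2"
 then show "(%w. vec2 (a w) (b w) i) : reg W (points W)"
  using assms(2,3) by (elim less2_cases) (simp_all add: vec2_simps(2))
qed simp

text \<open>
 A chart of the model is given by a polynomial lift \<open>L\<close> of a rational parametrisation of the Hirzebruch
 surface such that the coordinates \<open>Phi r (L p)\<close> have the common factor \<open>k p\<close>; the identities between
 regular functions need to be checked on the dense set \<open>aff_points\<close> only.
\<close>

lemma lift_chart:
 fixes tf tg :: "(nat => 'k::field_char_0) set => 'k"
 assumes S: "Opn (model_space r) S"
  and \<theta>: "tf : reg (model_space r) S" "tg : reg (model_space r) S" "\<eta> : reg (model_space r) S"
  and \<delta>: "\<delta> : Polys 2" and k: "k : Polys 2" "k a ~= 0" "a : affine_basic 2 \<delta>"
  and P: "!!j. (%p. P p j) : Polys 2"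
  and L: "!!i. i < 4 ==> (%p. L p i) : Polys 2" "!!p. p : affine_basic 2 \<delta> ==> L p : Dom"
  and fac: "!!p j. p : affine_basic 2 \<delta> ==> Phi r (L p) j = k p * P p j"
  and nz: "!!p. p : affine_basic 2 \<delta> ==> EX j<=top_index r. P p j ~= 0"
  and PS: "!!p. p : affine_basic 2 \<delta> ==> hp (top_index r) (P p) : model r ==> hp (top_index r) (P p) : S &
   tf (hp (top_index r) (P p)) = p 0 & tg (hp (top_index r) (P p)) = p 1"
  and D: "!!x y. aff r x y : S ==> k (vec2 (tf (aff r x y)) (tg (aff r x y))) ~= 0 &
   \<delta> (vec2 (tf (aff r x y)) (tg (aff r x y))) * \<eta> (aff r x y) = 1 &
   Cls r (L (vec2 (tf (aff r x y)) (tg (aff r x y)))) = Cls r (vec4 1 x y 1)"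
 shows "plane_chart (model_space r) S & (EX \<rho>. morphism (Sub (model_space r) S) (hirzebruch r) \<rho> &
   (ALL x y. aff r x y : S --> \<rho> (aff r x y) = Cls r (vec4 1 x y 1)))"
proof -
 let ?B = "Sub (Aff 2) (affine_basic 2 \<delta>)"
 let ?S = "Sub (model_space r) S"
 let ?\<theta> = "%\<zeta>. vec2 (tf \<zeta>) (tg \<zeta>)"
 let ?P = "%p. hp (top_index r) (P p)"
 have oB: "Opn (Aff 2) (affine_basic 2 \<delta>)" by (rule openin_affine_basic[OF \<delta>])
 have B: "swf ?B" and Sw: "swf ?S" using swf_subspace swf_affine swf_model by metis+
 have pB: "points ?B = affine_basic 2 \<delta>" by (auto simp: affine_basic_def)
 have SM: "S <= model r" using openin_subset[OF S] points_model by metis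
 have pS: "points ?S = S" unfolding points_subspace points_model by (rule Int_absorb1[OF SM])
 have regS: "h : reg ?S (points ?S)" if "h : reg (model_space r) S" for h
  unfolding pS reg_subspace_open[OF swf_model S S subset_refl] by (rule that)
 have dS: "dense_in ?S (aff_points r)" by (rule dense_in_subspace[OF dense_model S])
 have \<theta>m: "morphism ?S (Aff 2) ?\<theta>" by (rule morphism_vec2[OF Sw regS[OF \<theta>(1)] regS[OF \<theta>(2)]])
 \<comment> \<open>The equation extends from affine points to all of \<open>S\<close>; the regular
   function \<eta> is thus an inverse of \<delta>, so the chart map lands where \<delta> does not
   vanish.\<close>
 have \<delta>\<theta>: "\<delta> (?\<theta> \<zeta>) * \<eta> \<zeta> = 1" if \<zeta>: "\<zeta> : S" for \<zeta>
 proof -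
  have oS: "Opn ?S (points ?S)" by (rule openin_topspace)
  have "(%\<zeta>. \<delta> (?\<theta> \<zeta>)) : reg ?S (points ?S)"
   by (rule morphism_reg_on[OF Sw \<theta>m openin_topspace reg_affine_poly[OF \<delta> openin_topspace] oS])
    (simp only: points_affine vec2_affine)
  then have h: "(%\<zeta>. \<delta> (?\<theta> \<zeta>) * \<eta> \<zeta> - 1) : reg ?S (points ?S)"
   by (intro reg_diff[OF Sw oS] reg_mult[OF Sw oS] regS[OF \<theta>(3)] reg_const[OF Sw oS])
  note o = reg_nonzero[OF Sw oS h]
  show ?thesis
  proof (rule ccontr)
   assume "\<delta> (?\<theta> \<zeta>) * \<eta> \<zeta> ~= 1"
   then have "{\<zeta> : points ?S. \<delta> (?\<theta> \<zeta>) * \<eta> \<zeta> - 1 ~= 0} ~= {}" using \<zeta> pS by auto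
   then have "{\<zeta> : points ?S. \<delta> (?\<theta> \<zeta>) * \<eta> \<zeta> - 1 ~= 0} \<inter> aff_points r ~= {}"
    using dS o unfolding dense_in_def by blast
   then obtain x y where "aff r x y : S" "\<delta> (?\<theta> (aff r x y)) * \<eta> (aff r x y) ~= 1"
    unfolding aff_points_def pS by auto
   then show False using D by blast
  qed
 qed
 have \<theta>B: "?\<theta> \<zeta> : affine_basic 2 \<delta>" if "\<zeta> : S" for \<zeta>
  using \<delta>\<theta>[OF that] by (auto simp: affine_basic_def)
 have \<theta>mB: "morphism ?S ?B ?\<theta>"
  unfolding morphism_into_subspace_iff[OF swf_affine Sw] pS using \<theta>m \<theta>B by blast
 have regB: "h : reg ?B (affine_basic 2 \<delta>)" if "h : Polys 2" for h
  unfolding reg_subspace_open[OF swf_affine oB oB subset_refl] by (rule reg_affine_poly[OF that oB])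
 have Pm: "morphism ?B (Proj (top_index r)) ?P"
  by (rule morphism_hp[OF B, of "top_index r" "%j p. P p j", unfolded pB, OF regB[OF P] nz])
 have HP: "?P p = Hmap r (L p)" if "p : affine_basic 2 \<delta>" "k p ~= 0" for p
  unfolding Hmap_def by (rule hp_eqI[OF that(2), symmetric]) (rule fac[OF that(1)])
 \<comment> \<open>Where \<open>k\<close> vanishes, \<open>Phi r (L p)\<close> gives no point of
   projective space. The vector \<open>P p\<close> still does, and it lies in the model because the
   points with \<open>k\<close> nonzero are dense.\<close>
 have PM: "?P p : model r" if p: "p : affine_basic 2 \<delta>" for p
 proof (rule closed_image_model[OF B Pm dense_affine_nonzero[OF oB k(1,2)]])
  show "a : affine_points 2" using k(3) by (simp add: affine_basic_def)
  show "p : points ?B" using p pB by simp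
  fix e assume "e : {x. k x ~= 0}" "e : points ?B"
  then have e: "k e ~= 0" "e : affine_basic 2 \<delta>" using pB by auto
  obtain j where "j <= top_index r" "P e j ~= 0" using nz[OF e(2)] by auto
  then have "EX j<=top_index r. Phi r (L e) j ~= 0" using fac[OF e(2)] e(1) by (intro exI[of _ j]) simp
  then have "L e : good r" using Phi_nonzero_iff[OF L(2)[OF e(2)]] by blast
  then show "?P e : model r" unfolding HP[OF e(2,1)] by (rule Hmap_model)
 qed
 have "morphism ?B (model_space r) ?P"
  unfolding model_space_def morphism_into_subspace_iff[OF swf_proj B] using Pm PM pB by blast
 then have PmS: "morphism ?B ?S ?P"
  unfolding morphism_into_subspace_iff[OF swf_model B] using PM PS pB by blast
 \<comment> \<open>Over an affine point both sides come from the same class on the Hirzebruch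
   surface; density does the rest.\<close>
 have P\<theta>: "?P (?\<theta> \<zeta>) = \<zeta>" if "\<zeta> : S" for \<zeta>
 proof (rule agree_on_dense[OF separated_proj[OF Sw] dS morphism_comp[OF \<theta>mB Pm]
    morphism_restrict[OF swf_model morphism_model]])
  fix d assume "d : aff_points r" "d : points ?S"
  then obtain x y where d: "d = aff r x y" "aff r x y : S" unfolding aff_points_def pS by auto
  note D' = D[OF d(2)]
  show "?P (?\<theta> d) = d"
   unfolding d(1) using HP[OF \<theta>B[OF d(2)]] D' Hmap_class[OF _ L(2)[OF \<theta>B[OF d(2)]], of r "vec4 1 x y 1"]
   unfolding aff_def by metis
 qed (use that pS in simp)
 have "isomorphism ?S ?B ?\<theta>"
 proof (rule isomorphismI[OF \<theta>mB PmS])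
  show "?P (?\<theta> \<zeta>) = \<zeta>" if "\<zeta> : points ?S" for \<zeta> using P\<theta> that pS by simp
  fix p assume "p : points ?B"
  then have p: "p : affine_basic 2 \<delta>" using pB by simp
  then show "?\<theta> (?P p) = p" using PS[OF p PM[OF p]] vec2_eta[of p] by (simp add: affine_basic_def)
 qed
 then have chart: "plane_chart (model_space r) S"
  unfolding plane_chart_def isomorphic_spaces_def using S \<delta> k(3) by blast
 have Lm: "morphism ?B (Sub (Aff 4) Dom) L"
  unfolding morphism_into_subspace_iff[OF swf_affine B] pB
 proof (intro conjI image_subsetI L(2))
  show "morphism ?B (Aff 4) L"
   by (rule morphism_into_affine[OF B]) (unfold pB, use L domain_affine regB in auto)
 qed
 let ?\<rho> = "%\<zeta>. Cls r (L (?\<theta> \<zeta>))"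
 have "morphism ?S (hirzebruch r) ?\<rho>"
  by (rule morphism_comp[OF morphism_comp[OF \<theta>mB Lm] morphism_hirzebruch_class])
 then show ?thesis using chart D by blast
qed

subsection \<open>Charts of the model\<close>

text \<open>The coordinates of the blocks \<open>x^i\<close>, \<open>y x^i\<close>,
  \<open>z x^i\<close> and \<open>y z x^i\<close>, in this order for \<open>cX\<close>,
  \<open>cY\<close>, \<open>cZ\<close> and \<open>cT\<close>.\<close>

definition cX :: "nat => (nat => 'k) => 'k" where "cX i z = z (4 * i)"
definition cY :: "nat => (nat => 'k) => 'k" where "cY i z = z (4 * i + 1)"
definition cZ :: "nat => (nat => 'k) => 'k" where "cZ i z = z (4 * i + 2)"
definition cT :: "nat => (nat => 'k) => 'k" where "cT i z = z (4 * i + 3)"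

lemma blk_coords:
 "i <= 3 * r ==> cX i (blk r a b c d) = a i" "i <= 2 * r ==> cY i (blk r a b c d) = b i"
 "i <= r + 1 ==> cZ i (blk r a b c d) = c i" "i <= 1 ==> cT i (blk r a b c d) = d i"
 unfolding cX_def cY_def cZ_def cT_def blk_simps by simp_all

lemma hom_coords:
 "i <= 3 * r ==> hom_poly (top_index r) 1 (cX i)" "i <= 2 * r ==> hom_poly (top_index r) 1 (cY i)"
 "i <= r + 1 ==> hom_poly (top_index r) 1 (cZ i)" "i <= 1 ==> hom_poly (top_index r) 1 (cT i)"
 unfolding cX_def cY_def cZ_def cT_def by (rule hom_poly_coord, simp)+

lemma hom_poly_cmult: "hom_poly n d F ==> hom_poly n d (%v. c * F v)"
 by (simp add: hom_poly_def poly_ops)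

lemma hom_ratio_hp:
 assumes F: "hom_poly n d F" and G: "hom_poly n d G"
 shows "F (rep (hp n v)) / G (rep (hp n v)) = F v / G v"
proof -
 obtain c where c: "c ~= 0" "ALL i<=n. rep (hp n v) i = c * v i" using rep_hp by metis
 have H: "H (rep (hp n v)) = c ^ d * H v" if "hom_poly n d H" for H
 proof -
  have "H (rep (hp n v)) = H (%i. c * v i)"
   using that c(2) by (intro poly_cong[of H "Suc n"]) (auto simp: hom_poly_def)
  then show ?thesis using that by (simp add: hom_poly_def)
 qed
 show ?thesis unfolding H[OF F] H[OF G] using c(1) by simp
qed

lemma openin_model_hom:
 assumes "hom_poly (top_index r) d G"
 shows "Opn (model_space r) {\<zeta> : model r. G (rep \<zeta>) ~= 0}"
proof -
 have "{\<zeta> : points (model_space r). \<zeta> : {A : points (Proj (top_index r)). G (rep A) ~= 0}} =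
   {\<zeta> : model r. G (rep \<zeta>) ~= 0}"
  unfolding points_model using model_sub by auto
 then show ?thesis using morphism_open[OF morphism_model openin_hom_poly[OF assms]] by simp
qed

lemma model_ratio_reg:
 assumes "hom_poly (top_index r) d F" "hom_poly (top_index r) d G" "Opn (model_space r) S"
  "!!\<zeta>. \<zeta> : S ==> G (rep \<zeta>) ~= 0"
 shows "(%\<zeta>. F (rep \<zeta>) / G (rep \<zeta>)) : reg (model_space r) S"
 by (rule hom_ratio_reg_on[OF swf_model morphism_model assms])

lemma aff_hp: "aff r x y = hp (top_index r) (blk r (%i. x ^ i) (%i. y * x ^ i) (%i. y * (y - x ^ r) * x ^ i)
  (%i. y ^ 2 * (y - x ^ r) * x ^ i))"
 unfolding aff_def Hmap_def Phi_affine ..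

text \<open>Each chart carries its piece of the projection to the Hirzebruch surface, prescribed on
  affine points so that the pieces can be glued.\<close>

definition chart_with_lift :: "nat => (nat => 'k::field) set set => bool" where
 "chart_with_lift r S \<longleftrightarrow> plane_chart (model_space r) S & (EX \<rho>. morphism (Sub (model_space r) S) (hirzebruch r) \<rho> &
   (ALL x y. aff r x y : S --> \<rho> (aff r x y) = Cls r (vec4 1 x y 1)))"

lemma vec4_poly:
 assumes "a : Polys n" "b : Polys n" "c : Polys n" "d : Polys n" "i < 4"
 shows "(%p. vec4 (a p) (b p) (c p) (d p) i) : Polys n"
 using assms(5) by (rule less4_cases) (use assms in \<open>simp_all add: vec4_simps(3)\<close>)

text \<open>The affine plane itself: after division by the coordinate \<open>x^0\<close>, the
  coordinates \<open>x^1\<close> and \<open>y x^0\<close> recover the point.\<close>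

lemma chart_A:
 assumes r: "1 <= r"
 shows "chart_with_lift r {\<zeta> : model r. cX 0 (rep \<zeta> :: nat => 'k::field_char_0) ~= 0}"
proof -
 let ?S = "{\<zeta> : model r. cX 0 (rep \<zeta> :: nat => 'k) ~= 0}"
 let ?L = "%p::nat => 'k. vec4 1 (p 0) (p 1) 1"
 have h: "hom_poly (top_index r) 1 (cX 0 :: (nat => 'k) => 'k)" "hom_poly (top_index r) 1 (cX 1 :: (nat => 'k) => 'k)"
  "hom_poly (top_index r) 1 (cY 0 :: (nat => 'k) => 'k)" by ((intro hom_coords; use r in simp))+
 have S: "Opn (model_space r) ?S" by (rule openin_model_hom[OF h(1)])
 have \<theta>: "cX 1 (rep (hp (top_index r) (Phi r (?L p)))) / cX 0 (rep (hp (top_index r) (Phi r (?L p)))) = p 0"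
  "cY 0 (rep (hp (top_index r) (Phi r (?L p)))) / cX 0 (rep (hp (top_index r) (Phi r (?L p)))) = p 1"
  "cX 0 (rep (hp (top_index r) (Phi r (?L p)))) ~= 0" for p :: "nat => 'k"
  unfolding hom_ratio_hp[OF h(2,1)] hom_ratio_hp[OF h(3,1)] hom_poly_rep_zero[OF h(1)] Phi_affine
  using r by (simp_all add: blk_coords)
 show ?thesis unfolding chart_with_lift_def
 proof (rule lift_chart[OF S, where \<delta> = "%_. 1" and k = "%_. 1" and L = ?L and P = "%p. Phi r (?L p)" and \<eta> = "%_. 1"
   and a = "vec2 0 0" and tf = "%\<zeta>. cX 1 (rep \<zeta>) / cX 0 (rep \<zeta>)" and tg = "%\<zeta>. cY 0 (rep \<zeta>) / cX 0 (rep \<zeta>)"])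
  show "(%\<zeta>. cX 1 (rep \<zeta>) / cX 0 (rep \<zeta>)) : reg (model_space r) ?S"
   by (rule model_ratio_reg[OF h(2,1) S]) simp
  show "(%\<zeta>. cY 0 (rep \<zeta>) / cX 0 (rep \<zeta>)) : reg (model_space r) ?S"
   by (rule model_ratio_reg[OF h(3,1) S]) simp
  show "(%_. 1) : reg (model_space r) ?S" by (rule reg_const[OF swf_model S])
  show L: "(%p. ?L p i) : Polys 2" if "i < 4" for i
   by (rule vec4_poly[OF _ _ _ _ that]) (simp_all add: poly_ops)
  show "(%p. Phi r (?L p) j) : Polys 2" for j by (rule poly_subst[OF Phi_poly L])
  show "EX j<=top_index r. Phi r (?L p) j ~= 0" for p :: "nat => 'k"
   using Phi_nonzero_iff[of "?L p" r] by (simp add: good_def vec4_domain)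
  fix x y :: 'k
  have "vec2 (cX 1 (rep (aff r x y)) / cX 0 (rep (aff r x y))) (cY 0 (rep (aff r x y)) / cX 0 (rep (aff r x y))) = vec2 x y"
   using \<theta>[of "vec2 x y"] by (simp add: aff_def Hmap_def)
  then show "(1::'k) ~= 0 & (1::'k) * 1 = 1 & Cls r (?L (vec2 (cX 1 (rep (aff r x y)) / cX 0 (rep (aff r x y)))
   (cY 0 (rep (aff r x y)) / cX 0 (rep (aff r x y))))) = Cls r (vec4 1 x y 1)" by simp
 qed (use \<theta> in \<open>auto simp: vec4_domain poly_ops affine_basic_def\<close>)
qed

lemma class_at_infinity:
 assumes "x ~= 0" shows "Cls r (vec4 (1 / x) 1 (y / x ^ r) 1) = Cls r (vec4 1 x (y::'k::field) 1)"
 by (rule class_vec4_eqI[of "1 / x" "1 / x ^ r"]) (use assms in \<open>simp_all add: power_divide\<close>)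

text \<open>A neighbourhood of the section \<open>v 3 = 0\<close> over \<open>v 0 ~= 0\<close>, with
  coordinates \<open>x\<close> and \<open>1 / y\<close>. The curve \<open>y = x^r\<close> has to be
  removed, which is the role of \<open>1 - p 0 ^ r * p 1\<close>.\<close>

lemma chart_B:
 assumes r: "1 <= r"
 shows "chart_with_lift r {\<zeta> : model r. cT 0 (rep \<zeta> :: nat => 'k::field_char_0) ~= 0}"
proof -
 let ?S = "{\<zeta> : model r. cT 0 (rep \<zeta> :: nat => 'k) ~= 0}"
 let ?L = "%p::nat => 'k. vec4 1 (p 0) 1 (p 1)"
 let ?d = "%p::nat => 'k. 1 - p 0 ^ r * p 1"
 \<comment> \<open>On affine points this sum is
   \<open>y^2 (y - x^r) + y (y - x^r) x^r + y x^(2 r) = y^3\<close>. Divided by \<open>y z\<close>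
   it gives the inverse of \<open>1 - x^r / y\<close>.\<close>
 let ?cE = "%z::nat => 'k. cT 0 z + cZ r z + cY (2 * r) z"
 have h: "hom_poly (top_index r) 1 (cT 0 :: (nat => 'k) => 'k)" "hom_poly (top_index r) 1 (cT 1 :: (nat => 'k) => 'k)"
  "hom_poly (top_index r) 1 (cZ 0 :: (nat => 'k) => 'k)" "hom_poly (top_index r) 1 ?cE"
  by ((intro hom_coords hom_poly_add; simp))+
 have S: "Opn (model_space r) ?S" by (rule openin_model_hom[OF h(1)])
 have Phi: "Phi r (?L p) = blk r (%i. p 0 ^ i * p 1 ^ 3) (%i. p 1 ^ 2 * p 0 ^ i) (%i. ?d p * p 1 * p 0 ^ i) (%i. ?d p * p 0 ^ i)"
  for p :: "nat => 'k" unfolding Phi_def by simp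
 have \<theta>: "cT 1 (rep (hp (top_index r) (Phi r (?L p)))) / cT 0 (rep (hp (top_index r) (Phi r (?L p)))) = p 0"
  "cZ 0 (rep (hp (top_index r) (Phi r (?L p)))) / cT 0 (rep (hp (top_index r) (Phi r (?L p)))) = p 1"
  "cT 0 (rep (hp (top_index r) (Phi r (?L p)))) ~= 0" if "?d p ~= 0" for p :: "nat => 'k"
  unfolding hom_ratio_hp[OF h(2,1)] hom_ratio_hp[OF h(3,1)] hom_poly_rep_zero[OF h(1)] Phi
  using that by (simp_all add: blk_coords)
 show ?thesis unfolding chart_with_lift_def
 proof (rule lift_chart[OF S, where \<delta> = ?d and k = "%_. 1" and L = ?L and P = "%p. Phi r (?L p)"
   and \<eta> = "%\<zeta>. ?cE (rep \<zeta>) / cT 0 (rep \<zeta>)"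
   and a = "vec2 0 0" and tf = "%\<zeta>. cT 1 (rep \<zeta>) / cT 0 (rep \<zeta>)" and tg = "%\<zeta>. cZ 0 (rep \<zeta>) / cT 0 (rep \<zeta>)"])
  show "(%\<zeta>. cT 1 (rep \<zeta>) / cT 0 (rep \<zeta>)) : reg (model_space r) ?S"
   by (rule model_ratio_reg[OF h(2,1) S]) simp
  show "(%\<zeta>. cZ 0 (rep \<zeta>) / cT 0 (rep \<zeta>)) : reg (model_space r) ?S"
   by (rule model_ratio_reg[OF h(3,1) S]) simp
  show "(%\<zeta>. ?cE (rep \<zeta>) / cT 0 (rep \<zeta>)) : reg (model_space r) ?S"
   by (rule model_ratio_reg[OF h(4,1) S]) simp
  show L: "(%p. ?L p i) : Polys 2" if "i < 4" for i
   by (rule vec4_poly[OF _ _ _ _ that]) (simp_all add: poly_ops)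
  show "(%p. Phi r (?L p) j) : Polys 2" for j by (rule poly_subst[OF Phi_poly L])
  show "EX j<=top_index r. Phi r (?L p) j ~= 0" for p :: "nat => 'k"
   using Phi_nonzero_iff[of "?L p" r] by (simp add: good_def vec4_domain)
  fix x y :: 'k
  assume "aff r x y : ?S"
  then have "cT 0 (rep (aff r x y)) ~= 0" by simp
  then have y: "y ~= 0" "y ~= x ^ r"
   unfolding aff_hp hom_poly_rep_zero[OF h(1)] by (simp_all add: blk_coords)
  have x2: "x ^ (r * 2) = x ^ r * x ^ r" by (simp add: mult_2_right power_add)
  have e: "cT 1 (rep (aff r x y)) / cT 0 (rep (aff r x y)) = x" "cZ 0 (rep (aff r x y)) / cT 0 (rep (aff r x y)) = 1 / y"
   "?cE (rep (aff r x y)) / cT 0 (rep (aff r x y)) = y / (y - x ^ r)"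
   unfolding aff_hp hom_ratio_hp[OF h(2,1)] hom_ratio_hp[OF h(3,1)] hom_ratio_hp[OF h(4,1)]
   using y by (simp_all add: blk_coords field_simps power2_eq_square x2)
  have "Cls r (vec4 1 x 1 (1 / y)) = Cls r (vec4 1 x y 1)"
   by (rule class_vec4_eqI[of 1 "1 / y"]) (use y in simp_all)
  moreover have "(1 - x ^ r * (1 / y)) * (y / (y - x ^ r)) = 1" using y by (simp add: field_simps)
  ultimately show "(1::'k) ~= 0 & ?d (vec2 (cT 1 (rep (aff r x y)) / cT 0 (rep (aff r x y))) (cZ 0 (rep (aff r x y)) / cT 0 (rep (aff r x y)))) *
    (?cE (rep (aff r x y)) / cT 0 (rep (aff r x y))) = 1 &
   Cls r (?L (vec2 (cT 1 (rep (aff r x y)) / cT 0 (rep (aff r x y)))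
   (cZ 0 (rep (aff r x y)) / cT 0 (rep (aff r x y))))) = Cls r (vec4 1 x y 1)" unfolding e by simp
 qed (use \<theta> r in \<open>auto simp: vec4_domain poly_ops affine_basic_def power_0_left\<close>)
qed

text \<open>The fiber at infinity without its point on \<open>v 3 = 0\<close>. With
  \<open>u = 1 / x\<close> and \<open>v = y / x^r\<close> this is the blowup chart
  \<open>u = v (v - 1) s\<close>, which treats both blown up points at once; \<open>s = 0\<close> is
  the strict transform of the fiber.\<close>

lemma chart_C:
 assumes r: "1 <= r"
 shows "chart_with_lift r {\<zeta> : model r. cZ (r + 1) (rep \<zeta> :: nat => 'k::field_char_0) ~= 0}"
proof -
 let ?S = "{\<zeta> : model r. cZ (r + 1) (rep \<zeta> :: nat => 'k) ~= 0}"
 let ?k = "%p::nat => 'k. p 1 * (p 1 - 1)"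
 let ?u = "%p::nat => 'k. ?k p * p 0"
 let ?L = "%p::nat => 'k. vec4 (?u p) 1 (p 1) 1"
 let ?P = "%p::nat => 'k. blk r (%i. p 0 * ?u p ^ (3 * r - i)) (%i. p 0 * p 1 * ?u p ^ (2 * r - i)) (%i. ?u p ^ (r + 1 - i)) (%i. p 1 * ?u p ^ (1 - i))"
 have h: "hom_poly (top_index r) 1 (cZ (r + 1) :: (nat => 'k) => 'k)" "hom_poly (top_index r) 1 (cX (3 * r) :: (nat => 'k) => 'k)"
  "hom_poly (top_index r) 1 (cT 1 :: (nat => 'k) => 'k)" by (rule hom_coords, simp)+
 have S: "Opn (model_space r) ?S" by (rule openin_model_hom[OF h(1)])
 have \<theta>: "cX (3 * r) (rep (hp (top_index r) (?P p))) / cZ (r + 1) (rep (hp (top_index r) (?P p))) = p 0"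
  "cT 1 (rep (hp (top_index r) (?P p))) / cZ (r + 1) (rep (hp (top_index r) (?P p))) = p 1"
  "cZ (r + 1) (rep (hp (top_index r) (?P p))) ~= 0" for p :: "nat => 'k"
  unfolding hom_ratio_hp[OF h(2,1)] hom_ratio_hp[OF h(3,1)] hom_poly_rep_zero[OF h(1)]
  by (simp_all add: blk_coords)
 show ?thesis unfolding chart_with_lift_def
 \<comment> \<open>The sample point has \<open>v = 2\<close>, where the common factor
   \<open>v (v - 1)\<close> does not vanish.\<close>
 proof (rule lift_chart[OF S, where \<delta> = "%_. 1" and k = ?k and L = ?L and P = ?P and \<eta> = "%_. 1"
   and a = "vec2 0 2" and tf = "%\<zeta>. cX (3 * r) (rep \<zeta>) / cZ (r + 1) (rep \<zeta>)"
   and tg = "%\<zeta>. cT 1 (rep \<zeta>) / cZ (r + 1) (rep \<zeta>)"])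
  show "(%\<zeta>. cX (3 * r) (rep \<zeta>) / cZ (r + 1) (rep \<zeta>)) : reg (model_space r) ?S"
   by (rule model_ratio_reg[OF h(2,1) S]) simp
  show "(%\<zeta>. cT 1 (rep \<zeta>) / cZ (r + 1) (rep \<zeta>)) : reg (model_space r) ?S"
   by (rule model_ratio_reg[OF h(3,1) S]) simp
  show "(%_. 1) : reg (model_space r) ?S" by (rule reg_const[OF swf_model S])
  show L: "(%p. ?L p i) : Polys 2" if "i < 4" for i
   by (rule vec4_poly[OF _ _ _ _ that]) (simp_all add: poly_ops)
  show "(%p. ?P p j) : Polys 2" for j by (rule blk_poly) (simp_all add: poly_ops)
  show "EX j<=top_index r. ?P p j ~= 0" for p :: "nat => 'k"
   by (rule exI[of _ "4 * (r + 1) + 2"]) (simp add: blk_simps(3)[of _ _ _ _ _ "r + 1", simplified])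
  show "Phi r (?L p) j = ?k p * ?P p j" for p :: "nat => 'k" and j
   unfolding Phi_def vec4_simps
  proof (rule blk_scale)
   fix i assume "i <= 3 * r"
   then have "3 * r + 1 - i = Suc (3 * r - i)" by simp
   then show "?u p ^ (3 * r + 1 - i) * 1 ^ i * 1 ^ 3 = ?k p * (p 0 * ?u p ^ (3 * r - i))" by (simp add: ac_simps)
  next
   fix i assume "i <= 2 * r"
   then have "2 * r + 1 - i = Suc (2 * r - i)" by simp
   then show "p 1 * 1\<^sup>2 * (?u p ^ (2 * r + 1 - i) * 1 ^ i) = ?k p * (p 0 * p 1 * ?u p ^ (2 * r - i))" by (simp add: ac_simps)
  qed (simp_all add: power2_eq_square ac_simps)
  fix x y :: 'k
  assume "aff r x y : ?S"
  then have "cZ (r + 1) (rep (aff r x y)) ~= 0" by simp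
  then have y: "y ~= 0" "y ~= x ^ r" "x ~= 0"
   unfolding aff_hp hom_poly_rep_zero[OF h(1)] by (simp_all add: blk_coords)
  define s where "s = cX (3 * r) (rep (aff r x y)) / cZ (r + 1) (rep (aff r x y))"
  define v where "v = cT 1 (rep (aff r x y)) / cZ (r + 1) (rep (aff r x y))"
  have v: "v = y / x ^ r" unfolding v_def aff_hp hom_ratio_hp[OF h(3,1)]
   using y by (simp add: blk_coords field_simps power2_eq_square)
  have s: "s = x ^ (3 * r) / (y * (y - x ^ r) * x ^ (r + 1))" unfolding s_def aff_hp hom_ratio_hp[OF h(2,1)]
   by (simp add: blk_coords)
  have k: "v * (v - 1) ~= 0" using y by (simp add: v field_simps)
  have x3: "x ^ (3 * r) = x ^ r * x ^ r * x ^ r" unfolding power_add[symmetric] by (rule arg_cong[of _ _ "%n. x ^ n"]) simp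
  have u: "v * (v - 1) * s = 1 / x" using y unfolding v s x3 by (simp add: field_simps)
  show "?k (vec2 s v) ~= 0 & (1::'k) * 1 = 1 & Cls r (?L (vec2 s v)) = Cls r (vec4 1 x y 1)"
   using k u class_at_infinity[OF y(3), of r y] unfolding vec2_simps v[symmetric] by simp
 qed (use \<theta> in \<open>auto simp: vec4_domain poly_ops affine_basic_def\<close>)
qed

text \<open>The fiber at infinity near \<open>v 3 = 0\<close>, with \<open>e = x^r / y\<close>. The
  blown up point \<open>e = 1\<close> still lies in this chart, so the other coordinate is
  \<open>p\<close> with \<open>1 / x = (1 - e) p\<close>.\<close>

lemma chart_D:
 assumes r: "1 <= r"
 shows "chart_with_lift r {\<zeta> : model r. cT 1 (rep \<zeta> :: nat => 'k::field_char_0) ~= 0}"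
proof -
 let ?S = "{\<zeta> : model r. cT 1 (rep \<zeta> :: nat => 'k) ~= 0}"
 let ?k = "%p::nat => 'k. 1 - p 1"
 let ?u = "%p::nat => 'k. ?k p * p 0"
 let ?L = "%p::nat => 'k. vec4 (?u p) 1 1 (p 1)"
 let ?P = "%p::nat => 'k. blk r (%i. p 0 * ?u p ^ (3 * r - i) * p 1 ^ 3) (%i. p 0 * p 1 ^ 2 * ?u p ^ (2 * r - i)) (%i. p 1 * ?u p ^ (r + 1 - i)) (%i. ?u p ^ (1 - i))"
 let ?cE = "%z::nat => 'k. cT 0 z + cZ r z + cY (2 * r) z"
 have h: "hom_poly (top_index r) 1 (cT 1 :: (nat => 'k) => 'k)" "hom_poly (top_index r) 1 ?cE"
  "hom_poly (top_index r) 1 (cZ (r + 1) :: (nat => 'k) => 'k)"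
  by ((intro hom_coords hom_poly_add; simp))+
 have S: "Opn (model_space r) ?S" by (rule openin_model_hom[OF h(1)])
 have \<theta>: "?cE (rep (hp (top_index r) (?P p))) / cT 1 (rep (hp (top_index r) (?P p))) = p 0"
  "cZ (r + 1) (rep (hp (top_index r) (?P p))) / cT 1 (rep (hp (top_index r) (?P p))) = p 1"
  "cT 1 (rep (hp (top_index r) (?P p))) ~= 0" for p :: "nat => 'k"
  unfolding hom_ratio_hp[OF h(2,1)] hom_ratio_hp[OF h(3,1)] hom_poly_rep_zero[OF h(1)]
  by (simp_all add: blk_coords algebra_simps power2_eq_square)
 show ?thesis unfolding chart_with_lift_def
 proof (rule lift_chart[OF S, where \<delta> = "%_. 1" and k = ?k and L = ?L and P = ?P and \<eta> = "%_. 1"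
   and a = "vec2 0 0" and tf = "%\<zeta>. ?cE (rep \<zeta>) / cT 1 (rep \<zeta>)"
   and tg = "%\<zeta>. cZ (r + 1) (rep \<zeta>) / cT 1 (rep \<zeta>)"])
  show "(%\<zeta>. ?cE (rep \<zeta>) / cT 1 (rep \<zeta>)) : reg (model_space r) ?S"
   by (rule model_ratio_reg[OF h(2,1) S]) simp
  show "(%\<zeta>. cZ (r + 1) (rep \<zeta>) / cT 1 (rep \<zeta>)) : reg (model_space r) ?S"
   by (rule model_ratio_reg[OF h(3,1) S]) simp
  show "(%_. 1) : reg (model_space r) ?S" by (rule reg_const[OF swf_model S])
  show L: "(%p. ?L p i) : Polys 2" if "i < 4" for i
   by (rule vec4_poly[OF _ _ _ _ that]) (simp_all add: poly_ops)
  show "(%p. ?P p j) : Polys 2" for j by (rule blk_poly) (simp_all add: poly_ops)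
  show "EX j<=top_index r. ?P p j ~= 0" for p :: "nat => 'k"
   by (rule exI[of _ "4 * 1 + 3"]) (unfold blk_simps, simp)
  show "Phi r (?L p) j = ?k p * ?P p j" for p :: "nat => 'k" and j
   unfolding Phi_def vec4_simps
  proof (rule blk_scale)
   fix i assume "i <= 3 * r"
   then have "3 * r + 1 - i = Suc (3 * r - i)" by simp
   then show "?u p ^ (3 * r + 1 - i) * 1 ^ i * p 1 ^ 3 = ?k p * (p 0 * ?u p ^ (3 * r - i) * p 1 ^ 3)" by (simp add: ac_simps)
  next
   fix i assume "i <= 2 * r"
   then have "2 * r + 1 - i = Suc (2 * r - i)" by simp
   then show "1 * (p 1)\<^sup>2 * (?u p ^ (2 * r + 1 - i) * 1 ^ i) = ?k p * (p 0 * (p 1)\<^sup>2 * ?u p ^ (2 * r - i))" by (simp add: ac_simps)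
  qed (simp_all add: ac_simps)
  fix x y :: 'k
  assume "aff r x y : ?S"
  then have "cT 1 (rep (aff r x y)) ~= 0" by simp
  then have y: "y ~= 0" "y ~= x ^ r" "x ~= 0"
   unfolding aff_hp hom_poly_rep_zero[OF h(1)] by (simp_all add: blk_coords)
  define p where "p = ?cE (rep (aff r x y)) / cT 1 (rep (aff r x y))"
  define e where "e = cZ (r + 1) (rep (aff r x y)) / cT 1 (rep (aff r x y))"
  have e: "e = x ^ r / y" unfolding e_def aff_hp hom_ratio_hp[OF h(3,1)]
   using y by (simp add: blk_coords field_simps power2_eq_square)
  have x2: "x ^ (r * 2) = x ^ r * x ^ r" by (simp add: mult_2_right power_add)
  have p: "p = y / ((y - x ^ r) * x)" unfolding p_def aff_hp hom_ratio_hp[OF h(2,1)]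
   using y by (simp add: blk_coords field_simps power2_eq_square x2)
  have k: "1 - e ~= 0" using y by (simp add: e field_simps)
  have u: "(1 - e) * p = 1 / x" using y unfolding e p by (simp add: field_simps)
  have "Cls r (vec4 (1 / x) 1 1 (x ^ r / y)) = Cls r (vec4 1 x y 1)"
   by (rule class_vec4_eqI[of "1 / x" "1 / y"]) (use y in \<open>simp_all add: power_one_over field_simps\<close>)
  then show "?k (vec2 p e) ~= 0 & (1::'k) * 1 = 1 & Cls r (?L (vec2 p e)) = Cls r (vec4 1 x y 1)"
   using k u unfolding vec2_simps e[symmetric] by simp
 qed (use \<theta> in \<open>auto simp: vec4_domain poly_ops affine_basic_def\<close>)
qed

text \<open>The remaining direction of the blowup over \<epsilon>: here \<open>u = 1 / x\<close> is
  the equation of the exceptional curve and \<open>y / x^r = \<epsilon> + u w\<close>.\<close>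

lemma chart_E:
 assumes r: "1 <= r" and \<epsilon>: "\<epsilon> = 0 | \<epsilon> = (1::'k::field_char_0)"
 shows "chart_with_lift r {\<zeta> : model r. cX (3 * r) (rep \<zeta>) * (cY (2 * r) (rep \<zeta>) + (\<epsilon> - 1) * cX (3 * r) (rep \<zeta>)) ~= 0}"
proof -
 \<comment> \<open>Divided by the coordinate \<open>x^(3 r)\<close> this is
   \<open>y / x^r - (1 - \<epsilon>)\<close>, so its non-vanishing keeps away from the other blown
   up point. In chart coordinates it is \<open>?d\<close>.\<close>
 let ?G = "%z::nat => 'k. cY (2 * r) z + (\<epsilon> - 1) * cX (3 * r) z"
 let ?S = "{\<zeta> : model r. cX (3 * r) (rep \<zeta>) * ?G (rep \<zeta>) ~= 0}"
 let ?v = "%p::nat => 'k. \<epsilon> + p 0 * p 1"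
 let ?d = "%p::nat => 'k. p 0 * p 1 + 2 * \<epsilon> - 1"
 let ?t = "%p::nat => 'k. p 1 * ?d p"
 let ?L = "%p::nat => 'k. vec4 (p 0) 1 (?v p) 1"
 let ?P = "%p::nat => 'k. blk r (%i. p 0 ^ (3 * r - i)) (%i. ?v p * p 0 ^ (2 * r - i)) (%i. ?t p * p 0 ^ (r + 1 - i)) (%i. ?v p * ?t p * p 0 ^ (1 - i))"
 have \<epsilon>2: "\<epsilon> * \<epsilon> = \<epsilon>" using \<epsilon> by auto
 have h: "hom_poly (top_index r) 1 (cX (3 * r) :: (nat => 'k) => 'k)" "hom_poly (top_index r) 1 (cX (3 * r - 1) :: (nat => 'k) => 'k)"
  "hom_poly (top_index r) 1 ?G" "hom_poly (top_index r) 1 (cZ (r + 1) :: (nat => 'k) => 'k)"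
  by ((intro hom_coords hom_poly_add hom_poly_cmult; simp))+
 have h5: "hom_poly (top_index r) (1 + 1) (%z. cX (3 * r) z * ?G z)" by (rule hom_poly_mult[OF h(1,3)])
 have S: "Opn (model_space r) ?S" by (rule openin_model_hom[OF h5])
 have vG: "?v p + (\<epsilon> - 1) = ?d p" for p :: "nat => 'k" by simp
 have r1: "3 * r - (3 * r - 1) = 1" using r by simp
 have PG: "?G (?P p) = ?d p" "cX (3 * r) (?P p) = 1" for p :: "nat => 'k"
  by (simp_all add: blk_coords)
 have \<theta>: "cX (3 * r - 1) (rep (hp (top_index r) (?P p))) / cX (3 * r) (rep (hp (top_index r) (?P p))) = p 0"
  "cZ (r + 1) (rep (hp (top_index r) (?P p))) / ?G (rep (hp (top_index r) (?P p))) = p 1"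
  "cX (3 * r) (rep (hp (top_index r) (?P p))) * ?G (rep (hp (top_index r) (?P p))) ~= 0"
  if d: "?d p ~= 0" for p :: "nat => 'k"
 proof -
  show "cX (3 * r - 1) (rep (hp (top_index r) (?P p))) / cX (3 * r) (rep (hp (top_index r) (?P p))) = p 0"
   unfolding hom_ratio_hp[OF h(2,1)] PG by (simp add: blk_coords r1[simplified])
  show "cZ (r + 1) (rep (hp (top_index r) (?P p))) / ?G (rep (hp (top_index r) (?P p))) = p 1"
  proof -
   have t: "cZ (r + 1) (?P p) = p 1 * ?d p" by (simp add: blk_coords)
   show ?thesis unfolding hom_ratio_hp[OF h(4,3)] PG(1) t by (rule nonzero_mult_div_cancel_right[OF d])
  qed
  show "cX (3 * r) (rep (hp (top_index r) (?P p))) * ?G (rep (hp (top_index r) (?P p))) ~= 0"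
   unfolding hom_poly_rep_zero[OF h5] unfolding PG(1) unfolding PG(2) using d by simp
 qed
 have vv: "?v p * (?v p - 1) = p 0 * ?t p" for p :: "nat => 'k"
 proof -
  have "?v p * (?v p - 1) - p 0 * ?t p = \<epsilon> * \<epsilon> - \<epsilon>" by (simp add: algebra_simps)
  then show ?thesis using \<epsilon>2 by simp
 qed
 show ?thesis unfolding chart_with_lift_def
 \<comment> \<open>At the sample point \<open>(1, 3)\<close> the factor \<open>u\<close> is
   \<open>1\<close> and \<open>?d\<close> is \<open>2\<close> or \<open>4\<close>, nonzero in
   characteristic zero.\<close>
 proof (rule lift_chart[OF S, where \<delta> = ?d and k = "%p. p 0" and L = ?L and P = ?P
   and \<eta> = "%\<zeta>. cX (3 * r) (rep \<zeta>) / ?G (rep \<zeta>)"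
   and a = "vec2 1 3" and tf = "%\<zeta>. cX (3 * r - 1) (rep \<zeta>) / cX (3 * r) (rep \<zeta>)"
   and tg = "%\<zeta>. cZ (r + 1) (rep \<zeta>) / ?G (rep \<zeta>)"])
  show "(%\<zeta>. cX (3 * r - 1) (rep \<zeta>) / cX (3 * r) (rep \<zeta>)) : reg (model_space r) ?S"
   by (rule model_ratio_reg[OF h(2,1) S]) simp
  show "(%\<zeta>. cZ (r + 1) (rep \<zeta>) / ?G (rep \<zeta>)) : reg (model_space r) ?S"
   by (rule model_ratio_reg[OF h(4,3) S]) simp
  show "(%\<zeta>. cX (3 * r) (rep \<zeta>) / ?G (rep \<zeta>)) : reg (model_space r) ?S"
   by (rule model_ratio_reg[OF h(1,3) S]) simp
  show L: "(%p. ?L p i) : Polys 2" if "i < 4" for i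
   by (rule vec4_poly[OF _ _ _ _ that]) (simp_all add: poly_ops)
  show "(%p. ?P p j) : Polys 2" for j by (rule blk_poly) (simp_all add: poly_ops)
  show "EX j<=top_index r. ?P p j ~= 0" for p :: "nat => 'k"
   by (rule exI[of _ "4 * (3 * r)"]) (unfold blk_simps, simp)
  show "Phi r (?L p) j = p 0 * ?P p j" for p :: "nat => 'k" and j
   unfolding Phi_def vec4_simps
  proof (rule blk_scale)
   fix i assume "i <= 3 * r"
   then have "3 * r + 1 - i = Suc (3 * r - i)" by simp
   then show "p 0 ^ (3 * r + 1 - i) * 1 ^ i * 1 ^ 3 = p 0 * p 0 ^ (3 * r - i)" by simp
  next
   fix i assume "i <= 2 * r"
   then have "2 * r + 1 - i = Suc (2 * r - i)" by simp
   then show "?v p * 1\<^sup>2 * (p 0 ^ (2 * r + 1 - i) * 1 ^ i) = p 0 * (?v p * p 0 ^ (2 * r - i))" by (simp add: ac_simps)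
  next
   fix i
   have "?v p * (?v p - 1 ^ r * 1) * 1 * (p 0 ^ (r + 1 - i) * 1 ^ i) = (?v p * (?v p - 1)) * p 0 ^ (r + 1 - i)" by simp
   then show "?v p * (?v p - 1 ^ r * 1) * 1 * (p 0 ^ (r + 1 - i) * 1 ^ i) = p 0 * (?t p * p 0 ^ (r + 1 - i))"
    unfolding vv by (simp only: mult.assoc)
  next
   fix i :: nat
   have "(?v p)\<^sup>2 * (?v p - 1 ^ r * 1) * (p 0 ^ (1 - i) * 1 ^ i) = ?v p * (?v p * (?v p - 1)) * p 0 ^ (1 - i)"
    by (simp only: power2_eq_square mult.assoc power_one mult_1_right)
   then show "(?v p)\<^sup>2 * (?v p - 1 ^ r * 1) * (p 0 ^ (1 - i) * 1 ^ i) = p 0 * (?v p * ?t p * p 0 ^ (1 - i))"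
    unfolding vv by (simp only: ac_simps)
  qed
  fix x y :: 'k
  assume "aff r x y : ?S"
  then have nz: "cX (3 * r) (rep (aff r x y)) * ?G (rep (aff r x y)) ~= 0" by simp
  have x2: "x ^ (2 * r) = x ^ r * x ^ r" by (simp add: mult_2 power_add)
  have x3: "x ^ (3 * r) = x ^ r * x ^ r * x ^ r" unfolding power_add[symmetric] by (rule arg_cong[of _ _ "%n. x ^ n"]) simp
  from nz have nz': "x ^ (3 * r) * (y * x ^ (2 * r) + (\<epsilon> - 1) * x ^ (3 * r)) ~= 0"
   unfolding aff_hp hom_poly_rep_zero[OF h5] by (simp add: blk_coords)
  then have x: "x ~= 0" using r by (auto simp: power_0_left)
  let ?m = "y + (\<epsilon> - 1) * x ^ r"
  have G: "y * x ^ (2 * r) + (\<epsilon> - 1) * x ^ (3 * r) = x ^ r * x ^ r * ?m" unfolding x2 x3 by (simp add: algebra_simps)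
  have m: "?m ~= 0" using nz' unfolding G by auto
  define u where "u = cX (3 * r - 1) (rep (aff r x y)) / cX (3 * r) (rep (aff r x y))"
  define w where "w = cZ (r + 1) (rep (aff r x y)) / ?G (rep (aff r x y))"
  define e where "e = cX (3 * r) (rep (aff r x y)) / ?G (rep (aff r x y))"
  have "x ^ (3 * r) = x ^ (3 * r - 1) * x" using r by (cases "3 * r") auto
  then have u: "u = 1 / x" unfolding u_def aff_hp hom_ratio_hp[OF h(2,1)]
   using x by (simp add: blk_coords)
  have canc: "a * b * x ^ (r + 1) / (x ^ r * x ^ r * b) = a * x / x ^ r" if "b ~= 0" for a b
   using x that by (simp add: field_simps)
  have canc': "x ^ r * x ^ r * x ^ r / (x ^ r * x ^ r * b) = x ^ r / b" if "b ~= 0" for b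
   using x that by (simp add: field_simps)
  have "y * (y - x ^ r) - (y - \<epsilon> * x ^ r) * ?m = (\<epsilon> * \<epsilon> - \<epsilon>) * x ^ r * x ^ r" by (simp add: algebra_simps)
  then have fact: "y * (y - x ^ r) = (y - \<epsilon> * x ^ r) * ?m" using \<epsilon>2 by simp
  have "w = y * (y - x ^ r) * x ^ (r + 1) / (y * x ^ (2 * r) + (\<epsilon> - 1) * x ^ (3 * r))"
   unfolding w_def aff_hp hom_ratio_hp[OF h(4,3)] by (simp add: blk_coords)
  also have "\<dots> = (y - \<epsilon> * x ^ r) * x / x ^ r" unfolding fact G by (rule canc[OF m])
  finally have uw: "u * w = y / x ^ r - \<epsilon>" using x unfolding u by (simp add: field_simps)
  have "e = x ^ (3 * r) / (y * x ^ (2 * r) + (\<epsilon> - 1) * x ^ (3 * r))"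
   unfolding e_def aff_hp hom_ratio_hp[OF h(1,3)] by (simp add: blk_coords)
  also have "\<dots> = x ^ r / ?m" unfolding G unfolding x3 by (rule canc'[OF m])
  finally have e: "e = x ^ r / ?m" .
  have "(u * w + 2 * \<epsilon> - 1) = ?m / x ^ r" unfolding uw using x by (simp add: field_simps)
  then have de: "(u * w + 2 * \<epsilon> - 1) * e = 1" unfolding e using x m by simp
  have v: "\<epsilon> + u * w = y / x ^ r" unfolding uw by simp
  show "vec2 u w 0 ~= 0 & ?d (vec2 u w) * e = 1 &
   Cls r (?L (vec2 u w)) = Cls r (vec4 1 x y 1)"
   using de x class_at_infinity[OF x, of r y] unfolding vec2_simps v u[symmetric] by (simp add: u)
 next
  show "vec2 1 3 : affine_basic 2 ?d" using \<epsilon> by (auto simp: affine_basic_def)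
 qed (use \<theta> in \<open>auto simp: vec4_domain poly_ops affine_basic_def\<close>)
qed

section \<open>The charts cover the model\<close>

lemma model_coord_zero:
 fixes \<zeta> :: "(nat => 'k::field_char_0) set"
 assumes \<zeta>: "\<zeta> : model r" and r: "1 <= r"
  and z: "cX 0 (rep \<zeta>) = 0" "cT 0 (rep \<zeta>) = 0" "cT 1 (rep \<zeta>) = 0" "cZ (r + 1) (rep \<zeta>) = 0" "cX (3 * r) (rep \<zeta>) = 0"
 shows False
proof -
 let ?z = "rep \<zeta>"
 note hc = hom_coords
 have X: "cX i ?z = 0" if "i < 3 * r" for i
  using that
 proof (induction i)
  case (Suc i)
  \<comment> \<open>The relation \<open>(x^(i+1))^2 = x^i x^(i+2)\<close> carries the vanishing
    upwards from \<open>x^0\<close>; the last exponent \<open>3 r\<close> has no right neighbour and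
    is a hypothesis.\<close>
  have "hom_poly (top_index r) (1 + 1) (%v. cX (Suc i) v * cX (Suc i) v - cX i v * (cX (Suc (Suc i)) v :: 'k))"
   by (intro hom_poly_diff hom_poly_mult hc; use Suc.prems in simp)
  then have "cX (Suc i) ?z * cX (Suc i) ?z - cX i ?z * cX (Suc (Suc i)) ?z = 0"
   by (rule model_hom[OF _ _ \<zeta>]) (use Suc.prems in \<open>simp add: Phi_affine blk_coords\<close>)
  then show ?case using Suc by simp
 qed (use z in simp)
 have X': "cX i ?z = 0" if "i <= 3 * r" for i using X[of i] z(5) that by (cases "i = 3 * r") auto
 have Z: "cZ i ?z = 0" if i: "i <= r" for i
 proof -
  \<comment> \<open>Here \<open>z^2 = (y z) (y - x^r)\<close> is used; the vanishing of
    \<open>y z\<close> forces that of \<open>z x^i\<close>.\<close>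
  have "hom_poly (top_index r) (1 + 1) (%v. cZ i v * cZ i v - cT 0 v * (cY (2 * i) v - (cX (r + 2 * i) v :: 'k)))"
   by (intro hom_poly_diff hom_poly_mult hc; use i in simp)
  then have "cZ i ?z * cZ i ?z - cT 0 ?z * (cY (2 * i) ?z - cX (r + 2 * i) ?z) = 0"
  proof (rule model_hom[OF _ _ \<zeta>])
   fix x y :: 'k
   have b: "i <= r + 1" "2 * i <= 2 * r" "r + 2 * i <= 3 * r" "0 <= (1::nat)" using i by auto
   have e: "x ^ (2 * i) = x ^ i * x ^ i" "x ^ (r + 2 * i) = x ^ r * (x ^ i * x ^ i)"
    by (simp_all add: power_add mult_2)
   have "y ^ 2 * (y - x ^ r) * x ^ 0 * (y * x ^ (2 * i) - x ^ (r + 2 * i)) =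
     y * (y - x ^ r) * x ^ i * (y * x ^ i * y - y * x ^ i * x ^ r)"
    unfolding e by (simp add: power2_eq_square right_diff_distrib ac_simps)
   also have "\<dots> = y * (y - x ^ r) * x ^ i * (y * (y - x ^ r) * x ^ i)"
    by (simp add: right_diff_distrib left_diff_distrib ac_simps)
   finally have E: "y ^ 2 * (y - x ^ r) * x ^ 0 * (y * x ^ (2 * i) - x ^ (r + 2 * i)) =
     y * (y - x ^ r) * x ^ i * (y * (y - x ^ r) * x ^ i)" .
   show "cZ i (Phi r (vec4 1 x y 1)) * cZ i (Phi r (vec4 1 x y 1)) - cT 0 (Phi r (vec4 1 x y 1)) *
     (cY (2 * i) (Phi r (vec4 1 x y 1)) - cX (r + 2 * i) (Phi r (vec4 1 x y 1))) = 0"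
    unfolding Phi_affine blk_coords(1)[OF b(3)] blk_coords(2)[OF b(2)] blk_coords(3)[OF b(1)] blk_coords(4)[OF b(4)]
     E by (rule diff_self)
  qed
  then show ?thesis using z(2) by simp
 qed
 have Z': "cZ i ?z = 0" if "i <= r + 1" for i using Z[of i] z(4) that by (cases "i = r + 1") auto
 have Y: "cY j ?z = 0" if j: "j <= 2 * r" for j
 proof -
  \<comment> \<open>The relation is \<open>(y x^j)^2 = (z x^k) x^a + (y x^b) x^c\<close>, from
    \<open>y^2 = z + y x^r\<close>. The exponents \<open>2 j\<close> and \<open>r + 2 j\<close> are
    split so that each part stays within the bound of its block.\<close>
  define k where "k = min (2 * j) (r + 1)"
  define a where "a = 2 * j - k"
  define b where "b = min (2 * r) (r + 2 * j)"
  define c where "c = r + 2 * j - b"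
  have k: "k <= r + 1" "a <= 3 * r" "k + a = 2 * j" using j r unfolding k_def a_def by auto
  have b: "b <= 2 * r" "c <= 3 * r" "b + c = r + 2 * j" using j unfolding b_def c_def by auto
  have "hom_poly (top_index r) (1 + 1) (%v. cY j v * cY j v - (cZ k v * cX a v + cY b v * (cX c v :: 'k)))"
   by (intro hom_poly_diff hom_poly_add hom_poly_mult hc j k b)
  then have "cY j ?z * cY j ?z - (cZ k ?z * cX a ?z + cY b ?z * cX c ?z) = 0"
  proof (rule model_hom[OF _ _ \<zeta>])
   fix x y :: 'k
   have e: "x ^ k * x ^ a = x ^ j * x ^ j" "x ^ b * x ^ c = x ^ r * (x ^ j * x ^ j)"
    using k(3) b(3) by (simp_all only: power_add[symmetric] mult_2)
   have "y * (y - x ^ r) * x ^ k * x ^ a + y * x ^ b * x ^ c = y * (y - x ^ r) * (x ^ k * x ^ a) + y * (x ^ b * x ^ c)"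
    by (simp only: mult.assoc)
   also have "\<dots> = y * x ^ j * (y * x ^ j)" unfolding e by (simp add: algebra_simps)
   finally have "y * x ^ j * (y * x ^ j) - (y * (y - x ^ r) * x ^ k * x ^ a + y * x ^ b * x ^ c) = 0" by simp
   then show "cY j (Phi r (vec4 1 x y 1)) * cY j (Phi r (vec4 1 x y 1)) - (cZ k (Phi r (vec4 1 x y 1)) * cX a (Phi r (vec4 1 x y 1)) +
    cY b (Phi r (vec4 1 x y 1)) * cX c (Phi r (vec4 1 x y 1))) = 0"
    unfolding Phi_affine blk_coords(1)[OF k(2)] blk_coords(1)[OF b(2)] blk_coords(2)[OF b(1)] blk_coords(2)[OF j]
     blk_coords(3)[OF k(1)] .
  qed
  then show ?thesis using X'[OF k(2)] X'[OF b(2)] by simp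
 qed
 have T: "cT i ?z = 0" if "i <= 1" for i using that z(2,3) by (cases i) auto
 have unused: "?z j = 0" if "j <= top_index r" "!!x y. Phi r (vec4 1 x y (1::'k)) j = 0" for j
  by (rule model_hom[OF hom_poly_coord[OF that(1)] that(2) \<zeta>])
 have "?z j = 0" if j: "j <= top_index r" for j
 proof (cases j rule: mod4_cases)
  case (1 i) then show ?thesis using X'[of i] unused[OF j] unfolding 1 Phi_affine blk_simps cX_def by (cases "i <= 3 * r") auto
 next
  case (2 i) then show ?thesis using Y[of i] unused[OF j] unfolding 2 Phi_affine blk_simps cY_def by (cases "i <= 2 * r") auto
 next
  case (3 i) then show ?thesis using Z'[of i] unused[OF j] unfolding 3 Phi_affine blk_simps cZ_def by (cases "i <= r + 1") auto
 next
  case (4 i) then show ?thesis using T[of i] unused[OF j] unfolding 4 Phi_affine blk_simps cT_def by (cases "i <= 1") auto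
 qed
 then show False using rep_nonzero[of \<zeta> "top_index r"] \<zeta> model_sub by blast
qed

lemma model_charts:
 assumes r: "1 <= r"
 shows "EX \<U> :: (nat => 'k::field_char_0) set set set. finite \<U> & \<Union>\<U> = model r & (ALL U:\<U>. chart_with_lift r U)"
proof -
 let ?A = "{\<zeta> : model r. cX 0 (rep \<zeta> :: nat => 'k) ~= 0}"
 let ?B = "{\<zeta> : model r. cT 0 (rep \<zeta> :: nat => 'k) ~= 0}"
 let ?C = "{\<zeta> : model r. cZ (r + 1) (rep \<zeta> :: nat => 'k) ~= 0}"
 let ?D = "{\<zeta> : model r. cT 1 (rep \<zeta> :: nat => 'k) ~= 0}"
 let ?E = "%\<epsilon>. {\<zeta> : model r. cX (3 * r) (rep \<zeta>) * (cY (2 * r) (rep \<zeta>) + (\<epsilon> - 1) * cX (3 * r) (rep \<zeta>)) ~= (0::'k)}"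
 have "chart_with_lift r U" if "U : {?A, ?B, ?C, ?D, ?E 0, ?E 1}" for U
  using that chart_A[OF r, where 'k = 'k] chart_B[OF r, where 'k = 'k] chart_C[OF r, where 'k = 'k] chart_D[OF r, where 'k = 'k]
   chart_E[OF r, of "0::'k"] chart_E[OF r, of "1::'k"]
  by (elim insertE emptyE) simp_all
 moreover have "model r <= \<Union>{?A, ?B, ?C, ?D, ?E 0, ?E 1}"
 proof
  fix \<zeta> :: "(nat => 'k) set" assume \<zeta>: "\<zeta> : model r"
  consider "cX 0 (rep \<zeta>) ~= 0" | "cT 0 (rep \<zeta>) ~= 0" | "cT 1 (rep \<zeta>) ~= 0" | "cZ (r + 1) (rep \<zeta>) ~= 0" | "cX (3 * r) (rep \<zeta>) ~= 0"
   using model_coord_zero[OF \<zeta> r] by blast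
  then show "\<zeta> : \<Union>{?A, ?B, ?C, ?D, ?E 0, ?E 1}"
  proof cases
   case 5
   \<comment> \<open>If both charts failed, the coordinate \<open>y x^(2 r)\<close> and its
     difference with \<open>x^(3 r)\<close> would vanish, and so would
     \<open>x^(3 r)\<close>.\<close>
   then have "\<zeta> : ?E 0 | \<zeta> : ?E 1" using \<zeta> by auto
   then show ?thesis by blast
  qed (use \<zeta> in auto)
 qed
 moreover have "\<Union>{?A, ?B, ?C, ?D, ?E 0, ?E 1} <= model r" by auto
 ultimately show ?thesis by (intro exI[of _ "{?A, ?B, ?C, ?D, ?E 0, ?E 1}"] conjI ballI) auto
qed

text \<open>The model is the closure of the image of the irreducible plane: one of two closed parts
  pulls back to the whole plane and therefore contains a dense set.\<close>

lemma irreducible_model: "irreducible_closed (topo (model_space r)) (points (model_space r :: ((nat => 'k::field_char_0) set, 'k) fspace))"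
 unfolding irreducible_closed_def
proof (intro conjI allI impI)
 let ?M = "model_space r :: 'k pspace"
 show "points ?M ~= {}" using aff_model[of r 0 0] points_model by blast
 fix A B assume AB: "closedin (topo ?M) A & closedin (topo ?M) B & points ?M = A \<union> B"
 have aff: "morphism (Aff 2) ?M (%p. aff r (p 0) (p 1))"
 proof -
  have "(%p. Phi r (vec4 1 (p 0) (p 1) 1) j) : Polys 2" for j
   by (rule poly_subst[OF Phi_poly vec4_poly]) (simp_all add: poly_ops)
  then have reg: "(%p. Phi r (vec4 1 (p 0) (p 1) 1) j) : reg (Aff 2) (points (Aff 2 :: 'k aspace))" for j
   by (rule reg_affine_poly) (rule openin_topspace)
  have nz: "EX j<=top_index r. Phi r (vec4 1 (p 0) (p 1) 1) j ~= 0" for p :: "nat => 'k"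
   using Phi_nonzero_iff[of "vec4 1 (p 0) (p 1) 1" r] by (simp add: good_def vec4_domain)
  have "morphism (Aff 2) (Proj (top_index r)) (%p. hp (top_index r) (%j. Phi r (vec4 1 (p 0) (p 1) (1::'k)) j))"
   by (rule morphism_hp[OF swf_affine reg nz])
  then show ?thesis
   unfolding model_space_def morphism_into_subspace_iff[OF swf_proj swf_affine] aff_def Hmap_def[symmetric]
   using Hmap_model[OF good_affine] by auto
 qed
 have c: "continuous_map (topo (Aff 2)) (topo ?M) (%p. aff r (p 0) (p 1))" using aff unfolding morphism_def by auto
 let ?p = "%C. {p : affine_points 2. aff r (p 0) (p (1::nat)) : C}"
 have cl: "closedin (topo (Aff 2)) (?p C)" if "closedin (topo ?M) C" for C
  using closedin_continuous_map_preimage[OF c that] by simp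
 have "aff r (p 0) (p 1) : A \<union> B" for p :: "nat => 'k" using AB aff_model points_model by metis
 then have "affine_points 2 = ?p A \<union> ?p B" by auto
 then have "affine_points 2 = ?p A | affine_points 2 = ?p B"
  using irreducible_affine[of 2, where 'k = 'k] cl AB unfolding irreducible_closed_def by blast
 moreover have "points ?M = C" if C: "closedin (topo ?M) C" "affine_points 2 = ?p C" for C
 proof
  show "C <= points ?M" by (rule closedin_subset[OF C(1)])
  show "points ?M <= C"
  proof
   fix \<zeta> assume \<zeta>: "\<zeta> : points ?M"
   show "\<zeta> : C"
   proof (rule closedin_dense[OF dense_model C(1) _ \<zeta>])
    fix d :: "(nat => 'k) set" assume "d : aff_points r"
    then obtain x y where d: "d = aff r x y" unfolding aff_points_def by auto
    have "vec2 x y : ?p C" using C(2) vec2_affine[of x y] by blast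
    then show "d : C" using d by simp
   qed
  qed
 qed
 ultimately show "points ?M = A | points ?M = B" using AB by blast
qed simp

text \<open>The projection of the model onto the Hirzebruch surface, glued from the charts.\<close>

lemma rho_exists:
 assumes r: "1 <= r"
 obtains \<rho> :: "(nat => 'k::field_char_0) set => (nat => 'k) set" where "morphism (model_space r) (hirzebruch r) \<rho>"
  "!!x y. \<rho> (aff r x y) = Cls r (vec4 1 x y 1)"
proof -
 let ?M = "model_space r :: 'k pspace"
 obtain \<U> :: "(nat => 'k) set set set" where \<U>: "\<Union>\<U> = model r" "ALL U:\<U>. chart_with_lift r U"
  using model_charts[OF r, where 'k = 'k] by blast
 \<comment> \<open>Affine coordinates are chosen here by \<open>SOME\<close>; that the class does
   not depend on them follows from any local lift, which takes a single value at the point.\<close>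
 define R where "R \<zeta> = (SOME A. EX x y. \<zeta> = aff r x y & A = Cls r (vec4 1 x (y::'k) 1))" for \<zeta>
 have loc: "EX V f. Opn ?M V & w : V & morphism (Sub ?M V) (hirzebruch r) f &
   (ALL d:aff_points r \<inter> V. ALL x y. d = aff r x y --> f d = Cls r (vec4 1 x y 1))" if "w : points ?M" for w
 proof -
  obtain U where U: "U : \<U>" "w : U" using \<U>(1) \<open>w : points ?M\<close> points_model by blast
  then obtain \<rho> where "plane_chart ?M U" "morphism (Sub ?M U) (hirzebruch r) \<rho>"
   "ALL x y. aff r x y : U --> \<rho> (aff r x y) = Cls r (vec4 1 x y 1)"
   using \<U>(2) unfolding chart_with_lift_def by blast
  then show ?thesis using U(2) unfolding plane_chart_def by (intro exI[of _ U] exI[of _ \<rho>]) auto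
 qed
 have R: "R (aff r x y) = Cls r (vec4 1 x y 1)" for x y
 proof -
  have "EX x' y'. aff r x y = aff r x' y' & R (aff r x y) = Cls r (vec4 1 x' (y'::'k) 1)"
   unfolding R_def by (rule someI_ex[where P = "%A. EX x' y'. aff r x y = aff r x' y' & A = Cls r (vec4 1 x' y' 1)"]) blast
  then obtain x' y' where xy: "aff r x y = aff r x' y'" "R (aff r x y) = Cls r (vec4 1 x' y' 1)" by blast
  have p: "aff r x y : points ?M" using aff_model points_model by blast
  have d: "aff r x y : aff_points r" unfolding aff_points_def by blast
  from loc[OF p] obtain V f where V: "aff r x y : V"
   "ALL d:aff_points r \<inter> V. ALL x y. d = aff r x y --> f d = Cls r (vec4 1 x y 1)" by (elim exE conjE)
  have f: "f (aff r x y) = Cls r (vec4 1 x'' y'' 1)" if "aff r x y = aff r x'' y''" for x'' y''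
   using bspec[OF V(2), of "aff r x y"] V(1) d that by blast
  show ?thesis using xy(2) f[OF refl] f[OF xy(1)] by (simp only:)
 qed
 have loc': "EX V f. Opn ?M V & w : V & morphism (Sub ?M V) (hirzebruch r) f &
   (ALL d:aff_points r \<inter> V. f d = R d)" if w: "w : points ?M" for w
 proof -
  from loc[OF w] obtain V f where V: "Opn ?M V" "w : V" "morphism (Sub ?M V) (hirzebruch r) f"
   "ALL d:aff_points r \<inter> V. ALL x y. d = aff r x y --> f d = Cls r (vec4 1 x y 1)" by (elim exE conjE)
  have "ALL d:aff_points r \<inter> V. f d = R d"
  proof
   fix d assume d: "d : aff_points r \<inter> V"
   then obtain x y where xy: "d = aff r x y" unfolding aff_points_def by blast
   have "f d = Cls r (vec4 1 x y 1)" using bspec[OF V(4) d] xy by blast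
   then show "f d = R d" unfolding xy R .
  qed
  then show ?thesis using V(1-3) by (intro exI[of _ V] exI[of _ f] conjI)
 qed
 show thesis
 proof (rule glue_morphism[OF swf_model dense_model separated_hirzebruch[OF swf_subspace[OF swf_model]] loc'], assumption, goal_cases)
  case (1 F)
  have "F (aff r x y) = Cls r (vec4 1 x y 1)" for x y
  proof -
   have "aff r x y : aff_points r" unfolding aff_points_def by blast
   then show ?thesis using 1(2)[of "aff r x y"] R[of x y] aff_model points_model by metis
  qed
  then show thesis using that 1(1) by blast
 qed
qed

section \<open>The model and the Hirzebruch surface agree away from the two points\<close>

definition Gd :: "nat => (nat => 'k::field) set set" where
 "Gd r = {A : points (hirzebruch r). rep A : good r}"

lemma Gd_open: "Opn (hirzebruch r) (Gd r :: (nat => 'k::field) set set)"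
proof -
 have "(Gd r :: (nat => 'k) set set) = (\<Union>j\<in>{..top_index r}. {A : points (hirzebruch r). Phi r (rep A) j ~= 0})"
  unfolding Gd_def using Phi_nonzero_iff[OF rep_domain, of _ r] by blast
 moreover have "Opn (hirzebruch r) (\<Union>j\<in>{..top_index r}. {A : points (hirzebruch r). Phi r (rep A :: nat => 'k) j ~= 0})"
  by (rule openin_Union) (use openin_torus_weight[OF Phi_weight] in blast)
 ultimately show ?thesis by simp
qed

lemma good_torus: "c ~= 0 ==> d ~= 0 ==> v : Dom ==> torus r c d v : good r \<longleftrightarrow> v : good r"
 using Phi_nonzero_iff[of v r] Phi_nonzero_iff[OF torus_domain[of c d v r], of r] Phi_torus[of c d r v] by auto

lemma class_Gd:
 assumes "v : Dom" shows "Cls r v : Gd r \<longleftrightarrow> v : good r"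
proof -
 obtain c d where cd: "c ~= 0" "d ~= 0" "rep (Cls r v) = torus r c d v" using rep_class by metis
 show ?thesis unfolding Gd_def using good_torus[OF cd(1,2) assms] class_points[OF assms, of r] cd(3) by simp
qed

lemma Hmap_rep_class: "Hmap r (rep (Cls r v)) = Hmap r v"
 using rep_class[of r v] Hmap_torus by metis

lemma morphism_Hbar: "morphism (Sub (hirzebruch r) (Gd r)) (Proj (top_index r)) (%A. Hmap r (rep A :: nat => 'k::field))"
proof (rule morphism_hp_local[OF swf_subspace[OF swf_hirzebruch]])
 let ?Y = "hirzebruch r :: 'k pspace"
 fix A assume "A : points (Sub ?Y (Gd r))"
 then have A: "A : points ?Y" "rep A : good r" unfolding Gd_def by auto
 obtain l where l: "l <= top_index r" "Phi r (rep A) l ~= 0" using Phi_nonzero_iff[OF rep_domain[OF A(1)]] A(2) by blast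
 let ?V = "{A : points ?Y. Phi r (rep A) l ~= 0}"
 have o: "Opn ?Y ?V" by (rule openin_torus_weight[OF Phi_weight])
 have sub: "?V <= Gd r" unfolding Gd_def using Phi_nonzero_iff[OF rep_domain] l(1) by blast
 let ?F = "%j A. Phi r (rep A) j / Phi r (rep A) l"
 have reg: "?F j : reg (Sub ?Y (Gd r)) ?V" for j
  unfolding reg_subspace_open[OF swf_hirzebruch Gd_open o sub] by (rule torus_ratio_reg[OF Phi_weight Phi_weight])
 have o': "Opn (Sub ?Y (Gd r)) ?V" using openin_subspace_open[OF Gd_open] o sub by blast
 have "(EX j<=top_index r. ?F j B ~= 0) & Hmap r (rep B) = hp (top_index r) (%j. ?F j B)" if B: "B : ?V" for B
 proof
  show "EX j<=top_index r. ?F j B ~= 0" using l(1) B by (intro exI[of _ l]) simp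
  show "Hmap r (rep B) = hp (top_index r) (%j. ?F j B)"
   unfolding Hmap_def by (rule hp_eqI[of "Phi r (rep B) l"]) (use B in simp_all)
 qed
 then show "EX V F. Opn (Sub ?Y (Gd r)) V & A : V & (ALL i<=top_index r. F i : reg (Sub ?Y (Gd r)) V) &
   (ALL v:V. (EX i<=top_index r. F i v ~= 0) & Hmap r (rep v) = hp (top_index r) (%i. F i v))"
  using o' A l reg by (intro exI[of _ ?V] exI[of _ ?F]) blast
qed

text \<open>Together with \<open>Hmap_rho\<close> this says that \<rho> and \<open>Hmap\<close> are
  inverse to each other off the two points; both composites are compared with the identity on a
  dense set.\<close>

lemma rho_Hmap:
 fixes \<rho> :: "(nat => 'k::field_char_0) set => (nat => 'k) set"
 assumes \<rho>: "morphism (model_space r) (hirzebruch r) \<rho>" "!!x y. \<rho> (aff r x y) = Cls r (vec4 1 x y 1)"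
  and v: "v : good r"
 shows "\<rho> (Hmap r v) = Cls r v"
proof -
 let ?G = "Sub (Aff 4 :: 'k aspace) (good r)"
 have G: "swf ?G" by (rule swf_subspace[OF swf_affine])
 have p: "points ?G = good r" using domain_affine by (auto simp: good_def)
 have gd: "good r <= (Dom :: (nat => 'k) set)" by (auto simp: good_def)
 have H: "morphism ?G (model_space r) (Hmap r)"
  unfolding model_space_def morphism_into_subspace_iff[OF swf_proj G] p using morphism_Hmap Hmap_model by blast
 have c: "morphism ?G (hirzebruch r) (Cls r)"
  by (rule subspace_subspace_morphism[OF swf_affine morphism_hirzebruch_class gd])
 show ?thesis
 proof (rule agree_on_dense[OF separated_hirzebruch[OF G] dense_good morphism_comp[OF H \<rho>(1)] c])
  fix d :: "nat => 'k" assume "d : {v. v 0 * v 3 ~= 0}" "d : points ?G"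
  then have d: "d 0 ~= 0" "d 3 ~= 0" "d : Dom" using gd unfolding p by auto
  show "\<rho> (Hmap r d) = Cls r d" unfolding Hmap_aff(2)[OF d] \<rho>(2) Hmap_aff(1)[OF d] ..
 qed (use v p in simp)
qed

lemma Hmap_rho:
 fixes \<rho> :: "(nat => 'k::field_char_0) set => (nat => 'k) set"
 assumes \<rho>: "morphism (model_space r) (hirzebruch r) \<rho>" "!!x y. \<rho> (aff r x y) = Cls r (vec4 1 x y 1)"
  and \<zeta>: "\<zeta> : model r" "\<rho> \<zeta> : Gd r"
 shows "Hmap r (rep (\<rho> \<zeta>)) = \<zeta>"
proof -
 let ?V = "{\<zeta> : points (model_space r). \<rho> \<zeta> : Gd r}"
 let ?M = "Sub (model_space r) ?V"
 have o: "Opn (model_space r) ?V" by (rule morphism_open[OF \<rho>(1) Gd_open])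
 have M: "swf ?M" by (rule swf_subspace[OF swf_model])
 have "morphism ?M (Sub (hirzebruch r) (Gd r)) \<rho>"
  unfolding morphism_into_subspace_iff[OF swf_hirzebruch M] using morphism_restrict[OF swf_model \<rho>(1)] by auto
 from morphism_comp[OF this morphism_Hbar]
 have H: "morphism ?M (Proj (top_index r)) (%\<zeta>. Hmap r (rep (\<rho> \<zeta>)))" .
 show ?thesis
 proof (rule agree_on_dense[OF separated_proj[OF M] dense_in_subspace[OF dense_model o] H
    morphism_restrict[OF swf_model morphism_model]])
  fix d :: "(nat => 'k) set" assume "d : aff_points r"
  then obtain x y where d: "d = aff r x y" unfolding aff_points_def by auto
  show "Hmap r (rep (\<rho> d)) = d" unfolding d unfolding \<rho>(2) Hmap_rep_class unfolding aff_def ..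
 qed (use \<zeta> points_model in auto)
qed

section \<open>Local structure of a blowup\<close>

text \<open>
 What is used of a blowup over an open set \<open>U\<close>: \<open>f\<^sub>0, \<dots>, f\<^sub>m\<close> generate the ideal of \<open>S\<close> locally, and
 \<open>x \<mapsto> (\<pi> x, \<omega> x)\<close> identifies the preimage of \<open>U\<close> with the closure of the graph of \<open>[f\<^sub>0 : \<dots> : f\<^sub>m]\<close>,
 so that maps to \<open>X\<close> are the same as maps to \<open>U \<times> \<bbbP>\<^sup>m\<close> which generically lie on the graph.
\<close>

definition blowup_chart ::
 "('x, 'k::field) fspace => ('x => 'y) => ('y, 'k) fspace => 'y set => 'y set => nat => (nat => 'y => 'k) =>
  ('x => (nat => 'k) set) => bool" where
 "blowup_chart X \<pi> Y S U m f \<omega> \<longleftrightarrow> Opn Y U &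
  (ALL i<=m. f i : reg Y U & (ALL y:S \<inter> U. f i y = 0)) &
  (ALL V h y. Opn Y V --> y : V \<inter> U --> h : reg Y V --> (ALL s:S \<inter> V. h s = 0) -->
    (EX V' a. Opn Y V' & y : V' & V' <= U \<inter> V & (ALL i<=m. a i : reg Y V') &
     (ALL z:V'. h z = (\<Sum>i\<le>m. a i z * f i z)))) &
  morphism (Sub X {x : points X. \<pi> x : U}) (Proj m) \<omega> &
  (ALL x:points X. ALL x':points X. \<pi> x : U --> \<pi> x = \<pi> x' --> \<omega> x = \<omega> x' --> x = x') &
  dense_in (Sub X {x : points X. \<pi> x : U}) {x. \<pi> x ~: S} &
  (ALL y:U - S. EX i<=m. f i y ~= 0) &
  (ALL x:points X. \<pi> x : U - S --> \<omega> x = hp m (%i. f i (\<pi> x))) &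
  (ALL (W :: 'k pspace) \<alpha> \<beta> D. swf W --> morphism W Y \<alpha> --> \<alpha> ` points W <= U -->
    morphism W (Proj m) \<beta> --> dense_in W D -->
    (ALL d:D \<inter> points W. (EX i<=m. f i (\<alpha> d) ~= 0) & \<beta> d = hp m (%i. f i (\<alpha> d))) -->
    (EX \<xi>. morphism W X \<xi> & (ALL w:points W. \<pi> (\<xi> w) = \<alpha> w & \<omega> (\<xi> w) = \<beta> w)))"

text \<open>The idea is to clear denominators, which is possible as \<open>U\<close> is affine.\<close>

lemma generates_ideal_locally:
 fixes Y :: "('y, 'k::field) fspace"
 assumes Y: "swf Y" and U: "Opn Y U" "affine_variety (Sub Y U)"
  and gen: "generates_ideal_of Y S U m f"
  and V: "Opn Y V" "y : V \<inter> U" "h : reg Y V" "ALL s:S \<inter> V. h s = 0"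
 shows "EX V' a. Opn Y V' & y : V' & V' <= U \<inter> V & (ALL i<=m. a i : reg Y V') &
     (ALL z:V'. h z = (\<Sum>i\<le>m. a i z * f i z))"
proof -
 let ?YU = "Sub Y U"
 have YU: "swf ?YU" by (rule swf_subspace[OF Y])
 have pU: "points ?YU = U" using openin_subset[OF U(1)] by auto
 obtain n Z \<theta> where \<theta>: "isomorphism ?YU (Sub (Aff n :: 'k aspace) Z) \<theta>"
  using U(2) unfolding affine_variety_def isomorphic_spaces_def by blast
 let ?A = "Sub (Aff n :: 'k aspace) Z"
 have A: "swf ?A" by (rule swf_subspace[OF swf_affine])
 obtain \<kappa> where t: "morphism ?YU ?A \<theta>" "morphism ?A ?YU \<kappa>" and t3: "ALL x:points ?YU. \<kappa> (\<theta> x) = x"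
  using \<theta> unfolding isomorphism_def by (elim exE conjE)
 have tt: "\<kappa> (\<theta> x) = x" if "x : U" for x using bspec[OF t3, unfolded pU, OF that] .
 have \<theta>m: "morphism ?YU (Aff n) \<theta>" "!!x. x : U ==> \<theta> x : Z"
  using t(1) unfolding morphism_into_subspace_iff[OF swf_affine YU] pU by auto
 have \<kappa>m: "morphism ?A Y \<kappa>" using t(2) unfolding morphism_into_subspace_iff[OF Y A] by blast
 have \<theta>A: "\<theta> x : affine_points n" if "x : U" for x using morphism_points[OF \<theta>m(1)] that pU by auto
 let ?N = "{w : points ?A. \<kappa> w : V}"
 have hN: "(%w. h (\<kappa> w)) : reg ?A ?N" by (rule morphism_reg[OF \<kappa>m V(1,3)])
 have yU: "y : U" "y : V" using V(2) by blast+
 have yN: "\<theta> y : ?N" using tt[OF yU(1)] yU(2) \<theta>A[OF yU(1)] \<theta>m(2)[OF yU(1)] by simp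
 obtain V0 g0 where 0: "Opn (Aff n) V0" "\<theta> y : V0" "V0 \<inter> Z <= ?N"
  "g0 : reg (Aff n) V0" "ALL w:V0 \<inter> Z. h (\<kappa> w) = g0 w" using reg_subspaceD[OF hN yN] by (elim exE conjE)
 from reg_affineD[OF 0(4,2)] obtain P Q where PQ: "P : Polys n" "Q : Polys n" "Q (\<theta> y) ~= 0"
  "affine_basic n Q <= V0" "ALL w:affine_basic n Q. g0 w = P w / Q w" by (elim exE conjE)
 have reg: "(%x. H (\<theta> x)) : reg Y U" if "H : Polys n" for H
 proof -
  have o: "Opn ?YU U" using U(1) openin_subspace_open[OF U(1), of U] by blast
  have o2: "Opn (Aff n) (affine_points n)" using openin_topspace[of "topo (Aff n)"] by simp
  have "(%x. H (\<theta> x)) : reg ?YU U"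
   by (rule morphism_reg_on[OF YU \<theta>m(1) o2 reg_affine_poly[OF that o2] o]) (rule \<theta>A)
  then show ?thesis using reg_subspace_open[OF Y U(1) U(1)] by simp
 qed
 let ?V = "{x : U. Q (\<theta> x) ~= 0}"
 have oV: "Opn Y ?V" by (rule reg_nonzero[OF Y U(1) reg[OF PQ(2)]])
 have x: "x : V & h x = P (\<theta> x) / Q (\<theta> x)" if "x : ?V" for x
 proof -
  have b: "\<theta> x : affine_basic n Q" using that \<theta>A by (simp add: affine_basic_def)
  then have v: "\<theta> x : V0 \<inter> Z" using PQ(4) \<theta>m(2) that by auto
  then have "\<theta> x : ?N" using 0(3) by blast
  then have "\<kappa> (\<theta> x) : V" by simp
  moreover have "h (\<kappa> (\<theta> x)) = P (\<theta> x) / Q (\<theta> x)" using bspec[OF 0(5) v] bspec[OF PQ(5) b] by simp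
  ultimately show ?thesis using tt[of x] that by simp
 qed
 \<comment> \<open>Unlike \<open>h\<close>, this product is regular on all of \<open>U\<close>. On
   \<open>S\<close> it vanishes: trivially where \<open>Q\<close> does, and otherwise because it
   equals \<open>h Q^2\<close>. Dividing its expression through the generators by \<open>Q^2\<close>
   recovers \<open>h\<close>.\<close>
 let ?k = "%x. P (\<theta> x) * Q (\<theta> x)"
 have k: "?k : reg Y U" by (rule reg_mult[OF Y U(1) reg[OF PQ(1)] reg[OF PQ(2)]])
 have "ALL s:S \<inter> U. ?k s = 0"
 proof
  fix s assume s: "s : S \<inter> U"
  show "?k s = 0"
  proof (cases "Q (\<theta> s) = 0")
   case False
   then have "s : V" "h s = P (\<theta> s) / Q (\<theta> s)" using x[of s] s by auto
   then show ?thesis using V(4) s False by auto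
  qed simp
 qed
 moreover have "ALL g:reg Y U. (ALL y:S \<inter> U. g y = 0) -->
    (EX a. (ALL i<=m. a i : reg Y U) & (ALL y:U. g y = (\<Sum>i\<le>m. a i y * f i y)))"
  using gen unfolding generates_ideal_of_def by (elim conjE)
 ultimately obtain a where a: "ALL i<=m. a i : reg Y U" "ALL z:U. ?k z = (\<Sum>i\<le>m. a i z * f i z)"
  using k by (elim ballE[of _ _ ?k] impE exE conjE) auto
 let ?q = "%x. Q (\<theta> x) * Q (\<theta> x)"
 have q: "?q : reg Y ?V" by (rule reg_mono[OF Y U(1) reg_mult[OF Y U(1) reg[OF PQ(2)] reg[OF PQ(2)]] oV]) blast
 have r: "(%x. a i x / ?q x) : reg Y ?V" if "i <= m" for i
  by (rule reg_divide[OF Y oV reg_mono[OF Y U(1) _ oV] q]) (use a that in auto)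
 have hz: "h z = (\<Sum>i\<le>m. a i z / ?q z * f i z)" if z: "z : ?V" for z
 proof -
  have "(\<Sum>i\<le>m. a i z / ?q z * f i z) = (\<Sum>i\<le>m. a i z * f i z) / ?q z"
   by (simp add: sum_divide_distrib)
  also have "\<dots> = ?k z / ?q z" using a(2) z by auto
  finally show ?thesis using x[OF z] z by simp
 qed
 show ?thesis
 proof (rule exI[of _ ?V], rule exI[of _ "%i x. a i x / ?q x"], intro conjI allI impI ballI)
  show "y : ?V" using yU(1) PQ(3) by simp
  show "?V <= U \<inter> V" using x by blast
 qed (fact oV, rule r, assumption, rule hz)
qed

text \<open>The isomorphism \<phi> with the graph closure is split into \<pi> and its projective
  component \<omega>; from here on the graph closure is used only through the properties collected
  in \<open>blowup_chart\<close>.\<close>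

lemma blowup_chart_exists:
 fixes Y :: "('y, 'k::field) fspace" and X :: "('x, 'k) fspace"
 assumes Y: "swf Y" and S: "closedin (topo Y) S" and bl: "is_blowup X \<pi> Y S" and y: "y : points Y"
 shows "EX U m f \<omega>. y : U & blowup_chart X \<pi> Y S U m f \<omega>"
proof -
 have X: "swf X" and \<pi>: "morphism X Y \<pi>" using bl unfolding is_blowup_def by auto
 obtain U m f \<phi> where U: "Opn Y U" "y : U" "affine_variety (Sub Y U)"
  "generates_ideal_of Y S U m f"
  "isomorphism (Sub X {x : points X. \<pi> x : U}) (graph_closure Y U m f) \<phi>"
  "ALL x:points X. \<pi> x : U --> fst (\<phi> x) = \<pi> x"
  using bl y unfolding is_blowup_def by blast
 let ?YU = "Sub Y U" and ?XU = "Sub X {x : points X. \<pi> x : U}"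
 let ?P = "prod_space ?YU (Proj m :: 'k pspace)"
 define graph where "graph = {(y, hp m (%i. f i y)) | y. y : U & (EX i<=m. f i y ~= 0)}"
 let ?\<Gamma> = "topo ?P closure_of graph"
 have YU: "swf ?YU" and XU: "swf ?XU" using swf_subspace Y X by blast+
 have P: "swf ?P" by (rule swf_prod[OF YU swf_proj])
 have pU: "points ?YU = U" using openin_subset[OF U(1)] by auto
 have pX: "points ?XU = {x : points X. \<pi> x : U}" by auto
 have oX: "Opn X {x : points X. \<pi> x : U}" by (rule morphism_open[OF \<pi> U(1)])
 have G: "graph_closure Y U m f = Sub ?P ?\<Gamma>"
  unfolding graph_closure_def graph_def hp_def ..
 have Gs: "swf (Sub ?P ?\<Gamma>)" by (rule swf_subspace[OF P])
 have graph_sub: "graph <= points ?P"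
  unfolding points_prod[OF YU swf_proj] pU graph_def using hp_points by auto
 have graph\<Gamma>: "graph <= ?\<Gamma>" by (rule closure_of_subset[OF graph_sub])
 have \<Gamma>P: "?\<Gamma> <= points ?P" by (rule closure_of_subset_topspace)
 have pG: "points (Sub ?P ?\<Gamma>) = ?\<Gamma>" unfolding points_subspace by (rule Int_absorb1[OF \<Gamma>P])
 obtain \<psi> where \<phi>12: "morphism ?XU (Sub ?P ?\<Gamma>) \<phi>" "morphism (Sub ?P ?\<Gamma>) ?XU \<psi>"
  and \<phi>34: "ALL x:points ?XU. \<psi> (\<phi> x) = x" "ALL z:points (Sub ?P ?\<Gamma>). \<phi> (\<psi> z) = z"
  using U(5) unfolding G isomorphism_def by (elim exE conjE)
 have \<phi>3: "\<psi> (\<phi> x) = x" if "x : points ?XU" for x using bspec[OF \<phi>34(1) that] .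
 have \<phi>4: "\<phi> (\<psi> z) = z" if "z : ?\<Gamma>" for z using bspec[OF \<phi>34(2), unfolded pG, OF that] .
 note \<phi> = \<phi>12 \<phi>3 \<phi>4
 define \<omega> where "\<omega> x = snd (\<phi> x)" for x
 have \<phi>P: "morphism ?XU ?P \<phi>" using \<phi>(1) unfolding morphism_into_subspace_iff[OF P XU] by blast
 have \<omega>: "morphism ?XU (Proj m) \<omega>"
  unfolding \<omega>_def by (rule morphism_comp[OF \<phi>P morphism_snd[OF YU swf_proj]])
 have \<phi>\<omega>: "\<phi> x = (\<pi> x, \<omega> x)" if "x : points X" "\<pi> x : U" for x
  using U(6) that unfolding \<omega>_def by (metis prod.collapse)
 have \<psi>p: "\<psi> z : points X & \<pi> (\<psi> z) : U" if "z : ?\<Gamma>" for z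
  using morphism_points[OF \<phi>(2), unfolded pG pX, OF that] by simp
 have f: "f i : reg Y U" "ALL y:S \<inter> U. f i y = 0" if "i <= m" for i
  using U(4) that unfolding generates_ideal_of_def by auto
 note loc = generates_ideal_locally[OF Y U(1,3,4)]
 \<comment> \<open>Away from \<open>S\<close> the constant \<open>1\<close> satisfies the vanishing
   condition vacuously, so the generators have no common zero there.\<close>
 have fnz: "EX i<=m. f i z ~= 0" if z: "z : U - S" for z
 proof -
  have o: "Opn Y (U - S)" by (rule openin_diff[OF U(1) S])
  obtain V' a where "z : V'" "ALL w:V'. 1 = (\<Sum>i\<le>m. a i w * f i w)"
   using loc[OF o _ reg_const[OF Y o, of 1], of z] z by auto
  then have "(\<Sum>i\<le>m. a i z * f i z) = 1" by simp
  then show ?thesis by (metis (no_types, lifting) atMost_iff mult_zero_right sum.neutral zero_neq_one)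
 qed
 \<comment> \<open>The graph is dense in its closure, and density is carried over by the
   isomorphism.\<close>
 have dense: "dense_in ?XU {x. \<phi> x : graph}"
  unfolding dense_in_def
 proof (intro allI impI)
  fix O' assume O': "Opn ?XU O'" "O' ~= {}"
  let ?N = "{z : points (Sub ?P ?\<Gamma>). \<psi> z : O'}"
  have "Opn (Sub ?P ?\<Gamma>) ?N" by (rule morphism_open[OF \<phi>(2) O'(1)])
  then obtain V where V: "Opn ?P V" "?N = V \<inter> ?\<Gamma>" unfolding topo_subspace openin_subtopology by blast
  obtain x where x: "x : O'" using O'(2) by blast
  then have xX: "x : points ?XU" using openin_subset[OF O'(1)] by blast
  then have "\<phi> x : ?N" using \<phi>(3) x morphism_points[OF \<phi>(1)] by simp
  then have "\<phi> x : V" "\<phi> x : ?\<Gamma>" using V(2) by auto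
  then obtain z where z: "z : graph" "z : V" using V(1) unfolding in_closure_of by blast
  then have "z : ?N" using V(2) graph\<Gamma> by blast
  then have "\<psi> z : O'" by simp
  moreover have "\<phi> (\<psi> z) : graph" unfolding \<phi>(4)[OF subsetD[OF graph\<Gamma> z(1)]] by (rule z(1))
  ultimately show "O' \<inter> {x. \<phi> x : graph} ~= {}" by blast
 qed
 have graphS: "\<pi> x ~: S & \<omega> x = hp m (%i. f i (\<pi> x))" if "x : points X" "\<pi> x : U" "\<phi> x : graph" for x
  using that f \<phi>\<omega>[OF that(1,2)] unfolding graph_def by auto
 have denseS: "dense_in ?XU {x. \<pi> x ~: S}"
  unfolding dense_in_def
 proof (intro allI impI)
  fix O' assume O': "Opn ?XU O'" "O' ~= {}"
  then obtain x where x: "x : O'" "\<phi> x : graph" using dense unfolding dense_in_def by blast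
  then have "x : points X" "\<pi> x : U" using openin_subset[OF O'(1)] pX by auto
  then show "O' \<inter> {x. \<pi> x ~: S} ~= {}" using graphS x by blast
 qed
 \<comment> \<open>The equation holds by construction on the graph; both sides are morphisms on the
   preimage of \<open>U - S\<close>, where the graph part is dense.\<close>
 have \<omega>f: "\<omega> x = hp m (%i. f i (\<pi> x))" if x: "x : points X" "\<pi> x : U - S" for x
 proof -
  have o: "Opn Y (U - S)" by (rule openin_diff[OF U(1) S])
  let ?V = "{x : points X. \<pi> x : U - S}"
  have oV: "Opn X ?V" by (rule morphism_open[OF \<pi> o])
  have sub: "?V <= {x : points X. \<pi> x : U}" by blast
  let ?W = "Sub X ?V"
  have W: "swf ?W" by (rule swf_subspace[OF X])
  have pW: "points ?W = ?V" by auto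
  have 1: "(%x. f i (\<pi> x)) : reg ?W (points ?W)" if "i <= m" for i
   unfolding pW reg_subspace_open[OF X oV oV subset_refl]
   by (rule morphism_reg_on[OF X \<pi> U(1) f(1)[OF that] oV]) blast
  have 2: "EX i<=m. f i (\<pi> w) ~= 0" if "w : points ?W" for w using fnz that pW by blast
  have m: "morphism ?W (Proj m) (%x. hp m (%i. f i (\<pi> x)))" by (rule morphism_hp[OF W 1 2])
  have d: "dense_in ?W {x. \<phi> x : graph}"
   unfolding dense_in_def
  proof (intro allI impI)
   fix O' assume O': "Opn ?W O'" "O' ~= {}"
   then have "Opn X O'" "O' <= ?V" using openin_subspace_open[OF oV] by blast+
   then have "Opn ?XU O'" using openin_subspace_open[OF oX] sub by blast
   then show "O' \<inter> {x. \<phi> x : graph} ~= {}" using dense O'(2) unfolding dense_in_def by blast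
  qed
  show ?thesis
  proof (rule agree_on_dense[OF separated_proj[OF W] d subspace_subspace_morphism[OF X \<omega> sub] m])
   fix d assume "d : {x. \<phi> x : graph}" "d : points ?W"
   then show "\<omega> d = hp m (%i. f i (\<pi> d))" using graphS pW by blast
  qed (use x pW in blast)
 qed
 have lift: "EX \<xi>. morphism W X \<xi> & (ALL w:points W. \<pi> (\<xi> w) = \<alpha> w & \<omega> (\<xi> w) = \<beta> w)"
  if W: "swf W" and \<alpha>: "morphism W Y \<alpha>" "\<alpha> ` points W <= U" and \<beta>: "morphism W (Proj m) \<beta>" and D: "dense_in W D"
   "ALL d:D \<inter> points W. (EX i<=m. f i (\<alpha> d) ~= 0) & \<beta> d = hp m (%i. f i (\<alpha> d))"
  for W :: "'k pspace" and \<alpha> \<beta> D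
 proof -
  have "morphism W ?YU \<alpha>" unfolding morphism_into_subspace_iff[OF Y W] using \<alpha> by blast
  from morphism_pair[OF W YU swf_proj this \<beta>] have p: "morphism W ?P (%w. (\<alpha> w, \<beta> w))" .
  \<comment> \<open>The pair lies on the graph for points of \<open>D\<close>, so by density it lies
    in the graph closure everywhere and can be composed with \<psi>.\<close>
  have "(\<alpha> w, \<beta> w) : ?\<Gamma>" if w: "w : points W" for w
  proof -
   have "continuous_map (topo W) (topo ?P) (%w. (\<alpha> w, \<beta> w))" using p unfolding morphism_def by auto
   from closedin_continuous_map_preimage[OF this closedin_closure_of]
   have "closedin (topo W) {w : points W. (\<alpha> w, \<beta> w) : ?\<Gamma>}" .
   then have "w : {w : points W. (\<alpha> w, \<beta> w) : ?\<Gamma>}"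
   proof (rule closedin_dense[OF D(1) _ _ w])
    fix d assume d: "d : D" "d : points W"
    have "\<alpha> d : U" using \<alpha>(2) d(2) by blast
    then have "(\<alpha> d, \<beta> d) : graph" using D(2) d unfolding graph_def by blast
    then show "d : {w : points W. (\<alpha> w, \<beta> w) : ?\<Gamma>}" using d(2) graph\<Gamma> by blast
   qed
   then show ?thesis by simp
  qed note \<Gamma> = this
  have "morphism W (Sub ?P ?\<Gamma>) (%w. (\<alpha> w, \<beta> w))"
   unfolding morphism_into_subspace_iff[OF P W] using p \<Gamma> by blast
  from morphism_comp[OF morphism_comp[OF this \<phi>(2)] morphism_inclusion[OF X]]
  have m: "morphism W X (%w. \<psi> (\<alpha> w, \<beta> w))" .
  have "\<pi> (\<psi> (\<alpha> w, \<beta> w)) = \<alpha> w & \<omega> (\<psi> (\<alpha> w, \<beta> w)) = \<beta> w" if w: "w : points W" for w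
   using \<phi>(4)[OF \<Gamma>[OF w]] \<phi>\<omega>[of "\<psi> (\<alpha> w, \<beta> w)"] \<psi>p[OF \<Gamma>[OF w]] by auto
  then show ?thesis using m by blast
 qed
 have inj: "x = x'" if "x : points X" "x' : points X" "\<pi> x : U" "\<pi> x = \<pi> x'" "\<omega> x = \<omega> x'" for x x'
  using \<phi>(3)[of x] \<phi>(3)[of x'] \<phi>\<omega>[of x] \<phi>\<omega>[of x'] that pX by auto
 have "blowup_chart X \<pi> Y S U m f \<omega>"
  unfolding blowup_chart_def
 proof (intro conjI)
  show "ALL V h y. Opn Y V --> y : V \<inter> U --> h : reg Y V --> (ALL s:S \<inter> V. h s = 0) -->
    (EX V' a. Opn Y V' & y : V' & V' <= U \<inter> V & (ALL i<=m. a i : reg Y V') &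
     (ALL z:V'. h z = (\<Sum>i\<le>m. a i z * f i z)))"
   by (intro allI impI) (rule loc)
  show "ALL (W :: 'k pspace) \<alpha> \<beta> D. swf W --> morphism W Y \<alpha> --> \<alpha> ` points W <= U -->
    morphism W (Proj m) \<beta> --> dense_in W D -->
    (ALL d:D \<inter> points W. (EX i<=m. f i (\<alpha> d) ~= 0) & \<beta> d = hp m (%i. f i (\<alpha> d))) -->
    (EX \<xi>. morphism W X \<xi> & (ALL w:points W. \<pi> (\<xi> w) = \<alpha> w & \<omega> (\<xi> w) = \<beta> w))"
   by (intro allI impI) (rule lift)
  show "ALL x:points X. ALL x':points X. \<pi> x : U --> \<pi> x = \<pi> x' --> \<omega> x = \<omega> x' --> x = x'"
   by (intro ballI impI) (rule inj)
  show "ALL i<=m. f i : reg Y U & (ALL y:S \<inter> U. f i y = 0)" using f by blast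
  show "ALL y:U - S. EX i<=m. f i y ~= 0" by (intro ballI) (rule fnz)
  show "ALL x:points X. \<pi> x : U - S --> \<omega> x = hp m (%i. f i (\<pi> x))" by (intro ballI impI) (rule \<omega>f)
 qed (fact U(1) \<omega> denseS)+
 then show ?thesis using U(2) by blast
qed

text \<open>Composing the blowup map with an automorphism of the base replaces the blown up set by
  its image. This allows the two points to be assumed in standard position.\<close>

lemma blowup_chart_transport:
 fixes Y :: "('y, 'k::field) fspace" and Y' :: "('z, 'k) fspace"
 assumes Y: "swf Y" and Y': "swf Y'" and \<pi>: "morphism X Y \<pi>"
  and t: "morphism Y Y' t" "morphism Y' Y t'" "!!y. y : points Y ==> t' (t y) = y" "!!y. y : points Y' ==> t (t' y) = y"
  and S: "S <= points Y" and c: "blowup_chart X \<pi> Y S U m f \<omega>"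
 shows "blowup_chart X (%x. t (\<pi> x)) Y' (t ` S) {y : points Y'. t' y : U} m (%i y. f i (t' y)) \<omega>"
proof -
 let ?U = "{y : points Y'. t' y : U}"
 have U: "Opn Y U" and f: "ALL i<=m. f i : reg Y U & (ALL y:S \<inter> U. f i y = 0)"
  and loc: "!!V h y. Opn Y V ==> y : V \<inter> U ==> h : reg Y V ==> (ALL s:S \<inter> V. h s = 0) ==>
    (EX V' a. Opn Y V' & y : V' & V' <= U \<inter> V & (ALL i<=m. a i : reg Y V') &
     (ALL z:V'. h z = (\<Sum>i\<le>m. a i z * f i z)))"
  and \<omega>: "morphism (Sub X {x : points X. \<pi> x : U}) (Proj m) \<omega>"
  and inj: "!!x x'. x\<in>points X ==> x'\<in>points X ==> \<pi> x : U ==> \<pi> x = \<pi> x' ==> \<omega> x = \<omega> x' ==> x = x'"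
  and dense: "dense_in (Sub X {x : points X. \<pi> x : U}) {x. \<pi> x ~: S}"
  and fnz: "!!y. y\<in>U - S ==> EX i<=m. f i y ~= 0"
  and \<omega>f: "!!x. x\<in>points X ==> \<pi> x : U - S ==> \<omega> x = hp m (%i. f i (\<pi> x))"
  and lift: "!!(W :: 'k pspace) \<alpha> \<beta> D. swf W ==> morphism W Y \<alpha> ==> \<alpha> ` points W <= U ==>
    morphism W (Proj m) \<beta> ==> dense_in W D ==>
    (ALL d:D \<inter> points W. (EX i<=m. f i (\<alpha> d) ~= 0) & \<beta> d = hp m (%i. f i (\<alpha> d))) ==>
    (EX \<xi>. morphism W X \<xi> & (ALL w:points W. \<pi> (\<xi> w) = \<alpha> w & \<omega> (\<xi> w) = \<beta> w))"
  using c unfolding blowup_chart_def by (elim conjE; simp)+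
 have p: "\<pi> x : points Y" "t (\<pi> x) : points Y'" "t' (t (\<pi> x)) = \<pi> x" if "x : points X" for x
  using morphism_points[OF \<pi> that] morphism_points[OF t(1)] t(3) by auto
 have UY: "U <= points Y" by (rule openin_subset[OF U])
 have eU: "{x : points X. t (\<pi> x) : ?U} = {x : points X. \<pi> x : U}" using p by auto
 have tS: "t y : t ` S \<longleftrightarrow> y : S" if "y : points Y" for y
  using that S t(3) by (metis image_iff subsetD)
 have t'S: "t' y : S \<longleftrightarrow> y : t ` S" if "y : points Y'" for y
  using tS[of "t' y"] t(4)[OF that] morphism_points[OF t(2) that] by simp
 show ?thesis
  unfolding blowup_chart_def eU
 proof (intro conjI allI impI ballI)
  show oU: "Opn Y' ?U" by (rule morphism_open[OF t(2) U])
  show "(%y. f i (t' y)) : reg Y' ?U" if "i <= m" for i using morphism_reg[OF t(2) U, of "f i"] f that by simp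
  show "f i (t' y) = 0" if "i <= m" "y : t ` S \<inter> ?U" for i y using f that t'S by blast
  show "\<omega> x = \<omega> x' ==> x = x'" if "x : points X" "x' : points X" "t (\<pi> x) : ?U" "t (\<pi> x) = t (\<pi> x')" for x x'
  proof (rule inj[OF that(1,2)])
   show "\<pi> x : U" using that(1,3) p(3) by simp
   show "\<pi> x = \<pi> x'" using that p(3) by metis
  qed
  show "dense_in (Sub X {x : points X. \<pi> x : U}) {x. t (\<pi> x) ~: t ` S}"
   unfolding dense_in_def
  proof (intro allI impI)
   fix O' assume O': "Opn (Sub X {x : points X. \<pi> x : U}) O'" "O' ~= {}"
   then obtain x where x: "x : O'" "\<pi> x ~: S" using dense unfolding dense_in_def by blast
   then have "x : points X" using openin_subset[OF O'(1)] by auto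
   then show "O' \<inter> {x. t (\<pi> x) ~: t ` S} ~= {}" using x tS p(1) by blast
  qed
  show "EX i<=m. f i (t' y) ~= 0" if "y : ?U - t ` S" for y using fnz[of "t' y"] that t'S by blast
  show "\<omega> x = hp m (%i. f i (t' (t (\<pi> x))))" if "x : points X" "t (\<pi> x) : ?U - t ` S" for x
   unfolding p(3)[OF that(1)] using \<omega>f[OF that(1)] that p(3) tS p(1) by auto
 next
  fix V h y assume V: "Opn Y' V" "y : V \<inter> ?U" "h : reg Y' V" "ALL s:t ` S \<inter> V. h s = 0"
  let ?V = "{y : points Y. t y : V}"
  have oV: "Opn Y ?V" by (rule morphism_open[OF t(1) V(1)])
  have y: "t' y : ?V \<inter> U" using V(2) t(4) morphism_points[OF t(2)] by auto
  have h: "(%y. h (t y)) : reg Y ?V" by (rule morphism_reg[OF t(1) V(1,3)])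
  have z: "ALL s:S \<inter> ?V. h (t s) = 0" using V(4) by blast
  from loc[OF oV y h z] obtain V' a where 1: "Opn Y V'" "t' y : V'" "V' <= U \<inter> ?V"
   "ALL i<=m. a i : reg Y V'" "ALL z:V'. h (t z) = (\<Sum>i\<le>m. a i z * f i z)" by (elim exE conjE)
  let ?V' = "{y : points Y'. t' y : V'}"
  have "Opn Y' ?V'" by (rule morphism_open[OF t(2) 1(1)])
  moreover have "y : ?V'" using V(2) 1(2) by blast
  moreover have "?V' <= ?U \<inter> V"
  proof
   fix z assume z: "z : ?V'"
   then have "t' z : U \<inter> ?V" using 1(3) by blast
   then show "z : ?U \<inter> V" using z t(4)[of z] by auto
  qed
  moreover have "ALL i<=m. (%y. a i (t' y)) : reg Y' ?V'" using morphism_reg[OF t(2) 1(1)] 1(4) by blast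
  moreover have "ALL z:?V'. h z = (\<Sum>i\<le>m. a i (t' z) * f i (t' z))"
  proof
   fix z assume z: "z : ?V'"
   then show "h z = (\<Sum>i\<le>m. a i (t' z) * f i (t' z))" using bspec[OF 1(5), of "t' z"] t(4)[of z] by simp
  qed
  ultimately show "EX V' a. Opn Y' V' & y : V' & V' <= ?U \<inter> V & (ALL i<=m. a i : reg Y' V') &
     (ALL z:V'. h z = (\<Sum>i\<le>m. a i z * f i (t' z)))"
   by (intro exI[of _ ?V'] exI[of _ "%i y. a i (t' y)"] conjI)
 next
  fix W :: "'k pspace" and \<alpha> \<beta> D
  assume W: "swf W" and \<alpha>: "morphism W Y' \<alpha>" "\<alpha> ` points W <= ?U" and \<beta>: "morphism W (Proj m) \<beta>" and D: "dense_in W D"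
   "ALL d:D \<inter> points W. (EX i<=m. f i (t' (\<alpha> d)) ~= 0) & \<beta> d = hp m (%i. f i (t' (\<alpha> d)))"
  have s: "(%w. t' (\<alpha> w)) ` points W <= U" using \<alpha>(2) by blast
  obtain \<xi> where \<xi>: "morphism W X \<xi>" "ALL w:points W. \<pi> (\<xi> w) = t' (\<alpha> w) & \<omega> (\<xi> w) = \<beta> w"
   using lift[OF W morphism_comp[OF \<alpha>(1) t(2)] s \<beta> D] by blast
  have "t (\<pi> (\<xi> w)) = \<alpha> w" if "w : points W" for w
   using \<xi>(2) that t(4) morphism_points[OF \<alpha>(1)] by auto
  then show "EX \<xi>. morphism W X \<xi> & (ALL w:points W. t (\<pi> (\<xi> w)) = \<alpha> w & \<omega> (\<xi> w) = \<beta> w)" using \<xi> by blast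
 qed (rule \<omega>)
qed

subsection \<open>Comparison with the model\<close>

definition centre :: "nat => (nat => 'k::field) set set" where
 "centre r = points (hirzebruch r) - Gd r"

lemma closedin_centre: "closedin (topo (hirzebruch r)) (centre r)"
 unfolding centre_def by (rule closedin_diff[OF closedin_topspace Gd_open])

lemma centre_cases:
 assumes "A : centre r"
 shows "rep A 0 = 0 & rep A 1 ~= 0 & rep A 3 ~= 0 & (rep A 2 = 0 | rep A 2 = rep A 1 ^ r * rep A 3)"
proof -
 have A: "A : points (hirzebruch r)" "rep A ~: good r" using assms unfolding centre_def Gd_def by auto
 have d: "rep A : Dom" by (rule rep_domain[OF A(1)])
 then have 0: "rep A 0 = 0" "rep A 2 * (rep A 2 - rep A 1 ^ r * rep A 3) = 0" using A(2) unfolding good_def by auto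
 then have 1: "rep A 1 ~= 0" using d unfolding hirzebruch_domain_def by auto
 moreover have "rep A 3 ~= 0" using 0 d 1 unfolding hirzebruch_domain_def by auto
 ultimately show ?thesis using 0 by auto
qed

lemma sum_single:
 fixes f :: "nat => 'k::comm_monoid_add"
 assumes "j <= n" "!!i. i <= n ==> i ~= j ==> f i = 0" shows "(\<Sum>i\<le>n. f i) = f j"
proof -
 have "(\<Sum>i\<le>n. f i) = (\<Sum>i\<in>{j}. f i)" by (rule sum.mono_neutral_right) (use assms in auto)
 then show ?thesis by simp
qed

lemma sum_two:
 fixes f :: "nat => 'k::comm_monoid_add"
 assumes "j <= n" "l <= n" "j ~= l" "!!i. i <= n ==> i ~= j ==> i ~= l ==> f i = 0"
 shows "(\<Sum>i\<le>n. f i) = f j + f l"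
proof -
 have "(\<Sum>i\<le>n. f i) = (\<Sum>i\<in>{j, l}. f i)" by (rule sum.mono_neutral_right) (use assms in auto)
 then show ?thesis using assms(3) by simp
qed

text \<open>Up to a local unit, the coordinates \<open>Phi\<close> generate the ideal of the two
  points. Hence the closure of the graph of \<open>[Phi]\<close>, which is the model, must be the
  blowup.\<close>

lemma local_generators:
 fixes A :: "(nat => 'k::field_char_0) set"
 assumes A: "A : points (hirzebruch r)"
 shows "EX V g. Opn (hirzebruch r) V & A : V & (ALL j<=top_index r. g j : reg (hirzebruch r) V) &
  (ALL B:V. EX k. k ~= 0 & (ALL j<=top_index r. Phi r (rep B) j = k * g j B)) &
  (ALL V' h. Opn (hirzebruch r) V' --> A : V' --> h : reg (hirzebruch r) V' --> (ALL s:centre r \<inter> V'. h s = 0) -->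
    (EX V'' a. Opn (hirzebruch r) V'' & A : V'' & V'' <= V \<inter> V' & (ALL j<=top_index r. a j : reg (hirzebruch r) V'') &
     (ALL z:V''. h z = (\<Sum>j\<le>top_index r. a j z * g j z))))"
proof (cases "A : Gd r")
 case True
 let ?Y = "hirzebruch r :: 'k pspace"
 obtain l where l: "l <= top_index r" "Phi r (rep A) l ~= 0"
  using Phi_nonzero_iff[OF rep_domain[OF A]] True unfolding Gd_def by blast
 let ?V = "{B : points ?Y. Phi r (rep B) l ~= 0}"
 let ?g = "%j B. Phi r (rep B) j / Phi r (rep B) l"
 have o: "Opn ?Y ?V" by (rule openin_torus_weight[OF Phi_weight])
 have g: "?g j : reg ?Y ?V" for j by (rule torus_ratio_reg[OF Phi_weight Phi_weight])
 show ?thesis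
 proof (rule exI[of _ ?V], rule exI[of _ ?g], intro conjI allI impI ballI)
  show "EX k. k ~= 0 & (ALL j<=top_index r. Phi r (rep B) j = k * ?g j B)" if "B : ?V" for B
   by (rule exI[of _ "Phi r (rep B) l"]) (use that in simp)
  fix V' h assume V': "Opn ?Y V'" "A : V'" "h : reg ?Y V'"
  let ?V'' = "?V \<inter> V'"
  \<comment> \<open>Off the two points the ideal is the unit ideal: the \<open>l\<close>-th
    normalised coordinate is \<open>1\<close>, so \<open>h\<close> is its own multiple of
    it.\<close>
  let ?a = "%j. if j = l then h else (%_. 0)"
  have o': "Opn ?Y ?V''" by (rule openin_Int[OF o V'(1)])
  show "EX V'' a. Opn ?Y V'' & A : V'' & V'' <= ?V \<inter> V' & (ALL j<=top_index r. a j : reg ?Y V'') &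
     (ALL z:V''. h z = (\<Sum>j\<le>top_index r. a j z * ?g j z))"
  proof (rule exI[of _ ?V''], rule exI[of _ ?a], intro conjI allI impI ballI)
   show "A : ?V''" using A l V' by simp
   show "?a j : reg ?Y ?V''" for j
    using reg_mono[OF swf_hirzebruch V'(1,3) o'] reg_const[OF swf_hirzebruch o'] by auto
   show "h z = (\<Sum>j\<le>top_index r. ?a j z * ?g j z)" if "z : ?V''" for z
    using sum_single[OF l(1), of "%j. ?a j z * ?g j z"] that by simp
  qed (use o' in auto)
 qed (use o g A l in auto)
next
 case False
 let ?Y = "hirzebruch r :: 'k pspace"
 have "A : centre r" using A False unfolding centre_def by blast
 note c = centre_cases[OF this]
 \<comment> \<open>A monomial of the same weight as the coordinates that does not vanish at
   \<open>A\<close>; dividing by it turns them into functions near \<open>A\<close>.\<close>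
 let ?e = "%v :: nat => 'k. v 1 ^ (3 * r + 1) * v 3 ^ 3"
 let ?f = "%v :: nat => 'k. v 1 ^ r * v 3"
 have we: "torus_weight r (%c d. c * d ^ 3) ?e"
  unfolding torus_weight_def
 proof (intro conjI allI impI)
  show "?e : Polys 4" by (simp add: poly_ops)
  fix c d :: 'k and v :: "nat => 'k" assume cd: "c ~= 0" "d ~= 0"
  then show "c * d ^ 3 ~= 0" by simp
  have "?e (torus r c d v) = c * (c ^ r * inverse (c ^ r)) ^ 3 * d ^ 3 * ?e v"
   unfolding torus_def by (simp add: power_mult_distrib power_add power_mult[symmetric] ac_simps)
  then show "?e (torus r c d v) = c * d ^ 3 * ?e v" using cd by simp
 qed
 have w0: "torus_weight r (%c d. c) (%v :: nat => 'k. v 0)" "torus_weight r (%c d. c) (%v :: nat => 'k. v 1)"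
  "torus_weight r (%c d. d) (%v :: nat => 'k. v 2)" "torus_weight r (%c d. d) ?f"
  unfolding torus_weight_def torus_def by (simp_all add: poly_ops power_mult_distrib)
 let ?V = "{B : points ?Y. ?e (rep B) ~= 0}"
 have o: "Opn ?Y ?V" by (rule openin_torus_weight[OF we])
 have nz: "rep B 1 ~= 0 & rep B 3 ~= 0" if "B : ?V" for B using that by auto
 let ?g = "%j B. Phi r (rep B) j / ?e (rep B)"
 have g: "?g j : reg ?Y ?V" for j by (rule torus_ratio_reg[OF Phi_weight we])
 let ?u = "%B :: (nat => 'k) set. rep B 0 / rep B 1" and ?v = "%B :: (nat => 'k) set. rep B 2 / ?f (rep B)"
 have u: "?u : reg ?Y ?V"
  by (rule reg_mono[OF swf_hirzebruch openin_torus_weight[OF w0(2)] torus_ratio_reg[OF w0(1,2)] o]) auto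
 have v: "?v : reg ?Y ?V"
  by (rule reg_mono[OF swf_hirzebruch openin_torus_weight[OF w0(4)] torus_ratio_reg[OF w0(3,4)] o]) auto
 let ?YV = "Sub ?Y ?V"
 have YV: "swf ?YV" by (rule swf_subspace[OF swf_hirzebruch])
 have pV: "points ?YV = ?V" by auto
 let ?\<theta> = "%B. vec2 (?u B) (?v B)"
 have \<theta>: "morphism ?YV (Aff 2) ?\<theta>"
  by (rule morphism_vec2[OF YV]) (unfold pV reg_subspace_open[OF swf_hirzebruch o o subset_refl], fact u, fact v)
 let ?W = "affine_points 2 :: (nat => 'k) set"
 let ?\<kappa> = "%p :: nat => 'k. Cls r (vec4 (p 0) 1 (p 1) 1)"
 have oW: "Opn (Aff 2) ?W" using openin_topspace[of "topo (Aff 2 :: 'k aspace)"] by simp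
 have \<kappa>: "morphism (Sub (Aff 2) ?W) ?Y ?\<kappa>"
 proof -
  let ?A = "Aff 2 :: 'k aspace"
  have p: "h : reg ?A (points ?A)" if "h : Polys 2" for h by (rule reg_affine_poly[OF that openin_topspace])
  show ?thesis
   by (rule morphism_restrict[OF swf_affine], rule morphism_class_vec4[OF swf_affine p p p p])
    (simp_all add: poly_functions.const poly_functions.coord)
 qed
 have \<kappa>\<theta>: "?\<kappa> (?\<theta> B) = B" if B: "B : ?V" for B
 proof -
  have "Cls r (vec4 (rep B 0) (rep B 1) (rep B 2) (rep B 3)) = Cls r (vec4 (?u B) 1 (?v B) 1)"
   by (rule class_vec4_eqI[of "rep B 1" "?f (rep B)"]) (use nz[OF B] in auto)
  note e = this
  have hB: "B : points ?Y" using B by simp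
  show ?thesis using e class_rep[OF hB] unfolding vec4_eta[OF domain_affine[OF rep_domain[OF hB]]] by (simp add: vec2_simps)
 qed
 define w where "w = ?v A"
 have AV: "A : ?V" using A c by simp
 have w: "w = 0 | w = 1" using c unfolding w_def by auto
 have uA: "?u A = 0" using c by simp
 \<comment> \<open>The coordinates \<open>x^(3 r)\<close> and \<open>z x^(r+1)\<close>: after
   division they become \<open>u = v 0 / v 1\<close> and \<open>v (v - 1)\<close> with
   \<open>v = v 2 / (v 1 ^ r v 3)\<close>.\<close>
 define jx where "jx = 4 * (3 * r)"
 define jz where "jz = 4 * (r + 1) + (2::nat)"
 have j: "jx <= top_index r" "jz <= top_index r" "jx ~= jz" unfolding jx_def jz_def by presburger+
 have gx: "?g jx B = ?u B" if B: "B : ?V" for B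
  unfolding jx_def Phi_def blk_simps using nz[OF B] by (simp add: field_simps)
 have gz: "?g jz B = ?v B * (?v B - 1)" if B: "B : ?V" for B
 proof -
  have "Phi r (rep B) jz = rep B 2 * (rep B 2 - rep B 1 ^ r * rep B 3) * rep B 3 * rep B 1 ^ (r + 1)"
   unfolding jz_def Phi_def blk_simps by simp
  moreover have "?e (rep B) = rep B 1 ^ r * rep B 3 * (rep B 1 ^ r * rep B 3) * (rep B 3 * rep B 1 ^ (r + 1))"
  proof -
   have "3 * r + 1 = r + r + (r + 1)" by simp
   then show ?thesis unfolding power3_eq_cube by (simp only: power_add ac_simps)
  qed
  ultimately show ?thesis using nz[OF B] by (simp add: field_simps)
 qed
 show ?thesis
 proof (rule exI[of _ ?V], rule exI[of _ ?g], intro conjI allI impI ballI)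
  show "EX k. k ~= 0 & (ALL j<=top_index r. Phi r (rep B) j = k * ?g j B)" if "B : ?V" for B
   by (rule exI[of _ "?e (rep B)"]) (use that in simp)
  fix V' h assume V': "Opn ?Y V'" "A : V'" "h : reg ?Y V'" "ALL s:centre r \<inter> V'. h s = 0"
  have hA: "h A = 0" using V' \<open>A : centre r\<close> by blast
  have "EX W' a0 a1. Opn ?Y W' & A : W' & W' <= ?V \<inter> V' & a0 : reg ?Y W' & a1 : reg ?Y W' &
   (ALL x:W'. h x = a0 x * (?\<theta> x 0 - ?\<theta> A 0) + a1 x * (?\<theta> x 1 - ?\<theta> A 1))"
   by (rule chart_generators[OF swf_hirzebruch o oW \<theta> vec2_affine \<kappa> \<kappa>\<theta> AV V'(2,1,3) hA])
  then obtain W' a0 a1 where W': "Opn ?Y W'" "A : W'" "W' <= ?V \<inter> V'" "a0 : reg ?Y W'" "a1 : reg ?Y W'"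
   "ALL x:W'. h x = a0 x * (?\<theta> x 0 - ?\<theta> A 0) + a1 x * (?\<theta> x 1 - ?\<theta> A 1)" by (elim exE conjE)
  have vW: "?v : reg ?Y W'" by (rule reg_mono[OF swf_hirzebruch o v W'(1)]) (use W'(3) in blast)
  \<comment> \<open>With \<open>w\<close> the value \<open>0\<close> or \<open>1\<close> of
    \<open>v\<close> at \<open>A\<close>, one has \<open>v (v - 1) = (v - w) (v + w - 1)\<close>.
    The second factor is invertible near \<open>A\<close>, so \<open>u\<close> and
    \<open>v (v - 1)\<close> generate the same ideal as the two chart coordinates.\<close>
  let ?d = "%B. ?v B + (w - 1)"
  have dW: "?d : reg ?Y W'" by (rule reg_add[OF swf_hirzebruch W'(1) vW reg_const[OF swf_hirzebruch W'(1)]])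
  let ?V'' = "{B : W'. ?d B ~= 0}"
  have o'': "Opn ?Y ?V''" by (rule reg_nonzero[OF swf_hirzebruch W'(1) dW])
  have sub: "?V'' <= W'" by blast
  let ?a = "%j. if j = jx then a0 else if j = jz then (%B. a1 B / ?d B) else (%_. 0)"
  have r1: "(%B. a1 B / ?d B) : reg ?Y ?V''"
   by (rule reg_divide[OF swf_hirzebruch o'' reg_mono[OF swf_hirzebruch W'(1,5) o'' sub] reg_mono[OF swf_hirzebruch W'(1) dW o'' sub]]) simp
  have r0: "a0 : reg ?Y ?V''" by (rule reg_mono[OF swf_hirzebruch W'(1,4) o'' sub])
  show "EX V'' a. Opn ?Y V'' & A : V'' & V'' <= ?V \<inter> V' & (ALL j<=top_index r. a j : reg ?Y V'') &
     (ALL z:V''. h z = (\<Sum>j\<le>top_index r. a j z * ?g j z))"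
  proof (rule exI[of _ ?V''], rule exI[of _ ?a], intro conjI allI impI ballI)
   have "w + (w - 1) ~= 0" using w by auto
   then show "A : ?V''" using W'(2) unfolding w_def by simp
   show "?V'' <= ?V \<inter> V'" using W'(3) by blast
   show "?a j : reg ?Y ?V''" for j using r0 r1 reg_const[OF swf_hirzebruch o''] by auto
   fix z assume z: "z : ?V''"
   then have zV: "z : ?V" and zW: "z : W'" and dz: "?d z ~= 0" using W'(3) by blast+
   have "(\<Sum>j\<le>top_index r. ?a j z * ?g j z) = ?a jx z * ?g jx z + ?a jz z * ?g jz z"
    by (rule sum_two[OF j]) simp
   also have "\<dots> = a0 z * ?u z + a1 z / ?d z * (?v z * (?v z - 1))"
    unfolding gx[OF zV] gz[OF zV] using j(3) by simp
   also have "?v z * (?v z - 1) = (?v z - w) * ?d z" using w by (auto simp: algebra_simps)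
   also have "a1 z / ?d z * ((?v z - w) * ?d z) = a1 z * (?v z - w)" using dz by simp
   finally have s: "(\<Sum>j\<le>top_index r. ?a j z * ?g j z) = a0 z * ?u z + a1 z * (?v z - w)" .
   have "h z = a0 z * ?u z + a1 z * (?v z - w)" using bspec[OF W'(6) zW] unfolding vec2_simps uA w_def by simp
   then show "h z = (\<Sum>j\<le>top_index r. ?a j z * ?g j z)" unfolding s .
  qed (rule o'')
 qed (use o g AV in auto)
qed

lemma finite_common_neighbourhood:
 fixes n :: nat
 assumes V: "openin T V" "y : V" and Q: "!!i. i <= n ==> EX W. openin T W & y : W & W <= V & Q i W"
  and mono: "!!i W W'. Q i W ==> openin T W ==> openin T W' ==> W' <= W ==> Q i W'"
 shows "EX W. openin T W & y : W & W <= V & (ALL i<=n. Q i W)"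
 using Q
proof (induction n)
 case 0 then show ?case by auto
next
 case (Suc n)
 then obtain W where W: "openin T W" "y : W" "W <= V" "ALL i<=n. Q i W" by (metis le_SucI)
 obtain W' where W': "openin T W'" "y : W'" "Q (Suc n) W'" using Suc.prems[of "Suc n"] by auto
 have o: "openin T (W \<inter> W')" using W W' by blast
 have "Q i (W \<inter> W')" if "i <= Suc n" for i
 proof (cases "i = Suc n")
  case True then show ?thesis using mono[OF W'(3,1) o] by auto
 next
  case False then show ?thesis using mono[OF _ W(1) o, of i] W(4) that by auto
 qed
 then show ?case using W W' o by (intro exI[of _ "W \<inter> W'"]) auto
qed

text \<open>Two systems of generators of one ideal express each other. All these expressions are
  collected on a common neighbourhood; they show that the blowup does not depend on the
  generators.\<close>

lemma comparison_matrices: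
 fixes \<pi> :: "'x => (nat => 'k::field_char_0) set"
 assumes y: "y : U" and c: "blowup_chart X \<pi> (hirzebruch r) (centre r) U m f \<omega>"
 shows "EX V g a b. Opn (hirzebruch r) V & y : V & V <= U &
  (ALL i<=m. ALL j<=top_index r. a i j : reg (hirzebruch r) V & b j i : reg (hirzebruch r) V) &
  (ALL B:V. EX k. k ~= 0 & (ALL j<=top_index r. Phi r (rep B) j = k * g j B)) &
  (ALL z:V. (ALL i<=m. f i z = (\<Sum>j\<le>top_index r. a i j z * g j z)) &
    (ALL j<=top_index r. g j z = (\<Sum>i\<le>m. b j i z * f i z)))"
proof -
 let ?Y = "hirzebruch r :: 'k pspace"
 let ?N = "top_index r"
 have U: "Opn ?Y U" and f: "ALL i<=m. f i : reg ?Y U & (ALL y:centre r \<inter> U. f i y = 0)"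
  and loc: "!!V h y. Opn ?Y V ==> y : V \<inter> U ==> h : reg ?Y V ==> (ALL s:centre r \<inter> V. h s = 0) ==>
    (EX V' a. Opn ?Y V' & y : V' & V' <= U \<inter> V & (ALL i<=m. a i : reg ?Y V') &
     (ALL z:V'. h z = (\<Sum>i\<le>m. a i z * f i z)))"
  using c unfolding blowup_chart_def by (elim conjE; simp)+
 have yY: "y : points ?Y" using y openin_subset[OF U] by blast
 from local_generators[OF yY] obtain V g where V: "Opn ?Y V" "y : V" "ALL j<=?N. g j : reg ?Y V"
  "ALL B:V. EX k. k ~= 0 & (ALL j<=?N. Phi r (rep B) j = k * g j B)"
  and Vloc: "ALL V' h. Opn ?Y V' --> y : V' --> h : reg ?Y V' --> (ALL s:centre r \<inter> V'. h s = 0) -->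
    (EX V'' a. Opn ?Y V'' & y : V'' & V'' <= V \<inter> V' & (ALL j<=?N. a j : reg ?Y V'') &
     (ALL z:V''. h z = (\<Sum>j\<le>?N. a j z * g j z)))" by (elim exE conjE)
 have UV: "Opn ?Y (U \<inter> V)" "y : U \<inter> V" using U V y by blast+
 have g0: "g j s = 0" if s: "s : centre r \<inter> V" and j: "j <= ?N" for s j
 proof -
  have sp: "s : points ?Y" "rep s ~: good r" using s unfolding centre_def Gd_def by auto
  obtain k where k: "k ~= 0" "ALL j<=?N. Phi r (rep s) j = k * g j s" using V(4) s by blast
  have "Phi r (rep s) j = 0" using Phi_nonzero_iff[OF rep_domain[OF sp(1)]] sp(2) j by blast
  then show ?thesis using k j by simp
 qed
 define Qf where "Qf i W \<longleftrightarrow> (EX a. (ALL j<=?N. a j : reg ?Y W) & (ALL z:W. f i z = (\<Sum>j\<le>?N. a j z * g j z)))" for i W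
 define Qg where "Qg j W \<longleftrightarrow> (EX b. (ALL i<=m. b i : reg ?Y W) & (ALL z:W. g j z = (\<Sum>i\<le>m. b i z * f i z)))" for j W
 have "EX W. Opn ?Y W & y : W & W <= U \<inter> V & (ALL i<=m. Qf i W)"
 proof (rule finite_common_neighbourhood[OF UV])
  fix i assume i: "i <= m"
  have "EX V'' a. Opn ?Y V'' & y : V'' & V'' <= V \<inter> U & (ALL j<=?N. a j : reg ?Y V'') &
     (ALL z:V''. f i z = (\<Sum>j\<le>?N. a j z * g j z))" using Vloc U y f i by auto
  then obtain V'' a where 1: "Opn ?Y V''" "y : V''" "V'' <= V \<inter> U" "ALL j<=?N. a j : reg ?Y V''"
     "ALL z:V''. f i z = (\<Sum>j\<le>?N. a j z * g j z)" by (elim exE conjE)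
  then have "Qf i V''" unfolding Qf_def by (intro exI[of _ a] conjI)
  then show "EX W. Opn ?Y W & y : W & W <= U \<inter> V & Qf i W" using 1(1-3) by (intro exI[of _ V'']) auto
 next
  fix i W W' assume W: "Qf i W" "Opn ?Y W" "Opn ?Y W'" "W' <= W"
  from W(1) obtain a where "ALL j<=?N. a j : reg ?Y W" "ALL z:W. f i z = (\<Sum>j\<le>?N. a j z * g j z)"
   unfolding Qf_def by (elim exE conjE)
  then show "Qf i W'" unfolding Qf_def using reg_mono[OF swf_hirzebruch W(2) _ W(3,4)] W(4)
   by (intro exI[of _ a] conjI) blast+
 qed
 then obtain W1 where W1: "Opn ?Y W1" "y : W1" "W1 <= U \<inter> V" "ALL i<=m. Qf i W1" by (elim exE conjE)
 have "EX W. Opn ?Y W & y : W & W <= W1 & (ALL j<=?N. Qg j W)"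
 proof (rule finite_common_neighbourhood[OF W1(1,2)])
  fix j assume j: "j <= ?N"
  have r: "g j : reg ?Y W1" by (rule reg_mono[OF swf_hirzebruch V(1) _ W1(1)]) (use V(3) j W1(3) in auto)
  have "EX V'' a. Opn ?Y V'' & y : V'' & V'' <= U \<inter> W1 & (ALL i<=m. a i : reg ?Y V'') &
     (ALL z:V''. g j z = (\<Sum>i\<le>m. a i z * f i z))"
   by (rule loc[OF W1(1) _ r]) (use W1(2,3) y g0 j in auto)
  then obtain V'' a where 1: "Opn ?Y V''" "y : V''" "V'' <= U \<inter> W1" "ALL i<=m. a i : reg ?Y V''"
     "ALL z:V''. g j z = (\<Sum>i\<le>m. a i z * f i z)" by (elim exE conjE)
  then have "Qg j V''" unfolding Qg_def by (intro exI[of _ a] conjI)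
  then show "EX W. Opn ?Y W & y : W & W <= W1 & Qg j W" using 1(1-3) by (intro exI[of _ V'']) auto
 next
  fix j W W' assume W: "Qg j W" "Opn ?Y W" "Opn ?Y W'" "W' <= W"
  from W(1) obtain a where "ALL i<=m. a i : reg ?Y W" "ALL z:W. g j z = (\<Sum>i\<le>m. a i z * f i z)"
   unfolding Qg_def by (elim exE conjE)
  then show "Qg j W'" unfolding Qg_def using reg_mono[OF swf_hirzebruch W(2) _ W(3,4)] W(4)
   by (intro exI[of _ a] conjI) blast+
 qed
 then obtain W where W: "Opn ?Y W" "y : W" "W <= W1" "ALL j<=?N. Qg j W" by (elim exE conjE)
 have "ALL i:{..m}. EX a. (ALL j<=?N. a j : reg ?Y W1) & (ALL z:W1. f i z = (\<Sum>j\<le>?N. a j z * g j z))"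
  using W1(4) unfolding Qf_def by simp
 from bchoice[OF this] obtain a where a: "ALL i:{..m}. (ALL j<=?N. a i j : reg ?Y W1) & (ALL z:W1. f i z = (\<Sum>j\<le>?N. a i j z * g j z))" ..
 have "ALL j:{..?N}. EX b. (ALL i<=m. b i : reg ?Y W) & (ALL z:W. g j z = (\<Sum>i\<le>m. b i z * f i z))"
  using W(4) unfolding Qg_def by simp
 from bchoice[OF this] obtain b where b: "ALL j:{..?N}. (ALL i<=m. b j i : reg ?Y W) & (ALL z:W. g j z = (\<Sum>i\<le>m. b j i z * f i z))" ..
 have WV: "W <= U" "W <= V" using W(3) W1(3) by auto
 show ?thesis
 proof (rule exI[of _ W], rule exI[of _ g], rule exI[of _ a], rule exI[of _ b], intro conjI allI impI ballI)
  show "a i j : reg ?Y W" if "i <= m" "j <= ?N" for i j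
   by (rule reg_mono[OF swf_hirzebruch W1(1) _ W(1,3)]) (use a that in auto)
  show "b j i : reg ?Y W" if "i <= m" "j <= ?N" for i j using b that by auto
  show "EX k. k ~= 0 & (ALL j<=?N. Phi r (rep B) j = k * g j B)" if "B : W" for B using V(4) WV(2) that by blast
  show "f i z = (\<Sum>j\<le>?N. a i j z * g j z)" if "z : W" "i <= m" for z i using a that W(3) by auto
  show "g j z = (\<Sum>i\<le>m. b j i z * f i z)" if "z : W" "j <= ?N" for z j using b that by auto
 qed (use W WV in auto)
qed

text \<open>The matrix \<open>A\<close> changes generators \<open>F\<close> into \<open>G\<close>.
  It kills no coordinate vector of \<omega>: the relation \<open>B A \<omega> = \<omega>\<close>
  holds on the dense set because \<open>B\<close> changes \<open>G\<close> back, and being a closed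
  linear condition it holds everywhere.\<close>

lemma linear_comparison:
 fixes W :: "('w, 'k::field) fspace"
 assumes W: "swf W" and D: "dense_in W D" and \<omega>: "morphism W (Proj m) \<omega>"
  and A: "!!j i. j <= n ==> i <= m ==> A j i : reg W (points W)"
  and B: "!!j i. j <= n ==> i <= m ==> B i j : reg W (points W)"
  and F: "!!d. d : D ==> d : points W ==> \<omega> d = hp m (F d)"
  and FG: "!!d i. d : D ==> d : points W ==> i <= m ==> F d i = (\<Sum>j\<le>n. B i j d * G d j)"
  and GF: "!!d j. d : D ==> d : points W ==> j <= n ==> G d j = (\<Sum>i\<le>m. A j i d * F d i)"
 shows "morphism W (Proj n) (%w. hp n (%j. \<Sum>i\<le>m. A j i w * rep (\<omega> w) i))"
  and "!!d. d : D ==> d : points W ==> hp n (%j. \<Sum>i\<le>m. A j i d * rep (\<omega> d) i) = hp n (G d)"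
proof -
 have scale: "EX c. c ~= 0 & (ALL i<=m. rep (\<omega> d) i = c * F d i) & (ALL j<=n. (\<Sum>i\<le>m. A j i d * rep (\<omega> d) i) = c * G d j)"
  if d: "d : D" "d : points W" for d
 proof -
  obtain c where c: "c ~= 0" "ALL i<=m. rep (\<omega> d) i = c * F d i" using rep_hp[of m "F d"] F[OF d] by auto
  have "(\<Sum>i\<le>m. A j i d * rep (\<omega> d) i) = c * G d j" if "j <= n" for j
   unfolding GF[OF d that] sum_distrib_left by (rule sum.cong) (use c in simp_all)
  then show ?thesis using c by blast
 qed
 show "hp n (%j. \<Sum>i\<le>m. A j i d * rep (\<omega> d) i) = hp n (G d)" if d: "d : D" "d : points W" for d
 proof -
  obtain c where "c ~= 0" "ALL j<=n. (\<Sum>i\<le>m. A j i d * rep (\<omega> d) i) = c * G d j" using scale[OF d] by blast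
  then show ?thesis by (intro hp_eqI[of c]) auto
 qed
 show "morphism W (Proj n) (%w. hp n (%j. \<Sum>i\<le>m. A j i w * rep (\<omega> w) i))"
 proof (rule morphism_linear_map[OF W \<omega> A])
  fix w assume w: "w : points W"
  \<comment> \<open>The entries of \<open>B A - 1\<close>.\<close>
  let ?C = "%i k w. (\<Sum>j\<le>n. B i j w * A j k w) - (if k = i then 1 else 0)"
  have expand: "(\<Sum>k\<le>m. ?C i k w * z k) = (\<Sum>j\<le>n. B i j w * (\<Sum>k\<le>m. A j k w * z k)) - z i" if i: "i <= m" for i w and z :: "nat => 'k"
  proof -
   have "(\<Sum>k\<le>m. ?C i k w * z k) = (\<Sum>k\<le>m. \<Sum>j\<le>n. B i j w * A j k w * z k) - (\<Sum>k\<le>m. if k = i then z k else 0)"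
    unfolding sum_subtractf[symmetric] by (rule sum.cong) (simp_all add: left_diff_distrib sum_distrib_right)
   also have "(\<Sum>k\<le>m. if k = i then z k else 0) = z i" using i by simp
   also have "(\<Sum>k\<le>m. \<Sum>j\<le>n. B i j w * A j k w * z k) = (\<Sum>j\<le>n. B i j w * (\<Sum>k\<le>m. A j k w * z k))"
    by (subst sum.swap) (simp add: sum_distrib_left mult.assoc)
   finally show ?thesis .
  qed
  have rel: "(\<Sum>k\<le>m. ?C i k w * rep (\<omega> w) k) = 0" if i: "i <= m" for i
  proof -
   have "closedin (topo W) {w : points W. (\<Sum>k\<le>m. ?C i k w * rep (\<omega> w) k) = 0}"
   proof (rule linear_relation_closed[OF W \<omega>])
    fix k assume k: "k <= m"
    show "?C i k : reg W (points W)"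
     by (rule reg_diff[OF W openin_topspace reg_sum[OF W openin_topspace reg_mult[OF W openin_topspace B A]] reg_const[OF W openin_topspace]])
      (use i k in auto)
   qed
   then have "w : {w : points W. (\<Sum>k\<le>m. ?C i k w * rep (\<omega> w) k) = 0}"
   proof (rule closedin_dense[OF D _ _ w])
    fix d assume d: "d : D" "d : points W"
    obtain c where c: "ALL i<=m. rep (\<omega> d) i = c * F d i" "ALL j<=n. (\<Sum>i\<le>m. A j i d * rep (\<omega> d) i) = c * G d j"
     using scale[OF d] by blast
    have "(\<Sum>j\<le>n. B i j d * (\<Sum>k\<le>m. A j k d * rep (\<omega> d) k)) = (\<Sum>j\<le>n. B i j d * (c * G d j))"
     by (rule sum.cong) (use c(2) in simp_all)
    also have "\<dots> = c * F d i" unfolding FG[OF d i] sum_distrib_left by (simp add: ac_simps)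
    finally have "(\<Sum>j\<le>n. B i j d * (\<Sum>k\<le>m. A j k d * rep (\<omega> d) k)) = c * F d i" .
    then show "d : {w : points W. (\<Sum>k\<le>m. ?C i k w * rep (\<omega> w) k) = 0}" unfolding mem_Collect_eq expand[OF i] using c(1) i d(2) by simp
   qed
   then show ?thesis by simp
  qed
  show "EX j<=n. (\<Sum>i\<le>m. A j i w * rep (\<omega> w) i) ~= 0"
  proof (rule ccontr)
   assume "\<not> ?thesis"
   then have "(\<Sum>j\<le>n. B i j w * (\<Sum>k\<le>m. A j k w * rep (\<omega> w) k)) = 0" for i by (intro sum.neutral) auto
   then have "rep (\<omega> w) i = 0" if "i <= m" for i using rel[OF that] unfolding expand[OF that] by simp
   then show False using rep_nonzero[OF morphism_points[OF \<omega> w]] by blast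
  qed
 qed
qed

lemma morphism_restrict_both:
 assumes "swf W" "swf X" "morphism W X f" "!!w. w : V ==> w : points W ==> f w : P"
 shows "morphism (Sub W V) (Sub X P) f"
 unfolding morphism_into_subspace_iff[OF assms(2) swf_subspace[OF assms(1)]]
 using morphism_restrict[OF assms(1,3)] assms(4) by auto

context
 fixes X :: "('x, 'k::field_char_0) fspace" and \<pi> :: "'x => (nat => 'k) set"
  and \<rho> :: "(nat => 'k) set => (nat => 'k) set" and r :: nat
 assumes X: "swf X" and \<pi>: "morphism X (hirzebruch r) \<pi>"
  and charts: "!!y. y : points (hirzebruch r) ==> EX U m f \<omega>. y : U & blowup_chart X \<pi> (hirzebruch r) (centre r) U m f \<omega>"
  and \<rho>: "morphism (model_space r) (hirzebruch r) \<rho>" "!!x y. \<rho> (aff r x y) = Cls r (vec4 1 x y 1)"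
begin

lemma off_centre_dense: "dense_in X {x. \<pi> x : Gd r}"
 unfolding dense_in_def
proof (intro allI impI)
 fix O' assume O': "Opn X O'" "O' ~= {}"
 then obtain x where x: "x : O'" by blast
 have xX: "x : points X" using x openin_subset[OF O'(1)] by blast
 obtain U m f \<omega> where U: "\<pi> x : U" and c: "blowup_chart X \<pi> (hirzebruch r) (centre r) U m f \<omega>"
  using charts[OF morphism_points[OF \<pi> xX]] by (elim exE conjE)
 have oU: "Opn (hirzebruch r) U" and d: "dense_in (Sub X {x : points X. \<pi> x : U}) {x. \<pi> x ~: centre r}"
  by (insert c[unfolded blowup_chart_def], (elim conjE, assumption)+)
 let ?P = "{x : points X. \<pi> x : U}"
 have oP: "Opn X ?P" by (rule morphism_open[OF \<pi> oU])
 have "Opn (Sub X ?P) (O' \<inter> ?P)"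
  unfolding openin_subspace_open[OF oP] using openin_Int[OF O'(1) oP] by blast
 moreover have "O' \<inter> ?P ~= {}" using x xX U by blast
 ultimately have "O' \<inter> ?P \<inter> {x. \<pi> x ~: centre r} ~= {}" using d unfolding dense_in_def by blast
 then obtain z where "z : O'" "z : points X" "\<pi> z ~: centre r" by blast
 moreover from this have "\<pi> z : Gd r" using morphism_points[OF \<pi>] unfolding centre_def by blast
 ultimately show "O' \<inter> {x. \<pi> x : Gd r} ~= {}" by blast
qed

lemma off_centre_injective:
 assumes x: "x : points X" "x' : points X" "\<pi> x = \<pi> x'" "\<pi> x : Gd r"
 shows "x = x'"
proof -
 obtain U m f \<omega> where U: "\<pi> x : U" and c: "blowup_chart X \<pi> (hirzebruch r) (centre r) U m f \<omega>"
  using charts[OF morphism_points[OF \<pi> x(1)]] by (elim exE conjE)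
 have inj: "ALL x:points X. ALL x':points X. \<pi> x : U --> \<pi> x = \<pi> x' --> \<omega> x = \<omega> x' --> x = x'"
  and \<omega>: "ALL x:points X. \<pi> x : U - centre r --> \<omega> x = hp m (%i. f i (\<pi> x))"
  by (insert c[unfolded blowup_chart_def], (elim conjE, assumption)+)
 have "\<pi> x : U - centre r" using U x(4) unfolding centre_def by blast
 then have "\<omega> x = \<omega> x'" using \<omega> x by simp
 then show ?thesis using inj x U by blast
qed

text \<open>Separatedness is not part of \<open>is_blowup\<close>. Two points are told apart either
  by their images under \<pi> or, within one chart, by \<omega>.\<close>

lemma separated_blowup:
 fixes W :: "('w, 'k) fspace"
 assumes W: "swf W" shows "separated_for W X"
proof (rule separated_forI)
 fix f g w assume f: "morphism W X f" and g: "morphism W X g" and w: "w : points W" "f w ~= g w"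
 show "EX V. Opn W V & w : V & (ALL v:V. f v ~= g v)"
 proof (cases "\<pi> (f w) = \<pi> (g w)")
  case False
  have c: "closedin (topo W) {w : points W. \<pi> (f w) = \<pi> (g w)}"
   by (rule separated_forD[OF separated_hirzebruch[OF W] morphism_comp[OF f \<pi>] morphism_comp[OF g \<pi>]])
  show ?thesis
   by (rule exI[of _ "points W - {w : points W. \<pi> (f w) = \<pi> (g w)}"])
    (use openin_diff[OF openin_topspace c] w False in auto)
 next
  case True
  obtain U m fs \<omega> where U: "\<pi> (f w) : U" and c: "blowup_chart X \<pi> (hirzebruch r) (centre r) U m fs \<omega>"
   using charts[OF morphism_points[OF morphism_comp[OF f \<pi>] w(1)]] by (elim exE conjE)
  have oU: "Opn (hirzebruch r) U"
   and inj: "ALL x:points X. ALL x':points X. \<pi> x : U --> \<pi> x = \<pi> x' --> \<omega> x = \<omega> x' --> x = x'"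
   and \<omega>: "morphism (Sub X {x : points X. \<pi> x : U}) (Proj m) \<omega>"
   by (insert c[unfolded blowup_chart_def], (elim conjE, assumption)+)
  let ?P = "{x : points X. \<pi> x : U}"
  let ?V = "{w : points W. \<pi> (f w) : U} \<inter> {w : points W. \<pi> (g w) : U}"
  have oV: "Opn W ?V"
   by (rule openin_Int[OF morphism_open[OF morphism_comp[OF f \<pi>] oU] morphism_open[OF morphism_comp[OF g \<pi>] oU]])
  have mf: "morphism (Sub W ?V) (Proj m) (%w. \<omega> (f w))"
   by (rule morphism_comp[OF morphism_restrict_both[OF W X f] \<omega>]) (use morphism_points[OF f] in blast)
  have mg: "morphism (Sub W ?V) (Proj m) (%w. \<omega> (g w))"
   by (rule morphism_comp[OF morphism_restrict_both[OF W X g] \<omega>]) (use morphism_points[OF g] in blast)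
  let ?S = "Sub W ?V"
  have S: "swf ?S" by (rule swf_subspace[OF W])
  have cl: "closedin (topo ?S) {w : points ?S. \<omega> (f w) = \<omega> (g w)}"
   by (rule separated_forD[OF separated_proj[OF S] mf mg])
  let ?O = "points ?S - {w : points ?S. \<omega> (f w) = \<omega> (g w)}"
  have "Opn ?S ?O" by (rule openin_diff[OF openin_topspace cl])
  then have "Opn W ?O" unfolding openin_subspace_open[OF oV] by blast
  moreover have "w : ?O"
  proof -
   have "\<omega> (f w) ~= \<omega> (g w)" using inj morphism_points[OF f w(1)] morphism_points[OF g w(1)] U True w(2) by blast
   then show ?thesis using w(1) U True by simp
  qed
  moreover have "ALL v:?O. f v ~= g v" by auto
  ultimately show ?thesis by blast
 qed
qed

lemma local_comparison:
 assumes y: "y : points (hirzebruch r)"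
 obtains U m f \<omega> V g a b where "blowup_chart X \<pi> (hirzebruch r) (centre r) U m f \<omega>"
  "Opn (hirzebruch r) V" "y : V" "V <= U"
  "!!i j. i <= m ==> j <= top_index r ==> a i j : reg (hirzebruch r) V"
  "!!i j. i <= m ==> j <= top_index r ==> b j i : reg (hirzebruch r) V"
  "!!B. B : V ==> Hmap r (rep B) = hp (top_index r) (%j. g j B)"
  "!!z i. z : V ==> i <= m ==> f i z = (\<Sum>j\<le>top_index r. a i j z * g j z)"
  "!!z j. z : V ==> j <= top_index r ==> g j z = (\<Sum>i\<le>m. b j i z * f i z)"
proof -
 obtain U m f \<omega> where U: "y : U" and c: "blowup_chart X \<pi> (hirzebruch r) (centre r) U m f \<omega>"
  using charts[OF y] by (elim exE conjE)
 from comparison_matrices[OF U c] obtain V g a b where V: "Opn (hirzebruch r) V" "y : V" "V <= U"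
  "ALL i<=m. ALL j<=top_index r. a i j : reg (hirzebruch r) V & b j i : reg (hirzebruch r) V"
  "ALL B:V. EX k. k ~= 0 & (ALL j<=top_index r. Phi r (rep B) j = k * g j B)"
  "ALL z:V. (ALL i<=m. f i z = (\<Sum>j\<le>top_index r. a i j z * g j z)) &
    (ALL j<=top_index r. g j z = (\<Sum>i\<le>m. b j i z * f i z))" by (elim exE conjE)
 have "Hmap r (rep B) = hp (top_index r) (%j. g j B)" if B: "B : V" for B
 proof -
  obtain k where "k ~= 0" "ALL j<=top_index r. Phi r (rep B) j = k * g j B" using V(5) B by blast
  then show ?thesis unfolding Hmap_def by (intro hp_eqI[of k]) auto
 qed
 note h = this
 show thesis
 proof (rule that[OF c V(1-3) _ _ h])
  show "f i z = (\<Sum>j\<le>top_index r. a i j z * g j z)" if "z : V" "i <= m" for z i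
   using bspec[OF V(6) that(1)] that(2) by blast
  show "g j z = (\<Sum>i\<le>m. b j i z * f i z)" if "z : V" "j <= top_index r" for z j
   using bspec[OF V(6) that(1)] that(2) by blast
 qed (use V(4) in blast)+
qed

text \<open>Off the two points the map is forced; near them it is extended by applying the generator
  matrix \<open>b\<close> to \<omega>.\<close>

lemma to_model_exists:
 obtains \<Theta> where "morphism X (model_space r) \<Theta>" "!!x. x : points X ==> \<pi> x : Gd r ==> \<Theta> x = Hmap r (rep (\<pi> x))"
proof -
 let ?Y = "hirzebruch r :: 'k pspace" and ?N = "top_index r"
 let ?D = "{x. \<pi> x : Gd r}"
 have loc: "EX V f. Opn X V & x : V & morphism (Sub X V) (Proj ?N) f &
   (ALL d:?D \<inter> V. f d = Hmap r (rep (\<pi> d)))" if x: "x : points X" for x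
 proof -
  obtain U m f \<omega> V g a b where c: "blowup_chart X \<pi> ?Y (centre r) U m f \<omega>"
  and V: "Opn ?Y V" "\<pi> x : V" "V <= U"
  and a: "!!i j. i <= m ==> j <= ?N ==> a i j : reg ?Y V"
  and b: "!!i j. i <= m ==> j <= ?N ==> b j i : reg ?Y V"
  and g: "!!B. B : V ==> Hmap r (rep B) = hp ?N (%j. g j B)"
  and fg: "!!z i. z : V ==> i <= m ==> f i z = (\<Sum>j\<le>?N. a i j z * g j z)"
  and gf: "!!z j. z : V ==> j <= ?N ==> g j z = (\<Sum>i\<le>m. b j i z * f i z)"
   by (rule local_comparison[OF morphism_points[OF \<pi> x]]) (rule that; assumption)
  have \<omega>: "morphism (Sub X {x : points X. \<pi> x : U}) (Proj m) \<omega>"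
   and \<omega>f: "ALL x:points X. \<pi> x : U - centre r --> \<omega> x = hp m (%i. f i (\<pi> x))"
   by (insert c[unfolded blowup_chart_def], (elim conjE, assumption)+)
  let ?V = "{x : points X. \<pi> x : V}"
  let ?W = "Sub X ?V"
  have oV: "Opn X ?V" by (rule morphism_open[OF \<pi> V(1)])
  have W: "swf ?W" by (rule swf_subspace[OF X])
  have pW: "points ?W = ?V" by auto
  have D: "dense_in ?W ?D" by (rule dense_in_subspace[OF off_centre_dense oV])
  have \<omega>W: "morphism ?W (Proj m) \<omega>" by (rule subspace_subspace_morphism[OF X \<omega>]) (use V(3) in blast)
  have pull: "(%x. h (\<pi> x)) : reg ?W (points ?W)" if "h : reg ?Y V" for h
   unfolding pW reg_subspace_open[OF X oV oV subset_refl] by (rule morphism_reg[OF \<pi> V(1) that])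
  have F: "\<omega> d = hp m (%i. f i (\<pi> d))" if "d : ?D" "d : points ?W" for d
   using \<omega>f that V(3) unfolding pW centre_def by blast
  have A: "(%x. b j i (\<pi> x)) : reg ?W (points ?W)" if "j <= ?N" "i <= m" for i j by (rule pull[OF b[OF that(2,1)]])
  have B: "(%x. a i j (\<pi> x)) : reg ?W (points ?W)" if "j <= ?N" "i <= m" for i j by (rule pull[OF a[OF that(2,1)]])
  have FG: "f i (\<pi> d) = (\<Sum>j\<le>?N. a i j (\<pi> d) * g j (\<pi> d))" if "d : ?D" "d : points ?W" "i <= m" for d i
   using fg that(2,3) unfolding pW by blast
  have GF: "g j (\<pi> d) = (\<Sum>i\<le>m. b j i (\<pi> d) * f i (\<pi> d))" if "d : ?D" "d : points ?W" "j <= ?N" for d j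
   using gf that(2,3) unfolding pW by blast
  note lc = linear_comparison[where n = ?N and A = "%j i x. b j i (\<pi> x)" and B = "%i j x. a i j (\<pi> x)" and
   F = "%d i. f i (\<pi> d)" and G = "%d j. g j (\<pi> d)", OF W D \<omega>W A B F FG GF]
  let ?f = "%x. hp ?N (%j. \<Sum>i\<le>m. b j i (\<pi> x) * rep (\<omega> x) i)"
  have "?f d = Hmap r (rep (\<pi> d))" if "d : ?D \<inter> ?V" for d
  proof -
   have "?f d = hp ?N (%j. g j (\<pi> d))" by (rule lc(2)) (use that pW in auto)
   then show ?thesis using g that by auto
  qed
  moreover have "morphism ?W (Proj ?N) ?f" by (rule lc(1))
  moreover have "x : ?V" using x V(2) by blast
  ultimately show ?thesis using oV by blast
 qed
 obtain \<Theta> where \<Theta>: "morphism X (Proj ?N) \<Theta>" "!!d. d : ?D ==> d : points X ==> \<Theta> d = Hmap r (rep (\<pi> d))"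
  by (rule glue_morphism[OF X off_centre_dense separated_proj[OF swf_subspace[OF X]] loc], assumption) (rule that; assumption)
 have "\<Theta> x : model r" if x: "x : points X" for x
 proof (rule closed_image_model[OF X \<Theta>(1) off_centre_dense _ x])
  fix e assume e: "e : ?D" "e : points X"
  then have "rep (\<pi> e) : good r" unfolding Gd_def by blast
  then show "\<Theta> e : model r" unfolding \<Theta>(2)[OF e] by (rule Hmap_model)
 qed
 then have "morphism X (model_space r) \<Theta>"
  unfolding model_space_def morphism_into_subspace_iff[OF swf_proj X] using \<Theta>(1) by blast
 then show thesis using that \<Theta>(2) by blast
qed

text \<open>The lifting clause of \<open>blowup_chart\<close> is applied to an open part of the
  model, with \<rho> as the map to the base and the matrix \<open>a\<close> applied to the
  coordinates as the map to projective space.\<close>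

lemma from_model_local:
 assumes \<zeta>: "\<zeta> : model r"
 shows "EX V \<xi>. Opn (model_space r) V & \<zeta> : V & morphism (Sub (model_space r) V) X \<xi> &
  (ALL \<eta>:V. \<pi> (\<xi> \<eta>) = \<rho> \<eta>)"
proof -
 let ?Y = "hirzebruch r :: 'k pspace" and ?N = "top_index r"
 let ?M = "model_space r :: 'k pspace"
 let ?D = "aff_points r :: (nat => 'k) set set"
 have \<zeta>M: "\<zeta> : points ?M" using \<zeta> points_model by blast
 obtain U m f \<omega> V g a b where c: "blowup_chart X \<pi> ?Y (centre r) U m f \<omega>"
  and V: "Opn ?Y V" "\<rho> \<zeta> : V" "V <= U"
  and a: "!!i j. i <= m ==> j <= ?N ==> a i j : reg ?Y V"
  and b: "!!i j. i <= m ==> j <= ?N ==> b j i : reg ?Y V"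
  and g: "!!B. B : V ==> Hmap r (rep B) = hp ?N (%j. g j B)"
  and fg: "!!z i. z : V ==> i <= m ==> f i z = (\<Sum>j\<le>?N. a i j z * g j z)"
  and gf: "!!z j. z : V ==> j <= ?N ==> g j z = (\<Sum>i\<le>m. b j i z * f i z)"
  by (rule local_comparison[OF morphism_points[OF \<rho>(1) \<zeta>M]]) (rule that; assumption)
 have fnz: "ALL y:U - centre r. EX i<=m. f i y ~= 0"
  and lift: "ALL (W :: 'k pspace) \<alpha> \<beta> D. swf W --> morphism W ?Y \<alpha> --> \<alpha> ` points W <= U -->
    morphism W (Proj m) \<beta> --> dense_in W D -->
    (ALL d:D \<inter> points W. (EX i<=m. f i (\<alpha> d) ~= 0) & \<beta> d = hp m (%i. f i (\<alpha> d))) -->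
    (EX \<xi>. morphism W X \<xi> & (ALL w:points W. \<pi> (\<xi> w) = \<alpha> w & \<omega> (\<xi> w) = \<beta> w))"
  by (insert c[unfolded blowup_chart_def], (elim conjE, assumption)+)
 let ?V = "{\<eta> : points ?M. \<rho> \<eta> : V}"
 let ?W = "Sub ?M ?V"
 have oV: "Opn ?M ?V" by (rule morphism_open[OF \<rho>(1) V(1)])
 have W: "swf ?W" by (rule swf_subspace[OF swf_model])
 have pW: "points ?W = ?V" by auto
 have D: "dense_in ?W ?D" by (rule dense_in_subspace[OF dense_model oV])
 have \<rho>D: "\<rho> d : Gd r" if dD: "d : ?D" for d
 proof -
  obtain x y where d: "d = aff r x y" using dD unfolding aff_points_def by blast
  have "vec4 1 x y 1 : Dom" by (simp add: vec4_domain)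
  then show ?thesis unfolding d \<rho>(2) using class_Gd good_affine by blast
 qed
 have pull: "(%x. h (\<rho> x)) : reg ?W (points ?W)" if "h : reg ?Y V" for h
  unfolding pW reg_subspace_open[OF swf_model oV oV subset_refl] by (rule morphism_reg[OF \<rho>(1) V(1) that])
 have A: "(%x. a i j (\<rho> x)) : reg ?W (points ?W)" if "i <= m" "j <= ?N" for i j by (rule pull[OF a[OF that]])
 have B: "(%x. b j i (\<rho> x)) : reg ?W (points ?W)" if "i <= m" "j <= ?N" for i j by (rule pull[OF b[OF that]])
 have F: "d = hp ?N (%j. g j (\<rho> d))" if "d : ?D" "d : points ?W" for d
 proof -
  have "d : model r" "\<rho> d : V" using that(2) unfolding pW points_model by auto
  then show ?thesis using Hmap_rho[OF \<rho> _ \<rho>D[OF that(1)]] g by metis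
 qed
 have FG: "g j (\<rho> d) = (\<Sum>i\<le>m. b j i (\<rho> d) * f i (\<rho> d))" if "d : ?D" "d : points ?W" "j <= ?N" for d j
  using gf that(2,3) unfolding pW by blast
 have GF: "f i (\<rho> d) = (\<Sum>j\<le>?N. a i j (\<rho> d) * g j (\<rho> d))" if "d : ?D" "d : points ?W" "i <= m" for d i
  using fg that(2,3) unfolding pW by blast
 note lc = linear_comparison[where n = m and A = "%i j x. a i j (\<rho> x)" and B = "%j i x. b j i (\<rho> x)" and
  F = "%d j. g j (\<rho> d)" and G = "%d i. f i (\<rho> d)", OF W D morphism_restrict[OF swf_model morphism_model] A B F FG GF]
 let ?\<beta> = "%\<eta>. hp m (%i. \<Sum>j\<le>?N. a i j (\<rho> \<eta>) * rep \<eta> j)"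
 have \<beta>: "morphism ?W (Proj m) ?\<beta>" by (rule lc(1))
 have \<alpha>: "morphism ?W ?Y \<rho>" by (rule morphism_restrict[OF swf_model \<rho>(1)])
 have img: "\<rho> ` points ?W <= U" using V(3) unfolding pW by blast
 have dd: "ALL d:?D \<inter> points ?W. (EX i<=m. f i (\<rho> d) ~= 0) & ?\<beta> d = hp m (%i. f i (\<rho> d))"
 proof (intro ballI conjI)
  fix d assume d: "d : ?D \<inter> points ?W"
  show "EX i<=m. f i (\<rho> d) ~= 0"
   by (rule bspec[OF fnz]) (use d \<rho>D[of d] V(3) in \<open>unfold pW centre_def, blast\<close>)
  show "?\<beta> d = hp m (%i. f i (\<rho> d))" by (rule lc(2)) (use d in blast)+
 qed
 obtain \<xi> where \<xi>: "morphism ?W X \<xi>" "ALL w:points ?W. \<pi> (\<xi> w) = \<rho> w & \<omega> (\<xi> w) = ?\<beta> w"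
  using lift[THEN spec, THEN spec, THEN spec, THEN spec, THEN mp, THEN mp, THEN mp, THEN mp, THEN mp, THEN mp, OF W \<alpha> img \<beta> D dd]
  by (elim exE conjE)
 have "ALL \<eta>:?V. \<pi> (\<xi> \<eta>) = \<rho> \<eta>" using \<xi>(2) unfolding pW by blast
 moreover have "\<zeta> : ?V" using \<zeta>M V(2) by blast
 ultimately show ?thesis using oV \<xi>(1) by blast
qed

text \<open>The local lifts glue since \<pi> is injective off the two points, and the two maps are
  inverse to each other because they are so on dense sets.\<close>

lemma blowup_isomorphic_model: "isomorphic_spaces X (model_space r)"
proof -
 let ?M = "model_space r :: 'k pspace"
 let ?D = "aff_points r :: (nat => 'k) set set"
 let ?G = "{x. \<pi> x : Gd r}"
 have \<rho>D: "\<rho> d : Gd r" if dD: "d : ?D" for d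
 proof -
  obtain x y where d: "d = aff r x y" using dD unfolding aff_points_def by blast
  have "vec4 1 x y 1 : Dom" by (simp add: vec4_domain)
  then show ?thesis unfolding d \<rho>(2) using class_Gd good_affine by blast
 qed
 obtain \<Theta> where \<Theta>: "morphism X ?M \<Theta>" "!!x. x : points X ==> \<pi> x : Gd r ==> \<Theta> x = Hmap r (rep (\<pi> x))"
  by (rule to_model_exists) (rule that; assumption)
 \<comment> \<open>Over the affine plane the preimage under \<pi> is a single point, so this choice
   is the value that every local lift must take.\<close>
 define R where "R \<zeta> = (SOME x. x : points X & \<pi> x = \<rho> \<zeta>)" for \<zeta>
 have R: "R \<zeta> = x" if "x : points X" "\<pi> x = \<rho> \<zeta>" "\<rho> \<zeta> : Gd r" for x \<zeta>
  unfolding R_def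
 proof (rule some_equality)
  fix x' assume "x' : points X & \<pi> x' = \<rho> \<zeta>"
  then show "x' = x" using off_centre_injective[OF that(1), of x'] that(2,3) by simp
 qed (use that in simp)
 have loc: "EX V f. Opn ?M V & \<zeta> : V & morphism (Sub ?M V) X f & (ALL d:?D \<inter> V. f d = R d & \<pi> (f d) = \<rho> d)"
  if \<zeta>: "\<zeta> : points ?M" for \<zeta>
 proof -
  obtain V \<xi> where V: "Opn ?M V" "\<zeta> : V" "morphism (Sub ?M V) X \<xi>" "ALL \<eta>:V. \<pi> (\<xi> \<eta>) = \<rho> \<eta>"
   using from_model_local[OF \<zeta>[unfolded points_model]] by (elim exE conjE)
  have "\<xi> d = R d & \<pi> (\<xi> d) = \<rho> d" if d: "d : ?D \<inter> V" for d
  proof -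
   have "d : points (Sub ?M V)" using d openin_subset[OF V(1)] by auto
   then have "\<xi> d : points X" by (rule morphism_points[OF V(3)])
   then show ?thesis using R[of "\<xi> d" d] V(4) d \<rho>D by auto
  qed
  then show ?thesis using V by blast
 qed
 have loc': "EX V f. Opn ?M V & \<zeta> : V & morphism (Sub ?M V) X f & (ALL d:?D \<inter> V. f d = R d)"
  if "\<zeta> : points ?M" for \<zeta> using loc[OF that] by (elim exE conjE, intro exI conjI) (assumption | blast)+
 obtain \<eta> where \<eta>: "morphism ?M X \<eta>" "!!d. d : ?D ==> d : points ?M ==> \<eta> d = R d"
  by (rule glue_morphism[OF swf_model dense_model separated_blowup[OF swf_subspace[OF swf_model]] loc'], assumption) (rule that; assumption)
 have \<pi>D: "\<pi> (\<eta> d) = \<rho> d" if d: "d : ?D" "d : points ?M" for d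
 proof -
  obtain V f where "d : V" "ALL d:?D \<inter> V. f d = R d & \<pi> (f d) = \<rho> d" using loc[OF d(2)] by (elim exE conjE)
  then have "f d = R d" "\<pi> (f d) = \<rho> d" using d(1) by blast+
  then show ?thesis unfolding \<eta>(2)[OF d] by metis
 qed
 have \<pi>\<eta>: "\<pi> (\<eta> \<zeta>) = \<rho> \<zeta>" if "\<zeta> : points ?M" for \<zeta>
  by (rule agree_on_dense[OF separated_hirzebruch[OF swf_model] dense_model morphism_comp[OF \<eta>(1) \<pi>] \<rho>(1) \<pi>D that])
 have e1: "\<Theta> (\<eta> \<zeta>) = \<zeta>" if "\<zeta> : points ?M" for \<zeta>
 proof (rule agree_on_dense[OF separated_proj[OF swf_model] dense_model morphism_comp[OF morphism_comp[OF \<eta>(1) \<Theta>(1)] morphism_model] morphism_model _ that])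
  fix d assume d: "d : ?D" "d : points ?M"
  show "\<Theta> (\<eta> d) = d"
   using \<Theta>(2)[OF morphism_points[OF \<eta>(1) d(2)]] \<pi>D[OF d] \<rho>D[OF d(1)] Hmap_rho[OF \<rho>, of d] d(2) unfolding points_model by simp
 qed
 have e2: "\<eta> (\<Theta> x) = x" if "x : points X" for x
 proof (rule agree_on_dense[OF separated_blowup[OF X] off_centre_dense morphism_comp[OF \<Theta>(1) \<eta>(1)] morphism_id[OF X] _ that])
  fix d assume d: "d : ?G" "d : points X"
  have g: "\<pi> d : points (hirzebruch r)" "rep (\<pi> d) : good r" using d(1) unfolding Gd_def by auto
  have t: "\<Theta> d : points ?M" by (rule morphism_points[OF \<Theta>(1) d(2)])
  have "\<rho> (\<Theta> d) = Cls r (rep (\<pi> d))" unfolding \<Theta>(2)[OF d(2) d(1)[simplified]] by (rule rho_Hmap[OF \<rho> g(2)])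
  then have "\<pi> (\<eta> (\<Theta> d)) = \<pi> d" unfolding \<pi>\<eta>[OF t] class_rep[OF g(1)] .
  then show "\<eta> (\<Theta> d) = d" using off_centre_injective[OF morphism_points[OF \<eta>(1) t] d(2)] d(1) by simp
 qed
 show ?thesis unfolding isomorphic_spaces_def
  by (rule exI[of _ \<Theta>], rule isomorphismI[OF \<Theta>(1) \<eta>(1)]) (use e1 e2 in auto)
qed

end

subsection \<open>Moving the centre into standard position\<close>

text \<open>Automorphisms of the ruling: a linear map of \<open>(v 0, v 1)\<close>, and on the
  fibers a scaling followed by adding a multiple of \<open>v 3\<close> times the \<open>r\<close>-th
  power of a linear form. The power makes it compatible with the torus.\<close>

definition fibred_map :: "nat => 'k::field => 'k => 'k => 'k => 'k => 'k => 'k => 'k => (nat => 'k) => nat => 'k" where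
 "fibred_map r a b c d s e g h v =
  vec4 (a * v 0 + b * v 1) (c * v 0 + d * v 1) (s * v 2 + e * (g * v 0 + h * v 1) ^ r * v 3) (v 3)"

lemma fibred_map_torus:
 assumes "k ~= 0"
 shows "fibred_map r a b c d s e g h (torus r k l v) = torus r k l (fibred_map r a b c d s e g h v)"
proof -
 have 1: "g * (k * v 0) + h * (k * v 1) = k * (g * v 0 + h * v 1)" for g h by (simp add: algebra_simps)
 have 2: "e * (k * (g * v 0 + h * v 1)) ^ r * (inverse (k ^ r) * l * v 3) = l * (e * (g * v 0 + h * v 1) ^ r * v 3)"
  unfolding power_mult_distrib using assms by simp
 have 3: "s * (l * v 2) + l * z = l * (s * v 2 + z)" for z by (simp add: algebra_simps)
 show ?thesis unfolding fibred_map_def torus_def vec4_simps 1 2 3 ..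
qed

lemma fibred_map_domain:
 assumes "a * d - b * c ~= 0" "s ~= 0" "v : Dom"
 shows "fibred_map r a b c d s e g h v : Dom"
proof -
 have "v 0 = 0 & v 1 = 0" if z: "a * v 0 + b * v 1 = 0" "c * v 0 + d * v 1 = 0"
 proof -
  have "(a * d - b * c) * v 0 = d * (a * v 0 + b * v 1) - b * (c * v 0 + d * v 1)"
   "(a * d - b * c) * v 1 = a * (c * v 0 + d * v 1) - c * (a * v 0 + b * v 1)" by (simp_all add: algebra_simps)
  then show ?thesis unfolding z using assms(1) by simp
 qed
 then show ?thesis using assms(2,3) unfolding fibred_map_def vec4_domain by (auto simp: hirzebruch_domain_def)
qed

lemma fibred_map_class:
 assumes "v : Dom"
 shows "Cls r (fibred_map r a b c d s e g h (rep (Cls r v))) = Cls r (fibred_map r a b c d s e g h v)"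
proof -
 obtain k l where kl: "k ~= 0" "l ~= 0" "rep (Cls r v) = torus r k l v" using rep_class by metis
 show ?thesis unfolding kl(3) fibred_map_torus[OF kl(1)] by (rule class_torus[OF kl(1,2)])
qed

lemma morphism_fibred_map:
 fixes a :: "'k::field"
 assumes nz: "a * d - b * c ~= 0" "s ~= 0"
 shows "morphism (hirzebruch r) (hirzebruch r) (%A. Cls r (fibred_map r a b c d s e g h (rep A)))"
proof -
 let ?S = "Sub (Aff 4 :: 'k aspace) Dom"
 let ?F = "fibred_map r a b c d s e g h"
 have p: "F : reg ?S (points ?S)" if "F : Polys 4" for F
  unfolding points_domain by (rule domain_poly_reg[OF that])
 have "morphism ?S (hirzebruch r) (%v. Cls r (?F v))"
  unfolding fibred_map_def
 proof (rule morphism_class_vec4[OF swf_domain p p p p])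
  fix v assume "v : points ?S"
  then have "?F v : Dom" unfolding points_domain by (rule fibred_map_domain[OF nz])
  then show "(a * v 0 + b * v 1 ~= 0 | c * v 0 + d * v 1 ~= 0) & (s * v 2 + e * (g * v 0 + h * v 1) ^ r * v 3 ~= 0 | v 3 ~= 0)"
   unfolding fibred_map_def vec4_domain .
 qed (simp_all add: poly_ops)
 then have "morphism ?S (hirzebruch r) (%v. Cls r (?F (rep (Cls r v))))"
  by (rule morphism_cong[OF swf_domain]) (use fibred_map_class points_domain in blast)
 then show ?thesis unfolding hirzebruch_def[of r] by (rule morphism_from_quotient)
qed

lemma centre_eq: "centre r = {Cls r (vec4 0 1 0 1), Cls r (vec4 0 1 1 1)}"
proof
 show "{Cls r (vec4 0 1 0 1), Cls r (vec4 0 1 1 (1::'a))} <= centre r"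
 proof -
  have d: "vec4 0 1 x (1::'a) : Dom" for x by (simp add: vec4_domain)
  have "vec4 0 1 0 (1::'a) ~: good r" "vec4 0 1 1 (1::'a) ~: good r" by (simp_all add: good_def)
  then show ?thesis unfolding centre_def using class_Gd[OF d, of r] class_points[OF d, of r] by blast
 qed
next
 show "centre r <= {Cls r (vec4 0 1 0 1), Cls r (vec4 0 1 1 (1::'a))}"
 proof
  fix A :: "(nat => 'a) set" assume A: "A : centre r"
  then have p: "A : points (hirzebruch r)" unfolding centre_def by blast
  note c = centre_cases[OF A]
  let ?x = "rep A 2 / (rep A 1 ^ r * rep A 3)"
  have "Cls r (vec4 (rep A 0) (rep A 1) (rep A 2) (rep A 3)) = Cls r (vec4 0 1 ?x 1)"
   by (rule class_vec4_eqI[of "rep A 1" "rep A 1 ^ r * rep A 3"]) (use c in auto)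
  then have "A = Cls r (vec4 0 1 ?x 1)"
   using class_rep[OF p] unfolding vec4_eta[OF domain_affine[OF rep_domain[OF p]]] by metis
  moreover have "?x = 0 | ?x = 1"
  proof (cases "rep A 2 = 0")
   case False
   then have "rep A 2 = rep A 1 ^ r * rep A 3" using c by blast
   then show ?thesis using False by simp
  qed simp
  ultimately obtain z where z: "A = Cls r (vec4 0 1 z 1)" "z = 0 | z = 1" by blast
  from z(2) show "A : {Cls r (vec4 0 1 0 1), Cls r (vec4 0 1 1 1)}"
   unfolding z(1) by (elim disjE) simp_all
 qed
qed

text \<open>Off the zero section \<open>v 3\<close> can be scaled to \<open>1\<close>, and two
  points of one fiber can be given the same base coordinates by rescaling one of them.\<close>

lemma fiber_normal_form:
 fixes p q :: "(nat => 'k::field) set"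
 assumes "p : hirzebruch_fiber r b - hirzebruch_zero_section r" "q : hirzebruch_fiber r b - hirzebruch_zero_section r"
 obtains b0 b1 x y where "b0 ~= 0 | b1 ~= 0" "p = Cls r (vec4 b0 b1 x 1)" "q = Cls r (vec4 b0 b1 y 1)"
proof -
 obtain v where v: "p = Cls r v" "v : Dom" "proj_class (%i. if i < 2 then v i else 0) = b"
  using assms(1) unfolding hirzebruch_fiber_def by blast
 obtain w where w: "q = Cls r w" "w : Dom" "proj_class (%i. if i < 2 then w i else 0) = b"
  using assms(2) unfolding hirzebruch_fiber_def by blast
 have v3: "v 3 ~= 0" using assms(1) v(1,2) unfolding hirzebruch_zero_section_def by blast
 have w3: "w 3 ~= 0" using assms(2) w(1,2) unfolding hirzebruch_zero_section_def by blast
 have "(%i. if i < 2 then w i else 0) : proj_class (%i. if i < 2 then w i else 0)"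
  unfolding proj_class_def by (rule CollectI, rule exI[of _ 1]) auto
 then have "(%i. if i < 2 then w i else 0) : proj_class (%i. if i < 2 then v i else 0)" unfolding w(3) v(3) .
 then obtain k where k: "k ~= 0" "(%i. if i < 2 then w i else 0) = (%i. k * (if i < 2 then v i else 0))"
  unfolding proj_class_def by blast
 have wk: "w 0 = k * v 0" "w 1 = k * v 1" using fun_cong[OF k(2), of 0] fun_cong[OF k(2), of 1] by simp_all
 show thesis
 proof (rule that)
  show "v 0 ~= 0 | v 1 ~= 0" using v(2) unfolding hirzebruch_domain_def by blast
  have "Cls r (vec4 (v 0) (v 1) (v 2) (v 3)) = Cls r (vec4 (v 0) (v 1) (v 2 / v 3) 1)"
   by (rule class_vec4_eqI[of 1 "v 3"]) (use v3 in auto)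
  then show "p = Cls r (vec4 (v 0) (v 1) (v 2 / v 3) 1)" unfolding vec4_eta[OF domain_affine[OF v(2)]] v(1) .
  have "Cls r (vec4 (w 0) (w 1) (w 2) (w 3)) = Cls r (vec4 (v 0) (v 1) (w 2 / (k ^ r * w 3)) 1)"
   by (rule class_vec4_eqI[of k "k ^ r * w 3"]) (use w3 wk k(1) in auto)
  then show "q = Cls r (vec4 (v 0) (v 1) (w 2 / (k ^ r * w 3)) 1)" unfolding vec4_eta[OF domain_affine[OF w(2)]] w(1) .
 qed
qed

text \<open>A linear change of base coordinates moves the fiber to \<open>v 0 = 0\<close>; an affine
  change of \<open>v 2\<close> along the fiber then moves the two points to \<open>0\<close> and
  \<open>1\<close>.\<close>

lemma centre_standard_position:
 fixes p q :: "(nat => 'k::field) set"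
 assumes pq: "p : hirzebruch_fiber r b - hirzebruch_zero_section r" "q : hirzebruch_fiber r b - hirzebruch_zero_section r" "p ~= q"
 obtains t t' where "morphism (hirzebruch r) (hirzebruch r) t" "morphism (hirzebruch r) (hirzebruch r) t'"
  "!!A. A : points (hirzebruch r) ==> t' (t A) = A" "!!A. A : points (hirzebruch r) ==> t (t' A) = A"
  "{p, q} <= points (hirzebruch r)" "t ` {p, q} = centre r"
proof -
 obtain b0 b1 x y where B: "b0 ~= 0 | b1 ~= 0" and p: "p = Cls r (vec4 b0 b1 x 1)" and q: "q = Cls r (vec4 b0 b1 y 1)"
  by (rule fiber_normal_form[OF pq(1,2)])
 have xy: "y - x ~= 0" using p q pq(3) by auto
 have "EX c0 c1. c0 * b0 + c1 * b1 = 1"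
 proof (cases "b0 = 0")
  case True then show ?thesis using B by (intro exI[of _ 0] exI[of _ "1 / b1"]) simp
 next
  case False then show ?thesis by (intro exI[of _ "1 / b0"] exI[of _ 0]) simp
 qed
 then obtain c0 c1 where c: "c0 * b0 + c1 * b1 = 1" by blast
 \<comment> \<open>The base matrix with rows \<open>(b1, -b0)\<close> and \<open>(c0, c1)\<close>
   has determinant \<open>1\<close> and sends \<open>(b0, b1)\<close> to \<open>(0, 1)\<close>. The
   form \<open>c0 v 0 + c1 v 1\<close> is \<open>1\<close> at the fiber, and after the change it is
   the second coordinate; hence the coefficients \<open>0\<close> and \<open>1\<close> in the
   inverse.\<close>
 let ?T = "fibred_map r b1 (- b0) c0 c1 (1 / (y - x)) (- x / (y - x)) c0 c1"
 let ?T' = "fibred_map r c1 b0 (- c0) b1 (y - x) x 0 1"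
 let ?t = "%A. Cls r (?T (rep A))" and ?t' = "%A. Cls r (?T' (rep A))"
 have n: "b1 * c1 - - b0 * c0 ~= 0" "1 / (y - x) ~= 0" "c1 * b1 - b0 * - c0 ~= 0" using c xy by (simp_all add: ac_simps)
 have l0: "c1 * (b1 * a0 + - b0 * a1) + b0 * (c0 * a0 + c1 * a1) = a0" "- c0 * (b1 * a0 + - b0 * a1) + b1 * (c0 * a0 + c1 * a1) = a1"
  for a0 a1
 proof -
  have "c1 * (b1 * a0 + - b0 * a1) + b0 * (c0 * a0 + c1 * a1) = (c0 * b0 + c1 * b1) * a0"
   "- c0 * (b1 * a0 + - b0 * a1) + b1 * (c0 * a0 + c1 * a1) = (c0 * b0 + c1 * b1) * a1" by (simp_all add: algebra_simps)
  then show "c1 * (b1 * a0 + - b0 * a1) + b0 * (c0 * a0 + c1 * a1) = a0" "- c0 * (b1 * a0 + - b0 * a1) + b1 * (c0 * a0 + c1 * a1) = a1"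
   unfolding c by simp_all
 qed
 have l1: "b1 * (c1 * a0 + b0 * a1) + - b0 * (- c0 * a0 + b1 * a1) = a0" "c0 * (c1 * a0 + b0 * a1) + c1 * (- c0 * a0 + b1 * a1) = a1"
  for a0 a1
 proof -
  have "b1 * (c1 * a0 + b0 * a1) + - b0 * (- c0 * a0 + b1 * a1) = (c0 * b0 + c1 * b1) * a0"
   "c0 * (c1 * a0 + b0 * a1) + c1 * (- c0 * a0 + b1 * a1) = (c0 * b0 + c1 * b1) * a1" by (simp_all add: algebra_simps)
  then show "b1 * (c1 * a0 + b0 * a1) + - b0 * (- c0 * a0 + b1 * a1) = a0" "c0 * (c1 * a0 + b0 * a1) + c1 * (- c0 * a0 + b1 * a1) = a1"
   unfolding c by simp_all
 qed
 have TT: "?T' (?T v) = v" "?T (?T' v) = v" if v: "v : Dom" for v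
 proof -
  have e': "D * (1 / D * v 2 + - x / D * L * v 3) + x * L * v 3 = v 2" "1 / D * (D * v 2 + x * L * v 3) + - x / D * L * v 3 = v 2"
   if "D ~= 0" for L D using that by (simp_all add: field_simps)
  note e = e'[OF xy]
  show "?T' (?T v) = v" "?T (?T' v) = v"
   unfolding fibred_map_def vec4_simps l0 l1 mult_zero_left mult_1_left add_0_left e by (rule vec4_eta[OF domain_affine[OF v]])+
 qed
 have dp: "vec4 b0 b1 z 1 : Dom" for z using B by (simp add: vec4_domain)
 have cb: "b1 * b0 + - b0 * b1 = 0" by simp
 have "?T (vec4 b0 b1 x 1) = vec4 0 1 0 1" "?T (vec4 b0 b1 y 1) = vec4 0 1 1 1"
  unfolding fibred_map_def vec4_simps c cb using xy by (simp_all add: diff_divide_distrib[symmetric])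
 then have tp: "?t p = Cls r (vec4 0 1 0 1)" "?t q = Cls r (vec4 0 1 1 1)"
  unfolding p q fibred_map_class[OF dp] by simp_all
 show thesis
 proof (rule that[of ?t ?t'])
  show "morphism (hirzebruch r) (hirzebruch r) ?t" by (rule morphism_fibred_map[OF n(1,2)])
  show "morphism (hirzebruch r) (hirzebruch r) ?t'" by (rule morphism_fibred_map[OF n(3) xy])
  fix A :: "(nat => 'k) set" assume A: "A : points (hirzebruch r)"
  note d = rep_domain[OF A]
  show "?t' (?t A) = A" unfolding fibred_map_class[OF fibred_map_domain[OF n(1,2) d]] TT(1)[OF d] by (rule class_rep[OF A])
  show "?t (?t' A) = A" unfolding fibred_map_class[OF fibred_map_domain[OF n(3) xy d]] TT(2)[OF d] by (rule class_rep[OF A])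
 next
  show "{p, q} <= points (hirzebruch r)" unfolding p q using class_points[OF dp] by blast
  show "?t ` {p, q} = centre r" unfolding centre_eq image_insert image_empty tp ..
 qed
qed

section \<open>Every blowup in question is isomorphic to the model\<close>

lemma blowup_two_points_model:
 fixes X :: "('x, 'k::field_char_0) fspace"
 assumes r: "1 <= r"
  and pq: "p : hirzebruch_fiber r b - hirzebruch_zero_section r" "q : hirzebruch_fiber r b - hirzebruch_zero_section r" "p ~= q"
  and bl: "is_blowup X \<pi> (hirzebruch r) {p, q}"
 shows "isomorphic_spaces X (model_space r)"
proof -
 let ?Y = "hirzebruch r :: 'k pspace"
 have X: "swf X" and \<pi>: "morphism X ?Y \<pi>" using bl unfolding is_blowup_def by blast+
 obtain t t' where t: "morphism ?Y ?Y t" "morphism ?Y ?Y t'" "!!A. A : points ?Y ==> t' (t A) = A"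
  "!!A. A : points ?Y ==> t (t' A) = A" and S: "{p, q} <= points ?Y" "t ` {p, q} = centre r"
  by (rule centre_standard_position[OF pq]) (rule that; assumption)
 \<comment> \<open>Writing the pair as a preimage of \<open>centre r\<close>, known to be closed,
   shows that it is closed.\<close>
 have "{p, q} = {A : points ?Y. t A : centre r}"
 proof
  show "{p, q} <= {A : points ?Y. t A : centre r}"
   by (intro subsetI CollectI conjI; (rule subsetD[OF S(1)] | (unfold S(2)[symmetric], rule imageI)); assumption)
  show "{A : points ?Y. t A : centre r} <= {p, q}"
  proof
   fix A assume A: "A : {A : points ?Y. t A : centre r}"
   then have "t A : t ` {p, q}" unfolding S(2) by simp
   then obtain s where s: "t A = t s" "s : {p, q}" by (rule imageE)
   have a: "t' (t A) = A" using A by (intro t(3)) simp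
   have b: "t' (t s) = s" by (rule t(3)[OF subsetD[OF S(1) s(2)]])
   have "A = s" by (rule trans[OF a[symmetric] trans[OF arg_cong[OF s(1), of t'] b]])
   then show "A : {p, q}" using s(2) by (rule ssubst)
  qed
 qed
 moreover have "closedin (topo ?Y) {A : points ?Y. t A : centre r}"
  using closedin_continuous_map_preimage[OF _ closedin_centre] t(1) unfolding morphism_def by blast
 ultimately have cl: "closedin (topo ?Y) {p, q}" by simp
 have \<pi>': "morphism X ?Y (%x. t (\<pi> x))" by (rule morphism_comp[OF \<pi> t(1)])
 have charts: "EX U m f \<omega>. y : U & blowup_chart X (%x. t (\<pi> x)) ?Y (centre r) U m f \<omega>" if y: "y : points ?Y" for y
 proof -
  have ty: "t' y : points ?Y" by (rule morphism_points[OF t(2) y])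
  obtain U m f \<omega> where U: "t' y : U" "blowup_chart X \<pi> ?Y {p, q} U m f \<omega>"
   using blowup_chart_exists[OF swf_hirzebruch cl bl ty] by (elim exE conjE)
  have "blowup_chart X (%x. t (\<pi> x)) ?Y (t ` {p, q}) {y : points ?Y. t' y : U} m (%i y. f i (t' y)) \<omega>"
   by (rule blowup_chart_transport[OF swf_hirzebruch swf_hirzebruch \<pi> t(1,2) t(3) t(4) S(1) U(2)])
  then show ?thesis unfolding S(2) by (intro exI conjI) (rule CollectI, rule conjI, rule y, rule U(1))
 qed
 obtain \<rho> where \<rho>: "morphism (model_space r) ?Y \<rho>" "!!x y. \<rho> (aff r x y) = Cls r (vec4 1 x y 1)"
  by (rule rho_exists[OF r]) (rule that; assumption)
 show ?thesis by (rule blowup_isomorphic_model[OF X \<pi>' charts \<rho>])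
qed

lemma model_surface:
 fixes X :: "('x, 'k::field_char_0) fspace"
 assumes r: "1 <= r" and X: "swf X" and iso: "isomorphic_spaces X (model_space r)"
 shows "surface X & smooth_variety X & projective_variety X"
proof -
 let ?M = "model_space r :: 'k pspace"
 obtain h where h: "isomorphism X ?M h" using iso unfolding isomorphic_spaces_def by blast
 obtain g where g: "morphism X ?M h" "morphism ?M X g" "!!x. x : points X ==> g (h x) = x" "!!y. y : points ?M ==> h (g y) = y"
  by (rule isomorphismE[OF h]) (rule that; assumption)
 obtain \<U> :: "(nat => 'k) set set set" where \<U>: "finite \<U>" "\<Union>\<U> = model r" "ALL U:\<U>. chart_with_lift r U"
  using model_charts[OF r] by (elim exE conjE)
 let ?V = "(%U. {x : points X. h x : U}) ` \<U>"
 have irr: "irreducible_closed (topo X) (points X)"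
 proof -
  have "irreducible_closed (topo X) (g ` points ?M)"
   by (rule irreducible_closed_homeomorphic[OF _ _ g(4) g(3) irreducible_model]) (use g(1,2) in \<open>simp_all add: morphism_def\<close>)
  moreover have "g ` points ?M = points X"
  proof
   show "g ` points ?M <= points X" using morphism_points[OF g(2)] by blast
   show "points X <= g ` points ?M" using morphism_points[OF g(1)] g(3) by (metis image_eqI subsetI)
  qed
  ultimately show ?thesis by simp
 qed
 have s: "surface X & smooth_variety X"
 proof (rule surface_from_charts[OF X irr])
  show "finite ?V" by (rule finite_imageI[OF \<U>(1)])
  show "\<Union>?V = points X"
  proof
   show "points X <= \<Union>?V"
   proof
    fix x assume x: "x : points X"
    have "h x : \<Union>\<U>" unfolding \<U>(2) using morphism_points[OF g(1) x] unfolding points_model .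
    then show "x : \<Union>?V" using x by auto
   qed
  qed blast
  show "plane_chart X U" if UV: "U : ?V" for U
  proof -
   obtain U' where U': "U' : \<U>" "U = {x : points X. h x : U'}" using UV by blast
   have "plane_chart ?M U'" using bspec[OF \<U>(3) U'(1)] unfolding chart_with_lift_def by blast
   then show ?thesis unfolding U'(2) by (rule plane_chart_isomorphic[OF X swf_model h])
  qed
  show "morphism X (Proj (top_index r)) h" by (rule morphism_comp[OF g(1) morphism_model])
  show "inj_on h (points X)" by (rule inj_on_inverseI) (rule g(3))
 qed
 moreover have "projective_variety X"
  unfolding projective_variety_def
 proof (intro conjI exI)
  show "variety X" using s unfolding surface_def by blast
  show "closedin (topo (Proj (top_index r))) (model r)" by (rule closedin_model)
  show "isomorphic_spaces X (Sub (Proj (top_index r)) (model r))" using iso unfolding model_space_def .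
 qed
 ultimately show ?thesis by blast
qed

section \<open>Transport of additive actions and their families along isomorphisms\<close>

lemma isomorphic_actions_transport:
 assumes h: "morphism X Z h" "morphism Z X g" "!!x. x : points X ==> g (h x) = x" "!!z. z : points Z ==> h (g z) = z"
  and s: "!!v x. v : points Ga2 ==> x : points X ==> \<sigma> (v, x) : points X"
  and 1: "!!v x. v : points Ga2 ==> x : points X ==> h (\<sigma> (v, x)) = \<tau> (v, h x)"
  and 2: "!!v x. v : points Ga2 ==> x : points X ==> h (\<sigma>' (v, x)) = \<tau>' (v, h x)"
  and iso: "isomorphic_actions X \<sigma> \<sigma>'"
 shows "isomorphic_actions Z \<tau> \<tau>'"
proof -
 obtain \<phi> \<psi> where \<phi>: "isomorphism X X \<phi>" and \<psi>: "Ga2_automorphism \<psi>"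
  and e: "ALL v:points Ga2. ALL x:points X. \<phi> (\<sigma> (v, x)) = \<sigma>' (\<psi> v, \<phi> x)"
  using iso unfolding isomorphic_actions_def by (elim exE conjE)
 have i: "isomorphism Z Z (%z. h (\<phi> (g z)))"
  by (rule isomorphism_comp[OF isomorphism_comp[OF isomorphismI[OF h(2,1,4,3)] \<phi>] isomorphismI[OF h]])
 note m = \<psi>[unfolded Ga2_automorphism_def isomorphism_def, THEN conjunct1, THEN conjunct1]
  \<phi>[unfolded isomorphism_def, THEN conjunct1]
 note \<psi>p = morphism_points[OF m(1)]
 have "h (\<phi> (g (\<tau> (v, z)))) = \<tau>' (\<psi> v, h (\<phi> (g z)))" if v: "v : points Ga2" and z: "z : points Z" for v z
 proof -
  have gz: "g z : points X" by (rule morphism_points[OF h(2) z])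
  have \<phi>g: "\<phi> (g z) : points X" by (rule morphism_points[OF m(2) gz])
  have "\<tau> (v, z) = h (\<sigma> (v, g z))" unfolding 1[OF v gz] h(4)[OF z] ..
  then have "g (\<tau> (v, z)) = \<sigma> (v, g z)" using h(3)[OF s[OF v gz]] by simp
  then have "h (\<phi> (g (\<tau> (v, z)))) = h (\<sigma>' (\<psi> v, \<phi> (g z)))" using e v gz by simp
  then show ?thesis unfolding 2[OF \<psi>p[OF v] \<phi>g] .
 qed
 then show ?thesis using i \<psi> unfolding isomorphic_actions_def by blast
qed

lemma action_points:
 assumes "swf X" "additive_action X \<sigma>" "v : points Ga2" "x : points X" shows "\<sigma> (v, x) : points X"
proof -
 have "morphism (prod_space Ga2 X) X \<sigma>" using assms(2) unfolding additive_action_def by blast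
 then show ?thesis by (rule morphism_points) (use assms in \<open>simp add: points_prod swf_affine\<close>)
qed

lemma additive_action_transport:
 fixes X :: "('x, 'k::field) fspace"
 assumes X: "swf X" and Z: "swf Z"
  and h: "morphism X Z h" "morphism Z X g" "!!x. x : points X ==> g (h x) = x" "!!z. z : points Z ==> h (g z) = z"
  and act: "additive_action Z \<sigma>"
 shows "additive_action X (%w. g (\<sigma> (fst w, h (snd w))))"
 unfolding additive_action_def
proof (intro conjI ballI impI)
 note pts = action_points[OF Z act]
 have hp: "h x : points Z" if "x : points X" for x by (rule morphism_points[OF h(1) that])
 have gp: "g z : points X" if "z : points Z" for z by (rule morphism_points[OF h(2) that])
 have m: "morphism (prod_space Ga2 Z) Z \<sigma>" and z0: "ALL x:points Z. \<sigma> (%_. 0, x) = x"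
  and add: "ALL v:points Ga2. ALL w:points Ga2. ALL x:points Z. \<sigma> (ga_add v w, x) = \<sigma> (v, \<sigma> (w, x))"
  and eff: "ALL v:points Ga2. (ALL x:points Z. \<sigma> (v, x) = x) --> v = (%_. 0)"
  and orb: "EX x:points Z. Opn Z ((%v. \<sigma> (v, x)) ` points Ga2)"
  by (insert act[unfolded additive_action_def], (elim conjE, assumption)+)
 have "morphism (prod_space Ga2 X) (prod_space Ga2 Z) (%w. (fst w, h (snd w)))"
  by (rule morphism_pair[OF swf_prod[OF swf_affine X] swf_affine Z morphism_fst[OF swf_affine X] morphism_comp[OF morphism_snd[OF swf_affine X] h(1)]])
 from morphism_comp[OF morphism_comp[OF this m] h(2)]
 show "morphism (prod_space Ga2 X) X (%w. g (\<sigma> (fst w, h (snd w))))" .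
 show "g (\<sigma> (fst (%_. 0, x), h (snd (%_. 0, x)))) = x" if x: "x : points X" for x
  using z0 hp[OF x] h(3)[OF x] by simp
 show "g (\<sigma> (fst (ga_add v w, x), h (snd (ga_add v w, x)))) =
   g (\<sigma> (fst (v, g (\<sigma> (fst (w, x), h (snd (w, x))))), h (snd (v, g (\<sigma> (fst (w, x), h (snd (w, x))))))))"
  if v: "v : points Ga2" and w: "w : points Ga2" and x: "x : points X" for v w x
  unfolding fst_conv snd_conv h(4)[OF pts[OF w hp[OF x]]] using add v w hp[OF x] by simp
 show "v = (%_. 0)" if v: "v : points Ga2" and fx: "ALL x:points X. g (\<sigma> (fst (v, x), h (snd (v, x)))) = x" for v
 proof (rule eff[THEN bspec, THEN mp, OF v], rule ballI)
  fix z assume z: "z : points Z"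
  have "g (\<sigma> (v, z)) = g z" using bspec[OF fx gp[OF z]] by (simp add: h(4)[OF z])
  then have "h (g (\<sigma> (v, z))) = h (g z)" by (rule arg_cong)
  then show "\<sigma> (v, z) = z" unfolding h(4)[OF z] h(4)[OF pts[OF v z]] .
 qed
 obtain z where z: "z : points Z" "Opn Z ((%v. \<sigma> (v, z)) ` points Ga2)" using orb by blast
 show "EX x:points X. Opn X ((%v. g (\<sigma> (fst (v, x), h (snd (v, x))))) ` points Ga2)"
 proof (rule bexI[of _ "g z"])
  have "(%v. g (\<sigma> (v, z))) ` points Ga2 = {x : points X. h x : (%v. \<sigma> (v, z)) ` points Ga2}"
  proof
   show "(%v. g (\<sigma> (v, z))) ` points Ga2 <= {x : points X. h x : (%v. \<sigma> (v, z)) ` points Ga2}"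
   proof (rule image_subsetI)
    fix v :: "nat => 'k" assume v: "v : points Ga2"
    show "g (\<sigma> (v, z)) : {x : points X. h x : (%v. \<sigma> (v, z)) ` points Ga2}"
     using gp[OF pts[OF v z(1)]] h(4)[OF pts[OF v z(1)]] v by simp
   qed
   show "{x : points X. h x : (%v. \<sigma> (v, z)) ` points Ga2} <= (%v. g (\<sigma> (v, z))) ` points Ga2"
   proof
    fix x assume "x : {x : points X. h x : (%v. \<sigma> (v, z)) ` points Ga2}"
    then have x: "x : points X" "h x : (%v. \<sigma> (v, z)) ` points Ga2" by blast+
    from x(2) obtain v where v: "h x = \<sigma> (v, z)" "v : points Ga2" by (rule imageE)
    have "x = g (\<sigma> (v, z))" using h(3)[OF x(1)] unfolding v(1) by (rule sym)
    then show "x : (%v. g (\<sigma> (v, z))) ` points Ga2" using v(2) by (rule image_eqI)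
   qed
  qed
  moreover have "Opn X {x : points X. h x : (%v. \<sigma> (v, z)) ` points Ga2}" by (rule morphism_open[OF h(1) z(2)])
  ultimately show "Opn X ((%v. g (\<sigma> (fst (v, g z), h (snd (v, g z))))) ` points Ga2)"
   unfolding fst_conv snd_conv h(4)[OF z(1)] by simp
 qed (rule gp[OF z(1)])
qed

lemma one_dim_family_transport:
 fixes X :: "('x, 'k::field) fspace" and Z :: "('z, 'k) fspace"
 assumes X: "swf X" and Z: "swf Z" and iso: "isomorphic_spaces X Z"
  and fam: "one_dim_family_of_nonisomorphic_actions Z"
 shows "one_dim_family_of_nonisomorphic_actions X"
proof -
 obtain h where "isomorphism X Z h" using iso unfolding isomorphic_spaces_def by blast
 then obtain g where h: "morphism X Z h" "morphism Z X g" "!!x. x : points X ==> g (h x) = x" "!!z. z : points Z ==> h (g z) = z"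
  by (rule isomorphismE) (rule that; assumption)
 from fam obtain T :: "'k aspace" and \<tau> and C :: "'k aspace" and q \<Sigma>
  where T: "curve T" and a: "ALL t:points T. additive_action Z (\<tau> t)"
  and non: "ALL t:points T. ALL t':points T. t ~= t' --> \<not> isomorphic_actions Z (\<tau> t) (\<tau> t')"
  and C: "curve C" "morphism C T q" "q ` points C = points T"
  and \<Sigma>: "morphism (prod_space C (prod_space Ga2 Z)) Z \<Sigma>"
  and \<Sigma>c: "ALL c:points C. additive_action Z (%z. \<Sigma> (c, z)) & isomorphic_actions Z (%z. \<Sigma> (c, z)) (\<tau> (q c))"
  unfolding one_dim_family_of_nonisomorphic_actions_def algebraic_family_of_actions_def by (elim exE conjE)
 have Cs: "swf C" using C(1) unfolding curve_def variety_def by blast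
 define pull where "pull \<sigma> = (%w :: (nat => 'k) \<times> 'x. g (\<sigma> (fst w, h (snd w))))" for \<sigma> :: "(nat => 'k) \<times> 'z => 'z"
 have act: "additive_action X (pull \<sigma>)" if "additive_action Z \<sigma>" for \<sigma>
  unfolding pull_def by (rule additive_action_transport[OF X Z h that])
 have eq: "g (\<sigma> (v, z)) = pull \<sigma> (v, g z)" if "z : points Z" for \<sigma> v z unfolding pull_def using h(4)[OF that] by simp
 have eq': "h (pull \<sigma> (v, x)) = \<sigma> (v, h x)" if "additive_action Z \<sigma>" "v : points Ga2" "x : points X" for \<sigma> v x
  unfolding pull_def fst_conv snd_conv by (rule h(4)[OF action_points[OF Z that(1,2) morphism_points[OF h(1) that(3)]]])
 let ?S = "%w. g (\<Sigma> (fst w, (fst (snd w), h (snd (snd w)))))"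
 have S: "(%z. ?S (c, z)) = pull (%z. \<Sigma> (c, z))" for c unfolding pull_def by simp
 show ?thesis
  unfolding one_dim_family_of_nonisomorphic_actions_def algebraic_family_of_actions_def
 proof (rule exI[of _ T], rule exI[of _ "%t. pull (\<tau> t)"], intro conjI ballI impI)
  show "additive_action X (pull (\<tau> t))" if "t : points T" for t by (rule act[OF bspec[OF a that]])
  show "\<not> isomorphic_actions X (pull (\<tau> t)) (pull (\<tau> t'))" if t: "t : points T" "t' : points T" "t ~= t'" for t t'
  proof
   assume i: "isomorphic_actions X (pull (\<tau> t)) (pull (\<tau> t'))"
   note a1 = bspec[OF a t(1)] and a2 = bspec[OF a t(2)]
   have "isomorphic_actions Z (\<tau> t) (\<tau> t')"
    by (rule isomorphic_actions_transport[OF h action_points[OF X act[OF a1]] eq'[OF a1] eq'[OF a2] i])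
   then show False using non t by blast
  qed
  show "EX (C :: 'k aspace) q \<Sigma>.
    curve C & morphism C T q & q ` points C = points T &
    morphism (prod_space C (prod_space Ga2 X)) X \<Sigma> &
    (ALL c:points C. additive_action X (%z. \<Sigma> (c, z)) &
     isomorphic_actions X (%z. \<Sigma> (c, z)) (pull (\<tau> (q c))))"
  proof (rule exI[of _ C], rule exI[of _ q], rule exI[of _ ?S], intro conjI ballI)
   let ?W = "prod_space C (prod_space Ga2 X)"
   have GX: "swf (prod_space Ga2 X)" by (rule swf_prod[OF swf_affine X])
   have W: "swf ?W" by (rule swf_prod[OF Cs GX])
   note m1 = morphism_fst[OF Cs GX] and m2 = morphism_snd[OF Cs GX]
   note m = morphism_pair[OF W Cs swf_prod[OF swf_affine Z] m1
    morphism_pair[OF W swf_affine Z morphism_comp[OF m2 morphism_fst[OF swf_affine X]] morphism_comp[OF morphism_comp[OF m2 morphism_snd[OF swf_affine X]] h(1)]]]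
   show "morphism ?W X ?S" by (rule morphism_comp[OF morphism_comp[OF m \<Sigma>] h(2)])
   fix c assume c: "c : points C"
   note a1 = bspec[OF \<Sigma>c c, THEN conjunct1] and i = bspec[OF \<Sigma>c c, THEN conjunct2]
   show "additive_action X (%z. ?S (c, z))" unfolding S by (rule act[OF a1])
   show "isomorphic_actions X (%z. ?S (c, z)) (pull (\<tau> (q c)))"
    unfolding S by (rule isomorphic_actions_transport[OF h(2,1,4,3) action_points[OF Z a1] eq eq i])
  qed (fact C)+
 qed (rule T)
qed

subsection \<open>Substitutions acting linearly on the model\<close>

definition mon :: "nat => 'k::field => 'k => nat => 'k" where
 "mon r x y = Phi r (vec4 1 x y 1)"

lemma mon_blk: "mon r x y = blk r (%i. x ^ i) (%i. y * x ^ i) (%i. y * (y - x ^ r) * x ^ i) (%i. y ^ 2 * (y - x ^ r) * x ^ i)"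
 unfolding mon_def by (rule Phi_affine)

lemma aff_mon: "aff r x y = hp (top_index r) (mon r x y)"
 unfolding aff_def Hmap_def mon_def ..

text \<open>The three parameters are the two coordinates of \<open>\<bbbG>\<^sub>a\<^sup>2\<close> and that of the family.\<close>

inductive bounded_degree :: "nat => ((nat => 'k::field) => 'k => 'k) => bool" where
 const: "h : Polys 3 ==> bounded_degree d (%p x. h p)"
| var: "bounded_degree d F ==> bounded_degree (Suc d) (%p x. x * F p x)"
| add: "bounded_degree d F ==> bounded_degree d G ==> bounded_degree d (%p x. F p x + G p x)"

lemma bounded_degree_mono: "bounded_degree d F ==> d <= e ==> bounded_degree e F"
proof (induction arbitrary: e rule: bounded_degree.induct)
 case (var d F)
 then obtain e' where "e = Suc e'" "d <= e'" by (cases e) auto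
 then show ?case using bounded_degree.var[OF var.IH] by simp
qed (simp_all add: bounded_degree.const bounded_degree.add)

lemma bounded_degree_mult:
 assumes "bounded_degree d F" and G: "bounded_degree e G" shows "bounded_degree (d + e) (%p x. F p x * G p x)"
 using assms(1)
proof (induction rule: bounded_degree.induct)
 case (const h d)
 from G have "bounded_degree e (%p x. h p * G p x)"
 proof (induction rule: bounded_degree.induct)
  case (var e G)
  then show ?case using bounded_degree.var by (fastforce simp: mult.left_commute)
 qed (simp_all add: const bounded_degree.const bounded_degree.add poly_functions.mult distrib_left)
 then show ?case by (rule bounded_degree_mono) simp
next
 case (var d F)
 then show ?case using bounded_degree.var[OF var.IH] by (simp add: mult.assoc)
next
 case (add d F F')
 then show ?case using bounded_degree.add[OF add.IH] by (simp add: distrib_right)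
qed

lemma bounded_degree_var: "bounded_degree 1 (%p x. x)"
 using bounded_degree.var[OF bounded_degree.const[OF poly_functions.const[of 1]], of 0] by simp

lemma bounded_degree_power: "bounded_degree d F ==> bounded_degree (n * d) (%p x. F p x ^ n)"
 by (induction n) (simp_all add: bounded_degree.const poly_functions.const bounded_degree_mult)

lemma bounded_degree_uminus: "bounded_degree d F ==> bounded_degree d (%p x. - F p x)"
 using bounded_degree_mult[OF bounded_degree.const[OF poly_functions.const[of "-1"]], of d F 0] by simp

text \<open>The coefficients are polynomial in the parameters, so that one matrix serves all group
  elements and the whole family, and regularity in the parameters comes for free.\<close>

definition in_span :: "nat => ((nat => 'k::field) => 'k => 'k => 'k) => bool" where
 "in_span r F \<longleftrightarrow> (EX m. (ALL k<=top_index r. m k : Polys 3) &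
  (ALL p x y. F p x y = (\<Sum>k\<le>top_index r. m k p * mon r x y k)))"

lemma in_span_add:
 assumes "in_span r F" "in_span r G" shows "in_span r (%p x y. F p x y + G p x y)"
proof -
 obtain m m' where "ALL k<=top_index r. m k : Polys 3" "ALL p x y. F p x y = (\<Sum>k\<le>top_index r. m k p * mon r x y k)"
  "ALL k<=top_index r. m' k : Polys 3" "ALL p x y. G p x y = (\<Sum>k\<le>top_index r. m' k p * mon r x y k)"
  using assms unfolding in_span_def by (elim exE conjE)
 then show ?thesis unfolding in_span_def
  by (intro exI[of _ "%k p. m k p + m' k p"]) (simp add: poly_functions.add distrib_right sum.distrib)
qed

lemma in_span_scale:
 assumes "in_span r F" "h : Polys 3" shows "in_span r (%p x y. h p * F p x y)"
proof -
 obtain m where "ALL k<=top_index r. m k : Polys 3" "ALL p x y. F p x y = (\<Sum>k\<le>top_index r. m k p * mon r x y k)"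
  using assms(1) unfolding in_span_def by (elim exE conjE)
 then show ?thesis unfolding in_span_def
  by (intro exI[of _ "%k p. h p * m k p"]) (simp add: poly_functions.mult assms(2) sum_distrib_left mult.assoc)
qed

lemma in_span_mon: assumes "k <= top_index r" shows "in_span r (%p x y. mon r x y k)"
 unfolding in_span_def
proof (rule exI[of _ "%l p. if l = k then 1 else 0"], intro conjI allI impI)
 show "(%p. if l = k then 1 else 0) : Polys 3" for l by (cases "l = k") (simp_all add: poly_functions.const)
 show "mon r x y k = (\<Sum>l\<le>top_index r. (if l = k then 1 else 0) * mon r x y l)" for x y :: 'a
  using sum_single[OF assms, of "%l. (if l = k then 1 else 0) * mon r x y l"] by simp
qed

lemma in_span_zero: "in_span r (%p x y. 0)"
 using in_span_scale[OF in_span_mon[of 0 r] poly_functions.const[of 0]] by simp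

text \<open>The induction needs \<open>E\<close> arbitrary: a factor \<open>x\<close> is moved from
  the coefficient into \<open>E\<close>, where it raises the admissible power by one.\<close>

lemma in_span_bounded:
 assumes "bounded_degree d F" "!!i. i <= d ==> in_span r (%p x y. x ^ i * E x y)"
 shows "in_span r (%p x y. F p x * E x y)"
 using assms
proof (induction arbitrary: E rule: bounded_degree.induct)
 case (const h d)
 then show ?case using in_span_scale[OF const.prems[of 0] const.hyps] by simp
next
 case (var d F)
 have "in_span r (%p x y. F p x * (x * E x y))"
 proof (rule var.IH)
  show "in_span r (%p x y. x ^ i * (x * E x y))" if "i <= d" for i
   using var.prems[of "Suc i"] that by (simp add: ac_simps)
 qed
 then show ?case by (simp add: ac_simps)
next
 case (add d F G)
 then show ?case using in_span_add[OF add.IH] by (simp add: distrib_right)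
qed

lemma in_span_blocks:
 fixes A B C D :: "(nat => 'k::field) => 'k => 'k"
 assumes "bounded_degree (3 * r) A" "bounded_degree (2 * r) B" "bounded_degree (r + 1) C" "bounded_degree 1 D"
 shows "in_span r (%p x y. A p x * 1 + B p x * y + C p x * (y * (y - x ^ r)) + D p x * (y ^ 2 * (y - x ^ r)))"
proof (intro in_span_add)
 show "in_span r (%p x y. A p x * 1)"
 proof (rule in_span_bounded[OF assms(1)])
  show "in_span r (%p x (y :: 'k). x ^ i * 1)" if "i <= 3 * r" for i
   using in_span_mon[of "4 * i" r] that by (simp add: mon_blk blk_simps)
 qed
 show "in_span r (%p x y. B p x * y)"
 proof (rule in_span_bounded[OF assms(2)])
  show "in_span r (%p x (y :: 'k). x ^ i * y)" if "i <= 2 * r" for i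
  proof -
   have a: "in_span r (%p x (y :: 'k). mon r x y (4 * i + 1))" by (rule in_span_mon) (use that in simp)
   have e: "mon r x y (4 * i + 1) = x ^ i * y" for x y :: 'k
    unfolding mon_blk blk_simps using that by (simp add: ac_simps)
   show ?thesis using a unfolding e .
  qed
 qed
 show "in_span r (%p x y. C p x * (y * (y - x ^ r)))"
 proof (rule in_span_bounded[OF assms(3)])
  show "in_span r (%p x (y :: 'k). x ^ i * (y * (y - x ^ r)))" if "i <= r + 1" for i
  proof -
   have a: "in_span r (%p x (y :: 'k). mon r x y (4 * i + 2))" by (rule in_span_mon) (use that in simp)
   have e: "mon r x y (4 * i + 2) = x ^ i * (y * (y - x ^ r))" for x y :: 'k
    unfolding mon_blk blk_simps using that by (simp add: ac_simps)
   show ?thesis using a unfolding e .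
  qed
 qed
 show "in_span r (%p x y. D p x * (y ^ 2 * (y - x ^ r)))"
 proof (rule in_span_bounded[OF assms(4)])
  show "in_span r (%p x (y :: 'k). x ^ i * (y ^ 2 * (y - x ^ r)))" if "i <= 1" for i
  proof -
   have a: "in_span r (%p x (y :: 'k). mon r x y (4 * i + 3))" by (rule in_span_mon) (use that in simp)
   have e: "mon r x y (4 * i + 3) = x ^ i * (y ^ 2 * (y - x ^ r))" for x y :: 'k
    unfolding mon_blk blk_simps using that by (simp add: ac_simps)
   show ?thesis using a unfolding e .
  qed
 qed
qed

definition subst_matrix ::
 "nat => ((nat => 'k::field) => 'k => 'k => 'k) => ((nat => 'k) => 'k => 'k => 'k) => (nat => nat => (nat => 'k) => 'k) => bool" where
 "subst_matrix r f g M \<longleftrightarrow> (ALL j<=top_index r. (ALL k<=top_index r. M j k : Polys 3) &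
  (ALL p x y. mon r (f p x y) (g p x y) j = (\<Sum>k\<le>top_index r. M j k p * mon r x y k)))"

lemma subst_matrix_exists:
 assumes X: "!!i. i <= 3 * r ==> in_span r (%p x y. f p x y ^ i)"
  and Y: "!!i. i <= 2 * r ==> in_span r (%p x y. g p x y * f p x y ^ i)"
  and Z: "!!i. i <= r + 1 ==> in_span r (%p x y. g p x y * (g p x y - f p x y ^ r) * f p x y ^ i)"
  and T: "!!i. i <= 1 ==> in_span r (%p x y. g p x y ^ 2 * (g p x y - f p x y ^ r) * f p x y ^ i)"
 shows "EX M. subst_matrix r f g M"
proof -
 have "in_span r (%p x y. mon r (f p x y) (g p x y) j)" for j
 proof (cases j rule: mod4_cases)
  case (1 i) show ?thesis unfolding 1 mon_blk blk_simps using X in_span_zero by (cases "i <= 3 * r") auto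
 next
  case (2 i) show ?thesis unfolding 2 mon_blk blk_simps using Y in_span_zero by (cases "i <= 2 * r") auto
 next
  case (3 i) show ?thesis unfolding 3 mon_blk blk_simps using Z in_span_zero by (cases "i <= r + 1") auto
 next
  case (4 i) show ?thesis unfolding 4 mon_blk blk_simps using T in_span_zero by (cases "i <= 1") auto
 qed
 then have "ALL j. EX m. (ALL k<=top_index r. m k : Polys 3) &
  (ALL p x y. mon r (f p x y) (g p x y) j = (\<Sum>k\<le>top_index r. m k p * mon r x y k))" unfolding in_span_def by (rule allI)
 from choice[OF this] show ?thesis unfolding subst_matrix_def by blast
qed

definition subst_map :: "nat => (nat => nat => (nat => 'k::field) => 'k) => (nat => 'k) => (nat => 'k) set => (nat => 'k) set" where
 "subst_map r M p \<zeta> = hp (top_index r) (%j. \<Sum>k\<le>top_index r. M j k p * rep \<zeta> k)"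

lemma subst_map_aff:
 assumes "subst_matrix r f g M" shows "subst_map r M p (aff r x y) = aff r (f p x y) (g p x y)"
proof -
 obtain c where c: "c ~= 0" "ALL i<=top_index r. rep (aff r x y) i = c * mon r x y i"
  using rep_hp[of "top_index r" "mon r x y"] unfolding aff_mon by (elim exE conjE)
 show ?thesis unfolding subst_map_def aff_mon[of r "f p x y"]
 proof (rule hp_eqI[OF c(1)])
  fix j assume j: "j <= top_index r"
  have "(\<Sum>k\<le>top_index r. M j k p * rep (aff r x y) k) = c * (\<Sum>k\<le>top_index r. M j k p * mon r x y k)"
   unfolding sum_distrib_left by (rule sum.cong) (use c(2) in \<open>simp_all add: ac_simps\<close>)
  then show "(\<Sum>k\<le>top_index r. M j k p * rep (aff r x y) k) = c * mon r (f p x y) (g p x y) j"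
   using assms j unfolding subst_matrix_def by simp
 qed
qed

text \<open>For the inverse parameter \<open>p'\<close> the product \<open>M p' M p\<close> fixes
  every coordinate vector of an affine point. These are linear equations, so by
  \<open>model_hom\<close> it fixes the coordinates of every point of the model, and
  \<open>M p\<close> cannot kill them.\<close>

lemma subst_map_nonzero:
 fixes M :: "nat => nat => (nat => 'k::field_char_0) => 'k"
 assumes M: "subst_matrix r f g M" and inv: "!!x y. f p' (f p x y) (g p x y) = x & g p' (f p x y) (g p x y) = y"
  and \<zeta>: "\<zeta> : model r"
 shows "EX j<=top_index r. (\<Sum>k\<le>top_index r. M j k p * rep \<zeta> k) ~= 0"
proof (rule ccontr)
 assume "\<not> ?thesis"
 then have z: "(\<Sum>k\<le>top_index r. M j k p * rep \<zeta> k) = 0" if "j <= top_index r" for j using that by blast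
 have M': "mon r (f q x y) (g q x y) j = (\<Sum>k\<le>top_index r. M j k q * mon r x y k)" if "j <= top_index r" for q x y j
  using M that unfolding subst_matrix_def by blast
 have "rep \<zeta> l = 0" if l: "l <= top_index r" for l
 proof -
  let ?F = "%v :: nat => 'k. (\<Sum>j\<le>top_index r. M l j p' * (\<Sum>k\<le>top_index r. M j k p * v k)) - v l"
  have h: "hom_poly (top_index r) 1 ?F"
   unfolding hom_poly_def
   by (intro conjI poly_diff poly_sum poly_functions.mult poly_functions.const poly_functions.coord)
    (use l in \<open>simp_all add: right_diff_distrib sum_distrib_left ac_simps\<close>)
  have "?F (rep \<zeta>) = 0"
  proof (rule model_hom[OF h _ \<zeta>])
   fix x y :: 'k
   have "(\<Sum>j\<le>top_index r. M l j p' * (\<Sum>k\<le>top_index r. M j k p * mon r x y k)) =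
     (\<Sum>j\<le>top_index r. M l j p' * mon r (f p x y) (g p x y) j)"
    by (rule sum.cong) (use M' in simp_all)
   also have "\<dots> = mon r x y l" unfolding M'[OF l, symmetric] using inv[of x y] by simp
   finally show "?F (Phi r (vec4 1 x y 1)) = 0" unfolding mon_def by simp
  qed
  then show ?thesis using z by simp
 qed
 then show False using rep_nonzero[OF subsetD[OF model_sub \<zeta>]] by blast
qed

lemma morphism_subst_map:
 fixes M :: "nat => nat => (nat => 'k::field_char_0) => 'k" and W :: "('w, 'k) fspace"
 assumes M: "subst_matrix r f g M" and inv: "!!p. EX p'. ALL x y. f p' (f p x y) (g p x y) = x & g p' (f p x y) (g p x y) = y"
  and W: "swf W" and P: "!!i. i < 3 ==> (%w. P w i) : reg W (points W)" and h: "morphism W (model_space r) h"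
 shows "morphism W (model_space r) (%w. subst_map r M (P w) (h w))"
proof -
 have nz: "EX j<=top_index r. (\<Sum>k\<le>top_index r. M j k p * rep \<zeta> k) ~= 0" if "\<zeta> : model r" for p \<zeta>
 proof -
  obtain p' where "ALL x y. f p' (f p x y) (g p x y) = x & g p' (f p x y) (g p x y) = y" using inv by blast
  then show ?thesis by (intro subst_map_nonzero[OF M _ that]) blast
 qed
 \<comment> \<open>Stated for any source because it is applied twice: on the model with a fixed
   parameter, to see that the model is preserved, and on \<open>W\<close>.\<close>
 have gen: "morphism V (Proj (top_index r)) (%w. subst_map r M (Q w) (k w))"
  if V: "swf V" and Q: "!!i. i < 3 ==> (%w. Q w i) : reg V (points V)" and k: "morphism V (model_space r) k"
  for V :: "('v, 'k) fspace" and Q k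
  unfolding subst_map_def
 proof (rule morphism_linear_map[OF V morphism_comp[OF k morphism_model]])
  show "(%w. M j i (Q w)) : reg V (points V)" if "j <= top_index r" "i <= top_index r" for j i
   by (rule reg_poly_comp[OF _ V openin_topspace Q]) (use M that in \<open>auto simp: subst_matrix_def\<close>)
  show "EX j<=top_index r. (\<Sum>i\<le>top_index r. M j i (Q w) * rep (k w) i) ~= 0" if "w : points V" for w
   by (rule nz) (use morphism_points[OF k that] in \<open>simp add: points_model\<close>)
 qed
 have "subst_map r M p \<zeta> : model r" if "\<zeta> : model r" for p \<zeta>
 proof (rule closed_image_model[OF swf_model gen[OF swf_model _ morphism_id[OF swf_model]] dense_model])
  show "(%w. p i) : reg (model_space r) (points (model_space r))" for i by (rule reg_const[OF swf_model openin_topspace])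
  show "subst_map r M p e : model r" if "e : aff_points r" for e
   using that subst_map_aff[OF M] aff_model unfolding aff_points_def by auto
  show "\<zeta> : points (model_space r)" unfolding points_model by (rule that)
 qed
 note sub = this
 have "subst_map r M (P w) (h w) : model r" if "w : points W" for w
  by (rule sub) (use morphism_points[OF h that] in \<open>simp only: points_model\<close>)
 then have "(%w. subst_map r M (P w) (h w)) ` points W <= model r" by (rule image_subsetI)
 then show ?thesis unfolding model_space_def morphism_into_subspace_iff[OF swf_proj W] using gen[OF W P h] by (intro conjI)
qed

subsection \<open>The family of actions on the model\<close>

definition shift_x :: "(nat => 'k::field) => 'k => 'k => 'k" where
 "shift_x p x y = x + p 0"

definition shift_y :: "nat => (nat => 'k::field) => 'k => 'k => 'k" where
 "shift_y r p x y = y + (p 1 + p 2 * ((x + p 0) ^ r - x ^ r))"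

text \<open>In the difference \<open>(x + a)\<^sup>r - x\<^sup>r\<close> the leading terms cancel; this keeps all degrees within the bounds.\<close>

lemma bounded_degree_difference: "bounded_degree n (%p x. (x + p 0 :: 'a::field) ^ Suc n - x ^ Suc n)"
proof (induction n)
 case 0 show ?case by (simp add: bounded_degree.const poly_functions.coord)
next
 case (Suc n)
 have c: "bounded_degree d (%p x. p 0 :: 'a)" for d by (rule bounded_degree.const) (simp add: poly_functions.coord)
 have l: "bounded_degree 1 (%p x. x + p 0 :: 'a)" by (rule bounded_degree.add[OF bounded_degree_var c])
 have x: "bounded_degree (Suc n) (%p x. x ^ Suc n :: 'a)" using bounded_degree_power[OF bounded_degree_var, of "Suc n"] by simp
 have m1: "bounded_degree (Suc n) (%p x. (x + p 0 :: 'a) * ((x + p 0) ^ Suc n - x ^ Suc n))"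
  by (rule bounded_degree_mono[OF bounded_degree_mult[OF l Suc]]) simp
 have m2: "bounded_degree (Suc n) (%p x. p 0 * x ^ Suc n :: 'a)"
  by (rule bounded_degree_mono[OF bounded_degree_mult[OF c[of 0] x]]) simp
 have e: "(x + p 0) ^ Suc (Suc n) - x ^ Suc (Suc n) = (x + p 0) * ((x + p 0) ^ Suc n - x ^ Suc n) + p 0 * x ^ Suc n" for x and p :: "nat => 'a"
  unfolding power_Suc[of _ "Suc n"] by (simp only: algebra_simps)
 show ?case unfolding e by (rule bounded_degree.add[OF m1 m2])
qed

text \<open>The degree count behind the choice of the bounds. The increments \<open>?P\<close> and
  \<open>?A\<close> have degree at most \<open>r - 1\<close> and \<open>?B\<close> at most
  \<open>2 r - 1\<close>; times \<open>(x + p 0)^(r+1)\<close> the last two give exactly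
  \<open>2 r\<close> and \<open>3 r\<close>.\<close>

lemma translation_matrix_exists:
 assumes r: "1 <= r" shows "EX M. subst_matrix r shift_x (shift_y r) M"
proof -
 obtain n where n: "r = Suc n" using r by (cases r) auto
 let ?Q = "%(p :: nat => 'a) x. (x + p 0) ^ r - x ^ r"
 let ?P = "%(p :: nat => 'a) x. p 1 + p 2 * ?Q p x"
 \<comment> \<open>With \<open>P\<close> the increment of \<open>y\<close> and \<open>Q\<close> that
   of \<open>x^r\<close>, the new \<open>z\<close> is \<open>z + A y + B\<close> for
   \<open>A = 2 P - Q\<close> and \<open>B = P (P - Q) - P x^r\<close>.\<close>
 let ?A = "%(p :: nat => 'a) x. ?P p x + (?P p x + - ?Q p x)"
 let ?B = "%(p :: nat => 'a) x. ?P p x * (?P p x + - ?Q p x) + - (?P p x * x ^ r)"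
 let ?R = "%i (p :: nat => 'a) x. (x + p 0) ^ i"
 note mono = bounded_degree_mono and mult = bounded_degree_mult and add = bounded_degree.add and un = bounded_degree_uminus
 have c: "bounded_degree d (%p x. p 0 :: 'a)" "bounded_degree d (%p x. p 1 :: 'a)" "bounded_degree d (%p x. p 2 :: 'a)" for d
  by (rule bounded_degree.const, rule poly_functions.coord, simp)+
 have Q: "bounded_degree n ?Q" unfolding n by (rule bounded_degree_difference)
 have P: "bounded_degree n ?P" by (rule add[OF c(2) mono[OF mult[OF c(3)[of 0] Q]]]) simp
 have A: "bounded_degree n ?A" by (rule add[OF P add[OF P un[OF Q]]])
 have x: "bounded_degree i (%p x. x ^ i :: 'a)" for i using bounded_degree_power[OF bounded_degree_var, of i] by simp
 have B: "bounded_degree (n + r) ?B"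
  by (rule add[OF mono[OF mult[OF P add[OF P un[OF Q]]]] un[OF mult[OF P x]]]) (simp add: n)
 have R: "bounded_degree i (?R i)" for i by (rule mono[OF bounded_degree_power[OF add[OF bounded_degree_var c(1)]]]) simp
 have z: "bounded_degree d (%p x. 0 :: 'a)" for d by (rule bounded_degree.const) (rule poly_functions.const)
 show ?thesis
 proof (rule subst_matrix_exists)
  fix i assume i: "i <= 3 * r"
  show "in_span r (%p x (y :: 'a). shift_x p x y ^ i)"
   using in_span_blocks[OF mono[OF R i] z z z] unfolding shift_x_def by simp
 next
  fix i assume i: "i <= 2 * r"
  have "in_span r (%p x (y :: 'a). (?P p x * ?R i p x) * 1 + ?R i p x * y + 0 * (y * (y - x ^ r)) + 0 * (y ^ 2 * (y - x ^ r)))"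
   by (rule in_span_blocks[OF mono[OF mult[OF P R]] mono[OF R] z z]) (use i n in simp_all)
  moreover have "shift_y r p x y * shift_x p x y ^ i = (?P p x * ?R i p x) * 1 + ?R i p x * y + 0 * (y * (y - x ^ r)) + 0 * (y ^ 2 * (y - x ^ r))"
   for p :: "nat => 'a" and x y unfolding shift_x_def shift_y_def by (simp add: distrib_right)
  ultimately show "in_span r (%p x (y :: 'a). shift_y r p x y * shift_x p x y ^ i)" by (simp only:)
 next
  fix i assume i: "i <= r + 1"
  have "in_span r (%p x (y :: 'a). (?B p x * ?R i p x) * 1 + (?A p x * ?R i p x) * y + ?R i p x * (y * (y - x ^ r)) + 0 * (y ^ 2 * (y - x ^ r)))"
   by (rule in_span_blocks[OF mono[OF mult[OF B R]] mono[OF mult[OF A R]] mono[OF R] z]) (use i n in simp_all)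
  moreover have "shift_y r p x y * (shift_y r p x y - shift_x p x y ^ r) * shift_x p x y ^ i =
   (?B p x * ?R i p x) * 1 + (?A p x * ?R i p x) * y + ?R i p x * (y * (y - x ^ r)) + 0 * (y ^ 2 * (y - x ^ r))" for p :: "nat => 'a" and x y
  proof -
   have "(y + P) * (y + P - U) * R = ((P * (P + - (U - u)) + - (P * u)) * R) * 1 + ((P + (P + - (U - u))) * R) * y + R * (y * (y - u)) + 0 * (y ^ 2 * (y - u))"
    for P U u R :: 'a by (simp add: algebra_simps)
   then show ?thesis unfolding shift_x_def shift_y_def .
  qed
  ultimately show "in_span r (%p x (y :: 'a). shift_y r p x y * (shift_y r p x y - shift_x p x y ^ r) * shift_x p x y ^ i)" by (simp only:)
 next
  fix i :: nat assume i: "i <= 1"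
  \<comment> \<open>Expanding \<open>(y + P) (z + A y + B)\<close> produces \<open>A y^2\<close>,
    which is rewritten by \<open>y^2 = z + x^r y\<close>.\<close>
  have "in_span r (%p x (y :: 'a). (?P p x * ?B p x * ?R i p x) * 1 + ((x ^ r * ?A p x + (?B p x + ?P p x * ?A p x)) * ?R i p x) * y
   + ((?A p x + ?P p x) * ?R i p x) * (y * (y - x ^ r)) + ?R i p x * (y ^ 2 * (y - x ^ r)))"
   by (rule in_span_blocks[OF mono[OF mult[OF mult[OF P B] R]]
    mono[OF mult[OF add[OF mono[OF mult[OF x A]] add[OF B mono[OF mult[OF P A]]]] R]] mono[OF mult[OF add[OF A P] R]] mono[OF R i]])
    (use i n in simp_all)
  moreover have "shift_y r p x y ^ 2 * (shift_y r p x y - shift_x p x y ^ r) * shift_x p x y ^ i =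
   (?P p x * ?B p x * ?R i p x) * 1 + ((x ^ r * ?A p x + (?B p x + ?P p x * ?A p x)) * ?R i p x) * y
   + ((?A p x + ?P p x) * ?R i p x) * (y * (y - x ^ r)) + ?R i p x * (y ^ 2 * (y - x ^ r))" for p :: "nat => 'a" and x y
  proof -
   have "(y + P) ^ 2 * (y + P - U) * R = (P * (P * (P + - (U - u)) + - (P * u)) * R) * 1 +
     ((u * (P + (P + - (U - u))) + ((P * (P + - (U - u)) + - (P * u)) + P * (P + (P + - (U - u))))) * R) * y +
     (((P + (P + - (U - u))) + P) * R) * (y * (y - u)) + R * (y ^ 2 * (y - u))"
    for P U u R :: 'a by (simp add: algebra_simps power2_eq_square)
   then show ?thesis unfolding shift_x_def shift_y_def .
  qed
  ultimately show "in_span r (%p x (y :: 'a). shift_y r p x y ^ 2 * (shift_y r p x y - shift_x p x y ^ r) * shift_x p x y ^ i)" by (simp only:)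
 qed
qed

text \<open>The substitution \<open>y \<mapsto> x^r - y\<close> leaves \<open>z\<close> fixed up to
  expansion, since it exchanges \<open>y\<close> and \<open>y - x^r\<close> up to sign;
  \<open>y z\<close> becomes \<open>x^r z - y z\<close>.\<close>

lemma reflection_matrix_exists: "EX M. subst_matrix r (%p x y. x) (%p x y. x ^ r - y) M"
proof (rule subst_matrix_exists)
 have x: "bounded_degree d (%p x. x ^ i :: 'a)" if "i <= d" for i d
  using bounded_degree_mono[OF bounded_degree_power[OF bounded_degree_var, of i]] that by simp
 note un = bounded_degree_uminus
 have z: "bounded_degree d (%p x. 0 :: 'a)" for d by (rule bounded_degree.const) (rule poly_functions.const)
 show "in_span r (%p x (y :: 'a). x ^ i)" if "i <= 3 * r" for i using in_span_blocks[OF x[OF that] z z z] by simp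
 show "in_span r (%p x (y :: 'a). (x ^ r - y) * x ^ i)" if "i <= 2 * r" for i
 proof -
  have "in_span r (%p x (y :: 'a). x ^ (r + i) * 1 + - (x ^ i) * y + 0 * (y * (y - x ^ r)) + 0 * (y ^ 2 * (y - x ^ r)))"
   by (rule in_span_blocks[OF x un[OF x[OF that]] z z]) (use that in simp)
  moreover have "(x ^ r - y) * x ^ i = x ^ (r + i) * 1 + - (x ^ i) * y + 0 * (y * (y - x ^ r)) + 0 * (y ^ 2 * (y - x ^ r))" for x y :: 'a
   by (simp add: algebra_simps power_add)
  ultimately show ?thesis by (simp only:)
 qed
 show "in_span r (%p x (y :: 'a). (x ^ r - y) * (x ^ r - y - x ^ r) * x ^ i)" if "i <= r + 1" for i
 proof -
  have "in_span r (%p x (y :: 'a). 0 * 1 + 0 * y + x ^ i * (y * (y - x ^ r)) + 0 * (y ^ 2 * (y - x ^ r)))"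
   by (rule in_span_blocks[OF z z x[OF that] z])
  moreover have "(x ^ r - y) * (x ^ r - y - x ^ r) * x ^ i = 0 * 1 + 0 * y + x ^ i * (y * (y - x ^ r)) + 0 * (y ^ 2 * (y - x ^ r))" for x y :: 'a
   by (simp add: algebra_simps)
  ultimately show ?thesis by (simp only:)
 qed
 show "in_span r (%p x (y :: 'a). (x ^ r - y) ^ 2 * (x ^ r - y - x ^ r) * x ^ i)" if "i <= 1" for i
 proof -
  have "in_span r (%p x (y :: 'a). 0 * 1 + 0 * y + x ^ (r + i) * (y * (y - x ^ r)) + - (x ^ i) * (y ^ 2 * (y - x ^ r)))"
   by (rule in_span_blocks[OF z z x un[OF x[OF that]]]) (use that in simp)
  moreover have "(x ^ r - y) ^ 2 * (x ^ r - y - x ^ r) * x ^ i = 0 * 1 + 0 * y + x ^ (r + i) * (y * (y - x ^ r)) + - (x ^ i) * (y ^ 2 * (y - x ^ r))" for x y :: 'a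
   by (simp add: algebra_simps power2_eq_square power_add)
  ultimately show ?thesis by (simp only:)
 qed
qed

text \<open>The matrix is not unique, but every choice gives the same map: it is determined on the
  affine points, by \<open>act_aff\<close>, and these are dense.\<close>

definition act :: "nat => 'k::field => (nat => 'k) \<times> (nat => 'k) set => (nat => 'k) set" where
 "act r l w = subst_map r (SOME M. subst_matrix r shift_x (shift_y r) M)
  (%i. if i = 0 then fst w 0 else if i = 1 then fst w 1 else l) (snd w)"

lemma act_aff:
 assumes "1 <= r" shows "act r l (v, aff r x y) = aff r (x + v 0) (y + (v 1 + l * ((x + v 0) ^ r - x ^ r)))"
 unfolding act_def fst_conv snd_conv subst_map_aff[OF someI_ex[OF translation_matrix_exists[OF assms]]]
 by (simp add: shift_x_def shift_y_def)

lemma morphism_act: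
 fixes W :: "('w, 'k::field_char_0) fspace"
 assumes r: "1 <= r" and W: "swf W" and l: "l : reg W (points W)" and v: "morphism W Ga2 v" and h: "morphism W (model_space r) h"
 shows "morphism W (model_space r) (%w. act r (l w) (v w, h w))"
 unfolding act_def fst_conv snd_conv
proof (rule morphism_subst_map[OF someI_ex[OF translation_matrix_exists[OF r]] _ W _ h])
 fix p :: "nat => 'k"
 show "EX p'. ALL x y. shift_x p' (shift_x p x y) (shift_y r p x y) = x & shift_y r p' (shift_x p x y) (shift_y r p x y) = y"
  by (rule exI[of _ "%i. if i = 2 then p 2 else - p i"]) (simp add: shift_x_def shift_y_def algebra_simps)
next
 fix i :: nat
 have "(%w. v w 0) : reg W (points W)" "(%w. v w 1) : reg W (points W)" by (rule coord_reg[OF W v openin_topspace], simp)+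
 then show "(%w. if i = 0 then v w 0 else if i = 1 then v w 1 else l w) : reg W (points W)" using l by (cases "i = 0"; cases "i = 1") simp_all
qed

lemma morphism_act_const:
 assumes r: "1 <= r" and v: "v : points Ga2"
 shows "morphism (model_space r) (model_space r) (%\<zeta>. act r (l::'k::field_char_0) (v, \<zeta>))"
 by (rule morphism_act[OF r swf_model reg_const[OF swf_model openin_topspace] morphism_const[OF swf_model v] morphism_id[OF swf_model]])

lemma model_agree:
 fixes f g :: "(nat => 'k::field_char_0) set => (nat => 'k) set"
 assumes f: "morphism (model_space r) (model_space r) f" and g: "morphism (model_space r) (model_space r) g"
  and e: "!!x y. f (aff r x y) = g (aff r x y)" and \<zeta>: "\<zeta> : points (model_space r)"
 shows "f \<zeta> = g \<zeta>"
proof (rule agree_on_dense[OF separated_proj[OF swf_model] dense_model morphism_comp[OF f morphism_model] morphism_comp[OF g morphism_model] _ \<zeta>])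
 fix d :: "(nat => 'k) set" assume "d : aff_points r"
 then obtain x y where "d = aff r x y" unfolding aff_points_def by blast
 then show "f d = g d" using e by simp
qed

lemma aff_injective:
 assumes "1 <= r" "aff r x y = aff r x' y'" shows "x = x' & y = y'"
proof -
 obtain c where c: "ALL i<=top_index r. mon r x y i = c * mon r x' y' i" using assms(2) hp_eqD unfolding aff_mon by blast
 have m: "mon r u w (4 * 0) = 1" "mon r u w (4 * 1) = u" "mon r u w (4 * 0 + 1) = w" for u w :: 'a
  using assms(1) unfolding mon_blk blk_simps by simp_all
 have "mon r x y i = c * mon r x' y' i" if "i <= 4" for i using c that by simp
 from this[of "4 * 0"] this[of "4 * 1"] this[of "4 * 0 + 1"] show ?thesis unfolding m by simp
qed

text \<open>The affine points are the open set where the coordinate \<open>x^0\<close> is nonzero;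
  on it a point is recovered from two ratios, which is again verified on the dense affine points
  only.\<close>

lemma openin_aff_points:
 assumes r: "1 <= r" shows "Opn (model_space r) (aff_points r :: (nat => 'k::field_char_0) set set)"
proof -
 let ?M = "model_space r :: 'k pspace"
 let ?S = "{\<zeta> : model r. cX 0 (rep \<zeta> :: nat => 'k) ~= 0}"
 have h: "hom_poly (top_index r) 1 (cX 0 :: (nat => 'k) => 'k)" "hom_poly (top_index r) 1 (cX 1 :: (nat => 'k) => 'k)"
  "hom_poly (top_index r) 1 (cY 0 :: (nat => 'k) => 'k)" by ((intro hom_coords; use r in simp))+
 have S: "Opn ?M ?S" by (rule openin_model_hom[OF h(1)])
 let ?x = "%\<zeta>. cX 1 (rep \<zeta>) / cX 0 (rep \<zeta>)" and ?y = "%\<zeta>. cY 0 (rep \<zeta>) / cX 0 (rep \<zeta>)"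
 have m: "cX 0 (mon r x y) = 1" "cX 1 (mon r x y) = x" "cY 0 (mon r x y) = y" for x y :: 'k
  unfolding mon_blk using r by (simp_all add: blk_coords)
 have xy: "?x (aff r x y) = x" "?y (aff r x y) = y" for x y :: 'k
  unfolding aff_mon hom_ratio_hp[OF h(2,1)] hom_ratio_hp[OF h(3,1)] m by simp_all
 let ?W = "Sub ?M ?S"
 have W: "swf ?W" by (rule swf_subspace[OF swf_model])
 have pW: "points ?W = ?S" unfolding points_subspace points_model by blast
 have reg: "?x : reg ?W (points ?W)" "?y : reg ?W (points ?W)"
  unfolding pW reg_subspace_open[OF swf_model S S subset_refl] by (rule model_ratio_reg[OF h(2,1) S] model_ratio_reg[OF h(3,1) S]; simp)+
 have f: "morphism ?W (Proj (top_index r)) (%\<zeta>. aff r (?x \<zeta>) (?y \<zeta>))"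
  unfolding aff_mon mon_def
 proof (rule morphism_hp[OF W])
  fix i show "(%w. Phi r (vec4 1 (?x w) (?y w) 1) i) : reg ?W (points ?W)"
  proof (rule reg_poly_comp[OF Phi_poly W openin_topspace])
   fix j :: nat assume "j < 4"
   then show "(%w. vec4 1 (?x w) (?y w) 1 j) : reg ?W (points ?W)"
    by (rule less4_cases) (simp_all only: vec4_simps reg reg_const[OF W openin_topspace])
  qed
  show "EX i<=top_index r. Phi r (vec4 1 (?x w) (?y w) 1) i ~= 0" for w
   using aff_point[of r "?x w" "?y w"] unfolding aff_def Hmap_def hp_points .
 qed
 have e: "aff r (?x \<zeta>) (?y \<zeta>) = \<zeta>" if "\<zeta> : ?S" for \<zeta>
 proof (rule agree_on_dense[OF separated_proj[OF W] dense_in_subspace[OF dense_model S] f morphism_restrict[OF swf_model morphism_model]])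
  fix d :: "(nat => 'k) set" assume "d : aff_points r"
  then obtain x y where "d = aff r x y" unfolding aff_points_def by blast
  then show "aff r (?x d) (?y d) = d" using xy by simp
 qed (use that pW in simp)
 have "aff_points r = ?S"
 proof
  show "?S <= aff_points r" using e unfolding aff_points_def by (smt (verit) mem_Collect_eq subsetI)
  show "aff_points r <= ?S"
  proof
   fix d :: "(nat => 'k) set" assume "d : aff_points r"
   then obtain x y where d: "d = aff r x y" unfolding aff_points_def by blast
   have "cX 0 (rep d) ~= 0" unfolding d aff_mon hom_poly_rep_zero[OF h(1)] m by simp
   then show "d : ?S" using aff_model unfolding d by blast
  qed
 qed
 then show ?thesis using S by simp
qed

text \<open>The group laws are checked on affine points. The open orbit is that of the origin, and
  the action is effective because only the zero vector fixes the origin.\<close>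

lemma additive_action_act:
 assumes r: "1 <= r" shows "additive_action (model_space r) (act r (l::'k::field_char_0))"
 unfolding additive_action_def
proof (intro conjI ballI impI)
 let ?M = "model_space r :: 'k pspace"
 have W: "swf (prod_space Ga2 ?M)" by (rule swf_prod[OF swf_affine swf_model])
 have "morphism (prod_space Ga2 ?M) ?M (%w. act r l (fst w, snd w))"
  by (rule morphism_act[OF r W reg_const[OF W openin_topspace] morphism_fst[OF swf_affine swf_model] morphism_snd[OF swf_affine swf_model]])
 then show "morphism (prod_space Ga2 ?M) ?M (act r l)" by simp
 have 0: "(%_. 0) : points (Ga2 :: 'k aspace)" by (simp add: affine_points_def)
 show "act r l (%_. 0, \<zeta>) = \<zeta>" if "\<zeta> : points ?M" for \<zeta>
  by (rule model_agree[OF morphism_act_const[OF r 0] morphism_id[OF swf_model] _ that]) (simp add: act_aff[OF r])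
 show "act r l (ga_add v w, \<zeta>) = act r l (v, act r l (w, \<zeta>))"
  if v: "v : points Ga2" and w: "w : points Ga2" and \<zeta>: "\<zeta> : points ?M" for v w \<zeta>
 proof (rule model_agree[OF morphism_act_const[OF r] morphism_comp[OF morphism_act_const[OF r w] morphism_act_const[OF r v]] _ \<zeta>])
  show "ga_add v w : points Ga2" using v w by (simp add: ga_add_def affine_points_def)
  show "act r l (ga_add v w, aff r x y) = act r l (v, act r l (w, aff r x y))" for x y
   unfolding act_aff[OF r] ga_add_def by (simp add: algebra_simps)
 qed
 have z: "(0::'k) ^ r = 0" using r by simp
 have orb: "act r l (v, aff r 0 0) = aff r (v 0) (v 1 + l * v 0 ^ r)" for v unfolding act_aff[OF r] by (simp add: z)
 have am: "aff r 0 0 : points ?M" unfolding points_model by (rule aff_model)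
 show "v = (%_. 0)" if v: "v : points Ga2" and f: "ALL \<zeta>:points ?M. act r l (v, \<zeta>) = \<zeta>" for v
 proof -
  have "aff r (v 0) (v 1 + l * v 0 ^ r) = aff r 0 0" unfolding orb[symmetric] by (rule bspec[OF f am])
  note v01 = aff_injective[OF r this]
  note v0 = v01[THEN conjunct1] and v1 = v01[THEN conjunct2]
  from v1 have "v 1 = 0" unfolding v0 by (simp add: z)
  then have "vec2 (v 0) (v 1) = (%_. 0)" using v0 by (auto simp: vec2_def)
  with vec2_eta[OF v[unfolded points_affine]] show ?thesis by (rule trans[OF sym])
 qed
 show "EX \<zeta>:points ?M. Opn ?M ((%v. act r l (v, \<zeta>)) ` points Ga2)"
 proof (rule bexI[OF _ am])
  have "(%v. act r l (v, aff r 0 0)) ` points Ga2 = aff_points r"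
  proof
   show "(%v. act r l (v, aff r 0 0)) ` points Ga2 <= aff_points r" unfolding orb aff_points_def by blast
   show "aff_points r <= (%v. act r l (v, aff r 0 0)) ` points Ga2"
   proof
    fix d :: "(nat => 'k) set" assume "d : aff_points r"
    then obtain x y where d: "d = aff r x y" unfolding aff_points_def by blast
    show "d : (%v. act r l (v, aff r 0 0)) ` points Ga2"
     by (rule image_eqI[of _ _ "vec2 x (y - l * x ^ r)"]) (simp_all add: orb d)
   qed
  qed
  then show "Opn ?M ((%v. act r l (v, aff r 0 0)) ` points Ga2)" using openin_aff_points[OF r] by simp
 qed
qed

lemma isomorphic_actions_refl:
 assumes "swf X" shows "isomorphic_actions X \<sigma> \<sigma>"
 unfolding isomorphic_actions_def
proof (intro exI conjI)
 show "isomorphism X X (%x. x)" using isomorphismI[OF morphism_id[OF assms] morphism_id[OF assms]] by simp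
 show "Ga2_automorphism (%v :: nat => 'b. v)" unfolding Ga2_automorphism_def
  using isomorphismI[OF morphism_id[OF swf_affine] morphism_id[OF swf_affine]] by simp
qed simp

text \<open>The automorphism \<open>y \<mapsto> x\<^sup>r - y\<close>, which exchanges the two blown up points.\<close>

lemma isomorphic_act_reflection:
 assumes r: "1 <= r" shows "isomorphic_actions (model_space r) (act r (l::'k::field_char_0)) (act r (1 - l))"
proof -
 let ?M = "model_space r :: 'k pspace"
 obtain M :: "nat => nat => (nat => 'k) => 'k" where M: "subst_matrix r (%p x y. x) (%p x y. x ^ r - y) M"
  using reflection_matrix_exists by blast
 let ?\<phi> = "%\<zeta>. subst_map r M (%_. 0) \<zeta>"
 have \<phi>: "morphism ?M ?M ?\<phi>"
  by (rule morphism_subst_map[OF M _ swf_model reg_const[OF swf_model openin_topspace] morphism_id[OF swf_model]]) simp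
 have \<phi>a: "?\<phi> (aff r x y) = aff r x (x ^ r - y)" for x y by (rule subst_map_aff[OF M])
 have "?\<phi> (?\<phi> \<zeta>) = \<zeta>" if "\<zeta> : points ?M" for \<zeta>
  by (rule model_agree[OF morphism_comp[OF \<phi> \<phi>] morphism_id[OF swf_model] _ that]) (simp add: \<phi>a)
 then have i: "isomorphism ?M ?M ?\<phi>" by (intro isomorphismI[OF \<phi> \<phi>]) auto
 let ?\<psi> = "%v :: nat => 'k. vec2 (v 0) (- v 1)"
 have m: "morphism Ga2 Ga2 ?\<psi>"
  by (rule morphism_vec2[OF swf_affine]; rule reg_affine_poly[OF _ openin_topspace]) (simp_all add: poly_ops)
 have "isomorphism Ga2 Ga2 ?\<psi>" by (rule isomorphismI[OF m m]) (simp_all add: vec2_eta[simplified])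
 moreover have "?\<psi> (ga_add v w) = ga_add (?\<psi> v) (?\<psi> w)" for v w by (auto simp: ga_add_def vec2_def)
 ultimately have \<psi>: "Ga2_automorphism ?\<psi>" unfolding Ga2_automorphism_def by blast
 have "?\<phi> (act r l (v, \<zeta>)) = act r (1 - l) (?\<psi> v, ?\<phi> \<zeta>)" if v: "v : points Ga2" and \<zeta>: "\<zeta> : points ?M" for v \<zeta>
  by (rule model_agree[OF morphism_comp[OF morphism_act_const[OF r v] \<phi>] morphism_comp[OF \<phi> morphism_act_const[OF r]] _ \<zeta>])
   (simp_all add: \<phi>a act_aff[OF r] algebra_simps)
 then show ?thesis unfolding isomorphic_actions_def using i \<psi> by blast
qed

lemma curve_line: "curve (Aff 1 :: (nat => 'k::field_char_0, 'k) fspace)"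
 unfolding curve_def variety_def
proof (intro conjI)
 let ?A = "Aff 1 :: 'k aspace"
 show "has_dimension ?A 1" by (rule has_dimension_line)
 show "swf ?A" by (rule swf_affine)
 show "irreducible_closed (topo ?A) (points ?A)" unfolding points_affine by (rule irreducible_affine)
 have "isomorphism (Sub ?A (points ?A)) (Sub ?A (points ?A)) (%x. x)"
  by (rule isomorphismI; (rule morphism_id[OF swf_subspace[OF swf_affine]] | simp))
 then have "affine_variety (Sub ?A (points ?A))"
  unfolding affine_variety_def isomorphic_spaces_def using closedin_topspace by blast
 then show "EX \<U>. finite \<U> & \<Union>\<U> = points ?A & (ALL U:\<U>. Opn ?A U & affine_variety (Sub ?A U))"
  using openin_topspace[of "topo ?A"] by (intro exI[of _ "{points ?A}"]) simp
 show "closedin (topo (prod_space ?A ?A)) {(x, x) |x. x : points ?A}"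
 proof (rule diagonal_closed[OF swf_affine])
  \<comment> \<open>The usual embedding of the line into the projective line, which makes the
    diagonal closed.\<close>
  let ?F = "%(i::nat) w :: nat => 'k. if i = 0 then 1 else w 0"
  show "morphism ?A (Proj 1) (%w. hp 1 (%i. ?F i w))"
  proof (rule morphism_hp[OF swf_affine])
   fix i :: nat
   show "?F i : reg ?A (points ?A)"
    by (rule reg_affine_poly[OF _ openin_topspace]) (cases "i = 0"; simp add: poly_ops)
  qed (auto intro: exI[of _ 0])
  show "inj_on (%w. hp 1 (%i. ?F i w)) (points ?A)"
  proof (rule inj_onI)
   fix v w assume v: "v : points ?A" and w: "w : points ?A" and "hp 1 (%i. ?F i v) = hp 1 (%i. ?F i w)"
   then obtain c where c: "ALL i<=1. ?F i v = c * ?F i w" using hp_eqD by blast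
   have "v 0 = w 0" using c[rule_format, of 0] c[rule_format, of 1] by simp
   then have "v i = w i" for i using v w by (cases "i = 0") (simp_all add: affine_points_def)
   then show "v = w" by blast
  qed
 qed
qed

text \<open>The quotient \<open>l \<mapsto> l (1 - l)\<close> identifies the parameters of isomorphic actions.\<close>

lemma one_dim_family_model:
 assumes r: "1 <= r"
  and non: "!!l m :: 'k::{alg_closed_field, field_char_0}. isomorphic_actions (model_space r) (act r l) (act r m) ==> l * (1 - l) = m * (1 - m)"
 shows "one_dim_family_of_nonisomorphic_actions (model_space r :: 'k pspace)"
proof -
 let ?A = "Aff 1 :: 'k aspace"
 let ?M = "model_space r :: 'k pspace"
 have "EX l :: 'k. l * (1 - l) = t" for t
 proof -
  obtain l where "poly [:t, -1, 1:] l = 0" using alg_closed_imp_poly_has_root[of "[:t, -1, 1:]"] by auto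
  then show ?thesis by (intro exI[of _ l]) (simp add: algebra_simps)
 qed
 \<comment> \<open>An arbitrary section of \<open>l \<mapsto> l (1 - l)\<close>. It indexes the
   actions by isomorphism class but is not a morphism; the total map of the family therefore lives
   over the line with parameter \<open>l\<close>.\<close>
 then obtain root :: "'k => 'k" where root: "root t * (1 - root t) = t" for t by metis
 let ?q = "%(c :: nat => 'k) (i :: nat). if i = 0 then c 0 * (1 - c 0) else 0"
 let ?S = "%w. act r (fst w 0) (fst (snd w), snd (snd w))"
 show ?thesis
  unfolding one_dim_family_of_nonisomorphic_actions_def algebraic_family_of_actions_def
 proof (rule exI[of _ ?A], rule exI[of _ "%t. act r (root (t 0))"], intro conjI ballI impI)
  show "curve ?A" by (rule curve_line)
  show "additive_action ?M (act r (root (t 0)))" for t by (rule additive_action_act[OF r])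
  show "\<not> isomorphic_actions ?M (act r (root (t 0))) (act r (root (t' 0)))"
   if t: "t : points ?A" "t' : points ?A" "t ~= t'" for t t'
  proof
   assume "isomorphic_actions ?M (act r (root (t 0))) (act r (root (t' 0)))"
   from non[OF this] have "t 0 = t' 0" unfolding root .
   then have "t i = t' i" for i using t by (cases "i = 0") (simp_all add: affine_points_def)
   then show False using t(3) by blast
  qed
  show "EX (C :: 'k aspace) q \<Sigma>.
    curve C & morphism C ?A q & q ` points C = points ?A &
    morphism (prod_space C (prod_space Ga2 ?M)) ?M \<Sigma> &
    (ALL c:points C. additive_action ?M (%z. \<Sigma> (c, z)) &
     isomorphic_actions ?M (%z. \<Sigma> (c, z)) (act r (root (q c 0))))"
  proof (rule exI[of _ ?A], rule exI[of _ ?q], rule exI[of _ ?S], intro conjI ballI)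
   show "curve ?A" by (rule curve_line)
   show "morphism ?A ?A ?q"
   proof (rule morphism_into_affine[OF swf_affine])
    show "?q w : affine_points 1" for w by (simp add: affine_points_def)
    show "(%w. ?q w i) : reg ?A (points ?A)" if "i < 1" for i
     by (rule reg_affine_poly[OF _ openin_topspace]) (use that in \<open>simp add: poly_ops\<close>)
   qed
   show "?q ` points ?A = points ?A"
   proof
    show "?q ` points ?A <= points ?A" by (auto simp: affine_points_def)
    show "points ?A <= ?q ` points ?A"
    proof
     fix t assume t: "t : points ?A"
     show "t : ?q ` points ?A"
     proof (rule image_eqI[of _ _ "%i. if i = 0 then root (t 0) else 0"])
      show "t = ?q (%i. if i = 0 then root (t 0) else 0)" using t root by (auto simp: affine_points_def)
     qed (simp add: affine_points_def)
    qed
   qed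
   let ?W = "prod_space ?A (prod_space Ga2 ?M)"
   have G: "swf (prod_space Ga2 ?M)" by (rule swf_prod[OF swf_affine swf_model])
   have W: "swf ?W" by (rule swf_prod[OF swf_affine G])
   note m1 = morphism_fst[OF swf_affine G] and m2 = morphism_snd[OF swf_affine G]
   have l: "(%w. fst w 0) : reg ?W (points ?W)" by (rule coord_reg[OF W m1 openin_topspace]) simp
   show "morphism ?W ?M ?S"
    by (rule morphism_act[OF r W l morphism_comp[OF m2 morphism_fst[OF swf_affine swf_model]] morphism_comp[OF m2 morphism_snd[OF swf_affine swf_model]]])
   fix c :: "nat => 'k"
   have S: "(%z. ?S (c, z)) = act r (c 0)" by simp
   show "additive_action ?M (%z. ?S (c, z))" unfolding S by (rule additive_action_act[OF r])
   let ?m = "root (c 0 * (1 - c 0))"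
   \<comment> \<open>The chosen root of \<open>c (1 - c)\<close> is \<open>c\<close> or
     \<open>1 - c\<close>; the second case is covered by the reflection.\<close>
   have "(?m - c 0) * (1 - c 0 - ?m) = ?m * (1 - ?m) - c 0 * (1 - c 0)" by (simp add: algebra_simps)
   then have "?m = c 0 | 1 - c 0 = ?m" unfolding root by simp
   then have "?m = c 0 | ?m = 1 - c 0" by (elim disjE) (simp_all only: simp_thms)
   then show "isomorphic_actions ?M (%z. ?S (c, z)) (act r (root (?q c 0)))"
    unfolding S using isomorphic_actions_refl[OF swf_model] isomorphic_act_reflection[OF r] by auto
  qed
 qed
qed

subsection \<open>Non-isomorphic actions\<close>

text \<open>In characteristic zero the natural numbers are dense in the line. This passes from
  additivity to linearity.\<close>

lemma line_regular_zero:
 fixes f :: "(nat => 'k::field_char_0) => 'k"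
 assumes f: "f : reg (Aff 1) (affine_points 1)" and 0: "!!n. f (%i. if i = 0 then of_nat n else 0) = 0"
  and z: "z : affine_points 1"
 shows "f z = 0"
proof (rule ccontr)
 assume "f z ~= 0"
 let ?A = "Aff 1 :: 'k aspace"
 have o: "Opn ?A (affine_points 1)" using openin_topspace[of "topo ?A"] by simp
 have "Opn ?A {x : affine_points 1. f x ~= 0}" by (rule reg_nonzero[OF swf_affine o f])
 then obtain h where h: "h : Polys 1" "z : affine_basic 1 h" "affine_basic 1 h <= {x : affine_points 1. f x ~= 0}"
  unfolding openin_affine using z \<open>f z ~= 0\<close> by blast
 obtain p where p: "ALL x. h x = poly p (x 0)" using poly_line[OF h(1)] by blast
 have "poly p (of_nat n) = 0" for n
 proof (rule ccontr)
  let ?n = "%i::nat. if i = 0 then of_nat n else (0::'k)"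
  assume "poly p (of_nat n) ~= 0"
  then have "?n : affine_basic 1 h" unfolding affine_basic_def using p by (simp add: affine_points_def)
  then show False using h(3) 0 by blast
 qed
 then have "range (of_nat :: nat => 'k) <= {x. poly p x = 0}" by blast
 moreover have "infinite (range (of_nat :: nat => 'k))" by (rule range_inj_infinite) (simp add: inj_def)
 ultimately have "p = 0" using poly_roots_finite finite_subset by blast
 then show False using h(2) p unfolding affine_basic_def by simp
qed

text \<open>Additivity gives compatibility with natural multiples; regularity extends it to all
  scalars.\<close>

lemma Ga2_automorphism_linear:
 fixes \<psi> :: "(nat => 'k::field_char_0) => nat => 'k"
 assumes \<psi>: "Ga2_automorphism \<psi>"
 obtains a b c d where "!!v. v : points Ga2 ==> \<psi> v 0 = a * v 0 + b * v 1" "!!v. v : points Ga2 ==> \<psi> v 1 = c * v 0 + d * v 1"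
  "!!x y. a * x + b * y = 0 ==> c * x + d * y = 0 ==> x = 0 & y = 0"
proof -
 obtain \<chi>' where m: "morphism Ga2 Ga2 \<psi>" and inv: "ALL v:points Ga2. \<chi>' (\<psi> v) = v"
  and add: "ALL g:points Ga2. ALL h:points Ga2. \<psi> (ga_add g h) = ga_add (\<psi> g) (\<psi> h)"
  using \<psi> unfolding Ga2_automorphism_def isomorphism_def by blast
 have z: "(%_. 0) : points (Ga2 :: 'k aspace)" by (simp add: affine_points_def)
 have \<psi>0: "\<psi> (%_. 0) = (%_. 0)"
 proof
  fix i
  have "\<psi> (%_. 0) = ga_add (\<psi> (%_. 0)) (\<psi> (%_. 0))" using bspec[OF bspec[OF add z] z] by (simp add: ga_add_def)
  then have "\<psi> (%_. 0) i = \<psi> (%_. 0) i + \<psi> (%_. 0) i" unfolding ga_add_def by (rule fun_cong)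
  then show "\<psi> (%_. 0) i = 0" by simp
 qed
 have sc: "\<psi> (%j. t * v j) i = t * \<psi> v i" if v: "v : points Ga2" and i: "i < 2" for t v i
 proof -
  let ?A = "Aff 1 :: 'k aspace"
  have pv: "(%j. s * v j) : points Ga2" for s using v by (simp add: affine_points_def)
  have nat: "\<psi> (%j. of_nat n * v j) i = of_nat n * \<psi> v i" for n
  proof (induction n)
   case 0 show ?case using \<psi>0 by simp
  next
   case (Suc n)
   have "(%j. of_nat (Suc n) * v j) = ga_add v (%j. of_nat n * v j)" unfolding ga_add_def by (simp add: algebra_simps)
   then have "\<psi> (%j. of_nat (Suc n) * v j) = ga_add (\<psi> v) (\<psi> (%j. of_nat n * v j))" using add v pv by simp
   then show ?case unfolding ga_add_def using Suc by (simp add: algebra_simps)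
  qed
  have line: "morphism ?A Ga2 (%z j. z 0 * v j)"
  proof (rule morphism_into_affine[OF swf_affine])
   show "(%z. z 0 * v j) : reg ?A (points ?A)" for j by (rule reg_affine_poly[OF _ openin_topspace]) (simp add: poly_ops)
   show "(%j. w 0 * v j) : affine_points 2" for w :: "nat => 'k" using pv by simp
  qed
  \<comment> \<open>The defect of homogeneity along the line through \<open>v\<close> is regular in
    the scalar and vanishes at all natural numbers.\<close>
  have r: "(%z. \<psi> (%j. z 0 * v j) i - z 0 * \<psi> v i) : reg ?A (points ?A)"
   by (rule reg_diff[OF swf_affine openin_topspace coord_reg[OF swf_affine morphism_comp[OF line m] openin_topspace i]
     reg_affine_poly[OF _ openin_topspace]]) (simp add: poly_ops)
  have "\<psi> (%j. (%i. if i = 0 then t else 0) (0::nat) * v j) i - (%i. if i = 0 then t else 0) (0::nat) * \<psi> v i = 0"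
   by (rule line_regular_zero[OF r[unfolded points_affine]]) (simp_all add: nat affine_points_def)
  then show ?thesis by simp
 qed
 let ?e0 = "vec2 1 0 :: nat => 'k" and ?e1 = "vec2 0 1 :: nat => 'k"
 have e: "?e0 : points Ga2" "?e1 : points Ga2" by simp_all
 have lin: "\<psi> v i = \<psi> ?e0 i * v 0 + \<psi> ?e1 i * v 1" if v: "v : points Ga2" and i: "i < 2" for v i
 proof -
  have "v = vec2 (v 0) (v 1)" by (rule vec2_eta[OF v[unfolded points_affine], symmetric])
  also have "\<dots> = ga_add (%j. v 0 * ?e0 j) (%j. v 1 * ?e1 j)" unfolding ga_add_def vec2_def by auto
  finally have "\<psi> v = \<psi> (ga_add (%j. v 0 * ?e0 j) (%j. v 1 * ?e1 j))" by (rule arg_cong)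
  also have "\<dots> = ga_add (\<psi> (%j. v 0 * ?e0 j)) (\<psi> (%j. v 1 * ?e1 j))"
   by (rule bspec[OF bspec[OF add]]) (simp_all add: affine_points_def vec2_def)
  finally have "\<psi> v i = \<psi> (%j. v 0 * ?e0 j) i + \<psi> (%j. v 1 * ?e1 j) i" unfolding ga_add_def by (rule fun_cong)
  then show ?thesis unfolding sc[OF e(1) i] sc[OF e(2) i] by (simp add: mult.commute)
 qed
 show thesis
 proof (rule that[of "\<psi> ?e0 0" "\<psi> ?e1 0" "\<psi> ?e0 1" "\<psi> ?e1 1"])
  fix x y assume xy: "\<psi> ?e0 0 * x + \<psi> ?e1 0 * y = 0" "\<psi> ?e0 1 * x + \<psi> ?e1 1 * y = 0"
  have v: "vec2 x y : points Ga2" by simp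
  have "\<psi> (vec2 x y) : affine_points 2" using morphism_points[OF m v] by simp
  then have "\<psi> (vec2 x y) = vec2 (\<psi> (vec2 x y) 0) (\<psi> (vec2 x y) 1)" by (rule vec2_eta[symmetric])
  also have "\<psi> (vec2 x y) 0 = 0" using lin[OF v, of 0] xy(1) by simp
  also have "\<psi> (vec2 x y) 1 = 0" using lin[OF v, of 1] xy(2) by simp
  also have "vec2 0 0 = (%_. 0 :: 'k)" by (auto simp: vec2_def)
  finally have "\<psi> (vec2 x y) = \<psi> (%_. 0)" unfolding \<psi>0 .
  then have "\<chi>' (\<psi> (vec2 x y)) = \<chi>' (\<psi> (%_. 0))" by (rule arg_cong)
  then have e: "vec2 x y = (%_. 0)" unfolding bspec[OF inv v] bspec[OF inv z] .
  have "vec2 x y 0 = 0" "vec2 x y 1 = 0" unfolding e by (rule refl)+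
  then show "x = 0 & y = 0" by simp
 qed (rule lin, assumption, simp)+
qed

text \<open>The isomorphism maps the origin into the open orbit. The group element
  \<open>(x, y - l x^r)\<close> moves the origin to \<open>(x, y)\<close>, so equivariance
  determines the isomorphism on the whole plane from \<psi> and the image of the origin.\<close>

lemma isomorphic_act_affine:
 fixes l m :: "'k::field_char_0"
 assumes r: "1 <= r" and iso: "isomorphic_actions (model_space r) (act r l) (act r m)"
 obtains \<Phi> a b c d x0 y0 where "morphism (model_space r) (model_space r) \<Phi>" "inj_on \<Phi> (model r)"
  "!!x y. a * x + b * y = 0 ==> c * x + d * y = 0 ==> x = 0 & y = 0"
  "!!x y. \<Phi> (aff r x y) = aff r (x0 + (a * x + b * (y - l * x ^ r)))
   (y0 + (c * x + d * (y - l * x ^ r) + m * ((x0 + (a * x + b * (y - l * x ^ r))) ^ r - x0 ^ r)))"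
proof -
 let ?M = "model_space r :: 'k pspace"
 obtain \<Phi> \<psi> where \<Phi>: "isomorphism ?M ?M \<Phi>" and \<psi>: "Ga2_automorphism \<psi>"
  and e: "ALL v:points Ga2. ALL \<zeta>:points ?M. \<Phi> (act r l (v, \<zeta>)) = act r m (\<psi> v, \<Phi> \<zeta>)"
  using iso unfolding isomorphic_actions_def by (elim exE conjE)
 obtain G where G: "morphism ?M ?M \<Phi>" "morphism ?M ?M G" "!!\<zeta>. \<zeta> : points ?M ==> G (\<Phi> \<zeta>) = \<zeta>" "!!\<zeta>. \<zeta> : points ?M ==> \<Phi> (G \<zeta>) = \<zeta>"
  by (rule isomorphismE[OF \<Phi>]) (rule that; assumption)
 have \<psi>p: "\<psi> v : points Ga2" if "v : points Ga2" for v
  by (rule morphism_points[OF _ that]) (rule \<psi>[unfolded Ga2_automorphism_def isomorphism_def, THEN conjunct1, THEN conjunct1])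
 have am: "aff r x y : points ?M" for x y unfolding points_model by (rule aff_model)
 note \<Phi>p = morphism_points[OF G(1)]
 have z: "(0::'k) ^ r = 0" using r by simp
 have orb: "act r l (vec2 x (y - l * x ^ r), aff r 0 0) = aff r x y" for x y l :: 'k
  unfolding act_aff[OF r] by (simp add: z algebra_simps)
 let ?p = "\<Phi> (aff r 0 0)"
 \<comment> \<open>The image of the plane is open, so it contains an affine point. That point is in
   the orbit of \<open>?p\<close>; acting by the negative group element brings it back to
   \<open>?p\<close> without leaving the plane.\<close>
 have "EX x y. ?p = aff r x y"
 proof -
  let ?V = "{\<zeta> : points ?M. G \<zeta> : aff_points r}"
  have "Opn ?M ?V" by (rule morphism_open[OF G(2) openin_aff_points[OF r]])
  moreover have "?p : ?V" using \<Phi>p[OF am] G(3)[OF am] unfolding aff_points_def by auto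
  ultimately have "?V \<inter> aff_points r ~= {}" using dense_model unfolding dense_in_def by blast
  then obtain \<zeta> x y x' y' where \<zeta>: "\<zeta> : points ?M" "G \<zeta> = aff r x y" "\<zeta> = aff r x' y'" unfolding aff_points_def by blast
  let ?v = "vec2 x (y - l * x ^ r)"
  have v: "?v : points Ga2" by simp
  note w = \<psi>p[OF v]
  have "\<zeta> = \<Phi> (act r l (?v, aff r 0 0))" using G(4)[OF \<zeta>(1)] unfolding \<zeta>(2) orb by (rule sym)
  also have "\<dots> = act r m (\<psi> ?v, ?p)" using e v am by blast
  finally have "aff r x' y' = act r m (\<psi> ?v, ?p)" unfolding \<zeta>(3) .
  moreover have "act r m ((%i. - \<psi> ?v i), act r m (\<psi> ?v, ?p)) = ?p"
  proof (rule model_agree[OF morphism_comp[OF morphism_act_const[OF r w] morphism_act_const[OF r]] morphism_id[OF swf_model] _ \<Phi>p[OF am]])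
   show "(%i. - \<psi> ?v i) : points Ga2" using w by (simp add: affine_points_def)
  qed (simp add: act_aff[OF r] algebra_simps)
  ultimately have "?p = act r m ((%i. - \<psi> ?v i), aff r x' y')" by simp
  then show ?thesis unfolding act_aff[OF r] by blast
 qed
 then obtain x0 y0 where p: "?p = aff r x0 y0" by blast
 obtain a b c d where lin: "!!v. v : points Ga2 ==> \<psi> v 0 = a * v 0 + b * v 1" "!!v. v : points Ga2 ==> \<psi> v 1 = c * v 0 + d * v 1"
  and inj: "!!x y. a * x + b * y = 0 ==> c * x + d * y = 0 ==> x = 0 & y = 0"
  by (rule Ga2_automorphism_linear[OF \<psi>]) (rule that; assumption)
 show thesis
 proof (rule that[OF G(1) _ inj])
  show "inj_on \<Phi> (model r)" by (rule inj_on_inverseI[of _ G]) (rule G(3), unfold points_model)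
  fix x y
  let ?v = "vec2 x (y - l * x ^ r)"
  have v: "?v : points Ga2" by simp
  have "\<Phi> (aff r x y) = act r m (\<psi> ?v, aff r x0 y0)" using e v am unfolding orb[symmetric, of x y l] p[symmetric] by blast
  then show "\<Phi> (aff r x y) = aff r (x0 + (a * x + b * (y - l * x ^ r)))
   (y0 + (c * x + d * (y - l * x ^ r) + m * ((x0 + (a * x + b * (y - l * x ^ r))) ^ r - x0 ^ r)))"
   unfolding act_aff[OF r] lin[OF v] by simp
 qed
qed

text \<open>Points near the exceptional curve over \<open>v\<^sub>2 = \<epsilon> v\<^sub>1\<^sup>r v\<^sub>3\<close>; the curve itself is \<open>u = 0\<close>.\<close>

definition exceptional :: "nat => 'k::field => 'k => 'k => (nat => 'k) set" where
 "exceptional r \<epsilon> u w = hp (top_index r) (blk r (%i. u ^ (3 * r - i)) (%i. (\<epsilon> + u * w) * u ^ (2 * r - i))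
  (%i. w * (u * w + (2 * \<epsilon> - 1)) * u ^ (r + 1 - i)) (%i. (\<epsilon> + u * w) * (w * (u * w + (2 * \<epsilon> - 1))) * u ^ (1 - i)))"

text \<open>Off the exceptional curve the coordinates of \<open>Phi\<close> have the common factor
  \<open>u\<close>, since \<open>v (v - 1) = u w (u w + 2 \<epsilon> - 1)\<close> for
  \<open>v = \<epsilon> + u w\<close>; dropping it extends the formula to
  \<open>u = 0\<close>.\<close>

lemma exceptional_Hmap:
 fixes \<epsilon> :: "'k::field"
 assumes \<epsilon>: "\<epsilon> = 0 | \<epsilon> = 1" and u: "u ~= 0"
 shows "exceptional r \<epsilon> u w = Hmap r (vec4 u 1 (\<epsilon> + u * w) 1)"
 unfolding exceptional_def Hmap_def
proof (rule hp_eqI[of "inverse u", OF _ ], goal_cases)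
 case (2 j)
 let ?v = "\<epsilon> + u * w" and ?t = "w * (u * w + (2 * \<epsilon> - 1))"
 have vv: "?v * (?v - 1) = u * ?t" using \<epsilon> by (auto simp: algebra_simps)
 have "Phi r (vec4 u 1 ?v 1) j = u * blk r (%i. u ^ (3 * r - i)) (%i. ?v * u ^ (2 * r - i)) (%i. ?t * u ^ (r + 1 - i))
   (%i. ?v * ?t * u ^ (1 - i)) j"
  unfolding Phi_def vec4_simps
 proof (rule blk_scale)
  fix i assume "i <= 3 * r"
  then have "3 * r + 1 - i = Suc (3 * r - i)" by simp
  then show "u ^ (3 * r + 1 - i) * 1 ^ i * 1 ^ 3 = u * u ^ (3 * r - i)" by simp
 next
  fix i assume "i <= 2 * r"
  then have "2 * r + 1 - i = Suc (2 * r - i)" by simp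
  then show "?v * 1\<^sup>2 * (u ^ (2 * r + 1 - i) * 1 ^ i) = u * (?v * u ^ (2 * r - i))" by (simp add: ac_simps)
 next
  fix i
  have "?v * (?v - 1 ^ r * 1) * 1 * (u ^ (r + 1 - i) * 1 ^ i) = (?v * (?v - 1)) * u ^ (r + 1 - i)" by simp
  then show "?v * (?v - 1 ^ r * 1) * 1 * (u ^ (r + 1 - i) * 1 ^ i) = u * (?t * u ^ (r + 1 - i))"
   unfolding vv by (simp only: mult.assoc)
 next
  fix i :: nat
  have "?v\<^sup>2 * (?v - 1 ^ r * 1) * (u ^ (1 - i) * 1 ^ i) = ?v * (?v * (?v - 1)) * u ^ (1 - i)" by (simp add: power2_eq_square)
  also have "\<dots> = u * (?v * ?t * u ^ (1 - i))" unfolding vv by (simp only: mult_ac)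
  finally show "?v\<^sup>2 * (?v - 1 ^ r * 1) * (u ^ (1 - i) * 1 ^ i) = u * (?v * ?t * u ^ (1 - i))" .
 qed
 then show ?case using u by simp
qed (use u in simp)

lemma morphism_exceptional:
 fixes W :: "('w, 'k::field) fspace"
 assumes W: "swf W" and u: "u : reg W (points W)" and w: "w : reg W (points W)"
 shows "morphism W (Proj (top_index r)) (%z. exceptional r \<epsilon> (u z) (w z))"
 unfolding exceptional_def
proof (rule morphism_hp[OF W])
 let ?P = "%p :: nat => 'k. blk r (%i. p 0 ^ (3 * r - i)) (%i. (\<epsilon> + p 0 * p 1) * p 0 ^ (2 * r - i))
  (%i. p 1 * (p 0 * p 1 + (2 * \<epsilon> - 1)) * p 0 ^ (r + 1 - i)) (%i. (\<epsilon> + p 0 * p 1) * (p 1 * (p 0 * p 1 + (2 * \<epsilon> - 1))) * p 0 ^ (1 - i))"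
 fix j
 have P: "(%p. ?P p j) : Polys 2" by (rule blk_poly) (simp_all add: poly_ops)
 have "(%z. if i = 0 then u z else w z) : reg W (points W)" for i :: nat by (cases "i = 0") (simp_all add: u w)
 then have "(%z. ?P (%i. if i = 0 then u z else w z) j) : reg W (points W)"
  by (rule reg_poly_comp[OF P W openin_topspace])
 then show "(%z. blk r (%i. u z ^ (3 * r - i)) (%i. (\<epsilon> + u z * w z) * u z ^ (2 * r - i))
  (%i. w z * (u z * w z + (2 * \<epsilon> - 1)) * u z ^ (r + 1 - i)) (%i. (\<epsilon> + u z * w z) * (w z * (u z * w z + (2 * \<epsilon> - 1))) * u z ^ (1 - i)) j)
  : reg W (points W)" by simp
qed (rule exI[of _ "4 * (3 * r)"], unfold blk_simps, simp)

text \<open>At \<open>u = 0\<close> the coordinate \<open>x^(3 r)\<close> is \<open>1\<close>, which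
  fixes the scale, and \<open>z x^(r+1)\<close> is \<open>w\<close> times the nonzero number
  \<open>2 \<epsilon> - 1\<close>.\<close>

lemma exceptional_injective:
 fixes \<epsilon> :: "'k::field_char_0"
 assumes r: "1 <= r" and \<epsilon>: "\<epsilon> = 0 | \<epsilon> = 1" and e: "exceptional r \<epsilon> 0 w = exceptional r \<epsilon> 0 w'"
 shows "w = w'"
proof -
 let ?B = "%w. blk r (%i. 0 ^ (3 * r - i)) (%i. (\<epsilon> + 0 * w) * 0 ^ (2 * r - i))
  (%i. w * (0 * w + (2 * \<epsilon> - 1)) * 0 ^ (r + 1 - i)) (%i. (\<epsilon> + 0 * w) * (w * (0 * w + (2 * \<epsilon> - 1))) * 0 ^ (1 - i))"
 obtain c where c: "ALL i<=top_index r. ?B w i = c * ?B w' i" using e hp_eqD unfolding exceptional_def by blast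
 have 1: "?B w (4 * (3 * r)) = 1" "?B w (4 * (r + 1) + 2) = w * (2 * \<epsilon> - 1)" for w unfolding blk_simps by simp_all
 have "c = 1" using c[rule_format, of "4 * (3 * r)"] unfolding 1 by simp
 moreover have "?B w (4 * (r + 1) + 2) = c * ?B w' (4 * (r + 1) + 2)" using r by (intro c[rule_format]) simp
 ultimately have "w * (2 * \<epsilon> - 1) = w' * (2 * \<epsilon> - 1)" unfolding 1 by simp
 moreover have "2 * \<epsilon> - 1 ~= 0" using \<epsilon> by auto
 ultimately show ?thesis by simp
qed

lemma dense_line:
 assumes "Opn (Aff 1) U"
 shows "dense_in (Sub (Aff 1) U) {z :: nat => 'k::field_char_0. z 0 ~= 0}"
 by (rule dense_affine_nonzero[OF assms, of _ "%i. if i = 0 then 1 else 0"]) (simp_all add: poly_ops affine_points_def)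

lemma exceptional_model:
 fixes \<epsilon> :: "'k::field_char_0"
 assumes \<epsilon>: "\<epsilon> = 0 | \<epsilon> = 1"
 shows "exceptional r \<epsilon> u w : model r"
proof -
 let ?A = "Aff 1 :: 'k aspace" and ?z = "%i::nat. if i = 0 then u else 0"
 have "exceptional r \<epsilon> (?z 0) w : model r"
 proof (rule closed_image_model[where f = "%z. exceptional r \<epsilon> (z 0) w" and w = ?z, OF swf_subspace[OF swf_affine] _ dense_line[OF openin_topspace]])
  show "morphism (Sub ?A (points ?A)) (Proj (top_index r)) (%z. exceptional r \<epsilon> (z 0) w)"
   by (rule morphism_restrict[OF swf_affine], rule morphism_exceptional[OF swf_affine]; rule reg_affine_poly[OF _ openin_topspace]) (simp_all add: poly_ops)
  fix e :: "nat => 'k" assume "e : {z. z 0 ~= 0}"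
  then have e: "e 0 ~= 0" by simp
  have "vec4 (e 0) 1 (\<epsilon> + e 0 * w) 1 : good r" using e by (simp add: good_def vec4_domain)
  then show "exceptional r \<epsilon> (e 0) w : model r" unfolding exceptional_Hmap[OF \<epsilon> e] by (rule Hmap_model)
 qed (simp add: affine_points_def)
 then show ?thesis by simp
qed

text \<open>Values of \<Phi> outside the plane are computed as limits along a curve: \<kappa>'
  expresses the image of the curve by coordinates that still make sense at the limit.\<close>

lemma limit_point:
 fixes \<kappa> \<kappa>' :: "(nat => 'k::field_char_0) => (nat => 'k) set"
 assumes U: "h : Polys 1" "h (%_. 0) ~= 0" and \<Phi>: "morphism (model_space r) (model_space r) \<Phi>"
  and \<kappa>: "morphism (Aff 1) (model_space r) \<kappa>"
  and \<kappa>': "morphism (Sub (Aff 1) (affine_basic 1 h)) (Proj (top_index r)) \<kappa>'"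
  and e: "!!z. z 0 ~= 0 ==> h z ~= 0 ==> \<Phi> (\<kappa> z) = \<kappa>' z"
 shows "\<Phi> (\<kappa> (%_. 0)) = \<kappa>' (%_. 0)"
proof (rule agree_on_dense[OF separated_proj[OF swf_subspace[OF swf_affine]] dense_line[OF openin_affine_basic[OF U(1)]] _ \<kappa>'])
 show "morphism (Sub (Aff 1) (affine_basic 1 h)) (Proj (top_index r)) (%z. \<Phi> (\<kappa> z))"
  by (rule morphism_restrict[OF swf_affine morphism_comp[OF morphism_comp[OF \<kappa> \<Phi>] morphism_model]])
qed (use U(2) e in \<open>auto simp: affine_basic_def affine_points_def\<close>)

lemma morphism_Hmap_curve:
 fixes W :: "('w, 'k::field) fspace"
 assumes W: "swf W" and r: "a : reg W (points W)" "b : reg W (points W)" "c : reg W (points W)" "d : reg W (points W)"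
  and good: "!!z. z : points W ==> vec4 (a z) (b z) (c z) (d z) : good r"
 shows "morphism W (Proj (top_index r)) (%z. Hmap r (vec4 (a z) (b z) (c z) (d z)))"
 unfolding Hmap_def
proof (rule morphism_hp[OF W])
 fix i show "(%z. Phi r (vec4 (a z) (b z) (c z) (d z)) i) : reg W (points W)"
 proof (rule reg_poly_comp[OF Phi_poly W openin_topspace])
  fix j :: nat assume "j < 4"
  then show "(%z. vec4 (a z) (b z) (c z) (d z) j) : reg W (points W)" by (rule less4_cases) (simp_all only: vec4_simps r)
 qed
next
 fix z assume z: "z : points W"
 have "vec4 (a z) (b z) (c z) (d z) : Dom" using good[OF z] unfolding good_def by blast
 then show "EX i<=top_index r. Phi r (vec4 (a z) (b z) (c z) (d z)) i ~= 0" using Phi_nonzero_iff good[OF z] by blast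
qed

text \<open>The case of a curve \<open>x = q / z\<close>, \<open>y = n / z^r\<close> going to
  infinity whose limit on the fiber \<open>v 0 = 0\<close> is neither of the blown up
  points.\<close>

lemma limit_good:
 fixes \<kappa> :: "(nat => 'k::field_char_0) => (nat => 'k) set"
 assumes \<Phi>: "morphism (model_space r) (model_space r) \<Phi>" and \<kappa>: "morphism (Aff 1) (model_space r) \<kappa>"
  and q: "q : Polys 1" "n : Polys 1" "q (%_. 0) * n (%_. 0) * (n (%_. 0) - q (%_. 0) ^ r) ~= 0"
  and e: "!!z. z 0 ~= 0 ==> \<Phi> (\<kappa> z) = aff r (q z / z 0) (n z / z 0 ^ r)"
 shows "\<Phi> (\<kappa> (%_. 0)) = Hmap r (vec4 0 (q (%_. 0)) (n (%_. 0)) 1)"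
proof -
 let ?h = "%z. q z * n z * (n z - q z ^ r)"
 have h: "?h : Polys 1" using q(1,2) by (simp add: poly_ops)
 let ?W = "Sub (Aff 1) (affine_basic 1 ?h)"
 have W: "swf ?W" by (rule swf_subspace[OF swf_affine])
 have g: "vec4 (z 0) (q z) (n z) 1 : good r" if "?h z ~= 0" for z using that by (simp add: good_def vec4_domain)
 have o: "Opn (Aff 1) (affine_basic 1 ?h)" by (rule openin_affine_basic[OF h])
 have pW: "points ?W = affine_basic 1 ?h" by (auto simp: affine_basic_def)
 have p: "f : reg ?W (points ?W)" if "f : Polys 1" for f
  unfolding pW reg_subspace_open[OF swf_affine o o subset_refl] by (rule reg_affine_poly[OF that o])
 have "\<Phi> (\<kappa> (%_. 0)) = Hmap r (vec4 ((%_. 0) (0::nat)) (q (%_. 0)) (n (%_. 0)) 1)"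
 proof (rule limit_point[OF h q(3) \<Phi> \<kappa>, where \<kappa>' = "%z. Hmap r (vec4 (z 0) (q z) (n z) 1)"])
  show "morphism ?W (Proj (top_index r)) (%z. Hmap r (vec4 (z 0) (q z) (n z) 1))"
  proof (rule morphism_Hmap_curve[OF W p p[OF q(1)] p[OF q(2)] p])
   show "vec4 (z 0) (q z) (n z) 1 : good r" if "z : points ?W" for z
    by (rule g) (use that in \<open>simp add: affine_basic_def\<close>)
  qed (simp_all add: poly_ops)
  fix z :: "nat => 'k" assume z: "z 0 ~= 0" "?h z ~= 0"
  have "Hmap r (vec4 (z 0) (q z) (n z) 1) = aff r (q z / z 0) (n z / z 0 ^ r)"
   using Hmap_aff(2)[of "vec4 (z 0) (q z) (n z) 1" r] z(1) by (simp add: vec4_domain)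
  then show "\<Phi> (\<kappa> z) = Hmap r (vec4 (z 0) (q z) (n z) 1)" unfolding e[of z, OF z(1)] by (rule sym)
 qed
 then show ?thesis .
qed

text \<open>
 An isomorphism between two actions of the family is affine on the open orbit. If \<open>b ~= 0\<close>, it contracts the section
 \<open>v\<^sub>3 = 0\<close> to a point. If \<open>b = 0\<close>, it maps exceptional curves to exceptional curves, which determines the parameter.
\<close>

context
 fixes r s :: nat and \<Phi> :: "(nat => 'k::field_char_0) set => (nat => 'k) set" and a b c d x0 y0 l m :: 'k
 assumes rs: "r = Suc (Suc s)" and \<Phi>: "morphism (model_space r) (model_space r) \<Phi>" and inj: "inj_on \<Phi> (model r)"
  and nd: "!!x y. a * x + b * y = 0 ==> c * x + d * y = 0 ==> x = 0 & y = 0"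
  and aff: "!!x y. \<Phi> (aff r x y) = aff r (x0 + (a * x + b * (y - l * x ^ r)))
   (y0 + (c * x + d * (y - l * x ^ r) + m * ((x0 + (a * x + b * (y - l * x ^ r))) ^ r - x0 ^ r)))"
begin

text \<open>The point with parameter \<open>x\<close> on the section \<open>v 3 = 0\<close> is
  approached by \<open>y = 1 / z\<close>. For nonzero \<open>b\<close> the leading terms of the
  image do not involve \<open>x\<close>.\<close>

lemma contracted_section:
 assumes b: "b ~= 0" shows "EX K. ALL x. \<Phi> (Hmap r (vec4 1 x 1 0)) = K"
proof -
 \<comment> \<open>\<open>?q\<close> and \<open>?n\<close> are the two coordinates of the image of
   \<open>(x, 1 / z)\<close>, cleared of denominators by \<open>z\<close> and \<open>z^r\<close>.
   The polynomial \<open>?m\<close> is the quotient of \<open>?n - m ?q^r\<close> by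
   \<open>z\<close>; writing it with \<open>z^s\<close> uses \<open>r >= 2\<close>.\<close>
 let ?q = "%x z :: nat => 'k. z 0 * x0 + a * z 0 * x + b * (1 - l * z 0 * x ^ r)"
 let ?m = "%x z :: nat => 'k. z 0 * z 0 ^ s * (y0 + c * x - m * x0 ^ r) + d * z 0 ^ s * (1 - l * z 0 * x ^ r)"
 let ?n = "%x z :: nat => 'k. z 0 * ?m x z + m * ?q x z ^ r"
 let ?\<kappa> = "%x z :: nat => 'k. Hmap r (vec4 1 x 1 (z 0))"
 have q: "?q x : Polys 1" and m: "?m x : Polys 1" for x by (simp_all add: poly_ops)
 have n: "?n x : Polys 1" for x by (intro poly_functions.add poly_functions.mult poly_power q m poly_functions.const poly_functions.coord) simp
 have g: "vec4 1 x 1 (z 0) : good r" for x and z :: "nat => 'k" by (simp add: good_def vec4_domain)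
 have \<kappa>: "morphism (Aff 1) (model_space r) (?\<kappa> x)" for x
 proof -
  have "morphism (Aff 1) (Proj (top_index r)) (?\<kappa> x)"
   by (rule morphism_Hmap_curve[OF swf_affine _ _ _ _ g]; rule reg_affine_poly[OF _ openin_topspace]) (simp_all add: poly_ops)
  then show ?thesis unfolding model_space_def morphism_into_subspace_iff[OF swf_proj swf_affine]
   using Hmap_model[OF g] by blast
 qed
 have e: "\<Phi> (?\<kappa> x z) = aff r (?q x z / z 0) (?n x z / z 0 ^ r)" if z: "z 0 ~= 0" for x z
 proof -
  have k: "?\<kappa> x z = aff r x (1 / z 0)" using Hmap_aff(2)[of "vec4 1 x 1 (z 0)" r] z by (simp add: vec4_domain)
  have X: "x0 + (a * x + b * (1 / z 0 - l * x ^ r)) = ?q x z / z 0" using z by (simp add: field_simps)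
  have Y: "y0 + (c * x + d * (1 / z 0 - l * x ^ r) + m * ((?q x z / z 0) ^ r - x0 ^ r)) = ?n x z / z 0 ^ r"
  proof -
   have "(A + m * Q ^ r) / t ^ r = A / t ^ r + m * (Q / t) ^ r" for A Q t by (simp add: add_divide_distrib power_divide)
   then have "?n x z / z 0 ^ r = z 0 * ?m x z / z 0 ^ r + m * (?q x z / z 0) ^ r" .
   also have "z 0 * ?m x z / z 0 ^ r = (y0 + c * x - m * x0 ^ r) + d * (1 / z 0 - l * x ^ r)"
   proof -
    have "z 0 * (t * z 0 ^ s * A + d * z 0 ^ s * B) = (A * t + d * B) * (z 0 * z 0 ^ s)" for A B t by (simp add: algebra_simps)
    then have "z 0 * ?m x z = ((y0 + c * x - m * x0 ^ r) * z 0 + d * (1 - l * z 0 * x ^ r)) * (z 0 * z 0 ^ s)" .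
    moreover have "z 0 ^ r = z 0 * (z 0 * z 0 ^ s)" unfolding rs by simp
    moreover have "z 0 * z 0 ^ s ~= 0" using z by simp
    ultimately have "z 0 * ?m x z / z 0 ^ r = ((y0 + c * x - m * x0 ^ r) * z 0 + d * (1 - l * z 0 * x ^ r)) / z 0" by simp
    also have "\<dots> = (y0 + c * x - m * x0 ^ r) + d * (1 / z 0 - l * x ^ r)" using z by (simp add: field_simps)
    finally show ?thesis .
   qed
   finally show ?thesis by (simp add: algebra_simps)
  qed
  show ?thesis unfolding k aff X Y ..
 qed
 show ?thesis
 proof (cases "m = 0 | m = 1")
  \<comment> \<open>The limit lies on the fiber at the value \<open>m\<close> of
    \<open>y / x^r\<close>, which is not one of the blown up points.\<close>
  case False
  have "\<Phi> (?\<kappa> x (%_. 0)) = Hmap r (vec4 0 b (m * b ^ r) 1)" for x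
  proof -
   have "\<Phi> (?\<kappa> x (%_. 0)) = Hmap r (vec4 0 (?q x (%_. 0)) (?n x (%_. 0)) 1)"
   proof (rule limit_good[where r = r and \<Phi> = \<Phi> and \<kappa> = "?\<kappa> x" and q = "?q x" and n = "?n x", OF \<Phi> \<kappa> q n])
    fix z :: "nat => 'k" assume "z 0 ~= 0"
    then show "\<Phi> (?\<kappa> x z) = aff r (?q x z / z 0) (?n x z / z 0 ^ r)" by (rule e)
   next
    have "m * b ^ r - b ^ r = (m - 1) * b ^ r" by (simp add: algebra_simps)
    then show "?q x (%_. 0) * ?n x (%_. 0) * (?n x (%_. 0) - ?q x (%_. 0) ^ r) ~= 0" using b False by simp
   qed
   then show ?thesis by simp
  qed
  then show ?thesis by blast
 next
  \<comment> \<open>The limit now lies on the exceptional curve over \<open>m\<close>, so it is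
    computed with \<open>u = z / q\<close> and \<open>w = ?m / q^(r-1)\<close>. At
    \<open>z = 0\<close> the latter is independent of \<open>x\<close>; for \<open>r = 2\<close> the
    factor \<open>0 ^ s\<close> is \<open>1\<close>.\<close>
  case True
  let ?W = "%x. Sub (Aff 1) (affine_basic 1 (?q x))"
  have "\<Phi> (?\<kappa> x (%_. 0)) = exceptional r m 0 (d * 0 ^ s / b ^ (r - 1))" for x
  proof -
   let ?w = "%z. ?m x z / ?q x z ^ (r - 1)"
   have o: "Opn (Aff 1) (affine_basic 1 (?q x))" by (rule openin_affine_basic[OF q])
   have pW: "points (?W x) = affine_basic 1 (?q x)" by (auto simp: affine_basic_def)
   have W: "swf (?W x)" by (rule swf_subspace[OF swf_affine])
   have p: "f : reg (?W x) (points (?W x))" if "f : Polys 1" for f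
    unfolding pW reg_subspace_open[OF swf_affine o o subset_refl] by (rule reg_affine_poly[OF that o])
   have z0: "(%z. z 0) : Polys 1" by (simp add: poly_ops)
   have nz: "?q x z ~= 0" if "z : points (?W x)" for z using that[unfolded pW, unfolded affine_basic_def] by blast
   have "\<Phi> (?\<kappa> x (%_. 0)) = exceptional r m ((%_. 0) (0::nat) / ?q x (%_. 0)) (?w (%_. 0))"
   proof (rule limit_point[where \<kappa>' = "%z. exceptional r m (z 0 / ?q x z) (?w z)" and h = "?q x" and r = r and \<Phi> = \<Phi> and \<kappa> = "?\<kappa> x", OF q _ \<Phi> \<kappa>])
    show "?q x (%_. 0) ~= 0" using b by simp
    show "morphism (?W x) (Proj (top_index r)) (%z. exceptional r m (z 0 / ?q x z) (?w z))"
    proof (rule morphism_exceptional[OF W])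
     show "(%z. z 0 / ?q x z) : reg (?W x) (points (?W x))"
      by (rule reg_divide[OF W openin_topspace p[OF z0] p[OF q]]) (rule nz)
     show "?w : reg (?W x) (points (?W x))"
      by (rule reg_divide[OF W openin_topspace p[OF m] p[OF poly_power[OF q]]]) (rule power_not_zero[OF nz])
    qed
    fix z :: "nat => 'k" assume z: "z 0 ~= 0" "?q x z ~= 0"
    have u: "z 0 / ?q x z ~= 0" using z by simp
    have gen: "Hmap r (vec4 (t / q) 1 (m + t / q * (M / q ^ (r - 1))) 1) = aff r (q / t) ((t * M + m * q ^ r) / t ^ r)"
     if tq: "t ~= 0" "q ~= 0" for t q M
    proof -
     have qr: "q ^ r = q * q ^ (r - 1)" unfolding rs by simp
     have "m + t / q * (M / q ^ (r - 1)) = (t * M + m * q ^ r) / q ^ r" unfolding qr using tq by (simp add: field_simps)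
     then have "(m + t / q * (M / q ^ (r - 1))) / (t / q) ^ r = (t * M + m * q ^ r) / t ^ r" using tq by (simp add: power_divide)
     then show ?thesis using Hmap_aff(2)[of "vec4 (t / q) 1 (m + t / q * (M / q ^ (r - 1))) 1" r] tq by (simp add: vec4_domain)
    qed
    show "\<Phi> (?\<kappa> x z) = exceptional r m (z 0 / ?q x z) (?w z)"
     unfolding e[of z, OF z(1)] exceptional_Hmap[OF True u] by (rule gen[OF z, symmetric])
   qed
   then show ?thesis by simp
  qed
  then show ?thesis by auto
 qed
qed

lemma section_not_contracted: "b = 0"
proof (rule ccontr)
 assume "b ~= 0"
 then obtain K where "ALL x. \<Phi> (Hmap r (vec4 1 x 1 0)) = K" using contracted_section by blast
 then have "\<Phi> (Hmap r (vec4 1 0 1 0)) = \<Phi> (Hmap r (vec4 1 1 1 0))" by simp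
 note e = this
 have "Hmap r (vec4 1 x 1 0) : model r" for x :: 'k by (rule Hmap_model) (simp add: good_def vec4_domain)
 then have h: "Hmap r (vec4 1 0 1 0) = Hmap r (vec4 1 1 1 (0::'k))" by (intro inj_onD[OF inj e])
 obtain k where k: "k ~= 0" "ALL i<=top_index r. Phi r (vec4 1 0 1 0) i = k * Phi r (vec4 1 1 1 (0::'k)) i"
  using hp_eqD[OF h[unfolded Hmap_def]] by (elim exE conjE)
 \<comment> \<open>The coordinate \<open>y z x^1\<close> equals \<open>v 1\<close> at these points,
   hence it is \<open>0\<close> at one and \<open>1\<close> at the other.\<close>
 have "Phi r (vec4 1 0 1 0) (4 * 1 + 3) = k * Phi r (vec4 1 1 1 (0::'k)) (4 * 1 + 3)" by (rule k(2)[rule_format]) simp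
 then show False using k(1) unfolding Phi_def blk_simps by simp
qed

text \<open>Otherwise the exceptional curve over \<epsilon> would be contracted to a point of the
  fiber at infinity that is not blown up, against injectivity.\<close>

lemma exceptional_curve_image:
 assumes \<epsilon>: "\<epsilon> = 0 | \<epsilon> = (1::'k)"
 shows "d * (\<epsilon> - l) + m * a ^ r = 0 | d * (\<epsilon> - l) + m * a ^ r = a ^ r"
proof (rule ccontr)
 assume no: "\<not> ?thesis"
 \<comment> \<open>As \<open>b = 0\<close>, the linear part is triangular; if \<open>a\<close>
   vanished, \<open>(d, -c)\<close> would be in its kernel.\<close>
 have a: "a ~= 0"
 proof
  assume a: "a = 0"
  have d: "d ~= 0" using nd[of 0 1] section_not_contracted by auto
  show False using nd[of d "- c"] a d section_not_contracted by simp
 qed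
 \<comment> \<open>The image of the curve \<open>x = 1 / z\<close>,
   \<open>y = (\<epsilon> + z w) / z^r\<close> in the form required by \<open>limit_good\<close>; at
   \<open>z = 0\<close> the parameter \<open>w\<close> drops out.\<close>
 let ?q = "%z :: nat => 'k. x0 * z 0 + a"
 let ?n = "%w z :: nat => 'k. z 0 ^ r * (y0 - m * x0 ^ r) + c * (z 0 * z 0 ^ s) + d * (\<epsilon> + z 0 * w - l) + m * ?q z ^ r"
 have q: "?q : Polys 1" and n: "?n w : Polys 1" for w by (simp_all add: poly_ops)
 let ?\<kappa> = "%w z :: nat => 'k. exceptional r \<epsilon> (z 0) w"
 have "\<Phi> (exceptional r \<epsilon> 0 w) = Hmap r (vec4 0 a (d * (\<epsilon> - l) + m * a ^ r) 1)" for w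
 proof -
  have \<kappa>: "morphism (Aff 1) (model_space r) (?\<kappa> w)"
  proof -
   have "morphism (Aff 1) (Proj (top_index r)) (?\<kappa> w)"
    by (rule morphism_exceptional[OF swf_affine]; rule reg_affine_poly[OF _ openin_topspace]) (simp_all add: poly_ops)
   then show ?thesis unfolding model_space_def morphism_into_subspace_iff[OF swf_proj swf_affine]
    using exceptional_model[OF \<epsilon>] by blast
  qed
  have "\<Phi> (?\<kappa> w (%_. 0)) = Hmap r (vec4 0 (?q (%_. 0)) (?n w (%_. 0)) 1)"
  proof (rule limit_good[where r = r and \<Phi> = \<Phi> and \<kappa> = "?\<kappa> w" and q = ?q and n = "?n w", OF \<Phi> \<kappa> q n])
   show "?q (%_. 0) * ?n w (%_. 0) * (?n w (%_. 0) - ?q (%_. 0) ^ r) ~= 0" using no a rs by simp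
   fix z :: "nat => 'k" assume z: "z 0 ~= 0"
   let ?y = "(\<epsilon> + z 0 * w) / z 0 ^ r"
   have k: "?\<kappa> w z = aff r (1 / z 0) ?y"
    unfolding exceptional_Hmap[OF \<epsilon> z] using Hmap_aff(2)[of "vec4 (z 0) 1 (\<epsilon> + z 0 * w) 1" r] z by (simp add: vec4_domain)
   have X: "x0 + (a * (1 / z 0) + b * (?y - l * (1 / z 0) ^ r)) = ?q z / z 0"
    unfolding section_not_contracted using z by (simp add: field_simps)
   have "(A + B + C + m * Q ^ r) / t ^ r = A / t ^ r + B / t ^ r + C / t ^ r + m * (Q / t) ^ r" for A B C Q t
    by (simp add: add_divide_distrib power_divide)
   then have "?n w z / z 0 ^ r = z 0 ^ r * (y0 - m * x0 ^ r) / z 0 ^ r + c * (z 0 * z 0 ^ s) / z 0 ^ r + d * (\<epsilon> + z 0 * w - l) / z 0 ^ r + m * (?q z / z 0) ^ r" .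
   also have "c * (z 0 * z 0 ^ s) / z 0 ^ r = c * (1 / z 0)" unfolding rs using z by simp
   also have "z 0 ^ r * (y0 - m * x0 ^ r) / z 0 ^ r = y0 - m * x0 ^ r" using z by simp
   also have "d * (\<epsilon> + z 0 * w - l) / z 0 ^ r = d * (?y - l * (1 / z 0) ^ r)" by (simp add: power_divide diff_divide_distrib right_diff_distrib)
   finally have Y: "y0 + (c * (1 / z 0) + d * (?y - l * (1 / z 0) ^ r) + m * ((?q z / z 0) ^ r - x0 ^ r)) = ?n w z / z 0 ^ r"
    by (simp add: algebra_simps)
   show "\<Phi> (?\<kappa> w z) = aff r (?q z / z 0) (?n w z / z 0 ^ r)" unfolding k aff X Y ..
  qed
  then show ?thesis unfolding rs by simp
 qed
 then have "\<Phi> (exceptional r \<epsilon> 0 0) = \<Phi> (exceptional r \<epsilon> 0 1)" by simp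
 then have "exceptional r \<epsilon> 0 0 = exceptional r \<epsilon> 0 1" using inj exceptional_model[OF \<epsilon>] by (simp add: inj_on_eq_iff)
 from exceptional_injective[OF _ \<epsilon> this] show False using rs by simp
qed

text \<open>The two values obtained for \<epsilon> equal to \<open>0\<close> and \<open>1\<close>
  differ by the nonzero \<open>d\<close>, so they are \<open>0\<close> and \<open>a^r\<close> in one
  of the two orders. One order gives \<open>m = l\<close>, the other
  \<open>m = 1 - l\<close>.\<close>

lemma parameters_equal: "l * (1 - l) = m * (1 - m)"
proof -
 have d: "d ~= 0" using nd[of 0 1] section_not_contracted by auto
 have 0: "d * (0 - l) + m * a ^ r = 0 | d * (0 - l) + m * a ^ r = a ^ r" by (rule exceptional_curve_image) simp
 have 1: "d * (1 - l) + m * a ^ r = 0 | d * (1 - l) + m * a ^ r = a ^ r" by (rule exceptional_curve_image) simp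
 have diff: "d * (1 - l) + m * a ^ r = d * (0 - l) + m * a ^ r + d" by (simp add: algebra_simps)
 from 0 show ?thesis
 proof
  assume z: "d * (0 - l) + m * a ^ r = 0"
  then have "d = a ^ r" using 1 d unfolding diff by simp
  then have "d * (m - l) = 0" using z by (simp add: algebra_simps)
  then show ?thesis using d by simp
 next
  assume z: "d * (0 - l) + m * a ^ r = a ^ r"
  then have "a ^ r = - d" using 1 d unfolding diff by (auto simp: eq_neg_iff_add_eq_0)
  then have "d * (1 - l - m) = 0" using z by (simp add: algebra_simps)
  then have "m = 1 - l" using d by simp
  then show ?thesis by simp
 qed
qed

end

theorem mainTheorem2:
  fixes r :: nat
    and b p q :: "(nat \<Rightarrow> 'k::{alg_closed_field, field_char_0}) set"
    and X :: "('x, 'k) fspace"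
    and \<pi> :: "'x \<Rightarrow> (nat \<Rightarrow> 'k) set"
  assumes "r \<ge> 2"
    and "b \<in> points (proj_space 1 :: ((nat \<Rightarrow> 'k) set, 'k) fspace)"
    and "p \<in> hirzebruch_fiber r b - hirzebruch_zero_section r"
    and "q \<in> hirzebruch_fiber r b - hirzebruch_zero_section r"
    and "p \<noteq> q"
    and "is_blowup X \<pi> (hirzebruch r) {p, q}"
  shows "surface X \<and> smooth_variety X \<and> projective_variety X \<and>
    one_dim_family_of_nonisomorphic_actions X"
proof -
 have r: "1 <= r" using assms(1) by simp
 have X: "swf X" using assms(6) unfolding is_blowup_def by blast
 have iso: "isomorphic_spaces X (model_space r)" by (rule blowup_two_points_model[OF r assms(3-6)])
 obtain s where s: "r = Suc (Suc s)" using assms(1) by (metis Suc_diff_le diff_Suc_Suc add_2_eq_Suc le_Suc_ex)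
 have "l * (1 - l) = m * (1 - m)" if i: "isomorphic_actions (model_space r) (act r l) (act r m)" for l m :: 'k
  by (rule isomorphic_act_affine[OF r i]) (rule parameters_equal[OF s]; assumption)
 then have "one_dim_family_of_nonisomorphic_actions (model_space r :: 'k pspace)"
  by (rule one_dim_family_model[OF r])
 then have "one_dim_family_of_nonisomorphic_actions X" by (rule one_dim_family_transport[OF X swf_model iso])
 then show ?thesis using model_surface[OF r X iso] by blast
qed

end
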